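(* Let $k$ be a field of prime characteristic $p>2$, let $R:=k\langle x,y\rangle/(x^p,\ y^p,\ yx-xy-\tfrac12x^2)$, and let $G:=\langle g\rangle$ be a cyclic group of order $q$ divisible by $p$, acting on $R$ by automorphisms with ${}^gx=x$ and ${}^gy=x+y$. Then the cohomology ring $\mathrm{H}^*(R\# kG,k)$ of the bosonization $R\# kG$ is finitely generated as a $k$-algebra.
   Context: As an algebra, the bosonization $R\# kG$ is the smash product (skew group algebra): it is $R\otimes kG$ as a vector space, with multiplication determined by those of $R$ and $kG$ and $g r=({}^gr)g$ for $r\in R$. It is augmented by $\varepsilon(x)=\varepsilon(y)=0$, $\varepsilon(g)=1$, and $k$ denotes the corresponding trivial left module. The cohomology ring is $\mathrm{H}^*(R\# kG,k):=\mathrm{Ext}^*_{R\# kG}(k,k)$, with Yoneda (equivalently cup) product. ($R$ is the rank two Nichols algebra of Jordan type, of dimension $p^2$.) *)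

theory Defs
  imports "HOL-Algebra.Algebra"
begin

section \<open>Algebras over a field\<close>

text \<open>
  Algebras over \<open>K\<close> are records of type \<^typ>\<open>('k, 'a) module\<close>: a (not necessarily commutative)
  ring together with a scalar multiplication by \<open>K\<close>.
\<close>

definition quot_algebra ::
  "('k, 'a) module \<Rightarrow> 'a set \<Rightarrow> ('k, 'a set) module" where
  "quot_algebra A I =
    \<lparr>carrier = carrier (A Quot I), monoid.mult = monoid.mult (A Quot I), one = \<one>\<^bsub>A Quot I\<^esub>,
     ring.zero = \<zero>\<^bsub>A Quot I\<^esub>, add = add (A Quot I),
     smult = (\<lambda>c C. \<Union>a\<in>C. I +>\<^bsub>A\<^esub> (c \<odot>\<^bsub>A\<^esub> a))\<rparr>"

definition subalgebra_of :: "('k, 'b) ring_scheme \<Rightarrow> 'a set \<Rightarrow> ('k, 'a) module \<Rightarrow> bool" where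
  "subalgebra_of K B A \<longleftrightarrow>
    subring B A \<and> (\<forall>c\<in>carrier K. \<forall>b\<in>B. c \<odot>\<^bsub>A\<^esub> b \<in> B)"

definition finitely_generated_algebra ::
  "('k, 'b) ring_scheme \<Rightarrow> ('k, 'a) module \<Rightarrow> bool" where
  "finitely_generated_algebra K A \<longleftrightarrow>
    (\<exists>S. finite S \<and> S \<subseteq> carrier A \<and>
      (\<forall>B. subalgebra_of K B A \<and> S \<subseteq> B \<longrightarrow> B = carrier A))"

text \<open>
  The free algebra \<open>K\<langle>X\<rangle>\<close> on the elements of the type \<^typ>\<open>'x\<close>: finitely supported functions
  on words, with the convolution product.
\<close>

definition free_algebra :: "('k, 'b) ring_scheme \<Rightarrow> ('k, 'x list \<Rightarrow> 'k) module" where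
  "free_algebra K =
    \<lparr>carrier = {f. (\<forall>w. f w \<in> carrier K) \<and> finite {w. f w \<noteq> \<zero>\<^bsub>K\<^esub>}},
     monoid.mult = (\<lambda>f h w. \<Oplus>\<^bsub>K\<^esub>i\<in>{..length w}. f (take i w) \<otimes>\<^bsub>K\<^esub> h (drop i w)),
     one = (\<lambda>w. if w = [] then \<one>\<^bsub>K\<^esub> else \<zero>\<^bsub>K\<^esub>),
     ring.zero = (\<lambda>w. \<zero>\<^bsub>K\<^esub>),
     add = (\<lambda>f h w. f w \<oplus>\<^bsub>K\<^esub> h w),
     smult = (\<lambda>c f w. c \<otimes>\<^bsub>K\<^esub> f w)\<rparr>"

definition free_gen :: "('k, 'b) ring_scheme \<Rightarrow> 'x \<Rightarrow> 'x list \<Rightarrow> 'k" where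
  "free_gen K v = (\<lambda>w. if w = [v] then \<one>\<^bsub>K\<^esub> else \<zero>\<^bsub>K\<^esub>)"


section \<open>The Nichols algebra of Jordan type and its bosonization\<close>

datatype gen = gen_x | gen_y

definition jordan_relations :: "('k, 'b) ring_scheme \<Rightarrow> nat \<Rightarrow> (gen list \<Rightarrow> 'k) set" where
  "jordan_relations K p =
    (let F = free_algebra K; x = free_gen K gen_x; y = free_gen K gen_y; half = inv\<^bsub>K\<^esub> (\<one>\<^bsub>K\<^esub> \<oplus>\<^bsub>K\<^esub> \<one>\<^bsub>K\<^esub>)
     in {x [^]\<^bsub>F\<^esub> p, y [^]\<^bsub>F\<^esub> p,
         (y \<otimes>\<^bsub>F\<^esub> x \<ominus>\<^bsub>F\<^esub> x \<otimes>\<^bsub>F\<^esub> y) \<ominus>\<^bsub>F\<^esub> half \<odot>\<^bsub>F\<^esub> (x [^]\<^bsub>F\<^esub> (2::nat))})"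

definition jordan_ideal :: "('k, 'b) ring_scheme \<Rightarrow> nat \<Rightarrow> (gen list \<Rightarrow> 'k) set" where
  "jordan_ideal K p = Idl\<^bsub>free_algebra K\<^esub> (jordan_relations K p)"

definition jordan_algebra ::
  "('k, 'b) ring_scheme \<Rightarrow> nat \<Rightarrow> ('k, (gen list \<Rightarrow> 'k) set) module" where
  "jordan_algebra K p = quot_algebra (free_algebra K) (jordan_ideal K p)"

definition jordan_gen :: "('k, 'b) ring_scheme \<Rightarrow> nat \<Rightarrow> gen \<Rightarrow> (gen list \<Rightarrow> 'k) set" where
  "jordan_gen K p v = jordan_ideal K p +>\<^bsub>free_algebra K\<^esub> free_gen K v"

definition acts_by_algebra_automorphisms ::
  "('k, 'b) ring_scheme \<Rightarrow> ('g, 'c) monoid_scheme \<Rightarrow> ('k, 'a) module \<Rightarrow> ('g \<Rightarrow> 'a \<Rightarrow> 'a) \<Rightarrow> bool"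
  where
  "acts_by_algebra_automorphisms K G R \<phi> \<longleftrightarrow>
    group_action G (carrier R) \<phi> \<and>
    (\<forall>h\<in>carrier G. \<phi> h \<in> ring_iso R R \<and>
      (\<forall>c\<in>carrier K. \<forall>r\<in>carrier R. \<phi> h (c \<odot>\<^bsub>R\<^esub> r) = c \<odot>\<^bsub>R\<^esub> \<phi> h r))"

text \<open>
  For a finite group \<open>G\<close>, the element \<open>\<Sum>h. r\<^sub>h h\<close> of \<open>R \<otimes> KG\<close> is encoded as the function
  \<open>h \<mapsto> r\<^sub>h\<close>. Since \<open>(r a) (s b) = (r (\<phi> a s)) (a b)\<close>, the coefficient of a product at \<open>u\<close> collects
  the pairs \<open>a\<close>, \<open>b = a\<^sup>-\<^sup>1 u\<close>.
\<close>

definition skew_group_algebra ::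
  "('k, 'a) module \<Rightarrow> ('g, 'c) monoid_scheme \<Rightarrow> ('g \<Rightarrow> 'a \<Rightarrow> 'a) \<Rightarrow> ('k, 'g \<Rightarrow> 'a) module" where
  "skew_group_algebra R G \<phi> =
    \<lparr>carrier = carrier G \<rightarrow>\<^sub>E carrier R,
     monoid.mult = (\<lambda>s t. \<lambda>u\<in>carrier G.
       \<Oplus>\<^bsub>R\<^esub>a\<in>carrier G. s a \<otimes>\<^bsub>R\<^esub> \<phi> a (t (inv\<^bsub>G\<^esub> a \<otimes>\<^bsub>G\<^esub> u))),
     one = (\<lambda>u\<in>carrier G. if u = \<one>\<^bsub>G\<^esub> then \<one>\<^bsub>R\<^esub> else \<zero>\<^bsub>R\<^esub>),
     ring.zero = (\<lambda>u\<in>carrier G. \<zero>\<^bsub>R\<^esub>),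
     add = (\<lambda>s t. \<lambda>u\<in>carrier G. s u \<oplus>\<^bsub>R\<^esub> t u),
     smult = (\<lambda>c s. \<lambda>u\<in>carrier G. c \<odot>\<^bsub>R\<^esub> s u)\<rparr>"

definition skew_elt ::
  "('k, 'a) module \<Rightarrow> ('g, 'c) monoid_scheme \<Rightarrow> 'a \<Rightarrow> 'g \<Rightarrow> 'g \<Rightarrow> 'a" where
  "skew_elt R G r h = (\<lambda>u\<in>carrier G. if u = h then r else \<zero>\<^bsub>R\<^esub>)"

definition augmentation ::
  "('k, 'b) ring_scheme \<Rightarrow> ('k, 'a) module \<Rightarrow> ('a \<Rightarrow> 'k) \<Rightarrow> bool" where
  "augmentation K A \<epsilon> \<longleftrightarrow>
    \<epsilon> \<in> ring_hom A K \<and> (\<forall>c\<in>carrier K. \<forall>a\<in>carrier A. \<epsilon> (c \<odot>\<^bsub>A\<^esub> a) = c \<otimes>\<^bsub>K\<^esub> \<epsilon> a)"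


section \<open>Left modules over noncommutative rings\<close>

text \<open>
  The library locale \<^locale>\<open>module\<close> requires a commutative ring of scalars. In the records below the
  fields \<^const>\<open>monoid.mult\<close> and \<^const>\<open>one\<close> play no role.
\<close>

locale left_module = A?: ring A + M?: abelian_group M
  for A :: "('a, 'b) ring_scheme" (structure) and M :: "('a, 'm, 'c) module_scheme" (structure) +
  assumes smult_closed:
      "\<lbrakk>a \<in> carrier A; x \<in> carrier M\<rbrakk> \<Longrightarrow> a \<odot>\<^bsub>M\<^esub> x \<in> carrier M"
    and smult_l_distr:
      "\<lbrakk>a \<in> carrier A; b \<in> carrier A; x \<in> carrier M\<rbrakk> \<Longrightarrow>
        (a \<oplus>\<^bsub>A\<^esub> b) \<odot>\<^bsub>M\<^esub> x = a \<odot>\<^bsub>M\<^esub> x \<oplus>\<^bsub>M\<^esub> b \<odot>\<^bsub>M\<^esub> x"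
    and smult_r_distr:
      "\<lbrakk>a \<in> carrier A; x \<in> carrier M; y \<in> carrier M\<rbrakk> \<Longrightarrow>
        a \<odot>\<^bsub>M\<^esub> (x \<oplus>\<^bsub>M\<^esub> y) = a \<odot>\<^bsub>M\<^esub> x \<oplus>\<^bsub>M\<^esub> a \<odot>\<^bsub>M\<^esub> y"
    and smult_assoc:
      "\<lbrakk>a \<in> carrier A; b \<in> carrier A; x \<in> carrier M\<rbrakk> \<Longrightarrow>
        (a \<otimes>\<^bsub>A\<^esub> b) \<odot>\<^bsub>M\<^esub> x = a \<odot>\<^bsub>M\<^esub> (b \<odot>\<^bsub>M\<^esub> x)"
    and smult_one:
      "x \<in> carrier M \<Longrightarrow> \<one>\<^bsub>A\<^esub> \<odot>\<^bsub>M\<^esub> x = x"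

text \<open>Homomorphisms are extensional functions, so that equality of homomorphisms is equality.\<close>

definition lin_hom ::
  "('a, 'b) ring_scheme \<Rightarrow> ('a, 'm) module \<Rightarrow> ('a, 'n) module \<Rightarrow> ('m \<Rightarrow> 'n) set" where
  "lin_hom A M N =
    {f \<in> carrier M \<rightarrow>\<^sub>E carrier N.
      (\<forall>x\<in>carrier M. \<forall>y\<in>carrier M. f (x \<oplus>\<^bsub>M\<^esub> y) = f x \<oplus>\<^bsub>N\<^esub> f y) \<and>
      (\<forall>a\<in>carrier A. \<forall>x\<in>carrier M. f (a \<odot>\<^bsub>M\<^esub> x) = a \<odot>\<^bsub>N\<^esub> f x)}"

definition trivial_module ::
  "('k, 'b) ring_scheme \<Rightarrow> ('a \<Rightarrow> 'k) \<Rightarrow> ('a, 'k) module" where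
  "trivial_module K \<epsilon> =
    \<lparr>carrier = carrier K, monoid.mult = undefined, one = undefined,
     ring.zero = \<zero>\<^bsub>K\<^esub>, add = add K, smult = (\<lambda>a c. \<epsilon> a \<otimes>\<^bsub>K\<^esub> c)\<rparr>"

definition free_module :: "('a, 'b) ring_scheme \<Rightarrow> 'i set \<Rightarrow> ('a, 'i \<Rightarrow> 'a) module" where
  "free_module A B =
    \<lparr>carrier = {f \<in> B \<rightarrow>\<^sub>E carrier A. finite {b \<in> B. f b \<noteq> \<zero>\<^bsub>A\<^esub>}},
     monoid.mult = undefined, one = undefined,
     ring.zero = (\<lambda>b\<in>B. \<zero>\<^bsub>A\<^esub>),
     add = (\<lambda>f h. \<lambda>b\<in>B. f b \<oplus>\<^bsub>A\<^esub> h b),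
     smult = (\<lambda>a f. \<lambda>b\<in>B. a \<otimes>\<^bsub>A\<^esub> f b)\<rparr>"

text \<open>
  A module is projective iff it is a direct summand of a free module. Basis sets inside \<^typ>\<open>'m\<close>
  suffice: \<open>M\<close> is a quotient of the free module on \<^term>\<open>carrier M\<close>.
\<close>

definition projective :: "('a, 'b) ring_scheme \<Rightarrow> ('a, 'm) module \<Rightarrow> bool" where
  "projective A M \<longleftrightarrow>
    left_module A M \<and>
    (\<exists>(B :: 'm set) i r.
      i \<in> lin_hom A M (free_module A B) \<and> r \<in> lin_hom A (free_module A B) M \<and>
      (\<forall>m\<in>carrier M. r (i m) = m))"


section \<open>Ext and the Yoneda product\<close>

text \<open>An exact sequence \<open>\<dots> \<rightarrow> P 2 \<rightarrow> P 1 \<rightarrow> P 0 \<rightarrow> M \<rightarrow> 0\<close> with \<open>d n : P (n + 1) \<rightarrow> P n\<close>.\<close>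

definition projective_resolution ::
  "('a, 'b) ring_scheme \<Rightarrow> ('a, 'n) module \<Rightarrow> (nat \<Rightarrow> ('a, 'm) module) \<Rightarrow>
    (nat \<Rightarrow> 'm \<Rightarrow> 'm) \<Rightarrow> ('m \<Rightarrow> 'n) \<Rightarrow> bool" where
  "projective_resolution A M P d \<eta> \<longleftrightarrow>
    left_module A M \<and>
    (\<forall>n. projective A (P n)) \<and>
    (\<forall>n. d n \<in> lin_hom A (P (Suc n)) (P n)) \<and>
    \<eta> \<in> lin_hom A (P 0) M \<and>
    \<eta> ` carrier (P 0) = carrier M \<and>
    d 0 ` carrier (P 1) = {x \<in> carrier (P 0). \<eta> x = \<zero>\<^bsub>M\<^esub>} \<and>
    (\<forall>n. d (Suc n) ` carrier (P (Suc (Suc n))) =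
         {x \<in> carrier (P (Suc n)). d n x = \<zero>\<^bsub>P n\<^esub>})"

text \<open>
  Cocycles and coboundaries of the complex \<open>Hom\<^sub>A(P, N)\<close>; the cocycles form a group, written
  multiplicatively in order to use the quotient \<^const>\<open>FactGroup\<close> of the library.
\<close>

definition cocycles ::
  "('a, 'b) ring_scheme \<Rightarrow> (nat \<Rightarrow> ('a, 'm) module) \<Rightarrow> (nat \<Rightarrow> 'm \<Rightarrow> 'm) \<Rightarrow> ('a, 'n) module \<Rightarrow>
    nat \<Rightarrow> ('m \<Rightarrow> 'n) monoid" where
  "cocycles A P d N n =
    \<lparr>carrier = {f \<in> lin_hom A (P n) N. \<forall>x\<in>carrier (P (Suc n)). f (d n x) = \<zero>\<^bsub>N\<^esub>},
     monoid.mult = (\<lambda>f h. \<lambda>x\<in>carrier (P n). f x \<oplus>\<^bsub>N\<^esub> h x),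
     one = (\<lambda>x\<in>carrier (P n). \<zero>\<^bsub>N\<^esub>)\<rparr>"

definition coboundaries ::
  "('a, 'b) ring_scheme \<Rightarrow> (nat \<Rightarrow> ('a, 'm) module) \<Rightarrow> (nat \<Rightarrow> 'm \<Rightarrow> 'm) \<Rightarrow> ('a, 'n) module \<Rightarrow>
    nat \<Rightarrow> ('m \<Rightarrow> 'n) set" where
  "coboundaries A P d N n =
    (case n of
      0 \<Rightarrow> {\<lambda>x\<in>carrier (P 0). \<zero>\<^bsub>N\<^esub>}
    | Suc m \<Rightarrow> (\<lambda>f. \<lambda>x\<in>carrier (P (Suc m)). f (d m x)) ` lin_hom A (P m) N)"

definition Ext ::
  "('a, 'b) ring_scheme \<Rightarrow> (nat \<Rightarrow> ('a, 'm) module) \<Rightarrow> (nat \<Rightarrow> 'm \<Rightarrow> 'm) \<Rightarrow> ('a, 'n) module \<Rightarrow>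
    nat \<Rightarrow> ('m \<Rightarrow> 'n) set monoid" where
  "Ext A P d N n = cocycles A P d N n Mod coboundaries A P d N n"

definition ext_class ::
  "('a, 'b) ring_scheme \<Rightarrow> (nat \<Rightarrow> ('a, 'm) module) \<Rightarrow> (nat \<Rightarrow> 'm \<Rightarrow> 'm) \<Rightarrow> ('a, 'n) module \<Rightarrow>
    nat \<Rightarrow> ('m \<Rightarrow> 'n) \<Rightarrow> ('m \<Rightarrow> 'n) set" where
  "ext_class A P d N n f = coboundaries A P d N n #>\<^bsub>cocycles A P d N n\<^esub> f"

text \<open>
  The action of the ground field on \<open>Ext\<close>, where \<open>c \<in> K\<close> acts on \<open>N\<close> through \<open>c \<cdot> 1\<^sub>A\<close>. This and the
  products below are unions over representatives, like the product of \<^const>\<open>FactRing\<close>.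
\<close>

definition ext_smult ::
  "('k, 'a) module \<Rightarrow> (nat \<Rightarrow> ('a, 'm) module) \<Rightarrow> (nat \<Rightarrow> 'm \<Rightarrow> 'm) \<Rightarrow> ('a, 'n) module \<Rightarrow>
    nat \<Rightarrow> 'k \<Rightarrow> ('m \<Rightarrow> 'n) set \<Rightarrow> ('m \<Rightarrow> 'n) set" where
  "ext_smult A P d N n c C =
    (\<Union>f\<in>C. ext_class A P d N n (\<lambda>x\<in>carrier (P n). (c \<odot>\<^bsub>A\<^esub> \<one>\<^bsub>A\<^esub>) \<odot>\<^bsub>N\<^esub> f x))"

text \<open>Chain maps \<open>L i : P (n + i) \<rightarrow> P i\<close> over a cocycle \<open>f : P n \<rightarrow> M\<close>.\<close>

definition chain_lift ::
  "('a, 'b) ring_scheme \<Rightarrow> (nat \<Rightarrow> ('a, 'm) module) \<Rightarrow> (nat \<Rightarrow> 'm \<Rightarrow> 'm) \<Rightarrow> ('m \<Rightarrow> 'n) \<Rightarrow>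
    nat \<Rightarrow> ('m \<Rightarrow> 'n) \<Rightarrow> (nat \<Rightarrow> 'm \<Rightarrow> 'm) \<Rightarrow> bool" where
  "chain_lift A P d \<eta> n f L \<longleftrightarrow>
    (\<forall>i. L i \<in> lin_hom A (P (n + i)) (P i)) \<and>
    (\<forall>x\<in>carrier (P n). \<eta> (L 0 x) = f x) \<and>
    (\<forall>i. \<forall>x\<in>carrier (P (n + Suc i)). d i (L (Suc i) x) = L i (d (n + i) x))"

text \<open>
  The Yoneda product \<open>Ext\<^sup>m(M, M) \<times> Ext\<^sup>n(M, M) \<rightarrow> Ext\<^sup>n\<^sup>+\<^sup>m(M, M)\<close>: the product of the classes of
  \<open>f\<close> and \<open>h\<close> is the class of \<open>f \<circ> L m\<close>, where \<open>L\<close> lifts \<open>h\<close>.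
\<close>

definition yoneda ::
  "('a, 'b) ring_scheme \<Rightarrow> (nat \<Rightarrow> ('a, 'm) module) \<Rightarrow> (nat \<Rightarrow> 'm \<Rightarrow> 'm) \<Rightarrow> ('m \<Rightarrow> 'n) \<Rightarrow>
    ('a, 'n) module \<Rightarrow> nat \<Rightarrow> nat \<Rightarrow> ('m \<Rightarrow> 'n) set \<Rightarrow> ('m \<Rightarrow> 'n) set \<Rightarrow> ('m \<Rightarrow> 'n) set" where
  "yoneda A P d \<eta> M m n C D =
    (\<Union>f\<in>C. \<Union>h\<in>D. \<Union>L\<in>{L. chain_lift A P d \<eta> n h L}.
      ext_class A P d M (n + m) (\<lambda>x\<in>carrier (P (n + m)). f (L m x)))"

text \<open>
  The algebra \<open>Ext\<^sup>*\<^sub>A(M, M) = \<Oplus>n. Ext\<^sup>n\<^sub>A(M, M)\<close> computed from a projective resolution \<open>(P, d, \<eta>)\<close>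
  of \<open>M\<close>. Its elements are the finitely supported families of classes. The identity is the class
  of \<open>\<eta>\<close> in degree zero.
\<close>

definition Ext_algebra ::
  "('k, 'a) module \<Rightarrow> (nat \<Rightarrow> ('a, 'm) module) \<Rightarrow> (nat \<Rightarrow> 'm \<Rightarrow> 'm) \<Rightarrow> ('m \<Rightarrow> 'n) \<Rightarrow>
    ('a, 'n) module \<Rightarrow> ('k, nat \<Rightarrow> ('m \<Rightarrow> 'n) set) module" where
  "Ext_algebra A P d \<eta> M =
    (let E = Ext A P d M in
    \<lparr>carrier = {\<alpha>. (\<forall>n. \<alpha> n \<in> carrier (E n)) \<and> finite {n. \<alpha> n \<noteq> \<one>\<^bsub>E n\<^esub>}},
     monoid.mult = (\<lambda>\<alpha> \<beta> n. \<Otimes>\<^bsub>E n\<^esub>i\<in>{..n}. yoneda A P d \<eta> M i (n - i) (\<alpha> i) (\<beta> (n - i))),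
     one = (\<lambda>n. if n = 0 then ext_class A P d M 0 \<eta> else \<one>\<^bsub>E n\<^esub>),
     ring.zero = (\<lambda>n. \<one>\<^bsub>E n\<^esub>),
     add = (\<lambda>\<alpha> \<beta> n. \<alpha> n \<otimes>\<^bsub>E n\<^esub> \<beta> n),
     smult = (\<lambda>c \<alpha> n. ext_smult A P d M n c (\<alpha> n))\<rparr>)"

end

theory Submission
  imports Defs
begin

text \<open>
  Put \<open>X = x / 2\<close> and choose \<open>j\<close> prime to \<open>q\<close> with \<open>2 j \<equiv> 1\<close> modulo \<open>p\<close>. Then \<open>\<gamma> = g\<^sup>j\<close> generates
  \<open>G\<close>, and \<open>z = X \<gamma>\<close> satisfies \<open>\<gamma> y = y \<gamma> + z\<close>. The relation \<open>y X = X y + X\<^sup>2\<close> says that \<open>z\<close> commutes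
  with \<open>y\<close>, so \<open>R # KG\<close> is a truncated Heisenberg algebra: \<open>z\<close> commutes with \<open>y\<close> and \<open>\<gamma>\<close>, and
  \<open>z\<^sup>p = y\<^sup>p = 0\<close>, \<open>\<gamma>\<^sup>q = 1\<close>.

  The periodic complexes of \<open>(z, z\<^sup>p\<^sup>-\<^sup>1)\<close>, \<open>(\<gamma> - 1, 1 + \<gamma> + \<dots> + \<gamma>\<^sup>q\<^sup>-\<^sup>1)\<close> and \<open>(y, y\<^sup>p\<^sup>-\<^sup>1)\<close> are combined
  into a free resolution of \<open>K\<close> whose basis in degree \<open>n\<close> consists of the triples of exponents with sum
  \<open>n\<close>. In the last step right multiplication by \<open>y\<close> has to be corrected to a chain map \<open>\<sigma>\<close>, and
  \<open>\<sigma>\<^sup>p = 0\<close> in characteristic \<open>p\<close>. The resolution is periodic in each of the three exponents, so the shifts by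
  two are chain maps lifting classes of degree two. After applying \<open>\<epsilon>\<close>, each component of the
  differential is zero or one, and which of the two depends only on the parities of the exponents.
  Hence cocycles are combinations of coordinate functionals, each of which, in degree at least four,
  factors through a shift: \<open>H\<^sup>n\<close> is spanned by products of \<open>H\<^sup>n\<^sup>-\<^sup>2\<close> with classes of degree two.
\<close>

section \<open>Left modules and their homomorphisms\<close>

text \<open>Right multiplication by \<open>y\<close> fails to commute with
  \<open>\<gamma> - 1\<close> and with \<open>N\<close>, the sum of the powers of
  \<open>\<gamma>\<close>: the defects are \<open>z\<close> and \<open>N' z\<close>, where
  \<open>N'\<close> is the formal derivative of \<open>N\<close>. Being multiples of
  \<open>z\<close>, they are absorbed by a term of \<open>\<sigma>\<close> that lowers the
  \<open>\<gamma>\<close>-exponent and raises the \<open>z\<close>-exponent, with coefficients 1 and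
  \<open>- N'\<close>. The two fit together because \<open>N' (\<gamma> - 1) + N = 0\<close>, which
  uses \<open>p dvd q\<close>. The extra term cannot act twice, so \<open>\<sigma>^p\<close>
  consists of \<open>y^p\<close> and of sums of \<open>y^k w y^m\<close> with
  \<open>k + m = p - 1\<close>; these expand into binomial coefficients divisible by
  \<open>p\<close> and one last term with a vanishing iterated derivative. The coefficient 1 is the
  only entry of the differential that survives \<open>\<epsilon>\<close>; \<open>- N'\<close> goes
  to \<open>- q (q - 1) / 2\<close>, which vanishes as \<open>p\<close> is odd.

  In the order \<open>z\<close>, \<open>\<gamma>\<close>, \<open>y\<close> each pair is exact modulo
  the left ideal of its predecessors, and since the earlier stage is acyclic in positive degrees
  this is all the exactness that has to be checked. Degree four is the pigeonhole bound: three
  exponents with sum four are not all below two.\<close>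

lemma lin_homI:
  assumes "f \<in> carrier M \<rightarrow>\<^sub>E carrier N"
    "\<And>x y. x \<in> carrier M \<Longrightarrow> y \<in> carrier M \<Longrightarrow> f (x \<oplus>\<^bsub>M\<^esub> y) = f x \<oplus>\<^bsub>N\<^esub> f y"
    "\<And>a x. a \<in> carrier A \<Longrightarrow> x \<in> carrier M \<Longrightarrow> f (a \<odot>\<^bsub>M\<^esub> x) = a \<odot>\<^bsub>N\<^esub> f x"
  shows "f \<in> lin_hom A M N"
  using assms by (simp add: lin_hom_def)

lemma lin_homD:
  assumes "f \<in> lin_hom A M N"
  shows "f \<in> carrier M \<rightarrow>\<^sub>E carrier N"
    "x \<in> carrier M \<Longrightarrow> f x \<in> carrier N"
    "x \<in> carrier M \<Longrightarrow> y \<in> carrier M \<Longrightarrow> f (x \<oplus>\<^bsub>M\<^esub> y) = f x \<oplus>\<^bsub>N\<^esub> f y"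
    "a \<in> carrier A \<Longrightarrow> x \<in> carrier M \<Longrightarrow> f (a \<odot>\<^bsub>M\<^esub> x) = a \<odot>\<^bsub>N\<^esub> f x"
  using assms by (auto simp: lin_hom_def)

lemma left_moduleD:
  assumes "left_module A M"
  shows "ring A" "abelian_group M"
  using assms by (auto simp: left_module_def)

lemma (in left_module) smult_zero:
  assumes "a \<in> carrier A" shows "a \<odot>\<^bsub>M\<^esub> \<zero>\<^bsub>M\<^esub> = \<zero>\<^bsub>M\<^esub>"
proof -
  have "a \<odot>\<^bsub>M\<^esub> \<zero>\<^bsub>M\<^esub> \<oplus>\<^bsub>M\<^esub> a \<odot>\<^bsub>M\<^esub> \<zero>\<^bsub>M\<^esub> = a \<odot>\<^bsub>M\<^esub> \<zero>\<^bsub>M\<^esub>"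
    using smult_r_distr[OF assms, of "\<zero>\<^bsub>M\<^esub>" "\<zero>\<^bsub>M\<^esub>"] by simp
  thus ?thesis using smult_closed[OF assms M.zero_closed] by (simp add: M.add.l_cancel_one)
qed

lemma (in left_module) smult_minus:
  assumes "a \<in> carrier A" "x \<in> carrier M"
  shows "a \<odot>\<^bsub>M\<^esub> (\<ominus>\<^bsub>M\<^esub> x) = \<ominus>\<^bsub>M\<^esub> (a \<odot>\<^bsub>M\<^esub> x)"
proof -
  have "a \<odot>\<^bsub>M\<^esub> (\<ominus>\<^bsub>M\<^esub> x) \<oplus>\<^bsub>M\<^esub> a \<odot>\<^bsub>M\<^esub> x = \<zero>\<^bsub>M\<^esub>"
    using assms smult_r_distr[of a "\<ominus>\<^bsub>M\<^esub> x" x] by (simp add: M.l_neg smult_zero)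
  thus ?thesis using assms smult_closed by (intro M.minus_equality[symmetric]) auto
qed

lemma lin_hom_zero_minus:
  assumes "f \<in> lin_hom A M N" "left_module A M" "left_module A N"
  shows "f \<zero>\<^bsub>M\<^esub> = \<zero>\<^bsub>N\<^esub>"
    "x \<in> carrier M \<Longrightarrow> f (\<ominus>\<^bsub>M\<^esub> x) = \<ominus>\<^bsub>N\<^esub> f x"
    "x \<in> carrier M \<Longrightarrow> y \<in> carrier M \<Longrightarrow> f (x \<ominus>\<^bsub>M\<^esub> y) = f x \<ominus>\<^bsub>N\<^esub> f y"
proof -
  interpret M: abelian_group M using assms left_moduleD by blast
  interpret N: abelian_group N using assms left_moduleD by blast
  note D = lin_homD[OF assms(1)]
  have "f \<zero>\<^bsub>M\<^esub> \<oplus>\<^bsub>N\<^esub> f \<zero>\<^bsub>M\<^esub> = f \<zero>\<^bsub>M\<^esub>" using D(3)[of "\<zero>\<^bsub>M\<^esub>" "\<zero>\<^bsub>M\<^esub>"] by simp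
  thus 0: "f \<zero>\<^bsub>M\<^esub> = \<zero>\<^bsub>N\<^esub>" using D(2)[OF M.zero_closed] by (simp add: N.add.l_cancel_one)
  show 1: "f (\<ominus>\<^bsub>M\<^esub> x) = \<ominus>\<^bsub>N\<^esub> f x" if "x \<in> carrier M" for x
    using D(3)[of "\<ominus>\<^bsub>M\<^esub> x" x] D(2) that 0
    by (intro N.minus_equality[symmetric]) (auto simp: M.l_neg)
  show "x \<in> carrier M \<Longrightarrow> y \<in> carrier M \<Longrightarrow> f (x \<ominus>\<^bsub>M\<^esub> y) = f x \<ominus>\<^bsub>N\<^esub> f y"
    using D 1 by (simp add: a_minus_def)
qed

lemma lin_hom_const_zero:
  assumes "left_module A M" "left_module A N"
  shows "(\<lambda>x\<in>carrier M. \<zero>\<^bsub>N\<^esub>) \<in> lin_hom A M N"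
proof -
  interpret M: left_module A M by fact
  interpret N: left_module A N by fact
  show ?thesis by (rule lin_homI) (auto simp: N.smult_zero M.smult_closed)
qed

lemma lin_hom_add:
  assumes "left_module A M" "left_module A N" "f \<in> lin_hom A M N" "h \<in> lin_hom A M N"
  shows "(\<lambda>x\<in>carrier M. f x \<oplus>\<^bsub>N\<^esub> h x) \<in> lin_hom A M N"
proof -
  interpret M: left_module A M by fact
  interpret N: left_module A N by fact
  note D = lin_homD[OF assms(3)] lin_homD[OF assms(4)]
  show ?thesis
    by (rule lin_homI) (auto simp: D N.smult_r_distr M.smult_closed N.M.a_ac)
qed

lemma lin_hom_minus:
  assumes "left_module A M" "left_module A N" "f \<in> lin_hom A M N" "h \<in> lin_hom A M N"
  shows "(\<lambda>x\<in>carrier M. f x \<ominus>\<^bsub>N\<^esub> h x) \<in> lin_hom A M N"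
proof -
  interpret M: left_module A M by fact
  interpret N: left_module A N by fact
  note D = lin_homD[OF assms(3)] lin_homD[OF assms(4)]
  show ?thesis
    by (rule lin_homI) (auto simp: a_minus_def D N.smult_r_distr M.smult_closed N.smult_minus N.M.a_ac
        N.M.minus_add N.smult_closed)
qed

lemma lin_hom_comp:
  assumes "left_module A M" "f \<in> lin_hom A M N" "h \<in> lin_hom A N Q"
  shows "(\<lambda>x\<in>carrier M. h (f x)) \<in> lin_hom A M Q"
proof -
  interpret M: left_module A M by fact
  note D = lin_homD[OF assms(2)] lin_homD[OF assms(3)]
  show ?thesis by (rule lin_homI) (auto simp: D M.smult_closed)
qed

section \<open>Retracts of free modules\<close>

lemma left_module_free_module:
  assumes "ring A" shows "left_module A (free_module A B)"
proof -
  interpret A: ring A by fact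
  have fin: "finite {b. (b \<in> B \<longrightarrow> f b \<oplus>\<^bsub>A\<^esub> h b \<noteq> \<zero>\<^bsub>A\<^esub>) \<and> b \<in> B}"
    if "finite {b \<in> B. f b \<noteq> \<zero>\<^bsub>A\<^esub>}" "finite {b \<in> B. h b \<noteq> \<zero>\<^bsub>A\<^esub>}" for f h
    by (rule finite_subset[OF _ finite_UnI[OF that]]) auto
  have ag: "abelian_group (free_module A B)"
  proof (rule abelian_groupI)
    fix f assume f: "f \<in> carrier (free_module A B)"
    show "\<exists>h\<in>carrier (free_module A B). h \<oplus>\<^bsub>free_module A B\<^esub> f = \<zero>\<^bsub>free_module A B\<^esub>"
    proof (rule bexI[of _ "\<lambda>b\<in>B. \<ominus>\<^bsub>A\<^esub> f b"])
      show "(\<lambda>b\<in>B. \<ominus>\<^bsub>A\<^esub> f b) \<oplus>\<^bsub>free_module A B\<^esub> f = \<zero>\<^bsub>free_module A B\<^esub>"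
        using f by (fastforce simp: free_module_def PiE_iff A.l_neg fun_eq_iff restrict_def)
      show "(\<lambda>b\<in>B. \<ominus>\<^bsub>A\<^esub> f b) \<in> carrier (free_module A B)"
        using f by (auto simp: free_module_def PiE_iff elim!: rev_finite_subset)
    qed
  qed (auto simp: free_module_def PiE_iff fun_eq_iff A.a_ac restrict_def extensional_def intro!: fin)
  interpret F: abelian_group "free_module A B" by (rule ag)
  show ?thesis
  proof (intro left_module.intro left_module_axioms.intro assms ag)
    fix a f assume "a \<in> carrier A" "f \<in> carrier (free_module A B)"
    thus "a \<odot>\<^bsub>free_module A B\<^esub> f \<in> carrier (free_module A B)"
      by (auto simp: free_module_def PiE_iff elim!: rev_finite_subset)
  qed (auto simp: free_module_def PiE_iff fun_eq_iff A.l_distr A.r_distr A.m_assoc extensional_def)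
qed

definition basis_elt :: "('a, 'b) ring_scheme \<Rightarrow> 'i set \<Rightarrow> 'i \<Rightarrow> 'i \<Rightarrow> 'a" where
  "basis_elt A B b = (\<lambda>c\<in>B. if c = b then \<one>\<^bsub>A\<^esub> else \<zero>\<^bsub>A\<^esub>)"

lemma basis_elt_closed:
  assumes "ring A" shows "basis_elt A B b \<in> carrier (free_module A B)"
proof -
  interpret A: ring A by fact
  show ?thesis
    by (auto simp: basis_elt_def free_module_def PiE_iff intro: finite_subset[of _ "{b}"])
qed

lemma free_module_hom_eq:
  assumes A: "ring A" and N: "left_module A N"
    and f: "f \<in> lin_hom A (free_module A B) N" and h: "h \<in> lin_hom A (free_module A B) N"
    and eq: "\<And>b. b \<in> B \<Longrightarrow> f (basis_elt A B b) = h (basis_elt A B b)"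
    and v: "v \<in> carrier (free_module A B)"
  shows "f v = h v"
proof -
  interpret A: ring A by fact
  let ?F = "free_module A B"
  note LM = left_module_free_module[OF A, of B]
  have "\<forall>v \<in> carrier ?F. {b \<in> B. v b \<noteq> \<zero>\<^bsub>A\<^esub>} \<subseteq> S \<longrightarrow> f v = h v" if "finite S" for S
    using that
  proof (induction S)
    case empty
    show ?case
    proof (intro ballI impI)
      fix v assume v: "v \<in> carrier ?F" and "{b \<in> B. v b \<noteq> \<zero>\<^bsub>A\<^esub>} \<subseteq> {}"
      hence "v = \<zero>\<^bsub>?F\<^esub>" by (auto simp: free_module_def fun_eq_iff PiE_iff extensional_def)
      thus "f v = h v" using lin_hom_zero_minus(1)[OF f LM N] lin_hom_zero_minus(1)[OF h LM N] by simp
    qed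
  next
    case (insert c S)
    show ?case
    proof (intro ballI impI)
      fix v assume v: "v \<in> carrier ?F" and s: "{b \<in> B. v b \<noteq> \<zero>\<^bsub>A\<^esub>} \<subseteq> insert c S"
      show "f v = h v"
      proof (cases "c \<in> B")
        case False
        hence "{b \<in> B. v b \<noteq> \<zero>\<^bsub>A\<^esub>} \<subseteq> S" using s by auto
        thus ?thesis using insert.IH v by blast
      next
        case True
        let ?w = "v(c := \<zero>\<^bsub>A\<^esub>)"
        have fin: "finite {b \<in> B. v b \<noteq> \<zero>\<^bsub>A\<^esub>}" using v by (auto simp: free_module_def)
        have w: "?w \<in> carrier ?F"
          using v True by (auto simp: free_module_def PiE_iff extensional_def intro!: finite_subset[OF _ fin])
        have vc: "v c \<in> carrier A" using v True by (auto simp: free_module_def PiE_iff)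
        have dec: "v = v c \<odot>\<^bsub>?F\<^esub> basis_elt A B c \<oplus>\<^bsub>?F\<^esub> ?w"
          using v True by (auto simp: free_module_def basis_elt_def fun_eq_iff PiE_iff extensional_def)
        interpret LM: left_module A ?F by (rule LM)
        note e = basis_elt_closed[OF A, of B c]
        have *: "k v = v c \<odot>\<^bsub>N\<^esub> k (basis_elt A B c) \<oplus>\<^bsub>N\<^esub> k ?w" if "k \<in> lin_hom A ?F N" for k
          using lin_homD[OF that] e vc w LM.smult_closed by (subst dec) simp
        have "{b \<in> B. ?w b \<noteq> \<zero>\<^bsub>A\<^esub>} \<subseteq> S" using s by auto
        hence "f ?w = h ?w" using insert.IH w by blast
        thus ?thesis using *[OF f] *[OF h] eq[OF True] by simp
      qed
    qed
  qed
  moreover have "finite {b \<in> B. v b \<noteq> \<zero>\<^bsub>A\<^esub>}" using v by (auto simp: free_module_def)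
  ultimately show ?thesis using v by blast
qed

lemma free_module_hom_exists:
  assumes A: "ring A" and M: "left_module A M" and m: "\<And>b. b \<in> B \<Longrightarrow> m b \<in> carrier M"
  shows "\<exists>h \<in> lin_hom A (free_module A B) M. \<forall>b\<in>B. h (basis_elt A B b) = m b"
proof -
  interpret A: ring A by fact
  interpret M: left_module A M by fact
  let ?F = "free_module A B"
  define S where "S v = {b \<in> B. v b \<noteq> \<zero>\<^bsub>A\<^esub>}" for v
  define h where "h = (\<lambda>v\<in>carrier ?F. \<Oplus>\<^bsub>M\<^esub>b\<in>S v. v b \<odot>\<^bsub>M\<^esub> m b)"
  have fin: "finite (S v)" if "v \<in> carrier ?F" for v using that by (simp add: free_module_def S_def)
  have vb: "v b \<in> carrier A" if "v \<in> carrier ?F" "b \<in> B" for v b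
    using that by (auto simp: free_module_def)
  have z: "\<zero>\<^bsub>A\<^esub> \<odot>\<^bsub>M\<^esub> x = \<zero>\<^bsub>M\<^esub>" if "x \<in> carrier M" for x
  proof -
    have "\<zero>\<^bsub>A\<^esub> \<odot>\<^bsub>M\<^esub> x \<oplus>\<^bsub>M\<^esub> \<zero>\<^bsub>A\<^esub> \<odot>\<^bsub>M\<^esub> x = \<zero>\<^bsub>A\<^esub> \<odot>\<^bsub>M\<^esub> x"
      using M.smult_l_distr[of "\<zero>\<^bsub>A\<^esub>" "\<zero>\<^bsub>A\<^esub>" x] that by simp
    thus ?thesis using M.smult_closed[OF A.zero_closed that] by (simp add: M.M.add.l_cancel_one)
  qed
  \<comment> \<open>The sum defining \<open>h v\<close> runs over the support of \<open>v\<close>.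
    Padding with zero terms allows vectors with different supports to be summed over one common
    finite set.\<close>
  have ext: "h v = (\<Oplus>\<^bsub>M\<^esub>b\<in>T. v b \<odot>\<^bsub>M\<^esub> m b)"
    if v: "v \<in> carrier ?F" and T: "finite T" "S v \<subseteq> T" "T \<subseteq> B" for v T
  proof -
    have "(\<Oplus>\<^bsub>M\<^esub>b\<in>S v. v b \<odot>\<^bsub>M\<^esub> m b) = (\<Oplus>\<^bsub>M\<^esub>b\<in>T. v b \<odot>\<^bsub>M\<^esub> m b)"
      using T v vb m by (intro M.M.add.finprod_mono_neutral_cong_left)
        (auto simp: S_def z M.smult_closed subset_eq)
    thus ?thesis using v by (simp add: h_def)
  qed
  interpret F: left_module A ?F by (rule left_module_free_module[OF A])
  have "h \<in> lin_hom A ?F M"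
  proof (rule lin_homI)
    show "h \<in> carrier ?F \<rightarrow>\<^sub>E carrier M"
      using vb m by (auto simp: h_def S_def intro!: M.M.finsum_closed M.smult_closed)
    fix v w assume v: "v \<in> carrier ?F" and w: "w \<in> carrier ?F"
    let ?T = "S v \<union> S w"
    have vw: "(v \<oplus>\<^bsub>?F\<^esub> w) b = v b \<oplus>\<^bsub>A\<^esub> w b" if "b \<in> B" for b using that by (simp add: free_module_def)
    have T: "finite ?T" "?T \<subseteq> B" "S (v \<oplus>\<^bsub>?F\<^esub> w) \<subseteq> ?T"
      using fin v w by (auto simp: S_def vw)
    have "h (v \<oplus>\<^bsub>?F\<^esub> w) = (\<Oplus>\<^bsub>M\<^esub>b\<in>?T. (v \<oplus>\<^bsub>?F\<^esub> w) b \<odot>\<^bsub>M\<^esub> m b)"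
      using T v w by (intro ext) auto
    also have "\<dots> = (\<Oplus>\<^bsub>M\<^esub>b\<in>?T. v b \<odot>\<^bsub>M\<^esub> m b \<oplus>\<^bsub>M\<^esub> w b \<odot>\<^bsub>M\<^esub> m b)"
      using T v w vb m by (intro M.M.finsum_cong') (auto simp: vw M.smult_l_distr M.smult_closed subset_eq Pi_iff)
    also have "\<dots> = (\<Oplus>\<^bsub>M\<^esub>b\<in>?T. v b \<odot>\<^bsub>M\<^esub> m b) \<oplus>\<^bsub>M\<^esub> (\<Oplus>\<^bsub>M\<^esub>b\<in>?T. w b \<odot>\<^bsub>M\<^esub> m b)"
      using T v w vb m by (intro M.M.finsum_addf) (auto simp: M.smult_closed subset_eq Pi_iff)
    also have "\<dots> = h v \<oplus>\<^bsub>M\<^esub> h w" using T v w ext[of v ?T] ext[of w ?T] by auto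
    finally show "h (v \<oplus>\<^bsub>?F\<^esub> w) = h v \<oplus>\<^bsub>M\<^esub> h w" .
  next
    fix a v assume a: "a \<in> carrier A" and v: "v \<in> carrier ?F"
    have av: "(a \<odot>\<^bsub>?F\<^esub> v) b = a \<otimes>\<^bsub>A\<^esub> v b" if "b \<in> B" for b using that by (simp add: free_module_def)
    have T: "S (a \<odot>\<^bsub>?F\<^esub> v) \<subseteq> S v" using a by (auto simp: S_def av)
    have sub: "S v \<subseteq> B" by (auto simp: S_def)
    have hom: "(\<Oplus>\<^bsub>M\<^esub>b\<in>U. a \<odot>\<^bsub>M\<^esub> (v b \<odot>\<^bsub>M\<^esub> m b)) = a \<odot>\<^bsub>M\<^esub> (\<Oplus>\<^bsub>M\<^esub>b\<in>U. v b \<odot>\<^bsub>M\<^esub> m b)"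
      if "finite U" "U \<subseteq> B" for U
      using that
    proof (induction U)
      case empty thus ?case using a by (simp add: M.smult_zero)
    next
      case (insert b U)
      have *: "(\<lambda>b. v b \<odot>\<^bsub>M\<^esub> m b) \<in> U \<rightarrow> carrier M" "v b \<odot>\<^bsub>M\<^esub> m b \<in> carrier M"
        using insert.prems v vb m by (auto simp: M.smult_closed subset_eq)
      hence "(\<lambda>b. a \<odot>\<^bsub>M\<^esub> (v b \<odot>\<^bsub>M\<^esub> m b)) \<in> U \<rightarrow> carrier M" using a by (auto simp: M.smult_closed Pi_iff)
      thus ?case using insert a * by (simp add: M.M.finsum_insert M.smult_closed M.smult_r_distr M.M.finsum_closed)
    qed
    have "h (a \<odot>\<^bsub>?F\<^esub> v) = (\<Oplus>\<^bsub>M\<^esub>b\<in>S v. (a \<odot>\<^bsub>?F\<^esub> v) b \<odot>\<^bsub>M\<^esub> m b)"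
      using T sub v a fin by (intro ext F.smult_closed) auto
    also have "\<dots> = (\<Oplus>\<^bsub>M\<^esub>b\<in>S v. a \<odot>\<^bsub>M\<^esub> (v b \<odot>\<^bsub>M\<^esub> m b))"
      using sub v vb m a by (intro M.M.finsum_cong') (auto simp: av M.smult_assoc M.smult_closed subset_eq Pi_iff)
    also have "\<dots> = a \<odot>\<^bsub>M\<^esub> h v" using hom[OF fin[OF v] sub] v by (simp add: h_def)
    finally show "h (a \<odot>\<^bsub>?F\<^esub> v) = a \<odot>\<^bsub>M\<^esub> h v" .
  qed
  moreover have "h (basis_elt A B b) = m b" if "b \<in> B" for b
  proof -
    have "h (basis_elt A B b) = (\<Oplus>\<^bsub>M\<^esub>c\<in>{b}. basis_elt A B b c \<odot>\<^bsub>M\<^esub> m c)"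
      using that by (intro ext basis_elt_closed A) (auto simp: S_def basis_elt_def split: if_splits)
    thus ?thesis using that m by (simp add: basis_elt_def M.smult_one M.M.finsum_insert)
  qed
  ultimately show ?thesis by blast
qed

text \<open>Projectivity with an index type of its own: \<open>projective\<close> draws the basis
  from the type of the module elements, whereas the resolution constructed here has its basis
  indexed by triples of exponents.\<close>

definition free_retract :: "('a, 'b) ring_scheme \<Rightarrow> ('a, 'm) module \<Rightarrow> 'i set \<Rightarrow> bool" where
  "free_retract A M B \<longleftrightarrow> left_module A M \<and>
    (\<exists>i r. i \<in> lin_hom A M (free_module A B) \<and> r \<in> lin_hom A (free_module A B) M \<and>
      (\<forall>m\<in>carrier M. r (i m) = m))"

text \<open>The map \<open>e\<close> may fail to be onto as long as \<open>f\<close> takes values in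
  its image. This form lifts through the augmentation and through the differentials of an exact
  complex alike.\<close>

lemma free_retract_lift:
  assumes P: "free_retract A P B" and M: "left_module A M" and N: "left_module A N"
    and e: "e \<in> lin_hom A M N" and f: "f \<in> lin_hom A P N"
    and im: "\<And>x. x \<in> carrier P \<Longrightarrow> f x \<in> e ` carrier M"
  shows "\<exists>h \<in> lin_hom A P M. \<forall>x\<in>carrier P. e (h x) = f x"
proof -
  let ?F = "free_module A B"
  obtain i r where i: "i \<in> lin_hom A P ?F" and r: "r \<in> lin_hom A ?F P"
    and ri: "\<And>m. m \<in> carrier P \<Longrightarrow> r (i m) = m" and LP: "left_module A P"
    using P by (auto simp: free_retract_def)
  have A: "ring A" using M left_moduleD by blast
  note LF = left_module_free_module[OF A, of B]
  \<comment> \<open>For \<open>b\<close> outside \<open>B\<close> the vector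
    \<open>basis_elt A B b\<close> is zero and still lies in the free module, so preimages can be
    chosen for all \<open>b\<close> without a side condition.\<close>
  have "\<exists>m. m \<in> carrier M \<and> e m = f (r (basis_elt A B b))" for b
    using im[of "r (basis_elt A B b)"] lin_homD(2)[OF r] basis_elt_closed[OF A, of B b] by auto
  then obtain m where m: "\<And>b. m b \<in> carrier M" "\<And>b. e (m b) = f (r (basis_elt A B b))" by metis
  obtain h where h: "h \<in> lin_hom A ?F M" "\<And>b. b \<in> B \<Longrightarrow> h (basis_elt A B b) = m b"
    using free_module_hom_exists[OF A M, of B m] m by auto
  have "e (h v) = f (r v)" if "v \<in> carrier ?F" for v
    using free_module_hom_eq[OF A N lin_hom_comp[OF LF h(1) e] lin_hom_comp[OF LF r f] _ that]
      basis_elt_closed[OF A, of B] h(2) m(2) that by auto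
  hence "\<forall>x\<in>carrier P. e ((\<lambda>x\<in>carrier P. h (i x)) x) = f x" using lin_homD(2)[OF i] ri by simp
  thus ?thesis using lin_hom_comp[OF LP i h(1)] by blast
qed

section \<open>Complexes and cohomology groups\<close>

lemma (in abelian_group) a_inv_zero: "\<ominus> \<zero> = \<zero>"
  by (rule minus_equality) auto

lemma (in abelian_group) a_minus_eq_zero:
  assumes "x \<in> carrier G" "y \<in> carrier G" "x \<ominus> y = \<zero>" shows "x = y"
proof -
  have "x = x \<ominus> y \<oplus> y" using assms(1,2) by (simp add: a_minus_def a_assoc l_neg)
  thus ?thesis using assms by simp
qed

section \<open>Cocycles and coboundaries of a complex with values in a module\<close>

locale module_complex =
  fixes A :: "('a, 'b) ring_scheme" and P :: "nat \<Rightarrow> ('a, 'm) module" and d :: "nat \<Rightarrow> 'm \<Rightarrow> 'm"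
  assumes LP: "left_module A (P n)"
    and d: "d n \<in> lin_hom A (P (Suc n)) (P n)"
    and dd: "x \<in> carrier (P (Suc (Suc n))) \<Longrightarrow> d n (d (Suc n) x) = \<zero>\<^bsub>P n\<^esub>"
begin

lemma d_closed: "x \<in> carrier (P (Suc n)) \<Longrightarrow> d n x \<in> carrier (P n)"
  using lin_homD(2)[OF d] .

lemma coboundariesE:
  assumes "s \<in> coboundaries A P d N n"
  obtains "n = 0" "s = (\<lambda>x\<in>carrier (P 0). \<zero>\<^bsub>N\<^esub>)"
  | k t where "n = Suc k" "t \<in> lin_hom A (P k) N" "s = (\<lambda>x\<in>carrier (P (Suc k)). t (d k x))"
  using assms by (cases n) (auto simp: coboundaries_def)

lemma coboundary_SucI:
  "t \<in> lin_hom A (P k) N \<Longrightarrow> (\<lambda>x\<in>carrier (P (Suc k)). t (d k x)) \<in> coboundaries A P d N (Suc k)"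
  by (auto simp: coboundaries_def)

lemma zero_coboundary:
  assumes N: "left_module A N"
  shows "(\<lambda>x\<in>carrier (P n). \<zero>\<^bsub>N\<^esub>) \<in> coboundaries A P d N n"
proof (cases n)
  case (Suc k)
  have "(\<lambda>x\<in>carrier (P (Suc k)). \<zero>\<^bsub>N\<^esub>) =
      (\<lambda>x\<in>carrier (P (Suc k)). (\<lambda>x\<in>carrier (P k). \<zero>\<^bsub>N\<^esub>) (d k x))"
    by (auto simp: fun_eq_iff d_closed)
  thus ?thesis using coboundary_SucI[OF lin_hom_const_zero[OF LP N], of k] Suc by simp
qed (simp add: coboundaries_def)

lemma coboundary_lin_hom:
  assumes "left_module A N" "s \<in> coboundaries A P d N n"
  shows "s \<in> lin_hom A (P n) N"
  using assms(2)
proof (cases rule: coboundariesE)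
  case 1 thus ?thesis using lin_hom_const_zero[OF LP assms(1)] by simp
next
  case (2 k t) thus ?thesis using lin_hom_comp[OF LP d] by blast
qed

lemma coboundary_d:
  assumes "left_module A N" "s \<in> coboundaries A P d N n" "x \<in> carrier (P (Suc n))"
  shows "s (d n x) = \<zero>\<^bsub>N\<^esub>"
  using assms(2)
proof (cases rule: coboundariesE)
  case 1 thus ?thesis using assms d_closed by simp
next
  case (2 k t) thus ?thesis
    using assms d_closed[of x n] dd lin_hom_zero_minus(1)[OF _ LP assms(1)] by simp
qed

lemma coboundary_comp:
  assumes N: "left_module A N" and N': "left_module A N'" and h: "h \<in> lin_hom A N N'"
    and s: "s \<in> coboundaries A P d N n"
  shows "(\<lambda>x\<in>carrier (P n). h (s x)) \<in> coboundaries A P d N' n"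
  using s
proof (cases rule: coboundariesE)
  case 1
  hence "(\<lambda>x\<in>carrier (P n). h (s x)) = (\<lambda>x\<in>carrier (P n). \<zero>\<^bsub>N'\<^esub>)"
    using lin_hom_zero_minus(1)[OF h N N'] by (auto simp: fun_eq_iff)
  thus ?thesis using zero_coboundary[OF N', of n] by simp
next
  case (2 k t)
  have "(\<lambda>x\<in>carrier (P n). h (s x)) = (\<lambda>x\<in>carrier (P (Suc k)). (\<lambda>x\<in>carrier (P k). h (t x)) (d k x))"
    using 2 by (auto simp: fun_eq_iff d_closed)
  thus ?thesis using coboundary_SucI[OF lin_hom_comp[OF LP 2(2) h]] 2(1) by simp
qed

lemma coboundary_minus:
  assumes N: "left_module A N" and "s \<in> coboundaries A P d N n" "s' \<in> coboundaries A P d N n"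
  shows "(\<lambda>x\<in>carrier (P n). s x \<ominus>\<^bsub>N\<^esub> s' x) \<in> coboundaries A P d N n"
proof -
  interpret N: left_module A N by fact
  show ?thesis
  proof (cases n)
    case 0
    hence "(\<lambda>x\<in>carrier (P n). s x \<ominus>\<^bsub>N\<^esub> s' x) = (\<lambda>x\<in>carrier (P n). \<zero>\<^bsub>N\<^esub>)"
      using assms by (auto simp: coboundaries_def fun_eq_iff N.M.r_neg a_minus_def)
    thus ?thesis using zero_coboundary[OF N, of n] by simp
  next
    case (Suc k)
    then obtain t t' where t: "t \<in> lin_hom A (P k) N" "t' \<in> lin_hom A (P k) N"
      "s = (\<lambda>x\<in>carrier (P (Suc k)). t (d k x))" "s' = (\<lambda>x\<in>carrier (P (Suc k)). t' (d k x))"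
      using assms by (auto simp: coboundaries_def)
    have "(\<lambda>x\<in>carrier (P n). s x \<ominus>\<^bsub>N\<^esub> s' x) =
        (\<lambda>x\<in>carrier (P (Suc k)). (\<lambda>x\<in>carrier (P k). t x \<ominus>\<^bsub>N\<^esub> t' x) (d k x))"
      using t Suc by (auto simp: fun_eq_iff d_closed)
    thus ?thesis using coboundary_SucI[OF lin_hom_minus[OF LP N t(1,2)]] Suc by simp
  qed
qed

lemma cocycleI:
  "f \<in> lin_hom A (P n) N \<Longrightarrow> (\<And>x. x \<in> carrier (P (Suc n)) \<Longrightarrow> f (d n x) = \<zero>\<^bsub>N\<^esub>) \<Longrightarrow>
    f \<in> carrier (cocycles A P d N n)"
  by (simp add: cocycles_def)

lemma cocycleD:
  assumes "f \<in> carrier (cocycles A P d N n)"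
  shows "f \<in> lin_hom A (P n) N" "x \<in> carrier (P (Suc n)) \<Longrightarrow> f (d n x) = \<zero>\<^bsub>N\<^esub>"
    "x \<in> carrier (P n) \<Longrightarrow> f x \<in> carrier N" "f \<in> extensional (carrier (P n))"
  using assms by (auto simp: cocycles_def lin_hom_def PiE_iff)

lemma cocycle_minus:
  assumes N: "left_module A N"
    and f: "f \<in> carrier (cocycles A P d N n)" and h: "h \<in> carrier (cocycles A P d N n)"
  shows "(\<lambda>x\<in>carrier (P n). f x \<ominus>\<^bsub>N\<^esub> h x) \<in> carrier (cocycles A P d N n)"
proof -
  interpret N: left_module A N by fact
  show ?thesis
    by (rule cocycleI[OF lin_hom_minus[OF LP N cocycleD(1)[OF f] cocycleD(1)[OF h]]])
      (simp add: cocycleD[OF f] cocycleD[OF h] d_closed N.M.r_neg a_minus_def)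
qed

lemma cocycle_add:
  assumes N: "left_module A N"
    and f: "f \<in> carrier (cocycles A P d N n)" and h: "h \<in> carrier (cocycles A P d N n)"
  shows "(\<lambda>x\<in>carrier (P n). f x \<oplus>\<^bsub>N\<^esub> h x) \<in> carrier (cocycles A P d N n)"
proof -
  interpret N: left_module A N by fact
  show ?thesis
    by (rule cocycleI[OF lin_hom_add[OF LP N cocycleD(1)[OF f] cocycleD(1)[OF h]]])
      (simp add: cocycleD[OF f] cocycleD[OF h] d_closed)
qed

lemma cocycle_zero:
  assumes N: "left_module A N"
  shows "(\<lambda>x\<in>carrier (P n). \<zero>\<^bsub>N\<^esub>) \<in> carrier (cocycles A P d N n)"
  by (rule cocycleI[OF lin_hom_const_zero[OF LP N]]) (simp add: d_closed)

lemma cocycles_simps: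
  "f \<otimes>\<^bsub>cocycles A P d N n\<^esub> h = (\<lambda>x\<in>carrier (P n). f x \<oplus>\<^bsub>N\<^esub> h x)"
  "\<one>\<^bsub>cocycles A P d N n\<^esub> = (\<lambda>x\<in>carrier (P n). \<zero>\<^bsub>N\<^esub>)"
  by (simp_all add: cocycles_def)

lemma comm_group_cocycles:
  assumes N: "left_module A N" shows "comm_group (cocycles A P d N n)"
proof (rule comm_groupI)
  interpret N: left_module A N by fact
  let ?Z = "cocycles A P d N n"
  note D = cocycleD[of _ N n]
  show "\<one>\<^bsub>?Z\<^esub> \<in> carrier ?Z" using cocycle_zero[OF N] by (simp add: cocycles_simps)
  fix f assume f: "f \<in> carrier ?Z"
  show "\<one>\<^bsub>?Z\<^esub> \<otimes>\<^bsub>?Z\<^esub> f = f" using D(3,4)[OF f] by (auto simp: cocycles_simps fun_eq_iff extensional_def)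
  have "(\<lambda>x\<in>carrier (P n). (\<lambda>x\<in>carrier (P n). \<zero>\<^bsub>N\<^esub>) x \<ominus>\<^bsub>N\<^esub> f x) \<otimes>\<^bsub>?Z\<^esub> f = \<one>\<^bsub>?Z\<^esub>"
    using D(3)[OF f] by (auto simp: cocycles_simps fun_eq_iff a_minus_def N.M.l_neg)
  thus "\<exists>h\<in>carrier ?Z. h \<otimes>\<^bsub>?Z\<^esub> f = \<one>\<^bsub>?Z\<^esub>" using cocycle_minus[OF N cocycle_zero[OF N] f] by blast
  fix h assume h: "h \<in> carrier ?Z"
  show "f \<otimes>\<^bsub>?Z\<^esub> h \<in> carrier ?Z" using cocycle_add[OF N f h] by (simp add: cocycles_simps)
  show "f \<otimes>\<^bsub>?Z\<^esub> h = h \<otimes>\<^bsub>?Z\<^esub> f" using D(3)[OF f] D(3)[OF h] N.M.a_comm by (auto simp: cocycles_simps fun_eq_iff)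
  fix k assume k: "k \<in> carrier ?Z"
  show "f \<otimes>\<^bsub>?Z\<^esub> h \<otimes>\<^bsub>?Z\<^esub> k = f \<otimes>\<^bsub>?Z\<^esub> (h \<otimes>\<^bsub>?Z\<^esub> k)"
    using D(3)[OF f] D(3)[OF h] D(3)[OF k] N.M.a_assoc by (auto simp: cocycles_simps fun_eq_iff)
qed

lemma inv_cocycle:
  assumes N: "left_module A N" and f: "f \<in> carrier (cocycles A P d N n)"
  shows "inv\<^bsub>cocycles A P d N n\<^esub> f = (\<lambda>x\<in>carrier (P n). \<ominus>\<^bsub>N\<^esub> f x)"
proof -
  interpret N: left_module A N by fact
  interpret Z: comm_group "cocycles A P d N n" by (rule comm_group_cocycles[OF N])
  have "(\<lambda>x\<in>carrier (P n). \<ominus>\<^bsub>N\<^esub> f x) = (\<lambda>x\<in>carrier (P n). (\<lambda>x\<in>carrier (P n). \<zero>\<^bsub>N\<^esub>) x \<ominus>\<^bsub>N\<^esub> f x)"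
    using cocycleD(3)[OF f] by (auto simp: fun_eq_iff a_minus_def)
  hence "(\<lambda>x\<in>carrier (P n). \<ominus>\<^bsub>N\<^esub> f x) \<in> carrier (cocycles A P d N n)"
    using cocycle_minus[OF N cocycle_zero[OF N] f] by simp
  thus ?thesis using f cocycleD(3)[OF f]
    by (intro Z.inv_equality) (auto simp: cocycles_simps fun_eq_iff N.M.l_neg)
qed

lemma subgroup_coboundaries:
  assumes N: "left_module A N"
  shows "subgroup (coboundaries A P d N n) (cocycles A P d N n)"
proof -
  interpret N: left_module A N by fact
  interpret Z: comm_group "cocycles A P d N n" by (rule comm_group_cocycles[OF N])
  let ?B = "coboundaries A P d N n"
  have sub: "?B \<subseteq> carrier (cocycles A P d N n)"
    using cocycleI coboundary_lin_hom[OF N] coboundary_d[OF N] by blast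
  have inv: "inv\<^bsub>cocycles A P d N n\<^esub> s \<in> ?B" if s: "s \<in> ?B" for s
  proof -
    have "inv\<^bsub>cocycles A P d N n\<^esub> s = (\<lambda>x\<in>carrier (P n). (\<lambda>x\<in>carrier (P n). \<zero>\<^bsub>N\<^esub>) x \<ominus>\<^bsub>N\<^esub> s x)"
      using s sub cocycleD(3)[of s N n] inv_cocycle[OF N, of s n] by (auto simp: fun_eq_iff a_minus_def)
    thus ?thesis using coboundary_minus[OF N zero_coboundary[OF N] s] by simp
  qed
  show ?thesis
  proof (rule Z.subgroupI)
    show "?B \<noteq> {}" using zero_coboundary[OF N] by blast
    fix s t assume s: "s \<in> ?B" and t: "t \<in> ?B"
    have "s \<otimes>\<^bsub>cocycles A P d N n\<^esub> t =
        (\<lambda>x\<in>carrier (P n). s x \<ominus>\<^bsub>N\<^esub> (inv\<^bsub>cocycles A P d N n\<^esub> t) x)"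
      using t sub cocycleD(3)[of t N n] inv_cocycle[OF N, of t n]
      by (auto simp: cocycles_simps fun_eq_iff a_minus_def)
    thus "s \<otimes>\<^bsub>cocycles A P d N n\<^esub> t \<in> ?B" using coboundary_minus[OF N s inv[OF t]] by simp
  qed (use sub inv in auto)
qed

text \<open>Turns equality of cosets into a statement about pointwise differences, the form in which
  homotopies deliver it.\<close>

lemma ext_class_eq_iff:
  assumes N: "left_module A N"
    and f: "f \<in> carrier (cocycles A P d N n)" and h: "h \<in> carrier (cocycles A P d N n)"
  shows "ext_class A P d N n f = ext_class A P d N n h \<longleftrightarrow>
    (\<lambda>x\<in>carrier (P n). f x \<ominus>\<^bsub>N\<^esub> h x) \<in> coboundaries A P d N n"
proof -
  interpret N: left_module A N by fact
  interpret Z: comm_group "cocycles A P d N n" by (rule comm_group_cocycles[OF N])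
  interpret B: subgroup "coboundaries A P d N n" "cocycles A P d N n"
    by (rule subgroup_coboundaries[OF N])
  have "f \<otimes>\<^bsub>cocycles A P d N n\<^esub> inv\<^bsub>cocycles A P d N n\<^esub> h = (\<lambda>x\<in>carrier (P n). f x \<ominus>\<^bsub>N\<^esub> h x)"
    using inv_cocycle[OF N h] by (auto simp: cocycles_simps fun_eq_iff a_minus_def)
  moreover have "ext_class A P d N n f = ext_class A P d N n h \<longleftrightarrow>
      f \<otimes>\<^bsub>cocycles A P d N n\<^esub> inv\<^bsub>cocycles A P d N n\<^esub> h \<in> coboundaries A P d N n"
  proof
    assume "ext_class A P d N n f = ext_class A P d N n h"
    hence "f \<in> coboundaries A P d N n #>\<^bsub>cocycles A P d N n\<^esub> h"
      using Z.rcos_self[OF f B.subgroup_axioms] by (simp add: ext_class_def)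
    then obtain s where "s \<in> coboundaries A P d N n" "f = s \<otimes>\<^bsub>cocycles A P d N n\<^esub> h"
      by (auto simp: r_coset_def)
    thus "f \<otimes>\<^bsub>cocycles A P d N n\<^esub> inv\<^bsub>cocycles A P d N n\<^esub> h \<in> coboundaries A P d N n"
      using h B.subset by (auto simp: Z.m_assoc subset_eq)
  next
    assume *: "f \<otimes>\<^bsub>cocycles A P d N n\<^esub> inv\<^bsub>cocycles A P d N n\<^esub> h \<in> coboundaries A P d N n"
    have "f = f \<otimes>\<^bsub>cocycles A P d N n\<^esub> inv\<^bsub>cocycles A P d N n\<^esub> h \<otimes>\<^bsub>cocycles A P d N n\<^esub> h"
      using f h by (simp add: Z.m_assoc)
    hence "f \<in> coboundaries A P d N n #>\<^bsub>cocycles A P d N n\<^esub> h"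
      using * by (auto simp: r_coset_def)
    thus "ext_class A P d N n f = ext_class A P d N n h"
      using Z.repr_independence[OF _ h B.subgroup_axioms] by (simp add: ext_class_def)
  qed
  ultimately show ?thesis by simp
qed

end

section \<open>Comparison maps\<close>

text \<open>Separates exactness from projectivity: the comparison theorem uses the first in the
  target and the second in the source.\<close>

definition exact_complex ::
  "('a, 'b) ring_scheme \<Rightarrow> ('a, 'n) module \<Rightarrow> (nat \<Rightarrow> ('a, 'm) module) \<Rightarrow>
    (nat \<Rightarrow> 'm \<Rightarrow> 'm) \<Rightarrow> ('m \<Rightarrow> 'n) \<Rightarrow> bool" where
  "exact_complex A M P d \<eta> \<longleftrightarrow>
    left_module A M \<and> (\<forall>n. left_module A (P n)) \<and>
    (\<forall>n. d n \<in> lin_hom A (P (Suc n)) (P n)) \<and>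
    \<eta> \<in> lin_hom A (P 0) M \<and> \<eta> ` carrier (P 0) = carrier M \<and>
    d 0 ` carrier (P 1) = {x \<in> carrier (P 0). \<eta> x = \<zero>\<^bsub>M\<^esub>} \<and>
    (\<forall>n. d (Suc n) ` carrier (P (Suc (Suc n))) = {x \<in> carrier (P (Suc n)). d n x = \<zero>\<^bsub>P n\<^esub>})"

lemma exact_complex_module_complex:
  assumes "exact_complex A M P d \<eta>" shows "module_complex A P d"
proof (rule module_complex.intro)
  fix n x assume "x \<in> carrier (P (Suc (Suc n)))"
  hence "d (Suc n) x \<in> d (Suc n) ` carrier (P (Suc (Suc n)))" by blast
  thus "d n (d (Suc n) x) = \<zero>\<^bsub>P n\<^esub>" using assms by (auto simp: exact_complex_def)
qed (use assms in \<open>auto simp: exact_complex_def\<close>)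

text \<open>The two complexes have independent types because the locale is instantiated in three
  ways: from the given resolution to the constructed one, back again, and from the given one to
  itself.\<close>

locale comparison = module_complex A P d
  for A :: "('a, 'b) ring_scheme" and P :: "nat \<Rightarrow> ('a, 'm) module" and d :: "nat \<Rightarrow> 'm \<Rightarrow> 'm" +
  fixes M :: "('a, 'n) module" and Q :: "nat \<Rightarrow> ('a, 'q) module" and e :: "nat \<Rightarrow> 'q \<Rightarrow> 'q"
    and \<eta> :: "'q \<Rightarrow> 'n" and B :: "nat \<Rightarrow> 'i set"
  assumes P: "free_retract A (P n) (B n)"
    and Q: "exact_complex A M Q e \<eta>"
begin

sublocale Q: module_complex A Q e
  by (rule exact_complex_module_complex[OF Q])

lemma M: "left_module A M" and \<eta>: "\<eta> \<in> lin_hom A (Q 0) M"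
  and \<eta>_surj: "\<eta> ` carrier (Q 0) = carrier M"
  and \<eta>_e: "x \<in> carrier (Q 1) \<Longrightarrow> \<eta> (e 0 x) = \<zero>\<^bsub>M\<^esub>"
  using Q by (auto simp: exact_complex_def)

text \<open>In degree zero \<open>\<eta>\<close> takes the place of the missing differential, so
  that cycles coincide with boundaries in every degree (\<open>im_e\<close>).\<close>

definition ker :: "nat \<Rightarrow> 'q set" where
  "ker i = (case i of 0 \<Rightarrow> {x \<in> carrier (Q 0). \<eta> x = \<zero>\<^bsub>M\<^esub>}
     | Suc j \<Rightarrow> {x \<in> carrier (Q (Suc j)). e j x = \<zero>\<^bsub>Q j\<^esub>})"

lemma im_e: "e i ` carrier (Q (Suc i)) = ker i"
  using Q by (auto simp: exact_complex_def ker_def split: nat.split)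

definition lifts :: "nat \<Rightarrow> ('m \<Rightarrow> 'n) \<Rightarrow> (nat \<Rightarrow> 'm \<Rightarrow> 'q) \<Rightarrow> bool" where
  "lifts n f L \<longleftrightarrow> (\<forall>i. L i \<in> lin_hom A (P (n + i)) (Q i)) \<and>
    (\<forall>x\<in>carrier (P n). \<eta> (L 0 x) = f x) \<and>
    (\<forall>i. \<forall>x\<in>carrier (P (n + Suc i)). e i (L (Suc i) x) = L i (d (n + i) x))"

text \<open>Dependent choice with the invariant that \<open>L\<close> composed with \<open>d\<close>
  lands in the cycles \<open>ker i\<close>. By exactness these are boundaries, which is what the
  next lifting step requires.\<close>

lemma lift_exists:
  assumes f: "f \<in> carrier (cocycles A P d M n)"
  shows "\<exists>L. lifts n f L"
proof -
  let ?C = "\<lambda>i L. L \<in> lin_hom A (P (n + i)) (Q i) \<and>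
    (i = 0 \<longrightarrow> (\<forall>x\<in>carrier (P n). \<eta> (L x) = f x)) \<and>
    (\<forall>x\<in>carrier (P (Suc (n + i))). L (d (n + i) x) \<in> ker i)"
  let ?R = "\<lambda>i L L'. \<forall>x\<in>carrier (P (Suc (n + i))). e i (L' x) = L (d (n + i) x)"
  have "\<exists>L. \<forall>i. ?C i (L i) \<and> ?R i (L i) (L (Suc i))"
  proof (rule dependent_nat_choice)
    obtain L where L: "L \<in> lin_hom A (P n) (Q 0)" "\<forall>x\<in>carrier (P n). \<eta> (L x) = f x"
      using free_retract_lift[OF P[of n] Q.LP M \<eta> cocycleD(1)[OF f]] \<eta>_surj cocycleD(3)[OF f] by auto
    thus "\<exists>L. ?C 0 L"
      using d_closed lin_homD(2)[OF L(1)] cocycleD(2)[OF f] by (intro exI[of _ L]) (auto simp: ker_def)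
  next
    fix L i assume L: "?C i L"
    have "(\<lambda>x\<in>carrier (P (Suc (n + i))). L (d (n + i) x)) \<in> lin_hom A (P (Suc (n + i))) (Q i)"
      using L by (intro lin_hom_comp[OF LP d]) auto
    then obtain L' where L': "L' \<in> lin_hom A (P (Suc (n + i))) (Q (Suc i))"
      "\<forall>x\<in>carrier (P (Suc (n + i))). e i (L' x) = L (d (n + i) x)"
      using free_retract_lift[OF P Q.LP[of "Suc i"] Q.LP[of i] Q.d, of "\<lambda>x\<in>carrier (P (Suc (n + i))). L (d (n + i) x)" "Suc (n + i)"]
        L im_e[of i] by auto
    have "L' (d (Suc (n + i)) x) \<in> ker (Suc i)" if "x \<in> carrier (P (Suc (Suc (n + i))))" for x
      using that L' d_closed[OF that] dd[OF that] lin_homD(2)[OF L'(1)] L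
        lin_hom_zero_minus(1)[OF _ LP Q.LP, of L] by (auto simp: ker_def)
    thus "\<exists>L'. ?C (Suc i) L' \<and> ?R i L L'" using L' by (intro exI[of _ L']) simp
  qed
  then obtain L where "\<And>i. ?C i (L i)" "\<And>i. ?R i (L i) (L (Suc i))" by blast
  thus ?thesis unfolding lifts_def by (intro exI[of _ L]) auto
qed

text \<open>A lift of a coboundary is null-homotopic; in degree \<open>i\<close> only the part \<open>s\<close> of the homotopy
  that factors through \<open>d\<close> matters for cocycles on \<open>Q\<close>.\<close>

lemma null_lift:
  assumes f: "f \<in> coboundaries A P d M n" and L: "lifts n f L"
  shows "\<exists>s \<in> coboundaries A P d (Q i) (n + i). \<forall>x\<in>carrier (P (n + i)). L i x \<ominus>\<^bsub>Q i\<^esub> s x \<in> ker i"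
proof (induction i)
  case 0
  interpret M: left_module A M by (rule M)
  interpret Q0: left_module A "Q 0" by (rule Q.LP)
  have L0: "L 0 \<in> lin_hom A (P n) (Q 0)" "\<forall>x\<in>carrier (P n). \<eta> (L 0 x) = f x"
    using L by (auto simp: lifts_def dest: spec[of _ 0])
  have "\<exists>s \<in> coboundaries A P d (Q 0) n. \<forall>x\<in>carrier (P n). \<eta> (s x) = f x"
    using f
  proof (cases rule: coboundariesE)
    case 1
    thus ?thesis using zero_coboundary[OF Q.LP, of 0 n] lin_hom_zero_minus(1)[OF \<eta> Q.LP M]
      by (intro bexI[of _ "\<lambda>x\<in>carrier (P n). \<zero>\<^bsub>Q 0\<^esub>"]) auto
  next
    case (2 k t)
    \<comment> \<open>With \<open>f = t d\<close>, a lift of \<open>t\<close> through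
      \<open>\<eta>\<close>, composed with \<open>d\<close>, is the required
      \<open>s\<close>.\<close>
    obtain t' where t': "t' \<in> lin_hom A (P k) (Q 0)" "\<forall>x\<in>carrier (P k). \<eta> (t' x) = t x"
      using free_retract_lift[OF P Q.LP M \<eta> 2(2)] \<eta>_surj lin_homD(2)[OF 2(2)] by auto
    show ?thesis using 2 t' coboundary_SucI[OF t'(1)] d_closed
      by (intro bexI[of _ "\<lambda>x\<in>carrier (P (Suc k)). t' (d k x)"]) auto
  qed
  then obtain s where s: "s \<in> coboundaries A P d (Q 0) n" "\<forall>x\<in>carrier (P n). \<eta> (s x) = f x" by blast
  have "L 0 x \<ominus>\<^bsub>Q 0\<^esub> s x \<in> ker 0" if x: "x \<in> carrier (P n)" for x
  proof -
    have "L 0 x \<in> carrier (Q 0)" "s x \<in> carrier (Q 0)"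
      using x lin_homD(2)[OF L0(1)] lin_homD(2)[OF coboundary_lin_hom[OF Q.LP s(1)]] by auto
    moreover have "f x \<in> carrier M" using coboundary_lin_hom[OF M f] lin_homD(2) x by metis
    ultimately show ?thesis using L0(2) s(2) x lin_hom_zero_minus(3)[OF \<eta> Q.LP M]
      by (simp add: ker_def M.M.r_neg a_minus_def)
  qed
  thus ?case using s(1) by auto
next
  case (Suc i)
  interpret Q0: left_module A "Q i" by (rule Q.LP)
  interpret Q1: left_module A "Q (Suc i)" by (rule Q.LP)
  obtain s where s: "s \<in> coboundaries A P d (Q i) (n + i)"
    and sk: "\<And>x. x \<in> carrier (P (n + i)) \<Longrightarrow> L i x \<ominus>\<^bsub>Q i\<^esub> s x \<in> ker i" using Suc by blast
  have Li: "L i \<in> lin_hom A (P (n + i)) (Q i)" and LS: "L (Suc i) \<in> lin_hom A (P (Suc (n + i))) (Q (Suc i))"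
    and eL: "\<And>x. x \<in> carrier (P (Suc (n + i))) \<Longrightarrow> e i (L (Suc i) x) = L i (d (n + i) x)"
    using L by (auto simp: lifts_def dest: spec[of _ "Suc i"])
  note sl = coboundary_lin_hom[OF Q.LP s]
  let ?g = "\<lambda>x\<in>carrier (P (n + i)). L i x \<ominus>\<^bsub>Q i\<^esub> s x"
  \<comment> \<open>This is the next component of the homotopy: \<open>L i - s\<close> takes values
    in cycles, hence lifts through \<open>e i\<close>.\<close>
  obtain t where t: "t \<in> lin_hom A (P (n + i)) (Q (Suc i))"
    "\<And>x. x \<in> carrier (P (n + i)) \<Longrightarrow> e i (t x) = L i x \<ominus>\<^bsub>Q i\<^esub> s x"
    using free_retract_lift[OF P Q.LP Q.LP Q.d lin_hom_minus[OF LP Q.LP Li sl]] sk im_e[of i] by auto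
  let ?s = "\<lambda>x\<in>carrier (P (Suc (n + i))). t (d (n + i) x)"
  have "L (Suc i) x \<ominus>\<^bsub>Q (Suc i)\<^esub> ?s x \<in> ker (Suc i)" if x: "x \<in> carrier (P (Suc (n + i)))" for x
  proof -
    have c: "L (Suc i) x \<in> carrier (Q (Suc i))" "t (d (n + i) x) \<in> carrier (Q (Suc i))"
        "L i (d (n + i) x) \<in> carrier (Q i)"
      using x lin_homD(2)[OF LS] lin_homD(2)[OF t(1)] lin_homD(2)[OF Li] d_closed by auto
    \<comment> \<open>As a coboundary, \<open>s\<close> vanishes on the image of \<open>d\<close>,
      so \<open>e i\<close> sends both terms of the difference to
      \<open>L i (d (n + i) x)\<close>.\<close>
    have "e i (L (Suc i) x \<ominus>\<^bsub>Q (Suc i)\<^esub> ?s x) = L i (d (n + i) x) \<ominus>\<^bsub>Q i\<^esub> (L i (d (n + i) x) \<ominus>\<^bsub>Q i\<^esub> \<zero>\<^bsub>Q i\<^esub>)"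
      using x c eL t(2) d_closed coboundary_d[OF Q.LP s x] lin_hom_zero_minus(3)[OF Q.d Q.LP Q.LP] by simp
    also have "\<dots> = \<zero>\<^bsub>Q i\<^esub>" using c(3) by (simp add: a_minus_def Q0.M.r_neg Q0.M.a_inv_zero)
    finally show ?thesis using c x by (simp add: ker_def)
  qed
  thus ?case using coboundary_SucI[OF t(1)] by (intro bexI[of _ ?s]) simp_all
qed

text \<open>By \<open>null_lift\<close> the maps \<open>L m\<close> and \<open>s\<close> differ by
  boundaries, on which the cocycle \<open>h\<close> vanishes. Thus \<open>h L = h s\<close>, and
  composing a coboundary with \<open>h\<close> leaves it a coboundary.\<close>

lemma cocycle_comp_null_lift:
  assumes f: "f \<in> coboundaries A P d M n" and L: "lifts n f L"
    and N: "left_module A N" and h: "h \<in> carrier (cocycles A Q e N m)"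
  shows "(\<lambda>x\<in>carrier (P (n + m)). h (L m x)) \<in> coboundaries A P d N (n + m)"
proof -
  interpret N: left_module A N by (rule N)
  interpret Qm: left_module A "Q m" by (rule Q.LP)
  obtain s where s: "s \<in> coboundaries A P d (Q m) (n + m)"
    and sk: "\<And>x. x \<in> carrier (P (n + m)) \<Longrightarrow> L m x \<ominus>\<^bsub>Q m\<^esub> s x \<in> ker m" using null_lift[OF f L] by blast
  have "h (L m x) = h (s x)" if x: "x \<in> carrier (P (n + m))" for x
  proof -
    obtain z where z: "z \<in> carrier (Q (Suc m))" "e m z = L m x \<ominus>\<^bsub>Q m\<^esub> s x"
      using sk[OF x] im_e[of m] by (metis imageE)
    have "L m \<in> lin_hom A (P (n + m)) (Q m)" using L by (simp add: lifts_def)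
    hence c: "L m x \<in> carrier (Q m)" "s x \<in> carrier (Q m)"
      using x lin_homD(2) lin_homD(2)[OF coboundary_lin_hom[OF Q.LP s]] by metis+
    have "h (L m x) \<ominus>\<^bsub>N\<^esub> h (s x) = \<zero>\<^bsub>N\<^esub>"
      using Q.cocycleD(2)[OF h z(1)] z(2) lin_hom_zero_minus(3)[OF Q.cocycleD(1)[OF h] Q.LP N] c by simp
    thus ?thesis using c Q.cocycleD(3)[OF h] N.M.a_minus_eq_zero by blast
  qed
  hence "(\<lambda>x\<in>carrier (P (n + m)). h (L m x)) = (\<lambda>x\<in>carrier (P (n + m)). h (s x))" by auto
  thus ?thesis using coboundary_comp[OF Q.LP N Q.cocycleD(1)[OF h] s] by simp
qed

lemma cocycle_comp_lift:
  assumes L: "lifts n f L" and N: "left_module A N" and h: "h \<in> carrier (cocycles A Q e N m)"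
  shows "(\<lambda>x\<in>carrier (P (n + m)). h (L m x)) \<in> carrier (cocycles A P d N (n + m))"
proof (rule cocycleI)
  have Lm: "L i \<in> lin_hom A (P (n + i)) (Q i)" for i using L by (auto simp: lifts_def)
  show "(\<lambda>x\<in>carrier (P (n + m)). h (L m x)) \<in> lin_hom A (P (n + m)) N"
    by (rule lin_hom_comp[OF LP Lm Q.cocycleD(1)[OF h]])
  fix x assume x: "x \<in> carrier (P (Suc (n + m)))"
  hence "L m (d (n + m) x) = e m (L (Suc m) x)" using L by (simp add: lifts_def)
  thus "(\<lambda>x\<in>carrier (P (n + m)). h (L m x)) (d (n + m) x) = \<zero>\<^bsub>N\<^esub>"
    using x d_closed Q.cocycleD(2)[OF h, of "L (Suc m) x"] lin_homD(2)[OF Lm[of "Suc m"]] by simp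
qed

text \<open>The difference of the two lifts is a lift of the difference of the cocycles. The
  statement covers at once a change of the lift and a change of the cocycle within its
  class.\<close>

lemma lift_unique:
  assumes L: "lifts n f L" and L': "lifts n f' L'"
    and ff: "(\<lambda>x\<in>carrier (P n). f x \<ominus>\<^bsub>M\<^esub> f' x) \<in> coboundaries A P d M n"
    and N: "left_module A N" and h: "h \<in> carrier (cocycles A Q e N m)"
  shows "ext_class A P d N (n + m) (\<lambda>x\<in>carrier (P (n + m)). h (L m x)) =
    ext_class A P d N (n + m) (\<lambda>x\<in>carrier (P (n + m)). h (L' m x))"
proof -
  have Li: "L i \<in> lin_hom A (P (n + i)) (Q i)" and Li': "L' i \<in> lin_hom A (P (n + i)) (Q i)" for i
    using L L' by (auto simp: lifts_def)
  have c: "L i x \<in> carrier (Q i)" "L' i x \<in> carrier (Q i)" if "x \<in> carrier (P (n + i))" for i x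
    using lin_homD(2)[OF Li that] lin_homD(2)[OF Li' that] by auto
  let ?D = "\<lambda>i. \<lambda>x\<in>carrier (P (n + i)). L i x \<ominus>\<^bsub>Q i\<^esub> L' i x"
  have D: "lifts n (\<lambda>x\<in>carrier (P n). f x \<ominus>\<^bsub>M\<^esub> f' x) ?D"
    unfolding lifts_def
  proof (intro conjI allI ballI)
    show "?D i \<in> lin_hom A (P (n + i)) (Q i)" for i by (rule lin_hom_minus[OF LP Q.LP Li Li'])
    fix x assume x: "x \<in> carrier (P n)"
    thus "\<eta> (?D 0 x) = (\<lambda>x\<in>carrier (P n). f x \<ominus>\<^bsub>M\<^esub> f' x) x"
      using L L' c[of x 0] lin_hom_zero_minus(3)[OF \<eta> Q.LP M] by (simp add: lifts_def)
  next
    fix i x assume x: "x \<in> carrier (P (n + Suc i))"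
    thus "e i (?D (Suc i) x) = ?D i (d (n + i) x)"
      using L L' c[of x "Suc i"] d_closed lin_hom_zero_minus(3)[OF Q.d Q.LP Q.LP] by (simp add: lifts_def)
  qed
  have "(\<lambda>x\<in>carrier (P (n + m)). h (?D m x)) = (\<lambda>x\<in>carrier (P (n + m)).
      (\<lambda>x\<in>carrier (P (n + m)). h (L m x)) x \<ominus>\<^bsub>N\<^esub> (\<lambda>x\<in>carrier (P (n + m)). h (L' m x)) x)"
    using c[of _ m] lin_hom_zero_minus(3)[OF Q.cocycleD(1)[OF h] Q.LP N] by (auto simp: fun_eq_iff)
  thus ?thesis
    using cocycle_comp_null_lift[OF ff D N h] ext_class_eq_iff[OF N cocycle_comp_lift[OF L N h] cocycle_comp_lift[OF L' N h]]
    by simp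
qed

end

section \<open>A criterion for finite generation of the Yoneda algebra\<close>

lemma projective_resolution_comparison:
  assumes "projective_resolution A M P d \<eta>"
  shows "exact_complex A M P d \<eta>"
    "\<exists>B :: nat \<Rightarrow> 'm set. \<forall>n. free_retract A (P n :: ('a, 'm) module) (B n)"
proof -
  have "\<forall>n. \<exists>B :: 'm set. free_retract A (P n) B"
    using assms by (auto simp: projective_resolution_def projective_def free_retract_def)
  thus "\<exists>B :: nat \<Rightarrow> 'm set. \<forall>n. free_retract A (P n) (B n)" by (rule choice)
  show "exact_complex A M P d \<eta>"
    using assms by (auto simp: projective_resolution_def projective_def exact_complex_def)
qed

section \<open>The Yoneda product on cohomology classes\<close>

locale self_comparison = comparison A P d M P d \<eta> B
  for A :: "('a, 'b) ring_scheme" and P :: "nat \<Rightarrow> ('a, 'm) module" and d :: "nat \<Rightarrow> 'm \<Rightarrow> 'm"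
    and M :: "('a, 'n) module" and \<eta> :: "'m \<Rightarrow> 'n" and B :: "nat \<Rightarrow> 'i set"
begin

abbreviation "Z n \<equiv> carrier (cocycles A P d M n)"
abbreviation "cls n f \<equiv> ext_class A P d M n f"
abbreviation "E n \<equiv> Ext A P d M n"
abbreviation "yon m n C D \<equiv> yoneda A P d \<eta> M m n C D"

lemma chain_lift_iff: "chain_lift A P d \<eta> n f L \<longleftrightarrow> lifts n f L"
  by (simp add: chain_lift_def lifts_def)

lemma zero_cocycle: "(\<lambda>x\<in>carrier (P n). \<zero>\<^bsub>M\<^esub>) \<in> Z n"
  by (rule cocycle_zero[OF M])

lemma cls_mem_iff: "f \<in> Z n \<Longrightarrow> h \<in> cls n f \<longleftrightarrow> h \<in> Z n \<and> cls n h = cls n f"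
proof -
  assume f: "f \<in> Z n"
  interpret Z: comm_group "cocycles A P d M n" by (rule comm_group_cocycles[OF M])
  interpret B: subgroup "coboundaries A P d M n" "cocycles A P d M n"
    by (rule subgroup_coboundaries[OF M])
  show ?thesis
  proof
    assume h: "h \<in> cls n f"
    hence "h \<in> Z n" using f B.subset by (auto simp: ext_class_def r_coset_def)
    thus "h \<in> Z n \<and> cls n h = cls n f"
      using h Z.repr_independence[OF _ f B.subgroup_axioms] by (simp add: ext_class_def)
  next
    assume "h \<in> Z n \<and> cls n h = cls n f"
    thus "h \<in> cls n f" using Z.rcos_self[OF _ B.subgroup_axioms] by (auto simp: ext_class_def)
  qed
qed

lemma comm_group_E: "comm_group (E n)"
proof -
  interpret Z: comm_group "cocycles A P d M n" by (rule comm_group_cocycles[OF M])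
  show ?thesis unfolding Ext_def by (rule Z.abelian_FactGroup[OF subgroup_coboundaries[OF M]])
qed

lemma one_E_closed: "\<one>\<^bsub>E n\<^esub> \<in> carrier (E n)"
  using comm_group_E[of n] by (simp add: comm_group_def comm_monoid_def monoid.one_closed)

lemma carrier_E: "carrier (E n) = cls n ` Z n"
  by (auto simp: Ext_def FactGroup_def RCOSETS_def ext_class_def)

lemma cls_closed: "f \<in> Z n \<Longrightarrow> cls n f \<in> carrier (E n)"
  by (simp add: carrier_E)

lemma mult_E:
  assumes "f \<in> Z n" "h \<in> Z n"
  shows "cls n f \<otimes>\<^bsub>E n\<^esub> cls n h = cls n (\<lambda>x\<in>carrier (P n). f x \<oplus>\<^bsub>M\<^esub> h x)"
proof -
  interpret Z: comm_group "cocycles A P d M n" by (rule comm_group_cocycles[OF M])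
  interpret N: normal "coboundaries A P d M n" "cocycles A P d M n"
    using Z.normal_iff_subgroup subgroup_coboundaries[OF M] by blast
  show ?thesis using N.rcos_sum[OF assms]
    by (simp add: Ext_def FactGroup_def ext_class_def cocycles_simps)
qed

lemma one_E: "\<one>\<^bsub>E n\<^esub> = cls n (\<lambda>x\<in>carrier (P n). \<zero>\<^bsub>M\<^esub>)"
proof -
  interpret Z: comm_group "cocycles A P d M n" by (rule comm_group_cocycles[OF M])
  interpret B: subgroup "coboundaries A P d M n" "cocycles A P d M n"
    by (rule subgroup_coboundaries[OF M])
  show ?thesis using Z.coset_mult_one[OF B.subset]
    by (simp add: Ext_def FactGroup_def ext_class_def cocycles_simps)
qed

text \<open>If \<open>f - f'\<close> is \<open>t d\<close>, then its composite with the lift is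
  \<open>t L d\<close>, since lifts commute with the differentials without a sign.\<close>

lemma cls_comp_lift_cong:
  assumes f: "f \<in> Z m" "f' \<in> Z m" "cls m f = cls m f'" and L: "lifts n h L"
  shows "cls (n + m) (\<lambda>x\<in>carrier (P (n + m)). f (L m x)) = cls (n + m) (\<lambda>x\<in>carrier (P (n + m)). f' (L m x))"
proof -
  interpret M: left_module A M by (rule M)
  have Lm: "L i \<in> lin_hom A (P (n + i)) (P i)" for i using L by (simp add: lifts_def)
  let ?b = "\<lambda>x\<in>carrier (P m). f x \<ominus>\<^bsub>M\<^esub> f' x"
  have b: "?b \<in> coboundaries A P d M m" using ext_class_eq_iff[OF M f(1,2)] f(3) by simp
  have "(\<lambda>x\<in>carrier (P (n + m)). ?b (L m x)) \<in> coboundaries A P d M (n + m)"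
    using b
  proof (cases rule: coboundariesE)
    case 1
    hence "(\<lambda>x\<in>carrier (P (n + m)). ?b (L m x)) = (\<lambda>x\<in>carrier (P (n + m)). \<zero>\<^bsub>M\<^esub>)"
      using lin_homD(2)[OF Lm[of 0]] by (auto simp: fun_eq_iff)
    thus ?thesis using zero_coboundary[OF M, of "n + m"] by simp
  next
    case (2 k t)
    have "(\<lambda>x\<in>carrier (P (n + m)). ?b (L m x)) =
        (\<lambda>x\<in>carrier (P (Suc (n + k))). (\<lambda>x\<in>carrier (P (n + k)). t (L k x)) (d (n + k) x))"
      unfolding 2(3) using 2(1) lin_homD(2)[OF Lm[of "Suc k"]] d_closed L by (auto simp: fun_eq_iff lifts_def)
    thus ?thesis using coboundary_SucI[OF lin_hom_comp[OF LP Lm 2(2)]] 2(1) by simp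
  qed
  moreover have "(\<lambda>x\<in>carrier (P (n + m)). ?b (L m x)) = (\<lambda>x\<in>carrier (P (n + m)).
      (\<lambda>x\<in>carrier (P (n + m)). f (L m x)) x \<ominus>\<^bsub>M\<^esub> (\<lambda>x\<in>carrier (P (n + m)). f' (L m x)) x)"
    using lin_homD(2)[OF Lm[of m]] by (auto simp: fun_eq_iff)
  ultimately show ?thesis
    using ext_class_eq_iff[OF M cocycle_comp_lift[OF L M f(1)] cocycle_comp_lift[OF L M f(2)]] by simp
qed

text \<open>\<open>yoneda\<close> is a union over all representatives and all lifts. Every member of
  this union is the same coset and at least one member exists, so the union is that coset.\<close>

lemma yoneda_cls:
  assumes f: "f \<in> Z m" and h: "h \<in> Z n" and L: "lifts n h L"
  shows "yon m n (cls m f) (cls n h) = cls (n + m) (\<lambda>x\<in>carrier (P (n + m)). f (L m x))"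
proof -
  have *: "cls (n + m) (\<lambda>x\<in>carrier (P (n + m)). f' (L' m x)) = cls (n + m) (\<lambda>x\<in>carrier (P (n + m)). f (L m x))"
    if "f' \<in> cls m f" "h' \<in> cls n h" "chain_lift A P d \<eta> n h' L'" for f' h' L'
  proof -
    have f': "f' \<in> Z m" "cls m f' = cls m f" and h': "h' \<in> Z n" "cls n h' = cls n h"
      using that f h cls_mem_iff by auto
    have L': "lifts n h' L'" using that chain_lift_iff by simp
    have "cls (n + m) (\<lambda>x\<in>carrier (P (n + m)). f' (L' m x)) = cls (n + m) (\<lambda>x\<in>carrier (P (n + m)). f' (L m x))"
      using lift_unique[OF L' L _ M f'(1)] ext_class_eq_iff[OF M h'(1) h] h'(2) by simp
    also have "\<dots> = cls (n + m) (\<lambda>x\<in>carrier (P (n + m)). f (L m x))"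
      by (rule cls_comp_lift_cong[OF f'(1) f f'(2) L])
    finally show ?thesis .
  qed
  have ne: "f \<in> cls m f" "h \<in> cls n h" "chain_lift A P d \<eta> n h L"
    using f h L cls_mem_iff chain_lift_iff by auto
  show ?thesis
  proof (intro equalityI subsetI)
    fix z assume "z \<in> yon m n (cls m f) (cls n h)"
    then obtain f' h' L' where "f' \<in> cls m f" "h' \<in> cls n h" "chain_lift A P d \<eta> n h' L'"
      and z: "z \<in> cls (n + m) (\<lambda>x\<in>carrier (P (n + m)). f' (L' m x))"
      unfolding yoneda_def by blast
    show "z \<in> cls (n + m) (\<lambda>x\<in>carrier (P (n + m)). f (L m x))"
      using z unfolding *[OF \<open>f' \<in> cls m f\<close> \<open>h' \<in> cls n h\<close> \<open>chain_lift A P d \<eta> n h' L'\<close>] .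
  next
    fix z assume "z \<in> cls (n + m) (\<lambda>x\<in>carrier (P (n + m)). f (L m x))"
    thus "z \<in> yon m n (cls m f) (cls n h)"
      unfolding yoneda_def using ne(3) by (intro UN_I[OF ne(1)] UN_I[OF ne(2)] UN_I[of L]) simp_all
  qed
qed

lemma yoneda_closed:
  assumes "C \<in> carrier (E m)" "D \<in> carrier (E n)"
  shows "yon m n C D \<in> carrier (E (n + m))"
proof -
  obtain f h where fh: "f \<in> Z m" "C = cls m f" "h \<in> Z n" "D = cls n h" using assms by (auto simp: carrier_E)
  obtain L where L: "lifts n h L" using lift_exists[OF fh(3)] by blast
  show ?thesis using yoneda_cls[OF fh(1,3) L] cls_closed[OF cocycle_comp_lift[OF L M fh(1)]] fh by simp
qed

text \<open>The group \<open>E n\<close> is written multiplicatively, so its one is the zero class.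
  The two sides differ: a zero on the left is composed pointwise, a zero on the right needs the
  null-homotopy of a lift of zero.\<close>

lemma yoneda_one:
  assumes "C \<in> carrier (E m)" "D \<in> carrier (E n)" "C = \<one>\<^bsub>E m\<^esub> \<or> D = \<one>\<^bsub>E n\<^esub>"
  shows "yon m n C D = \<one>\<^bsub>E (n + m)\<^esub>"
proof -
  interpret M: left_module A M by (rule M)
  let ?z = "\<lambda>n. \<lambda>x\<in>carrier (P n). \<zero>\<^bsub>M\<^esub>"
  obtain f h where fh: "f \<in> Z m" "C = cls m f" "h \<in> Z n" "D = cls n h" using assms by (auto simp: carrier_E)
  show ?thesis
  proof (cases "C = \<one>\<^bsub>E m\<^esub>")
    case True
    obtain L where L: "lifts n h L" using lift_exists[OF fh(3)] by blast
    have "yon m n C D = cls (n + m) (\<lambda>x\<in>carrier (P (n + m)). ?z m (L m x))"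
      using yoneda_cls[OF zero_cocycle fh(3) L] True fh(4) by (simp add: one_E)
    moreover have "(\<lambda>x\<in>carrier (P (n + m)). ?z m (L m x)) = ?z (n + m)"
      using L lin_homD(2)[of "L m"] by (fastforce simp: fun_eq_iff lifts_def)
    ultimately show ?thesis by (simp add: one_E)
  next
    case False
    hence D: "D = cls n (?z n)" using assms one_E by simp
    obtain L where L: "lifts n (?z n) L" using lift_exists[OF zero_cocycle] by blast
    note F = cocycle_comp_lift[OF L M fh(1)]
    have "(\<lambda>x\<in>carrier (P (n + m)). (\<lambda>x\<in>carrier (P (n + m)). f (L m x)) x \<ominus>\<^bsub>M\<^esub> ?z (n + m) x) =
        (\<lambda>x\<in>carrier (P (n + m)). f (L m x))"
      using cocycleD(3)[OF F] by (auto simp: fun_eq_iff a_minus_def M.M.a_inv_zero)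
    hence "cls (n + m) (\<lambda>x\<in>carrier (P (n + m)). f (L m x)) = cls (n + m) (?z (n + m))"
      using cocycle_comp_null_lift[OF zero_coboundary[OF M] L M fh(1)]
        ext_class_eq_iff[OF M F zero_cocycle] by simp
    thus ?thesis using yoneda_cls[OF fh(1) zero_cocycle L] D fh(2) by (simp add: one_E)
  qed
qed

definition single :: "nat \<Rightarrow> ('m \<Rightarrow> 'n) set \<Rightarrow> nat \<Rightarrow> ('m \<Rightarrow> 'n) set" where
  "single n C = (\<lambda>i. if i = n then C else \<one>\<^bsub>E i\<^esub>)"

end

section \<open>The Yoneda algebra with trivial coefficients and its homogeneous elements\<close>

locale ext_algebra = self_comparison A P d "trivial_module K \<epsilon>" \<eta> B + K: field K
  for K :: "'k ring" and A :: "('k, 'a) module" and \<epsilon> :: "'a \<Rightarrow> 'k"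
    and P :: "nat \<Rightarrow> ('a, 'm) module" and d :: "nat \<Rightarrow> 'm \<Rightarrow> 'm"
    and \<eta> :: "'m \<Rightarrow> 'k" and B :: "nat \<Rightarrow> 'i set" +
  assumes aug: "augmentation K A \<epsilon>"
begin

abbreviation "T \<equiv> trivial_module K \<epsilon>"
abbreviation "EA \<equiv> Ext_algebra A P d \<eta> T"

lemma T_simps: "carrier T = carrier K" "\<zero>\<^bsub>T\<^esub> = \<zero>\<^bsub>K\<^esub>" "x \<oplus>\<^bsub>T\<^esub> y = x \<oplus>\<^bsub>K\<^esub> y" "a \<odot>\<^bsub>T\<^esub> x = \<epsilon> a \<otimes>\<^bsub>K\<^esub> x"
  by (simp_all add: trivial_module_def)

lemma T_minus: "\<ominus>\<^bsub>T\<^esub> x = \<ominus>\<^bsub>K\<^esub> x" "x \<ominus>\<^bsub>T\<^esub> y = x \<ominus>\<^bsub>K\<^esub> y"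
  by (simp_all add: a_minus_def a_inv_def m_inv_def trivial_module_def)

lemma A_ring: "ring A" using M left_moduleD by blast

lemma eps_scalar: "c \<in> carrier K \<Longrightarrow> \<epsilon> (c \<odot>\<^bsub>A\<^esub> \<one>\<^bsub>A\<^esub>) = c"
proof -
  interpret A: ring A by (rule A_ring)
  assume "c \<in> carrier K"
  thus ?thesis using aug ring_hom_one[of \<epsilon> A K] by (simp add: augmentation_def)
qed

lemma scaled_cocycle:
  assumes c: "c \<in> carrier K" and f: "f \<in> Z n"
  shows "(\<lambda>x\<in>carrier (P n). c \<otimes>\<^bsub>K\<^esub> f x) \<in> Z n"
proof (rule cocycleI)
  interpret Pn: left_module A "P n" by (rule LP)
  have eps: "\<epsilon> a \<in> carrier K" if "a \<in> carrier A" for a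
    using aug that by (auto simp: augmentation_def dest: ring_hom_closed)
  note D = cocycleD[OF f] lin_homD[OF cocycleD(1)[OF f]]
  show "(\<lambda>x\<in>carrier (P n). c \<otimes>\<^bsub>K\<^esub> f x) \<in> lin_hom A (P n) T"
  proof (rule lin_homI)
    show "(\<lambda>x\<in>carrier (P n). c \<otimes>\<^bsub>K\<^esub> f x) \<in> carrier (P n) \<rightarrow>\<^sub>E carrier T"
      using D(3) c by (auto simp: T_simps)
    show "(\<lambda>x\<in>carrier (P n). c \<otimes>\<^bsub>K\<^esub> f x) (x \<oplus>\<^bsub>P n\<^esub> y) =
        (\<lambda>x\<in>carrier (P n). c \<otimes>\<^bsub>K\<^esub> f x) x \<oplus>\<^bsub>T\<^esub> (\<lambda>x\<in>carrier (P n). c \<otimes>\<^bsub>K\<^esub> f x) y"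
      if "x \<in> carrier (P n)" "y \<in> carrier (P n)" for x y
      using that D(3) D(7)[OF that] c by (simp add: T_simps K.r_distr)
    show "(\<lambda>x\<in>carrier (P n). c \<otimes>\<^bsub>K\<^esub> f x) (a \<odot>\<^bsub>P n\<^esub> x) = a \<odot>\<^bsub>T\<^esub> (\<lambda>x\<in>carrier (P n). c \<otimes>\<^bsub>K\<^esub> f x) x"
      if "a \<in> carrier A" "x \<in> carrier (P n)" for a x
      using that D(3)[OF that(2)] D(8)[OF that] c eps[OF that(1)] by (simp add: T_simps Pn.smult_closed K.m_lcomm)
  qed
  fix x assume "x \<in> carrier (P (Suc n))"
  thus "(\<lambda>x\<in>carrier (P n). c \<otimes>\<^bsub>K\<^esub> f x) (d n x) = \<zero>\<^bsub>T\<^esub>" using D(2) c by (simp add: d_closed T_simps)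
qed

lemma cls_scaled_cong:
  assumes c: "c \<in> carrier K" and f: "f \<in> Z n" and h: "h \<in> Z n" and eq: "cls n f = cls n h"
  shows "cls n (\<lambda>x\<in>carrier (P n). c \<otimes>\<^bsub>K\<^esub> f x) = cls n (\<lambda>x\<in>carrier (P n). c \<otimes>\<^bsub>K\<^esub> h x)"
proof -
  let ?m = "\<lambda>x\<in>carrier T. c \<otimes>\<^bsub>K\<^esub> x"
  have eps: "\<epsilon> a \<in> carrier K" if "a \<in> carrier A" for a
    using aug that by (auto simp: augmentation_def dest: ring_hom_closed)
  have m: "?m \<in> lin_hom A T T"
    by (rule lin_homI) (auto simp: T_simps c K.r_distr K.m_lcomm eps)
  have b: "(\<lambda>x\<in>carrier (P n). f x \<ominus>\<^bsub>T\<^esub> h x) \<in> coboundaries A P d T n"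
    using ext_class_eq_iff[OF M f h] eq by simp
  have "(\<lambda>x\<in>carrier (P n). ?m ((\<lambda>x\<in>carrier (P n). f x \<ominus>\<^bsub>T\<^esub> h x) x)) = (\<lambda>x\<in>carrier (P n).
    (\<lambda>x\<in>carrier (P n). c \<otimes>\<^bsub>K\<^esub> f x) x \<ominus>\<^bsub>T\<^esub> (\<lambda>x\<in>carrier (P n). c \<otimes>\<^bsub>K\<^esub> h x) x)"
  proof (rule restrict_ext)
    fix x assume x: "x \<in> carrier (P n)"
    hence "f x \<in> carrier K" "h x \<in> carrier K" using cocycleD(3)[OF f] cocycleD(3)[OF h] by (auto simp: T_simps)
    thus "?m ((\<lambda>x\<in>carrier (P n). f x \<ominus>\<^bsub>T\<^esub> h x) x) =
        (\<lambda>x\<in>carrier (P n). c \<otimes>\<^bsub>K\<^esub> f x) x \<ominus>\<^bsub>T\<^esub> (\<lambda>x\<in>carrier (P n). c \<otimes>\<^bsub>K\<^esub> h x) x"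
      using x c by (simp only: restrict_apply' T_minus T_simps K.minus_closed) algebra
  qed
  thus ?thesis using coboundary_comp[OF M M m b]
    ext_class_eq_iff[OF M scaled_cocycle[OF c f] scaled_cocycle[OF c h]] by simp
qed

lemma ext_smult_cls:
  assumes c: "c \<in> carrier K" and f: "f \<in> Z n"
  shows "ext_smult A P d T n c (cls n f) = cls n (\<lambda>x\<in>carrier (P n). c \<otimes>\<^bsub>K\<^esub> f x)"
proof -
  have "(\<lambda>x\<in>carrier (P n). (c \<odot>\<^bsub>A\<^esub> \<one>\<^bsub>A\<^esub>) \<odot>\<^bsub>T\<^esub> h x) = (\<lambda>x\<in>carrier (P n). c \<otimes>\<^bsub>K\<^esub> h x)" for h
    using eps_scalar[OF c] by (simp add: T_simps)
  hence "ext_smult A P d T n c (cls n f) = (\<Union>h\<in>cls n f. cls n (\<lambda>x\<in>carrier (P n). c \<otimes>\<^bsub>K\<^esub> h x))"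
    by (simp add: ext_smult_def)
  also have "\<dots> = (\<Union>h\<in>cls n f. cls n (\<lambda>x\<in>carrier (P n). c \<otimes>\<^bsub>K\<^esub> f x))"
  proof (rule SUP_cong[OF refl])
    fix h assume "h \<in> cls n f"
    hence "h \<in> Z n" "cls n h = cls n f" using cls_mem_iff[OF f, of h] by blast+
    thus "cls n (\<lambda>x\<in>carrier (P n). c \<otimes>\<^bsub>K\<^esub> h x) = cls n (\<lambda>x\<in>carrier (P n). c \<otimes>\<^bsub>K\<^esub> f x)"
      using cls_scaled_cong[OF c _ f] by blast
  qed
  also have "\<dots> = cls n (\<lambda>x\<in>carrier (P n). c \<otimes>\<^bsub>K\<^esub> f x)" using cls_mem_iff[OF f, of f] f by blast
  finally show ?thesis .
qed

lemma EA_simps: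
  "carrier EA = {\<alpha>. (\<forall>n. \<alpha> n \<in> carrier (E n)) \<and> finite {n. \<alpha> n \<noteq> \<one>\<^bsub>E n\<^esub>}}"
  "\<alpha> \<otimes>\<^bsub>EA\<^esub> \<beta> = (\<lambda>n. \<Otimes>\<^bsub>E n\<^esub>i\<in>{..n}. yon i (n - i) (\<alpha> i) (\<beta> (n - i)))"
  "\<zero>\<^bsub>EA\<^esub> = (\<lambda>n. \<one>\<^bsub>E n\<^esub>)"
  "\<alpha> \<oplus>\<^bsub>EA\<^esub> \<beta> = (\<lambda>n. \<alpha> n \<otimes>\<^bsub>E n\<^esub> \<beta> n)"
  "c \<odot>\<^bsub>EA\<^esub> \<alpha> = (\<lambda>n. ext_smult A P d T n c (\<alpha> n))"
  by (simp_all add: Ext_algebra_def Let_def)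

lemma single_closed: "C \<in> carrier (E n) \<Longrightarrow> single n C \<in> carrier EA"
proof -
  assume C: "C \<in> carrier (E n)"
  have "single n C i \<in> carrier (E i)" for i
    using C one_E_closed by (simp add: single_def)
  moreover have "{i. single n C i \<noteq> \<one>\<^bsub>E i\<^esub>} \<subseteq> {n}" by (auto simp: single_def)
  ultimately show ?thesis by (auto simp: EA_simps intro: finite_subset)
qed

lemma single_add:
  "single n C \<oplus>\<^bsub>EA\<^esub> single n D = single n (C \<otimes>\<^bsub>E n\<^esub> D)"
proof
  fix i interpret Ei: comm_group "E i" by (rule comm_group_E)
  show "(single n C \<oplus>\<^bsub>EA\<^esub> single n D) i = single n (C \<otimes>\<^bsub>E n\<^esub> D) i"
    by (auto simp: EA_simps single_def)
qed

lemma single_smult: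
  assumes c: "c \<in> carrier K" and f: "f \<in> Z n"
  shows "c \<odot>\<^bsub>EA\<^esub> single n (cls n f) = single n (cls n (\<lambda>x\<in>carrier (P n). c \<otimes>\<^bsub>K\<^esub> f x))"
proof
  fix i
  have "(\<lambda>x\<in>carrier (P i). c \<otimes>\<^bsub>K\<^esub> (\<lambda>x\<in>carrier (P i). \<zero>\<^bsub>K\<^esub>) x) = (\<lambda>x\<in>carrier (P i). \<zero>\<^bsub>K\<^esub>)"
    using c by (auto simp: fun_eq_iff)
  thus "(c \<odot>\<^bsub>EA\<^esub> single n (cls n f)) i = single n (cls n (\<lambda>x\<in>carrier (P n). c \<otimes>\<^bsub>K\<^esub> f x)) i"
    using ext_smult_cls[OF c f] ext_smult_cls[OF c zero_cocycle, of i] by (simp add: EA_simps single_def one_E T_simps)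
qed

text \<open>By \<open>yoneda_one\<close> the convolution sum has at most one nontrivial term, the
  one at \<open>i = a\<close>. The degree is written \<open>b + a\<close> to match the order of
  summands in \<open>yoneda\<close>.\<close>

lemma single_mult:
  assumes C: "C \<in> carrier (E a)" and D: "D \<in> carrier (E b)"
  shows "single a C \<otimes>\<^bsub>EA\<^esub> single b D = single (b + a) (yon a b C D)"
proof
  fix n
  interpret En: comm_group "E n" by (rule comm_group_E)
  have c: "single a C i \<in> carrier (E i)" "single b D i \<in> carrier (E i)" for i
    using single_closed[OF C] single_closed[OF D] by (auto simp: EA_simps)
  let ?t = "\<lambda>i. yon i (n - i) (single a C i) (single b D (n - i))"
  have t1: "?t i = \<one>\<^bsub>E n\<^esub>" if "i \<le> n" "i \<noteq> a \<or> n - i \<noteq> b" for i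
    using yoneda_one[OF c, of i "n - i"] that by (auto simp: single_def)
  have t: "?t i \<in> carrier (E n)" if "i \<le> n" for i
    using yoneda_closed[OF c, of i "n - i"] that by simp
  have lhs: "(single a C \<otimes>\<^bsub>EA\<^esub> single b D) n = (\<Otimes>\<^bsub>E n\<^esub>i\<in>{..n}. ?t i)" by (simp add: EA_simps)
  show "(single a C \<otimes>\<^bsub>EA\<^esub> single b D) n = single (b + a) (yon a b C D) n"
  proof (cases "n = b + a")
    case False
    have "(\<Otimes>\<^bsub>E n\<^esub>i\<in>{..n}. ?t i) = \<one>\<^bsub>E n\<^esub>"
    proof (rule En.finprod_one_eqI)
      fix i assume "i \<in> {..n}"
      thus "?t i = \<one>\<^bsub>E n\<^esub>" using False by (intro t1) auto
    qed
    thus ?thesis using False lhs by (simp add: single_def)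
  next
    case True
    have "(\<Otimes>\<^bsub>E n\<^esub>i\<in>{..n}. ?t i) = (\<Otimes>\<^bsub>E n\<^esub>i\<in>{..n}. if a = i then ?t i else \<one>\<^bsub>E n\<^esub>)"
      using t1 t True yoneda_closed[OF c, of a b] one_E_closed by (intro En.finprod_cong') auto
    also have "\<dots> = ?t a" using True t by (intro En.finprod_singleton) auto
    finally show ?thesis using lhs True by (simp add: single_def)
  qed
qed

lemma linear_combination_cocycle:
  assumes "finite J" "\<And>b. b \<in> J \<Longrightarrow> c b \<in> carrier K" "\<And>b. b \<in> J \<Longrightarrow> \<beta> b \<in> Z n"
  shows "(\<lambda>x\<in>carrier (P n). \<Oplus>\<^bsub>K\<^esub>b\<in>J. c b \<otimes>\<^bsub>K\<^esub> \<beta> b x) \<in> Z n"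
  using assms
proof (induction J)
  case empty thus ?case using zero_cocycle[of n] by (simp only: K.finsum_empty T_simps)
next
  case (insert b J)
  have bc: "c i \<otimes>\<^bsub>K\<^esub> \<beta> i x \<in> carrier K" if "i \<in> insert b J" "x \<in> carrier (P n)" for i x
    using that insert.prems cocycleD(3)[of "\<beta> i" T n] by (auto simp: T_simps)
  have eq: "(\<lambda>x\<in>carrier (P n). \<Oplus>\<^bsub>K\<^esub>b\<in>insert b J. c b \<otimes>\<^bsub>K\<^esub> \<beta> b x) =
    (\<lambda>x\<in>carrier (P n). (\<lambda>x\<in>carrier (P n). c b \<otimes>\<^bsub>K\<^esub> \<beta> b x) x \<oplus>\<^bsub>T\<^esub>
       (\<lambda>x\<in>carrier (P n). \<Oplus>\<^bsub>K\<^esub>b\<in>J. c b \<otimes>\<^bsub>K\<^esub> \<beta> b x) x)"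
  proof (rule restrict_ext)
    fix x assume x: "x \<in> carrier (P n)"
    have "(\<lambda>b. c b \<otimes>\<^bsub>K\<^esub> \<beta> b x) \<in> J \<rightarrow> carrier K" using bc x by auto
    thus "(\<Oplus>\<^bsub>K\<^esub>b\<in>insert b J. c b \<otimes>\<^bsub>K\<^esub> \<beta> b x) = (\<lambda>x\<in>carrier (P n). c b \<otimes>\<^bsub>K\<^esub> \<beta> b x) x \<oplus>\<^bsub>T\<^esub>
       (\<lambda>x\<in>carrier (P n). \<Oplus>\<^bsub>K\<^esub>b\<in>J. c b \<otimes>\<^bsub>K\<^esub> \<beta> b x) x"
      using insert.hyps x bc[of b x] by (simp add: K.finsum_insert T_simps)
  qed
  show ?case unfolding eq
    by (rule cocycle_add[OF M scaled_cocycle insert.IH]) (use insert.prems in auto)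
qed

text \<open>The classes of the \<open>\<beta> b\<close> only have to span; relations among them are
  harmless. The hypothesis \<open>dec\<close> lowers the degree by two whenever the result is still
  at least two, so classes in degrees at most three generate.\<close>

theorem finitely_generatedI:
  fixes I :: "nat \<Rightarrow> 'c set" and \<beta> :: "'c \<Rightarrow> 'm \<Rightarrow> 'k"
  assumes fin: "\<And>n. finite (I n)"
    and coc: "\<And>n b. b \<in> I n \<Longrightarrow> \<beta> b \<in> Z n"
    and span: "\<And>n f. f \<in> Z n \<Longrightarrow> \<exists>c \<in> I n \<rightarrow> carrier K.
        cls n f = cls n (\<lambda>x\<in>carrier (P n). \<Oplus>\<^bsub>K\<^esub>b\<in>I n. c b \<otimes>\<^bsub>K\<^esub> \<beta> b x)"
    and dec: "\<And>n b. n \<ge> 2 \<Longrightarrow> b \<in> I (Suc (Suc n)) \<Longrightarrow> \<exists>b'\<in>I n. \<exists>e\<in>I 2.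
        cls (Suc (Suc n)) (\<beta> b) = yon n 2 (cls n (\<beta> b')) (cls 2 (\<beta> e))"
  shows "finitely_generated_algebra K EA"
proof -
  define S where "S = (\<Union>n\<in>{..3}. (\<lambda>b. single n (cls n (\<beta> b))) ` I n)"
  have finS: "finite S" using fin by (auto simp: S_def)
  have SE: "S \<subseteq> carrier EA" using coc by (auto simp: S_def intro!: single_closed cls_closed)
  have "B' = carrier EA" if sub: "subalgebra_of K B' EA" and SB: "S \<subseteq> B'" for B'
  proof -
    have sr: "subring B' EA" and sm: "\<And>c b. c \<in> carrier K \<Longrightarrow> b \<in> B' \<Longrightarrow> c \<odot>\<^bsub>EA\<^esub> b \<in> B'"
      using sub by (auto simp: subalgebra_of_def)
    have sg: "subgroup B' (add_monoid EA)" and smn: "submonoid B' EA"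
      using sr by (auto simp: subring_def)
    have B_sub: "B' \<subseteq> carrier EA" using subgroup.subset[OF sg] by simp
    have B_add: "a \<oplus>\<^bsub>EA\<^esub> b \<in> B'" if "a \<in> B'" "b \<in> B'" for a b using subgroup.m_closed[OF sg that] by simp
    have B_zero: "\<zero>\<^bsub>EA\<^esub> \<in> B'" using subgroup.one_closed[OF sg] by simp
    have B_mult: "a \<otimes>\<^bsub>EA\<^esub> b \<in> B'" if "a \<in> B'" "b \<in> B'" for a b using submonoid.m_closed[OF smn that] .
    have gen: "\<forall>b\<in>I n. single n (cls n (\<beta> b)) \<in> B'" for n
    proof (induction n rule: less_induct)
      case (less n)
      show ?case
      proof (cases "n \<le> 3")
        case True thus ?thesis using SB by (auto simp: S_def)
      next
        case False
        define k where "k = n - 2"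
        have k: "n = Suc (Suc k)" "k \<ge> 2" using False by (auto simp: k_def)
        show ?thesis
        proof
          fix b assume "b \<in> I n"
          then obtain b' e where b': "b' \<in> I k" "e \<in> I 2" 
            "cls n (\<beta> b) = yon k 2 (cls k (\<beta> b')) (cls 2 (\<beta> e))" using dec[OF k(2)] k(1) by blast
          have "single k (cls k (\<beta> b')) \<in> B'" "single 2 (cls 2 (\<beta> e)) \<in> B'"
            using less k b' by auto
          hence "single k (cls k (\<beta> b')) \<otimes>\<^bsub>EA\<^esub> single 2 (cls 2 (\<beta> e)) \<in> B'" by (rule B_mult)
          thus "single n (cls n (\<beta> b)) \<in> B'"
            using single_mult[OF cls_closed[OF coc[OF b'(1)]] cls_closed[OF coc[OF b'(2)]]] b'(3) k(1) by simp
        qed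
      qed
    qed
    have single_zero: "single n (cls n (\<lambda>x\<in>carrier (P n). \<zero>\<^bsub>K\<^esub>)) = \<zero>\<^bsub>EA\<^esub>" for n
      using one_E[of n] by (simp add: EA_simps single_def T_simps fun_eq_iff)
    have comb: "single n (cls n (\<lambda>x\<in>carrier (P n). \<Oplus>\<^bsub>K\<^esub>b\<in>J. c b \<otimes>\<^bsub>K\<^esub> \<beta> b x)) \<in> B'"
      if "finite J" "J \<subseteq> I n" "c \<in> I n \<rightarrow> carrier K" for n J c
      using that
    proof (induction J)
      case empty thus ?case using single_zero[of n] B_zero by (simp only: K.finsum_empty)
    next
      case (insert b J)
      have cb: "c b \<in> carrier K" "\<beta> b \<in> Z n" using insert.prems coc by auto
      have bc: "c i \<otimes>\<^bsub>K\<^esub> \<beta> i x \<in> carrier K" if "i \<in> insert b J" "x \<in> carrier (P n)" for i x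
        using that insert.prems cocycleD(3)[OF coc[of i n]] by (auto simp: T_simps)
      let ?f = "\<lambda>x\<in>carrier (P n). c b \<otimes>\<^bsub>K\<^esub> \<beta> b x"
      let ?h = "\<lambda>x\<in>carrier (P n). \<Oplus>\<^bsub>K\<^esub>b\<in>J. c b \<otimes>\<^bsub>K\<^esub> \<beta> b x"
      have h: "?h \<in> Z n" using insert.hyps insert.prems coc by (intro linear_combination_cocycle) auto
      have f: "?f \<in> Z n" by (rule scaled_cocycle[OF cb])
      have "(\<lambda>x\<in>carrier (P n). \<Oplus>\<^bsub>K\<^esub>b\<in>insert b J. c b \<otimes>\<^bsub>K\<^esub> \<beta> b x) = (\<lambda>x\<in>carrier (P n). ?f x \<oplus>\<^bsub>T\<^esub> ?h x)"
      proof (rule restrict_ext)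
        fix x assume x: "x \<in> carrier (P n)"
        have "(\<lambda>b. c b \<otimes>\<^bsub>K\<^esub> \<beta> b x) \<in> J \<rightarrow> carrier K" using bc x by auto
        thus "(\<Oplus>\<^bsub>K\<^esub>b\<in>insert b J. c b \<otimes>\<^bsub>K\<^esub> \<beta> b x) = ?f x \<oplus>\<^bsub>T\<^esub> ?h x"
          using insert.hyps x bc[of b x] by (simp add: K.finsum_insert T_simps)
      qed
      hence eq: "single n (cls n (\<lambda>x\<in>carrier (P n). \<Oplus>\<^bsub>K\<^esub>b\<in>insert b J. c b \<otimes>\<^bsub>K\<^esub> \<beta> b x)) =
          c b \<odot>\<^bsub>EA\<^esub> single n (cls n (\<beta> b)) \<oplus>\<^bsub>EA\<^esub> single n (cls n ?h)"
        using mult_E[OF f h] single_smult[OF cb] by (simp add: single_add)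
      have "single n (cls n ?h) \<in> B'" using insert.IH insert.prems by blast
      thus ?case unfolding eq using gen[of n] insert.prems cb(1) by (intro B_add sm) auto
    qed
    have sing: "single n C \<in> B'" if "C \<in> carrier (E n)" for n C
    proof -
      obtain f where f: "f \<in> Z n" "C = cls n f" using \<open>C \<in> carrier (E n)\<close> by (auto simp: carrier_E)
      thus ?thesis using span[OF f(1)] comb[OF fin, of n n] by auto
    qed
    have "\<forall>\<alpha>\<in>carrier EA. {n. \<alpha> n \<noteq> \<one>\<^bsub>E n\<^esub>} \<subseteq> J \<longrightarrow> \<alpha> \<in> B'" if "finite J" for J
      using that
    proof (induction J)
      case empty
      show ?case
      proof (intro ballI impI)
        fix \<alpha> assume "{n. \<alpha> n \<noteq> \<one>\<^bsub>E n\<^esub>} \<subseteq> {}"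
        hence "\<alpha> = \<zero>\<^bsub>EA\<^esub>" by (auto simp: EA_simps)
        thus "\<alpha> \<in> B'" using B_zero by simp
      qed
    next
      case (insert n J)
      show ?case
      proof (intro ballI impI)
        fix \<alpha> assume \<alpha>: "\<alpha> \<in> carrier EA" and s: "{n. \<alpha> n \<noteq> \<one>\<^bsub>E n\<^esub>} \<subseteq> insert n J"
        let ?\<alpha> = "\<alpha>(n := \<one>\<^bsub>E n\<^esub>)"
        have "{i. ?\<alpha> i \<noteq> \<one>\<^bsub>E i\<^esub>} \<subseteq> {n. \<alpha> n \<noteq> \<one>\<^bsub>E n\<^esub>}" by auto
        moreover have "finite {n. \<alpha> n \<noteq> \<one>\<^bsub>E n\<^esub>}" using \<alpha> unfolding EA_simps(1) by blast
        ultimately have "finite {i. ?\<alpha> i \<noteq> \<one>\<^bsub>E i\<^esub>}" by (rule finite_subset)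
        moreover have "\<forall>i. ?\<alpha> i \<in> carrier (E i)" using \<alpha> one_E_closed by (simp add: EA_simps(1))
        ultimately have \<alpha>': "?\<alpha> \<in> carrier EA" unfolding EA_simps(1) by blast
        have "{i. ?\<alpha> i \<noteq> \<one>\<^bsub>E i\<^esub>} \<subseteq> J" using s by auto
        hence "?\<alpha> \<in> B'" using insert.IH \<alpha>' by blast
        moreover have "single n (\<alpha> n) \<in> B'" using \<alpha> by (intro sing) (simp add: EA_simps)
        moreover have "\<alpha> = single n (\<alpha> n) \<oplus>\<^bsub>EA\<^esub> ?\<alpha>"
        proof
          fix i
          interpret Ei: comm_group "E i" by (rule comm_group_E)
          interpret En: comm_group "E n" by (rule comm_group_E)
          have "\<alpha> n \<in> carrier (E n)" "\<alpha> i \<in> carrier (E i)" using \<alpha> unfolding EA_simps(1) by blast+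
          thus "\<alpha> i = (single n (\<alpha> n) \<oplus>\<^bsub>EA\<^esub> ?\<alpha>) i" by (simp add: EA_simps single_def)
        qed
        ultimately show "\<alpha> \<in> B'" using B_add by metis
      qed
    qed
    hence "carrier EA \<subseteq> B'" unfolding EA_simps(1) by blast
    thus ?thesis using B_sub by blast
  qed
  thus ?thesis unfolding finitely_generated_algebra_def using finS SE by blast
qed

end

text \<open>The criterion may be checked on any convenient resolution \<open>F\<close>: comparison maps
  \<open>P \<rightarrow> F \<rightarrow> P\<close> compose to a lift of the identity, and chain maps of \<open>F\<close> lifting a degree two class
  correspond to Yoneda multiplication by that class.\<close>

theorem (in ext_algebra) finitely_generated_by_resolution:
  fixes F :: "nat \<Rightarrow> ('a, 'f) module" and e :: "nat \<Rightarrow> 'f \<Rightarrow> 'f" and \<theta> :: "'f \<Rightarrow> 'k"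
    and C :: "nat \<Rightarrow> 'j set" and I :: "nat \<Rightarrow> 'c set" and \<beta> :: "'c \<Rightarrow> 'f \<Rightarrow> 'k"
  assumes F: "exact_complex A T F e \<theta>" "\<And>n. free_retract A (F n) (C n)"
    and fin: "\<And>n. finite (I n)"
    and coc: "\<And>n b. b \<in> I n \<Longrightarrow> \<beta> b \<in> carrier (cocycles A F e T n)"
    and span: "\<And>n f. f \<in> carrier (cocycles A F e T n) \<Longrightarrow> \<exists>c \<in> I n \<rightarrow> carrier K.
        \<forall>x\<in>carrier (F n). f x = (\<Oplus>\<^bsub>K\<^esub>b\<in>I n. c b \<otimes>\<^bsub>K\<^esub> \<beta> b x)"
    and dec: "\<And>n b. n \<ge> 2 \<Longrightarrow> b \<in> I (Suc (Suc n)) \<Longrightarrow> \<exists>b'\<in>I n. \<exists>z\<in>I 2. \<exists>S.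
        chain_lift A F e \<theta> 2 (\<beta> z) S \<and> (\<forall>x\<in>carrier (F (Suc (Suc n))). \<beta> b x = \<beta> b' (S n x))"
  shows "finitely_generated_algebra K EA"
proof -
  interpret F: module_complex A F e by (rule exact_complex_module_complex[OF F(1)])
  interpret PF: comparison A P d T F e \<theta> B by unfold_locales (rule P, rule F(1))
  interpret FP: comparison A F e T P d \<eta> C by unfold_locales (rule F(2), rule Q)
  have eta: "\<eta> \<in> Z 0" by (rule cocycleI[OF \<eta>]) (simp add: \<eta>_e)
  have theta: "\<theta> \<in> carrier (cocycles A F e T 0)" by (rule F.cocycleI[OF PF.\<eta>]) (simp add: PF.\<eta>_e)
  obtain \<phi> where \<phi>: "PF.lifts 0 \<eta> \<phi>" using PF.lift_exists[OF eta] by blast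
  obtain \<psi> where \<psi>: "FP.lifts 0 \<theta> \<psi>" using FP.lift_exists[OF theta] by blast
  have \<phi>l: "\<phi> i \<in> lin_hom A (P i) (F i)" and \<phi>0: "x \<in> carrier (P 0) \<Longrightarrow> \<theta> (\<phi> 0 x) = \<eta> x"
    and \<phi>d: "y \<in> carrier (P (Suc i)) \<Longrightarrow> e i (\<phi> (Suc i) y) = \<phi> i (d i y)" for i x y
    using \<phi> by (auto simp: PF.lifts_def)
  have \<psi>l: "\<psi> i \<in> lin_hom A (F i) (P i)" and \<psi>0: "x \<in> carrier (F 0) \<Longrightarrow> \<eta> (\<psi> 0 x) = \<theta> x"
    and \<psi>d: "y \<in> carrier (F (Suc i)) \<Longrightarrow> d i (\<psi> (Suc i) y) = \<psi> i (e i y)" for i x y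
    using \<psi> by (auto simp: FP.lifts_def)
  note \<phi>c = lin_homD(2)[OF \<phi>l] and \<psi>c = lin_homD(2)[OF \<psi>l]
  \<comment> \<open>The index is paired with its degree because \<open>\<phi> n\<close> depends on
    \<open>n\<close>, while an index \<open>b\<close> by itself does not determine the degree in
    which it is used.\<close>
  define \<gamma> where "\<gamma> = (\<lambda>(n, b). \<lambda>x\<in>carrier (P n). \<beta> b (\<phi> n x))"
  have \<gamma>Z: "\<gamma> (n, b) \<in> Z n" if "b \<in> I n" for n b
    using PF.cocycle_comp_lift[OF \<phi> M coc[OF that]] by (simp add: \<gamma>_def)
  \<comment> \<open>The identity and the round trip through \<open>F\<close> both lift
    \<open>\<eta>\<close>, hence induce the same map on classes.\<close>
  have idl: "lifts 0 \<eta> (\<lambda>i. \<lambda>x\<in>carrier (P i). x)"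
    unfolding lifts_def
  proof (intro conjI allI ballI)
    fix i show "(\<lambda>x\<in>carrier (P i). x) \<in> lin_hom A (P (0 + i)) (P i)"
    proof -
      interpret Pi: left_module A "P i" by (rule LP)
      show ?thesis by (auto intro!: lin_homI simp: Pi.smult_closed)
    qed
  qed (auto simp: d_closed)
  have \<psi>\<phi>: "lifts 0 \<eta> (\<lambda>i. \<lambda>x\<in>carrier (P i). \<psi> i (\<phi> i x))"
    unfolding lifts_def
  proof (intro conjI allI ballI)
    fix i show "(\<lambda>x\<in>carrier (P i). \<psi> i (\<phi> i x)) \<in> lin_hom A (P (0 + i)) (P i)"
      using lin_hom_comp[OF LP \<phi>l \<psi>l, of i] by simp
  qed (auto simp: \<phi>0 \<psi>0 \<phi>d \<psi>d \<phi>c d_closed)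
  show ?thesis
  proof (rule finitely_generatedI[of "\<lambda>n. {n} \<times> I n" \<gamma>])
    fix n f assume f: "f \<in> Z n"
    \<comment> \<open>The cocycle is carried to \<open>F\<close>, expanded there, and carried back;
      up to a coboundary this returns \<open>f\<close>.\<close>
    let ?g = "\<lambda>x\<in>carrier (F n). f (\<psi> n x)"
    have g: "?g \<in> carrier (cocycles A F e T n)" using FP.cocycle_comp_lift[OF \<psi> M f] by simp
    obtain c where c: "c \<in> I n \<rightarrow> carrier K"
      "\<And>x. x \<in> carrier (F n) \<Longrightarrow> ?g x = (\<Oplus>\<^bsub>K\<^esub>b\<in>I n. c b \<otimes>\<^bsub>K\<^esub> \<beta> b x)" using span[OF g] by blast
    have "(\<lambda>x\<in>carrier (P n). \<eta> x \<ominus>\<^bsub>T\<^esub> \<eta> x) = (\<lambda>x\<in>carrier (P n). \<zero>\<^bsub>T\<^esub>)" if "n = 0" for n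
      using that lin_homD(2)[OF \<eta>] by (intro restrict_ext) (auto simp: T_minus T_simps a_minus_def K.r_neg)
    hence z: "(\<lambda>x\<in>carrier (P 0). \<eta> x \<ominus>\<^bsub>T\<^esub> \<eta> x) \<in> coboundaries A P d T 0"
      using zero_coboundary[OF M, of 0] by simp
    have fx: "f = (\<lambda>x\<in>carrier (P n). f ((\<lambda>x\<in>carrier (P n). x) x))"
      using cocycleD(4)[OF f] by (auto simp: fun_eq_iff extensional_def)
    have "cls n f = cls n (\<lambda>x\<in>carrier (P n). f ((\<lambda>x\<in>carrier (P n). \<psi> n (\<phi> n x)) x))"
      using lift_unique[OF idl \<psi>\<phi> z M f] fx by simp
    also have "(\<lambda>x\<in>carrier (P n). f ((\<lambda>x\<in>carrier (P n). \<psi> n (\<phi> n x)) x)) =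
        (\<lambda>x\<in>carrier (P n). \<Oplus>\<^bsub>K\<^esub>b\<in>{n} \<times> I n. (c \<circ> snd) b \<otimes>\<^bsub>K\<^esub> \<gamma> b x)"
    proof (rule restrict_ext)
      fix x assume x: "x \<in> carrier (P n)"
      have t: "c b \<otimes>\<^bsub>K\<^esub> \<beta> b (\<phi> n x) \<in> carrier K" if "b \<in> I n" for b
        using that c(1) F.cocycleD(3)[OF coc[OF that] \<phi>c[OF x]] by (auto simp: T_simps)
      have "f (\<psi> n (\<phi> n x)) = (\<Oplus>\<^bsub>K\<^esub>b\<in>I n. c b \<otimes>\<^bsub>K\<^esub> \<beta> b (\<phi> n x))" using c(2)[OF \<phi>c[OF x]] \<phi>c[OF x] by simp
      also have "\<dots> = (\<Oplus>\<^bsub>K\<^esub>b\<in>I n. (c \<circ> snd) (n, b) \<otimes>\<^bsub>K\<^esub> \<gamma> (n, b) x)"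
        using t x by (intro K.finsum_cong') (auto simp: \<gamma>_def)
      also have "\<dots> = (\<Oplus>\<^bsub>K\<^esub>b\<in>(\<lambda>b. (n, b)) ` I n. (c \<circ> snd) b \<otimes>\<^bsub>K\<^esub> \<gamma> b x)"
        using t x by (intro K.finsum_reindex[symmetric]) (auto simp: \<gamma>_def inj_on_def)
      also have "(\<lambda>b. (n, b)) ` I n = {n} \<times> I n" by auto
      finally show "f ((\<lambda>x\<in>carrier (P n). \<psi> n (\<phi> n x)) x) =
          (\<Oplus>\<^bsub>K\<^esub>b\<in>{n} \<times> I n. (c \<circ> snd) b \<otimes>\<^bsub>K\<^esub> \<gamma> b x)" using x by simp
    qed
    finally have "cls n f = cls n (\<lambda>x\<in>carrier (P n). \<Oplus>\<^bsub>K\<^esub>b\<in>{n} \<times> I n. (c \<circ> snd) b \<otimes>\<^bsub>K\<^esub> \<gamma> b x)" .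
    moreover have "c \<circ> snd \<in> {n} \<times> I n \<rightarrow> carrier K" using c(1) by auto
    ultimately show "\<exists>c \<in> {n} \<times> I n \<rightarrow> carrier K.
        cls n f = cls n (\<lambda>x\<in>carrier (P n). \<Oplus>\<^bsub>K\<^esub>b\<in>{n} \<times> I n. c b \<otimes>\<^bsub>K\<^esub> \<gamma> b x)" by blast
  next
    fix n nb assume n: "n \<ge> 2" and "nb \<in> {Suc (Suc n)} \<times> I (Suc (Suc n))"
    then obtain b where nb: "nb = (Suc (Suc n), b)" "b \<in> I (Suc (Suc n))" by auto
    obtain b' z S where b': "b' \<in> I n" "z \<in> I 2" and S: "chain_lift A F e \<theta> 2 (\<beta> z) S"
      and bS: "\<And>x. x \<in> carrier (F (Suc (Suc n))) \<Longrightarrow> \<beta> b x = \<beta> b' (S n x)" using dec[OF n nb(2)] by blast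
    have Sl: "S i \<in> lin_hom A (F (Suc (Suc i))) (F i)" and S0: "x \<in> carrier (F 2) \<Longrightarrow> \<theta> (S 0 x) = \<beta> z x"
      and Sd: "y \<in> carrier (F (Suc (Suc (Suc i)))) \<Longrightarrow> e i (S (Suc i) y) = S i (e (Suc (Suc i)) y)" for i x y
      using S by (auto simp: chain_lift_def)
    obtain L where L: "lifts 2 (\<gamma> (2, z)) L" using lift_exists[OF \<gamma>Z[OF b'(2)]] by blast
    have Ll: "L i \<in> lin_hom A (P (Suc (Suc i))) (P i)" and L0: "x \<in> carrier (P 2) \<Longrightarrow> \<eta> (L 0 x) = \<gamma> (2, z) x"
      and Ld: "y \<in> carrier (P (Suc (Suc (Suc i)))) \<Longrightarrow> d i (L (Suc i) y) = L i (d (Suc (Suc i)) y)" for i x y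
      using L by (auto simp: lifts_def)
    note Lc = lin_homD(2)[OF Ll]
    have 2: "Suc (Suc 0) = 2" by simp
    \<comment> \<open>Two lifts of one cocycle of degree two along \<open>P\<close> and
      \<open>F\<close>: lifting on \<open>P\<close> before comparing, and comparing before shifting
      on \<open>F\<close>. After composition with a cocycle they give the same class.\<close>
    have 1: "PF.lifts 2 (\<gamma> (2, z)) (\<lambda>i. \<lambda>x\<in>carrier (P (2 + i)). \<phi> i (L i x))"
      unfolding PF.lifts_def
    proof (intro conjI allI ballI)
      fix i show "(\<lambda>x\<in>carrier (P (2 + i)). \<phi> i (L i x)) \<in> lin_hom A (P (2 + i)) (F i)"
        using lin_hom_comp[OF LP Ll \<phi>l] by simp
    next
      fix x assume x: "x \<in> carrier (P 2)"
      thus "\<theta> ((\<lambda>x\<in>carrier (P (2 + 0)). \<phi> 0 (L 0 x)) x) = \<gamma> (2, z) x"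
        using Lc[of x 0] L0[OF x] \<phi>0 by (simp add: numeral_2_eq_2)
    qed (auto simp: \<phi>d Ld Lc d_closed)
    have 2: "PF.lifts 2 (\<gamma> (2, z)) (\<lambda>i. \<lambda>x\<in>carrier (P (2 + i)). S i (\<phi> (2 + i) x))"
      unfolding PF.lifts_def
    proof (intro conjI allI ballI)
      fix i show "(\<lambda>x\<in>carrier (P (2 + i)). S i (\<phi> (2 + i) x)) \<in> lin_hom A (P (2 + i)) (F i)"
        using lin_hom_comp[OF LP \<phi>l Sl] by simp
    next
      fix x assume x: "x \<in> carrier (P 2)"
      thus "\<theta> ((\<lambda>x\<in>carrier (P (2 + 0)). S 0 (\<phi> (2 + 0) x)) x) = \<gamma> (2, z) x"
        using S0[OF \<phi>c[OF x]] by (simp add: \<gamma>_def)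
    qed (auto simp: \<phi>d Sd \<phi>c d_closed)
    have "(\<lambda>x\<in>carrier (P 2). \<gamma> (2, z) x \<ominus>\<^bsub>T\<^esub> \<gamma> (2, z) x) = (\<lambda>x\<in>carrier (P 2). \<zero>\<^bsub>T\<^esub>)"
      using cocycleD(3)[OF \<gamma>Z[OF b'(2)]] by (intro restrict_ext) (auto simp: T_minus T_simps a_minus_def K.r_neg)
    hence zero: "(\<lambda>x\<in>carrier (P 2). \<gamma> (2, z) x \<ominus>\<^bsub>T\<^esub> \<gamma> (2, z) x) \<in> coboundaries A P d T 2"
      using zero_coboundary[OF M, of 2] by simp
    have "yon n 2 (cls n (\<gamma> (n, b'))) (cls 2 (\<gamma> (2, z))) = cls (2 + n) (\<lambda>x\<in>carrier (P (2 + n)). \<gamma> (n, b') (L n x))"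
      by (rule yoneda_cls[OF \<gamma>Z[OF b'(1)] \<gamma>Z[OF b'(2)] L])
    also have "(\<lambda>x\<in>carrier (P (2 + n)). \<gamma> (n, b') (L n x)) =
        (\<lambda>x\<in>carrier (P (2 + n)). \<beta> b' ((\<lambda>x\<in>carrier (P (2 + n)). \<phi> n (L n x)) x))"
      using Lc by (intro restrict_ext) (simp add: \<gamma>_def)
    also have "cls (2 + n) \<dots> = cls (2 + n) (\<lambda>x\<in>carrier (P (2 + n)). \<beta> b' ((\<lambda>x\<in>carrier (P (2 + n)). S n (\<phi> (2 + n) x)) x))"
      by (rule PF.lift_unique[OF 1 2 zero M coc[OF b'(1)]])
    also have "(\<lambda>x\<in>carrier (P (2 + n)). \<beta> b' ((\<lambda>x\<in>carrier (P (2 + n)). S n (\<phi> (2 + n) x)) x)) = \<gamma> nb"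
      using bS \<phi>c by (auto simp: nb(1) \<gamma>_def fun_eq_iff)
    finally have "cls (Suc (Suc n)) (\<gamma> nb) = yon n 2 (cls n (\<gamma> (n, b'))) (cls 2 (\<gamma> (2, z)))" by simp
    thus "\<exists>b'\<in>{n} \<times> I n. \<exists>e\<in>{2} \<times> I 2. cls (Suc (Suc n)) (\<gamma> nb) = yon n 2 (cls n (\<gamma> b')) (cls 2 (\<gamma> e))"
      using b' by blast
  qed (use fin \<gamma>Z in auto)
qed

section \<open>Twisted total complexes\<close>

text \<open>Free modules with a graded basis are realised inside the module of all functions from the
  basis, as the functions that vanish off the given degree. This keeps differentials total.\<close>

definition fun_module :: "('a, 'b) ring_scheme \<Rightarrow> ('a, 'i \<Rightarrow> 'a) module" where
  "fun_module A =
    \<lparr>carrier = {v. \<forall>b. v b \<in> carrier A}, monoid.mult = undefined, one = undefined,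
     ring.zero = (\<lambda>b. \<zero>\<^bsub>A\<^esub>), add = (\<lambda>v w b. v b \<oplus>\<^bsub>A\<^esub> w b), smult = (\<lambda>a v b. a \<otimes>\<^bsub>A\<^esub> v b)\<rparr>"

lemma fun_module_simps:
  "carrier (fun_module A) = {v. \<forall>b. v b \<in> carrier A}"
  "\<zero>\<^bsub>fun_module A\<^esub> = (\<lambda>b. \<zero>\<^bsub>A\<^esub>)"
  "v \<oplus>\<^bsub>fun_module A\<^esub> w = (\<lambda>b. v b \<oplus>\<^bsub>A\<^esub> w b)"
  "a \<odot>\<^bsub>fun_module A\<^esub> v = (\<lambda>b. a \<otimes>\<^bsub>A\<^esub> v b)"
  by (simp_all add: fun_module_def)

lemma left_module_fun_module:
  assumes "ring A" shows "left_module A (fun_module A)"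
proof -
  interpret A: ring A by fact
  have ag: "abelian_group (fun_module A)"
  proof (rule abelian_groupI)
    fix v assume "v \<in> carrier (fun_module A)"
    thus "\<exists>w\<in>carrier (fun_module A). w \<oplus>\<^bsub>fun_module A\<^esub> v = \<zero>\<^bsub>fun_module A\<^esub>"
      by (intro bexI[of _ "\<lambda>b. \<ominus>\<^bsub>A\<^esub> v b"]) (auto simp: fun_module_simps A.l_neg)
  qed (auto simp: fun_module_simps fun_eq_iff A.a_ac)
  show ?thesis
    by (intro left_module.intro left_module_axioms.intro assms ag)
      (auto simp: fun_module_simps fun_eq_iff A.l_distr A.r_distr A.m_assoc)
qed

definition lin_op :: "('a, 'b) ring_scheme \<Rightarrow> (('i \<Rightarrow> 'a) \<Rightarrow> 'j \<Rightarrow> 'a) \<Rightarrow> bool" where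
  "lin_op A f \<longleftrightarrow> (\<forall>v\<in>carrier (fun_module A). f v \<in> carrier (fun_module A)) \<and>
    (\<forall>v\<in>carrier (fun_module A). \<forall>w\<in>carrier (fun_module A).
      f (v \<oplus>\<^bsub>fun_module A\<^esub> w) = f v \<oplus>\<^bsub>fun_module A\<^esub> f w) \<and>
    (\<forall>a\<in>carrier A. \<forall>v\<in>carrier (fun_module A). f (a \<odot>\<^bsub>fun_module A\<^esub> v) = a \<odot>\<^bsub>fun_module A\<^esub> f v)"

text \<open>The pieces consist of functions on the full basis, so one operator can serve as
  differential in every degree. Finiteness of supports is recovered later from the finiteness of
  each degree.\<close>

definition graded :: "('a, 'b) ring_scheme \<Rightarrow> ('i \<Rightarrow> nat) \<Rightarrow> nat \<Rightarrow> ('i \<Rightarrow> 'a) set" where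
  "graded A wt n = {v \<in> carrier (fun_module A). \<forall>b. wt b \<noteq> n \<longrightarrow> v b = \<zero>\<^bsub>A\<^esub>}"

lemma lin_opI:
  assumes "\<And>v. v \<in> carrier (fun_module A) \<Longrightarrow> f v \<in> carrier (fun_module A)"
    "\<And>v w. v \<in> carrier (fun_module A) \<Longrightarrow> w \<in> carrier (fun_module A) \<Longrightarrow>
      f (v \<oplus>\<^bsub>fun_module A\<^esub> w) = f v \<oplus>\<^bsub>fun_module A\<^esub> f w"
    "\<And>a v. a \<in> carrier A \<Longrightarrow> v \<in> carrier (fun_module A) \<Longrightarrow>
      f (a \<odot>\<^bsub>fun_module A\<^esub> v) = a \<odot>\<^bsub>fun_module A\<^esub> f v"
  shows "lin_op A f"
  using assms by (simp add: lin_op_def)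

lemma lin_opD:
  assumes "lin_op A f"
  shows "v \<in> carrier (fun_module A) \<Longrightarrow> f v \<in> carrier (fun_module A)"
    "v \<in> carrier (fun_module A) \<Longrightarrow> w \<in> carrier (fun_module A) \<Longrightarrow>
      f (v \<oplus>\<^bsub>fun_module A\<^esub> w) = f v \<oplus>\<^bsub>fun_module A\<^esub> f w"
    "a \<in> carrier A \<Longrightarrow> v \<in> carrier (fun_module A) \<Longrightarrow>
      f (a \<odot>\<^bsub>fun_module A\<^esub> v) = a \<odot>\<^bsub>fun_module A\<^esub> f v"
  using assms by (auto simp: lin_op_def)

lemma lin_op_zero:
  assumes "ring A" "lin_op A f" shows "f \<zero>\<^bsub>fun_module A\<^esub> = \<zero>\<^bsub>fun_module A\<^esub>"
proof -
  interpret A: ring A by fact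
  have "f \<zero>\<^bsub>fun_module A\<^esub> = f (\<zero>\<^bsub>A\<^esub> \<odot>\<^bsub>fun_module A\<^esub> \<zero>\<^bsub>fun_module A\<^esub>)"
    by (simp add: fun_module_simps)
  also have "\<dots> = \<zero>\<^bsub>A\<^esub> \<odot>\<^bsub>fun_module A\<^esub> f \<zero>\<^bsub>fun_module A\<^esub>"
    using assms(2) by (intro lin_opD(3)) (auto simp: fun_module_simps)
  also have "\<dots> = \<zero>\<^bsub>fun_module A\<^esub>"
    using lin_opD(1)[OF assms(2), of "\<zero>\<^bsub>fun_module A\<^esub>"] by (simp add: fun_module_simps)
  finally show ?thesis .
qed

lemma lin_op_minus:
  assumes A: "ring A" and f: "lin_op A f"
    and v: "v \<in> carrier (fun_module A)" and w: "w \<in> carrier (fun_module A)"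
  shows "f (v \<ominus>\<^bsub>fun_module A\<^esub> w) = f v \<ominus>\<^bsub>fun_module A\<^esub> f w"
proof -
  interpret V: abelian_group "fun_module A :: ('a, 'c \<Rightarrow> 'a) module"
    using left_module_fun_module[OF A] left_moduleD by blast
  interpret W: abelian_group "fun_module A :: ('a, 'd \<Rightarrow> 'a) module"
    using left_module_fun_module[OF A] left_moduleD by blast
  have "f (v \<ominus>\<^bsub>fun_module A\<^esub> w) \<oplus>\<^bsub>fun_module A\<^esub> f w = f (v \<ominus>\<^bsub>fun_module A\<^esub> w \<oplus>\<^bsub>fun_module A\<^esub> w)"
    using lin_opD(2)[OF f V.minus_closed[OF v w] w] by simp
  also have "v \<ominus>\<^bsub>fun_module A\<^esub> w \<oplus>\<^bsub>fun_module A\<^esub> w = v"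
    using v w by (simp add: a_minus_def V.a_assoc V.l_neg)
  finally have "f v = f (v \<ominus>\<^bsub>fun_module A\<^esub> w) \<oplus>\<^bsub>fun_module A\<^esub> f w" ..
  thus ?thesis using lin_opD(1)[OF f] v w by (simp add: a_minus_def W.a_assoc W.r_neg)
qed

lemma graded_carrier: "v \<in> graded A wt n \<Longrightarrow> v \<in> carrier (fun_module A)"
  by (simp add: graded_def)

lemma (in ring) graded_zero: "\<zero>\<^bsub>fun_module R\<^esub> \<in> graded R wt n"
  by (simp add: graded_def fun_module_simps)

lemma (in ring) graded_add:
  "v \<in> graded R wt n \<Longrightarrow> w \<in> graded R wt n \<Longrightarrow> v \<oplus>\<^bsub>fun_module R\<^esub> w \<in> graded R wt n"
  by (simp add: graded_def fun_module_simps)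

lemma (in ring) graded_smult:
  "a \<in> carrier R \<Longrightarrow> v \<in> graded R wt n \<Longrightarrow> a \<odot>\<^bsub>fun_module R\<^esub> v \<in> graded R wt n"
  by (simp add: graded_def fun_module_simps)

lemma (in ring) fun_module_minus:
  assumes "v \<in> carrier (fun_module R)" "w \<in> carrier (fun_module R)"
  shows "v \<ominus>\<^bsub>fun_module R\<^esub> w = (\<lambda>b. v b \<ominus> w b)"
proof -
  interpret V: abelian_group "fun_module R :: ('a, 'c \<Rightarrow> 'a) module"
    using left_module_fun_module[OF ring_axioms] left_moduleD by blast
  have "\<ominus>\<^bsub>fun_module R\<^esub> w = (\<lambda>b. \<ominus> w b)"
    using assms by (intro V.minus_equality) (auto simp: fun_module_simps l_neg)
  thus ?thesis by (simp add: a_minus_def fun_module_simps)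
qed

lemma (in ring) graded_minus:
  "v \<in> graded R wt n \<Longrightarrow> w \<in> graded R wt n \<Longrightarrow> v \<ominus>\<^bsub>fun_module R\<^esub> w \<in> graded R wt n"
  using fun_module_minus[of v w] by (simp add: graded_def fun_module_simps)

text \<open>Exactness is demanded in positive degrees only: such a complex resolves its own cokernel
  in degree zero, and the cokernel changes from stage to stage.\<close>

locale graded_complex = ring A for A :: "('a, 'r) ring_scheme" +
  fixes wt :: "'i \<Rightarrow> nat" and d :: "('i \<Rightarrow> 'a) \<Rightarrow> 'i \<Rightarrow> 'a"
  assumes d_lin: "lin_op A d"
    and d_deg: "v \<in> graded A wt (Suc n) \<Longrightarrow> d v \<in> graded A wt n"
    and d_0: "v \<in> graded A wt 0 \<Longrightarrow> d v = \<zero>\<^bsub>fun_module A\<^esub>"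
    and d_d: "v \<in> carrier (fun_module A) \<Longrightarrow> d (d v) = \<zero>\<^bsub>fun_module A\<^esub>"
    and exact: "v \<in> graded A wt (Suc n) \<Longrightarrow> d v = \<zero>\<^bsub>fun_module A\<^esub> \<Longrightarrow>
      \<exists>w\<in>graded A wt (Suc (Suc n)). d w = v"

definition tot_wt :: "('i \<Rightarrow> nat) \<Rightarrow> nat \<times> 'i \<Rightarrow> nat" where
  "tot_wt wt = (\<lambda>(j, b). j + wt b)"

definition col :: "(nat \<times> 'i \<Rightarrow> 'a) \<Rightarrow> nat \<Rightarrow> 'i \<Rightarrow> 'a" where
  "col v j = (\<lambda>b. v (j, b))"

definition sg :: "('a, 'r) ring_scheme \<Rightarrow> nat \<Rightarrow> 'a" where
  "sg A j = (if even j then \<one>\<^bsub>A\<^esub> else \<ominus>\<^bsub>A\<^esub> \<one>\<^bsub>A\<^esub>)"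

text \<open>The columns are copies of the complex \<open>d\<close>, the maps between them alternate between
  \<open>u\<close> and \<open>w\<close>.\<close>

definition alt :: "'f \<Rightarrow> 'f \<Rightarrow> nat \<Rightarrow> 'f" where
  "alt u w j = (if odd j then u else w)"

text \<open>The horizontal maps commute with \<open>d\<close>; the sign on the column differential
  makes the two mixed terms of the square cancel.\<close>

definition tot_d :: "('a, 'r) ring_scheme \<Rightarrow> (('i \<Rightarrow> 'a) \<Rightarrow> 'i \<Rightarrow> 'a) \<Rightarrow> (('i \<Rightarrow> 'a) \<Rightarrow> 'i \<Rightarrow> 'a) \<Rightarrow>
    (('i \<Rightarrow> 'a) \<Rightarrow> 'i \<Rightarrow> 'a) \<Rightarrow> (nat \<times> 'i \<Rightarrow> 'a) \<Rightarrow> nat \<times> 'i \<Rightarrow> 'a" where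
  "tot_d A d u w v = (\<lambda>(j, b). alt u w (Suc j) (col v (Suc j)) b \<oplus>\<^bsub>A\<^esub> sg A j \<otimes>\<^bsub>A\<^esub> d (col v j) b)"

definition ins :: "('a, 'r) ring_scheme \<Rightarrow> nat \<Rightarrow> ('i \<Rightarrow> 'a) \<Rightarrow> nat \<times> 'i \<Rightarrow> 'a" where
  "ins A k m = (\<lambda>(j, b). if j = k then m b else \<zero>\<^bsub>A\<^esub>)"

lemma col_eqI: "(\<And>j. col v j = col w j) \<Longrightarrow> v = w"
  by (auto simp: col_def fun_eq_iff)

lemma col_closed: "v \<in> carrier (fun_module A) \<Longrightarrow> col v j \<in> carrier (fun_module A)"
  by (simp add: col_def fun_module_simps)

lemma carrier_col_iff: "v \<in> carrier (fun_module A) \<longleftrightarrow> (\<forall>j. col v j \<in> carrier (fun_module A))"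
  by (auto simp: col_def fun_module_simps)

lemma graded_col_iff:
  "v \<in> graded A (tot_wt wt) n \<longleftrightarrow>
    (\<forall>j. (j \<le> n \<longrightarrow> col v j \<in> graded A wt (n - j)) \<and> (j > n \<longrightarrow> col v j = \<zero>\<^bsub>fun_module A\<^esub>))"
  (is "?l = ?r")
  if "ring A"
proof -
  interpret ring A by fact
  show ?thesis
  proof
    assume ?l thus ?r by (fastforce simp: graded_def tot_wt_def col_def fun_module_simps)
  next
    assume r: ?r
    have "v (j, b) \<in> carrier A" for j b
      using spec[OF r, of j] by (cases "j \<le> n") (auto simp: graded_def col_def fun_module_simps fun_eq_iff)
    moreover have "v (j, b) = \<zero>\<^bsub>A\<^esub>" if "j + wt b \<noteq> n" for j b
      using spec[OF r, of j] that by (cases "j \<le> n") (auto simp: graded_def col_def fun_module_simps fun_eq_iff)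
    ultimately show ?l by (auto simp: graded_def tot_wt_def fun_module_simps)
  qed
qed

lemma col_simps:
  "col (v \<oplus>\<^bsub>fun_module A\<^esub> z) j = col v j \<oplus>\<^bsub>fun_module A\<^esub> col z j"
  "col (a \<odot>\<^bsub>fun_module A\<^esub> v) j = a \<odot>\<^bsub>fun_module A\<^esub> col v j"
  "col \<zero>\<^bsub>fun_module A\<^esub> j = \<zero>\<^bsub>fun_module A\<^esub>"
  "col (tot_d A d u w v) j = alt u w (Suc j) (col v (Suc j)) \<oplus>\<^bsub>fun_module A\<^esub> sg A j \<odot>\<^bsub>fun_module A\<^esub> d (col v j)"
  "col (ins A k m) j = (if j = k then m else \<zero>\<^bsub>fun_module A\<^esub>)"
  by (auto simp: col_def fun_module_simps tot_d_def ins_def)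

lemma (in ring) col_minus:
  assumes "v \<in> carrier (fun_module R)" "w \<in> carrier (fun_module R)"
  shows "col (v \<ominus>\<^bsub>fun_module R\<^esub> w) j = col v j \<ominus>\<^bsub>fun_module R\<^esub> col w j"
  using assms by (simp add: fun_module_minus col_closed) (simp add: col_def)

lemma (in ring) sg_simps:
  "sg R j \<in> carrier R" "sg R j \<otimes> sg R j = \<one>" "sg R (Suc j) \<oplus> sg R j = \<zero>"
  by (auto simp: sg_def l_minus r_minus l_neg r_neg)

text \<open>The composites of \<open>u\<close> and \<open>w\<close> vanish strictly and not merely
  up to homotopy, so the total differential has no further components. The last two assumptions say
  that \<open>u\<close> and \<open>w\<close> form an exact periodic sequence on the degree-zero
  homology of \<open>d\<close>.\<close>

locale twisted_tot = graded_complex A wt d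
  for A :: "('a, 'r) ring_scheme" and wt :: "'i \<Rightarrow> nat" and d :: "('i \<Rightarrow> 'a) \<Rightarrow> 'i \<Rightarrow> 'a" +
  fixes u w :: "('i \<Rightarrow> 'a) \<Rightarrow> 'i \<Rightarrow> 'a"
  assumes u_lin: "lin_op A u" and w_lin: "lin_op A w"
    and u_deg: "v \<in> graded A wt n \<Longrightarrow> u v \<in> graded A wt n"
    and w_deg: "v \<in> graded A wt n \<Longrightarrow> w v \<in> graded A wt n"
    and u_d: "v \<in> carrier (fun_module A) \<Longrightarrow> u (d v) = d (u v)"
    and w_d: "v \<in> carrier (fun_module A) \<Longrightarrow> w (d v) = d (w v)"
    and u_w: "v \<in> carrier (fun_module A) \<Longrightarrow> u (w v) = \<zero>\<^bsub>fun_module A\<^esub>"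
    and w_u: "v \<in> carrier (fun_module A) \<Longrightarrow> w (u v) = \<zero>\<^bsub>fun_module A\<^esub>"
    and exact_u: "m \<in> graded A wt 0 \<Longrightarrow> m' \<in> graded A wt 1 \<Longrightarrow> u m = d m' \<Longrightarrow>
      \<exists>a\<in>graded A wt 0. \<exists>b\<in>graded A wt 1. m = w a \<oplus>\<^bsub>fun_module A\<^esub> d b"
    and exact_w: "m \<in> graded A wt 0 \<Longrightarrow> m' \<in> graded A wt 1 \<Longrightarrow> w m = d m' \<Longrightarrow>
      \<exists>a\<in>graded A wt 0. \<exists>b\<in>graded A wt 1. m = u a \<oplus>\<^bsub>fun_module A\<^esub> d b"
begin

abbreviation "s \<equiv> alt u w"
abbreviation "D \<equiv> tot_d A d u w"
abbreviation "TG n \<equiv> graded A (tot_wt wt) n"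

lemma s_facts:
  "lin_op A (s j)" "v \<in> graded A wt n \<Longrightarrow> s j v \<in> graded A wt n"
  "v \<in> carrier (fun_module A) \<Longrightarrow> s j (d v) = d (s j v)"
  "v \<in> carrier (fun_module A) \<Longrightarrow> s j (s (Suc j) v) = \<zero>\<^bsub>fun_module A\<^esub>"
  "m \<in> graded A wt 0 \<Longrightarrow> m' \<in> graded A wt 1 \<Longrightarrow> s j m = d m' \<Longrightarrow>
      \<exists>a\<in>graded A wt 0. \<exists>b\<in>graded A wt 1. m = s (Suc j) a \<oplus>\<^bsub>fun_module A\<^esub> d b"
  using u_lin w_lin u_deg w_deg u_d w_d u_w w_u exact_u exact_w by (auto simp: alt_def)

lemma D_closed: "v \<in> carrier (fun_module A) \<Longrightarrow> D v \<in> carrier (fun_module A)"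
proof -
  interpret V: left_module A "fun_module A :: ('a, 'i \<Rightarrow> 'a) module"
    by (rule left_module_fun_module[OF ring_axioms])
  assume v: "v \<in> carrier (fun_module A)"
  show ?thesis unfolding carrier_col_iff
    using lin_opD(1)[OF s_facts(1)] lin_opD(1)[OF d_lin] col_closed[OF v] V.smult_closed sg_simps
    by (simp add: col_simps)
qed

lemma D_lin: "lin_op A D"
proof (rule lin_opI)
  interpret V: left_module A "fun_module A :: ('a, 'i \<Rightarrow> 'a) module"
    by (rule left_module_fun_module[OF ring_axioms])
  note c = lin_opD(1)[OF s_facts(1)] lin_opD(1)[OF d_lin] col_closed V.smult_closed sg_simps(1)
  fix v z :: "nat \<times> 'i \<Rightarrow> 'a"
  assume v: "v \<in> carrier (fun_module A)"
  show "D v \<in> carrier (fun_module A)" by (rule D_closed[OF v])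
  show "D (a \<odot>\<^bsub>fun_module A\<^esub> v) = a \<odot>\<^bsub>fun_module A\<^esub> D v" if a: "a \<in> carrier A" for a
  proof (rule col_eqI)
    fix j
    have "sg A j \<odot>\<^bsub>fun_module A\<^esub> (a \<odot>\<^bsub>fun_module A\<^esub> d (col v j)) =
        a \<odot>\<^bsub>fun_module A\<^esub> (sg A j \<odot>\<^bsub>fun_module A\<^esub> d (col v j))"
      using a c(2)[OF c(3)[OF v]] by (auto simp: sg_def fun_module_simps fun_eq_iff l_minus r_minus)
    thus "col (D (a \<odot>\<^bsub>fun_module A\<^esub> v)) j = col (a \<odot>\<^bsub>fun_module A\<^esub> D v) j"
      using lin_opD(3)[OF s_facts(1) a col_closed[OF v]] lin_opD(3)[OF d_lin a col_closed[OF v]]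
        V.smult_r_distr[OF a] c(1)[OF c(3)[OF v]] c(4)[OF c(5) c(2)[OF c(3)[OF v]]]
      by (simp add: col_simps)
  qed
  assume z: "z \<in> carrier (fun_module A)"
  show "D (v \<oplus>\<^bsub>fun_module A\<^esub> z) = D v \<oplus>\<^bsub>fun_module A\<^esub> D z"
    using v z
    by (intro col_eqI) (simp add: c col_simps lin_opD(2)[OF s_facts(1)] lin_opD(2)[OF d_lin]
        V.smult_r_distr V.M.a_ac)
qed

lemma D_D: assumes v: "v \<in> carrier (fun_module A)" shows "D (D v) = \<zero>\<^bsub>fun_module A\<^esub>"
proof (rule col_eqI)
  interpret V: left_module A "fun_module A :: ('a, 'i \<Rightarrow> 'a) module"
    by (rule left_module_fun_module[OF ring_axioms])
  fix j
  note c = lin_opD(1)[OF s_facts(1)] lin_opD(1)[OF d_lin] col_closed[OF v] V.smult_closed sg_simps(1)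
  let ?e = "s (Suc j) (d (col v (Suc j)))"
  have e: "?e \<in> carrier (fun_module A)" using c by simp
  have "col (D (D v)) j = sg A (Suc j) \<odot>\<^bsub>fun_module A\<^esub> ?e \<oplus>\<^bsub>fun_module A\<^esub> sg A j \<odot>\<^bsub>fun_module A\<^esub> ?e"
    using c by (simp add: col_simps lin_opD(2,3)[OF s_facts(1)] lin_opD(2,3)[OF d_lin] s_facts(4)
        d_d V.smult_zero s_facts(3))
  also have "\<dots> = \<zero>\<^bsub>fun_module A\<^esub>"
    using e sg_simps(1,3) V.smult_l_distr[of "sg A (Suc j)" "sg A j" ?e]
    by (simp add: fun_module_simps)
  finally show "col (D (D v)) j = col \<zero>\<^bsub>fun_module A\<^esub> j" by (simp add: col_simps)
qed

lemma D_deg: assumes v: "v \<in> TG (Suc n)" shows "D v \<in> TG n"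
  unfolding graded_col_iff[OF ring_axioms]
proof (intro allI conjI impI)
  interpret V: left_module A "fun_module A :: ('a, 'i \<Rightarrow> 'a) module"
    by (rule left_module_fun_module[OF ring_axioms])
  note g = v[unfolded graded_col_iff[OF ring_axioms]]
  fix j
  {
    assume j: "j \<le> n"
    have "s (Suc j) (col v (Suc j)) \<in> graded A wt (n - j)"
      using spec[OF g, of "Suc j"] j by (intro s_facts(2)) auto
    moreover have "d (col v j) \<in> graded A wt (n - j)"
      using spec[OF g, of j] j by (intro d_deg) (auto simp: Suc_diff_le)
    ultimately show "col (D v) j \<in> graded A wt (n - j)"
      by (simp add: col_simps graded_add graded_smult sg_simps)
  next
    assume j: "j > n"
    have "s (Suc j) (col v (Suc j)) = \<zero>\<^bsub>fun_module A\<^esub>"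
      using spec[OF g, of "Suc j"] j lin_op_zero[OF ring_axioms s_facts(1)] by simp
    moreover have "d (col v j) = \<zero>\<^bsub>fun_module A\<^esub>"
      using spec[OF g, of j] j lin_op_zero[OF ring_axioms d_lin] d_0 by (cases "j = Suc n") auto
    ultimately show "col (D v) j = \<zero>\<^bsub>fun_module A\<^esub>"
      by (simp add: col_simps V.smult_zero sg_simps)
  }
qed

lemma D_0: assumes v: "v \<in> TG 0" shows "D v = \<zero>\<^bsub>fun_module A\<^esub>"
proof (rule col_eqI)
  interpret V: left_module A "fun_module A :: ('a, 'i \<Rightarrow> 'a) module"
    by (rule left_module_fun_module[OF ring_axioms])
  note g = v[unfolded graded_col_iff[OF ring_axioms]]
  fix j
  have "d (col v j) = \<zero>\<^bsub>fun_module A\<^esub>"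
    using spec[OF g, of j] lin_op_zero[OF ring_axioms d_lin] d_0 by (cases "j = 0") auto
  thus "col (D v) j = col \<zero>\<^bsub>fun_module A\<^esub> j"
    using spec[OF g, of "Suc j"] lin_op_zero[OF ring_axioms s_facts(1)]
    by (simp add: col_simps V.smult_zero sg_simps)
qed

lemma ins_graded: "m \<in> graded A wt n \<Longrightarrow> ins A k m \<in> TG (k + n)"
  by (auto simp: graded_col_iff[OF ring_axioms] col_simps graded_zero)

lemma D_ins:
  assumes m: "m \<in> carrier (fun_module A)"
  shows "col (D (ins A k m)) j = (if Suc j = k then s k m else if j = k then sg A k \<odot>\<^bsub>fun_module A\<^esub> d m
    else \<zero>\<^bsub>fun_module A\<^esub>)"
proof -
  interpret V: left_module A "fun_module A :: ('a, 'i \<Rightarrow> 'a) module"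
    by (rule left_module_fun_module[OF ring_axioms])
  show ?thesis
    using m lin_opD(1)[OF s_facts(1)] lin_opD(1)[OF d_lin] lin_op_zero[OF ring_axioms s_facts(1)]
      lin_op_zero[OF ring_axioms d_lin] sg_simps V.smult_closed V.smult_zero
    by (simp add: col_simps)
qed

text \<open>The columns of a cycle are cleared from the right: the rightmost nonzero column is a cycle of
  \<open>d\<close>, unless it is the last one, where exactness of \<open>u\<close> and \<open>w\<close> modulo boundaries is used.\<close>

lemma D_exact_aux:
  "v \<in> TG (Suc n) \<Longrightarrow> D v = \<zero>\<^bsub>fun_module A\<^esub> \<Longrightarrow> (\<And>j. j \<ge> k \<Longrightarrow> col v j = \<zero>\<^bsub>fun_module A\<^esub>) \<Longrightarrow>
    \<exists>z\<in>TG (Suc (Suc n)). D z = v"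
proof (induction k arbitrary: v)
  case 0
  hence "v = \<zero>\<^bsub>fun_module A\<^esub>" by (intro col_eqI) (simp add: col_simps)
  thus ?case using graded_zero lin_op_zero[OF ring_axioms D_lin] by metis
next
  case (Suc k)
  interpret V: left_module A "fun_module A :: ('a, 'i \<Rightarrow> 'a) module"
    by (rule left_module_fun_module[OF ring_axioms])
  interpret W: left_module A "fun_module A :: ('a, nat \<times> 'i \<Rightarrow> 'a) module"
    by (rule left_module_fun_module[OF ring_axioms])
  note g = Suc.prems(1)[unfolded graded_col_iff[OF ring_axioms]]
  have vc: "v \<in> carrier (fun_module A)" using Suc.prems(1) graded_carrier by blast
  note cc = col_closed[OF vc]
  have Dv: "s (Suc j) (col v (Suc j)) \<oplus>\<^bsub>fun_module A\<^esub> sg A j \<odot>\<^bsub>fun_module A\<^esub> d (col v j) = \<zero>\<^bsub>fun_module A\<^esub>" for j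
    using arg_cong[OF Suc.prems(2), of "\<lambda>v. col v j"] by (simp add: col_simps)
  \<comment> \<open>If a boundary agrees with \<open>v\<close> in all columns from \<open>k\<close>
    on, subtracting it leaves a cycle with one column less, to which the induction hypothesis
    applies.\<close>
  have red: "\<exists>z\<in>TG (Suc (Suc n)). D z = v"
    if z: "z \<in> TG (Suc (Suc n))" and zc: "\<And>j. j \<ge> k \<Longrightarrow> col (D z) j = col v j" for z
  proof -
    have zc': "z \<in> carrier (fun_module A)" "D z \<in> carrier (fun_module A)"
      using z graded_carrier D_closed by blast+
    let ?v = "v \<ominus>\<^bsub>fun_module A\<^esub> D z"
    have "?v \<in> TG (Suc n)" by (rule graded_minus[OF Suc.prems(1) D_deg[OF z]])
    moreover have "D ?v = \<zero>\<^bsub>fun_module A\<^esub>"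
      using lin_op_minus[OF ring_axioms D_lin vc zc'(2)] Suc.prems(2) D_D[OF zc'(1)]
      by (simp add: a_minus_def W.M.r_neg)
    moreover have "col ?v j = \<zero>\<^bsub>fun_module A\<^esub>" if "j \<ge> k" for j
      using zc[OF that] col_minus[OF vc zc'(2)] cc by (simp add: a_minus_def V.M.r_neg)
    ultimately obtain y where y: "y \<in> TG (Suc (Suc n))" "D y = ?v" using Suc.IH by blast
    have "D (y \<oplus>\<^bsub>fun_module A\<^esub> z) = ?v \<oplus>\<^bsub>fun_module A\<^esub> D z"
      using lin_opD(2)[OF D_lin graded_carrier[OF y(1)] zc'(1)] y(2) by simp
    also have "\<dots> = v" using vc zc' by (simp add: a_minus_def W.M.a_assoc W.M.l_neg)
    finally show ?thesis using graded_add[OF y(1) z] by blast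
  qed
  consider "k > Suc n" | "k = Suc n" | "k \<le> n" by linarith
  thus ?case
  proof cases
    case 1
    hence "col v k = \<zero>\<^bsub>fun_module A\<^esub>" using spec[OF g, of k] by simp
    hence "col v j = \<zero>\<^bsub>fun_module A\<^esub>" if "j \<ge> k" for j
      using that Suc.prems(3)[of j] by (cases "j = k") auto
    thus ?thesis using Suc.IH Suc.prems by blast
  next
    \<comment> \<open>The column \<open>Suc n\<close> of an element of degree \<open>Suc n\<close>
      sits in degree zero, where \<open>d\<close> is not exact. The cycle condition in column
      \<open>n\<close> says that \<open>s k\<close> maps it to a boundary of
      \<open>d\<close>.\<close>
    case 2
    have c0: "col v k \<in> graded A wt 0" and c1: "col v n \<in> graded A wt 1"
      using spec[OF g, of k] spec[OF g, of n] 2 by auto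
    let ?m = "(\<ominus>\<^bsub>A\<^esub> sg A n) \<odot>\<^bsub>fun_module A\<^esub> col v n"
    have m: "?m \<in> graded A wt 1" using c1 sg_simps by (intro graded_smult) auto
    have "s k (col v k) = d ?m"
    proof -
      have "d ?m = (\<ominus>\<^bsub>A\<^esub> sg A n) \<odot>\<^bsub>fun_module A\<^esub> d (col v n)"
        using sg_simps cc by (intro lin_opD(3)[OF d_lin]) auto
      moreover have "(\<ominus>\<^bsub>A\<^esub> sg A n) \<odot>\<^bsub>fun_module A\<^esub> d (col v n) \<oplus>\<^bsub>fun_module A\<^esub> sg A n \<odot>\<^bsub>fun_module A\<^esub> d (col v n) = \<zero>\<^bsub>fun_module A\<^esub>"
        using lin_opD(1)[OF d_lin cc, of n] sg_simps(1)[of n] by (simp add: fun_module_simps l_minus l_neg)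
      moreover have "s k (col v k) \<oplus>\<^bsub>fun_module A\<^esub> sg A n \<odot>\<^bsub>fun_module A\<^esub> d (col v n) = \<zero>\<^bsub>fun_module A\<^esub>"
        using Dv[of n] 2 by simp
      moreover have "s k (col v k) \<in> carrier (fun_module A)" "d (col v n) \<in> carrier (fun_module A)"
        using lin_opD(1)[OF s_facts(1) cc] lin_opD(1)[OF d_lin cc] by auto
      ultimately have "\<ominus>\<^bsub>fun_module A\<^esub> (sg A n \<odot>\<^bsub>fun_module A\<^esub> d (col v n)) = s k (col v k)"
        "\<ominus>\<^bsub>fun_module A\<^esub> (sg A n \<odot>\<^bsub>fun_module A\<^esub> d (col v n)) = d ?m"
        using V.smult_closed sg_simps(1)[of n] by (auto intro!: V.M.minus_equality)
      thus ?thesis by simp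
    qed
    then obtain a b where ab: "a \<in> graded A wt 0" "b \<in> graded A wt 1"
      "col v k = s (Suc k) a \<oplus>\<^bsub>fun_module A\<^esub> d b" using s_facts(5)[OF c0 m] by blast
    let ?b = "sg A k \<odot>\<^bsub>fun_module A\<^esub> b"
    have bg: "?b \<in> graded A wt 1" using ab sg_simps by (intro graded_smult)
    let ?z = "ins A (Suc k) a \<oplus>\<^bsub>fun_module A\<^esub> ins A k ?b"
    have zz: "ins A (Suc k) a \<in> TG (Suc (Suc n))" "ins A k ?b \<in> TG (Suc (Suc n))"
      using ins_graded[OF ab(1), of "Suc k"] ins_graded[OF bg, of k] 2 by simp_all
    show ?thesis
    proof (rule red)
      show "?z \<in> TG (Suc (Suc n))" using zz by (rule graded_add)
      fix j assume j: "j \<ge> k"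
      have db: "sg A k \<odot>\<^bsub>fun_module A\<^esub> d ?b = d b"
        using lin_opD(1,3)[OF d_lin] graded_carrier[OF ab(2)] sg_simps(1,2)[of k]
        by (simp add: V.smult_assoc[symmetric] V.smult_one)
      have da: "d a = \<zero>\<^bsub>fun_module A\<^esub>" by (rule d_0[OF ab(1)])
      have "col (D ?z) j = col (D (ins A (Suc k) a)) j \<oplus>\<^bsub>fun_module A\<^esub> col (D (ins A k ?b)) j"
        using lin_opD(2)[OF D_lin] zz graded_carrier by (metis col_simps(1))
      also have "\<dots> = (if j = k then col v k else \<zero>\<^bsub>fun_module A\<^esub>)"
        using j D_ins[OF graded_carrier[OF ab(1)], of "Suc k" j] D_ins[OF graded_carrier[OF bg], of k j]
          db da ab(3) sg_simps V.smult_zero lin_opD(1)[OF s_facts(1) graded_carrier[OF ab(1)]]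
        by auto
      also have "\<dots> = col v j" using j Suc.prems(3)[of j] by (cases "j = k") auto
      finally show "col (D ?z) j = col v j" .
    qed
  next
    \<comment> \<open>Column \<open>Suc k\<close> vanishes, so up to a sign the cycle condition
      reads \<open>d (col v k) = 0\<close>, and this column has positive degree.\<close>
    case 3
    have gk: "col v k \<in> graded A wt (Suc (n - k))" using spec[OF g, of k] 3 by (simp add: Suc_diff_le)
    have e: "sg A k \<odot>\<^bsub>fun_module A\<^esub> d (col v k) = \<zero>\<^bsub>fun_module A\<^esub>"
      using Dv[of k] Suc.prems(3)[of "Suc k"] lin_op_zero[OF ring_axioms s_facts(1)]
        lin_opD(1)[OF d_lin cc] V.smult_closed sg_simps by simp
    have "d (col v k) = sg A k \<odot>\<^bsub>fun_module A\<^esub> (sg A k \<odot>\<^bsub>fun_module A\<^esub> d (col v k))"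
      using lin_opD(1)[OF d_lin cc] sg_simps(1,2) by (simp add: V.smult_assoc[symmetric] V.smult_one)
    hence "d (col v k) = \<zero>\<^bsub>fun_module A\<^esub>" using e V.smult_zero sg_simps by simp
    then obtain m where m: "m \<in> graded A wt (Suc (Suc (n - k)))" "d m = col v k" using exact[OF gk] by blast
    let ?m = "sg A k \<odot>\<^bsub>fun_module A\<^esub> m"
    have mg: "?m \<in> graded A wt (Suc (Suc (n - k)))" using m sg_simps by (intro graded_smult)
    show ?thesis
    proof (rule red)
      show "ins A k ?m \<in> TG (Suc (Suc n))" using ins_graded[OF mg, of k] 3 by simp
      fix j assume j: "j \<ge> k"
      have "sg A k \<odot>\<^bsub>fun_module A\<^esub> d ?m = d m"
        using lin_opD(1,3)[OF d_lin] graded_carrier[OF m(1)] sg_simps(1,2)[of k]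
        by (simp add: V.smult_assoc[symmetric] V.smult_one)
      thus "col (D (ins A k ?m)) j = col v j"
        using j D_ins[OF graded_carrier[OF mg], of k j] m(2) Suc.prems(3)[of j] by (cases "j = k") auto
    qed
  qed
qed

sublocale tot: graded_complex A "tot_wt wt" D
proof unfold_locales
  fix v n assume v: "v \<in> TG (Suc n)" "D v = \<zero>\<^bsub>fun_module A\<^esub>"
  show "\<exists>z\<in>TG (Suc (Suc n)). D z = v"
    using v(1)[unfolded graded_col_iff[OF ring_axioms]] by (intro D_exact_aux[OF v, of "Suc (Suc n)"]) auto
qed (use D_lin D_deg D_0 D_D in auto)

end

section \<open>Shift operators\<close>

text \<open>Degrees below two are sent to zero explicitly, because \<open>n - 2\<close> on natural
  numbers would place them in degree zero.\<close>

definition shift_op :: "('a, 'r) ring_scheme \<Rightarrow> ('i \<Rightarrow> nat) \<Rightarrow> (('i \<Rightarrow> 'a) \<Rightarrow> 'i \<Rightarrow> 'a) \<Rightarrow> bool" where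
  "shift_op A wt S \<longleftrightarrow> lin_op A S \<and>
    (\<forall>n. \<forall>v\<in>graded A wt n. if n < 2 then S v = \<zero>\<^bsub>fun_module A\<^esub> else S v \<in> graded A wt (n - 2))"

definition outer_shift :: "(nat \<times> 'i \<Rightarrow> 'a) \<Rightarrow> nat \<times> 'i \<Rightarrow> 'a" where
  "outer_shift v = (\<lambda>(j, b). v (j + 2, b))"

definition inner_op :: "(('i \<Rightarrow> 'a) \<Rightarrow> 'i \<Rightarrow> 'a) \<Rightarrow> (nat \<times> 'i \<Rightarrow> 'a) \<Rightarrow> nat \<times> 'i \<Rightarrow> 'a" where
  "inner_op S v = (\<lambda>(j, b). S (col v j) b)"

lemma col_outer_shift: "col (outer_shift v) j = col v (Suc (Suc j))"
  by (simp add: col_def outer_shift_def)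

lemma col_inner_op: "col (inner_op S v) j = S (col v j)"
  by (simp add: col_def inner_op_def)

lemma outer_shift_op:
  assumes "ring A" shows "shift_op A (tot_wt wt) outer_shift"
  unfolding shift_op_def
proof (intro conjI allI ballI)
  interpret ring A by fact
  show "lin_op A outer_shift"
    by (rule lin_opI) (auto simp: outer_shift_def fun_module_simps)
  fix n v assume v: "v \<in> graded A (tot_wt wt) n"
  note g = v[unfolded graded_col_iff[OF assms]]
  have *: "col (outer_shift v) j = \<zero>\<^bsub>fun_module A\<^esub>" if "n < 2 + j" for j
    using spec[OF g, of "Suc (Suc j)"] that by (simp add: col_outer_shift)
  show "if n < 2 then outer_shift v = \<zero>\<^bsub>fun_module A\<^esub> else outer_shift v \<in> graded A (tot_wt wt) (n - 2)"
  proof (cases "n < 2")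
    case True thus ?thesis using * by (auto intro: col_eqI simp: col_simps(3))
  next
    case False
    have "col (outer_shift v) j \<in> graded A wt (n - 2 - j)" if "j \<le> n - 2" for j
      using spec[OF g, of "Suc (Suc j)"] that False by (simp add: col_outer_shift numeral_2_eq_2)
    thus ?thesis using False * by (simp add: graded_col_iff[OF assms])
  qed
qed

lemma inner_shift_op:
  fixes A :: "('a, 'r) ring_scheme" and wt :: "'i \<Rightarrow> nat"
  assumes A: "ring A" and S: "shift_op A wt S" shows "shift_op A (tot_wt wt) (inner_op S)"
  unfolding shift_op_def
proof (intro conjI allI ballI)
  interpret ring A by fact
  have Sl: "lin_op A S" using S by (simp add: shift_op_def)
  show "lin_op A (inner_op S)"
  proof (rule lin_opI)
    fix v :: "nat \<times> 'i \<Rightarrow> 'a" assume "v \<in> carrier (fun_module A)"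
    thus "inner_op S v \<in> carrier (fun_module A)"
      using lin_opD(1)[OF Sl] by (simp add: carrier_col_iff[where v="inner_op S v"] col_inner_op col_closed)
  qed (auto intro!: col_eqI simp: col_inner_op col_simps(1,2) lin_opD(2,3)[OF Sl] col_closed)
  fix n v assume v: "v \<in> graded A (tot_wt wt) n"
  note g = v[unfolded graded_col_iff[OF A]]
  have Sz: "S \<zero>\<^bsub>fun_module A\<^esub> = \<zero>\<^bsub>fun_module A\<^esub>" by (rule lin_op_zero[OF A Sl])
  have *: "S (col v j) = \<zero>\<^bsub>fun_module A\<^esub>" if "n < 2 + j" for j
  proof (cases "j \<le> n")
    case True
    hence "n - j < 2" "col v j \<in> graded A wt (n - j)" using that spec[OF g, of j] by auto
    thus ?thesis using S unfolding shift_op_def by metis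
  next
    case False thus ?thesis using spec[OF g, of j] Sz by simp
  qed
  show "if n < 2 then inner_op S v = \<zero>\<^bsub>fun_module A\<^esub> else inner_op S v \<in> graded A (tot_wt wt) (n - 2)"
  proof (cases "n < 2")
    case True thus ?thesis using * by (auto intro: col_eqI simp: col_simps(3) col_inner_op)
  next
    case False
    have "S (col v j) \<in> graded A wt (n - 2 - j)" if j: "j \<le> n - 2" for j
    proof -
      have "\<not> n - j < 2" "col v j \<in> graded A wt (n - j)" using j False spec[OF g, of j] by auto
      hence "S (col v j) \<in> graded A wt (n - j - 2)" using S unfolding shift_op_def by metis
      thus ?thesis by (simp add: diff_commute)
    qed
    thus ?thesis using False * by (simp add: graded_col_iff[OF A] col_inner_op)
  qed
qed

text \<open>Both the alternation between \<open>u\<close> and \<open>w\<close> and the sign depend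
  on the column only through its parity, which a shift by two preserves.\<close>

lemma outer_shift_tot_d: "tot_d A d u w (outer_shift v) = outer_shift (tot_d A d u w v)"
  by (rule col_eqI) (simp add: col_outer_shift col_simps(4) alt_def sg_def)

lemma inner_op_tot_d:
  fixes A :: "('a, 'r) ring_scheme" and S :: "('i \<Rightarrow> 'a) \<Rightarrow> 'i \<Rightarrow> 'a"
  assumes A: "ring A" and S: "lin_op A S" and ops: "lin_op A d" "lin_op A u" "lin_op A w"
    and comm: "\<And>v. v \<in> carrier (fun_module A) \<Longrightarrow> d (S v) = S (d v)"
      "\<And>v. v \<in> carrier (fun_module A) \<Longrightarrow> u (S v) = S (u v)"
      "\<And>v. v \<in> carrier (fun_module A) \<Longrightarrow> w (S v) = S (w v)"
    and v: "v \<in> carrier (fun_module A)"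
  shows "tot_d A d u w (inner_op S v) = inner_op S (tot_d A d u w v)"
proof (rule col_eqI)
  interpret ring A by fact
  interpret V: left_module A "fun_module A :: ('a, 'i \<Rightarrow> 'a) module"
    by (rule left_module_fun_module[OF A])
  fix j
  have L: "lin_op A (alt u w (Suc j))"
    and c: "\<And>v. v \<in> carrier (fun_module A) \<Longrightarrow> alt u w (Suc j) (S v) = S (alt u w (Suc j) v)"
    using ops comm by (auto simp: alt_def)
  have "alt u w (Suc j) (col v (Suc j)) \<in> carrier (fun_module A)" "d (col v j) \<in> carrier (fun_module A)"
    using lin_opD(1)[OF L col_closed[OF v]] lin_opD(1)[OF ops(1) col_closed[OF v]] by auto
  thus "col (tot_d A d u w (inner_op S v)) j = col (inner_op S (tot_d A d u w v)) j"
    using v sg_simps(1)[of j]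
    by (simp add: c col_inner_op col_simps(4) col_closed comm(1) lin_opD(2,3)[OF S] V.smult_closed)
qed

section \<open>The resolution over a Heisenberg type algebra\<close>

text \<open>Relations of a truncated Heisenberg algebra, to be satisfied by three elements of a
  ring. At this level only identities between elements are derived; exactness enters in
  \<open>heis_exact\<close>.\<close>

locale heis = ring A for A :: "('a, 'r) ring_scheme" (structure) +
  fixes z y g :: 'a and p q :: nat
  assumes zc: "z \<in> carrier A" and yc: "y \<in> carrier A" and gc: "g \<in> carrier A"
    and zy: "z \<otimes> y = y \<otimes> z" and zg: "z \<otimes> g = g \<otimes> z"
    and gy: "g \<otimes> y = y \<otimes> g \<oplus> z"
    and zp: "z [^] p = \<zero>" and yp: "y [^] p = \<zero>" and gq: "g [^] q = \<one>"
    and p: "Factorial_Ring.prime p" and pq: "p dvd q" and q0: "q > 0"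
    and char: "[p] \<cdot> \<one> = \<zero>"
begin

lemma nat_mult_zero: "p dvd n \<Longrightarrow> a \<in> carrier A \<Longrightarrow> [n] \<cdot> a = \<zero>"
proof -
  assume a: "a \<in> carrier A" and "p dvd n"
  then obtain m where n: "n = p * m" by blast
  have "[p] \<cdot> a = [p] \<cdot> \<one> \<otimes> a" using a by (simp add: add_pow_ldistr)
  also have "\<dots> = \<zero>" using char a by simp
  finally show "[n] \<cdot> a = \<zero>" using a unfolding n by (simp add: add.nat_pow_pow[symmetric])
qed

lemma g_pow_closed: "g [^] (n::nat) \<in> carrier A" using gc by simp

lemma g_pow_y: "g [^] (n::nat) \<otimes> y = y \<otimes> g [^] n \<oplus> [n] \<cdot> (g [^] (n - 1) \<otimes> z)"
proof (induction n)
  case 0 thus ?case using yc by simp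
next
  case (Suc n)
  have "g [^] Suc n \<otimes> y = g [^] n \<otimes> (g \<otimes> y)" using gc yc by (simp add: m_assoc)
  also have "\<dots> = (g [^] n \<otimes> y) \<otimes> g \<oplus> g [^] n \<otimes> z"
    using gc yc zc by (simp add: gy r_distr m_assoc)
  also have "\<dots> = y \<otimes> g [^] Suc n \<oplus> ([n] \<cdot> (g [^] (n - 1) \<otimes> z)) \<otimes> g \<oplus> g [^] n \<otimes> z"
    unfolding Suc using gc yc zc by (simp add: l_distr m_assoc)
  also have "([n] \<cdot> (g [^] (n - 1) \<otimes> z)) \<otimes> g = [n] \<cdot> (g [^] n \<otimes> z)"
  proof (cases n)
    case (Suc m)
    have "(g [^] (n - 1) \<otimes> z) \<otimes> g = g [^] n \<otimes> z" using Suc gc zc zg by (simp add: m_assoc)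
    thus ?thesis using gc zc by (simp add: add_pow_ldistr)
  qed (use gc zc in simp)
  finally show ?case using gc yc zc by (simp add: a_assoc)
qed

text \<open>The iterated derivatives of \<open>1 + g + \<dots> + g\<^sup>q\<^sup>-\<^sup>1\<close> with respect to \<open>g\<close>.\<close>

definition W :: "nat \<Rightarrow> 'a" where
  "W k = (\<Oplus>i\<in>{..<q}. [((i choose k) * fact k :: nat)] \<cdot> (g [^] (i - k)))"

lemma W_closed: "W k \<in> carrier A"
  unfolding W_def by (intro finsum_closed) (auto simp: gc)

text \<open>Commutation with \<open>y\<close> differentiates polynomials in \<open>g\<close>: a
  polynomial \<open>f\<close> satisfies \<open>f(g) y = y f(g) + f'(g) z\<close>.\<close>

lemma W_y: "W k \<otimes> y = y \<otimes> W k \<oplus> W (Suc k) \<otimes> z"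
proof -
  let ?c = "\<lambda>i. (i choose k) * fact k :: nat"
  have term_eq: "[(?c i)] \<cdot> (g [^] (i - k)) \<otimes> y =
      y \<otimes> [(?c i)] \<cdot> (g [^] (i - k)) \<oplus> [((i choose Suc k) * fact (Suc k) :: nat)] \<cdot> (g [^] (i - Suc k)) \<otimes> z" for i
  proof -
    \<comment> \<open>Differentiating once more multiplies by \<open>i - k\<close>; with the
      factorial kept in the coefficient the result has the same shape again.\<close>
    have e: "?c i * (i - k) = (i choose Suc k) * fact (Suc k)"
    proof -
      have "Suc k * (i choose Suc k) = (i - k) * (i choose k)"
        using binomial_absorb_comp[of i k] binomial_absorption[of k i] by simp
      thus ?thesis unfolding fact_Suc of_nat_id by (metis mult.assoc mult.commute)
    qed
    have "[(?c i)] \<cdot> (g [^] (i - k)) \<otimes> y = [(?c i)] \<cdot> (g [^] (i - k) \<otimes> y)"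
      using gc yc by (simp add: add_pow_ldistr)
    also have "\<dots> = [(?c i)] \<cdot> (y \<otimes> g [^] (i - k)) \<oplus> [(?c i)] \<cdot> ([(i - k)] \<cdot> (g [^] (i - k - 1) \<otimes> z))"
      using gc yc zc by (simp add: g_pow_y add.nat_pow_distrib)
    also have "[(?c i)] \<cdot> ([(i - k)] \<cdot> (g [^] (i - k - 1) \<otimes> z)) = [(?c i * (i - k))] \<cdot> (g [^] (i - Suc k) \<otimes> z)"
      using gc zc by (simp add: add.nat_pow_pow mult.commute)
    finally show ?thesis using gc yc zc unfolding e by (simp add: add_pow_ldistr add_pow_rdistr)
  qed
  have "W k \<otimes> y = (\<Oplus>i\<in>{..<q}. [(?c i)] \<cdot> (g [^] (i - k)) \<otimes> y)"
    unfolding W_def using gc yc by (intro finsum_ldistr) auto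
  also have "\<dots> = (\<Oplus>i\<in>{..<q}. y \<otimes> [(?c i)] \<cdot> (g [^] (i - k))) \<oplus>
      (\<Oplus>i\<in>{..<q}. [((i choose Suc k) * fact (Suc k) :: nat)] \<cdot> (g [^] (i - Suc k)) \<otimes> z)"
    unfolding term_eq using gc yc zc by (intro finsum_addf) auto
  also have "(\<Oplus>i\<in>{..<q}. y \<otimes> [(?c i)] \<cdot> (g [^] (i - k))) = y \<otimes> W k"
    unfolding W_def using gc yc by (intro finsum_rdistr[symmetric]) auto
  also have "(\<Oplus>i\<in>{..<q}. [((i choose Suc k) * fact (Suc k) :: nat)] \<cdot> (g [^] (i - Suc k)) \<otimes> z) = W (Suc k) \<otimes> z"
    unfolding W_def using gc zc by (intro finsum_ldistr[symmetric]) auto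
  finally show ?thesis .
qed

text \<open>Every coefficient of a \<open>p\<close>-fold derivative contains \<open>p!\<close>. This
  is the reason for ordinary derivatives in \<open>W\<close>: divided powers would not
  vanish.\<close>

lemma W_p: "W p = \<zero>"
proof -
  have "p dvd (i choose p) * fact p" for i :: nat
    using p prime_gt_0_nat by (intro dvd_mult dvd_fact) (auto simp: Suc_le_eq)
  hence "W p = (\<Oplus>i\<in>{..<q}. \<zero>)" unfolding W_def
    by (intro finsum_cong') (auto simp: nat_mult_zero gc simp del: fact_reduce)
  thus ?thesis by simp
qed

abbreviation "N \<equiv> W 0"
abbreviation "N' \<equiv> W 1"

lemma N_eq: "N = (\<Oplus>i\<in>{..<q}. g [^] i)"
  unfolding W_def using gc by (intro finsum_cong') auto

lemma W_commute: "x \<in> carrier A \<Longrightarrow> x \<otimes> g = g \<otimes> x \<Longrightarrow> x \<otimes> W k = W k \<otimes> x"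
proof -
  assume x: "x \<in> carrier A" "x \<otimes> g = g \<otimes> x"
  have c: "x \<otimes> g [^] (n::nat) = g [^] n \<otimes> x" for n
    using x gc by (induction n) (simp_all add: m_assoc[symmetric], simp add: m_assoc)
  have "x \<otimes> W k = (\<Oplus>i\<in>{..<q}. x \<otimes> [((i choose k) * fact k :: nat)] \<cdot> (g [^] (i - k)))"
    unfolding W_def using x gc by (intro finsum_rdistr) auto
  also have "\<dots> = (\<Oplus>i\<in>{..<q}. [((i choose k) * fact k :: nat)] \<cdot> (g [^] (i - k)) \<otimes> x)"
    using x gc by (intro finsum_cong') (auto simp: add_pow_ldistr add_pow_rdistr c)
  also have "\<dots> = W k \<otimes> x"
    unfolding W_def using x gc by (intro finsum_ldistr[symmetric]) auto
  finally show ?thesis .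
qed

text \<open>Cyclic reindexing. It is applied to \<open>g^i\<close>, where the ends agree because
  \<open>g^q = 1\<close>, and to \<open>i g^(i-1)\<close>, where the value at \<open>q\<close> is
  zero because \<open>p\<close> divides \<open>q\<close>.\<close>

lemma finsum_shift:
  fixes r :: nat and f :: "nat \<Rightarrow> 'a"
  assumes f: "\<And>i. f i \<in> carrier A" and eq: "f r = f 0"
  shows "(\<Oplus>i\<in>{..<r}. f (Suc i)) = (\<Oplus>i\<in>{..<r}. f i)"
proof (cases r)
  case (Suc m)
  have "(\<Oplus>i\<in>{..<r}. f (Suc i)) = f (Suc m) \<oplus> (\<Oplus>i\<in>{..<m}. f (Suc i))"
    unfolding Suc lessThan_Suc using f by (subst finsum_insert) auto
  also have "(\<Oplus>i\<in>{..<m}. f (Suc i)) = (\<Oplus>i\<in>Suc ` {..<m}. f i)"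
    using f by (intro finsum_reindex[symmetric]) auto
  also have "f (Suc m) \<oplus> (\<Oplus>i\<in>Suc ` {..<m}. f i) = (\<Oplus>i\<in>insert 0 (Suc ` {..<m}). f i)"
    using f eq Suc by (subst finsum_insert) auto
  also have "insert 0 (Suc ` {..<m}) = {..<r}" by (simp add: Suc lessThan_Suc_eq_insert_0)
  finally show ?thesis .
qed simp

lemma N_g: "N \<otimes> g = N"
proof -
  have "N \<otimes> g = (\<Oplus>i\<in>{..<q}. g [^] Suc i)"
    unfolding N_eq using gc by (subst finsum_ldistr) auto
  also have "\<dots> = N" unfolding N_eq using gc gq by (intro finsum_shift) auto
  finally show ?thesis .
qed

lemma g_N: "g \<otimes> N = N" using W_commute[of g 0] gc N_g by simp

text \<open>The derivative of \<open>N (g - 1) = g^q - 1\<close>, whose right side has derivative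
  zero since \<open>q = 0\<close> in the ring.\<close>

lemma N'_eq: "N' = N' \<otimes> g \<oplus> N"
proof -
  have "N' \<otimes> g = (\<Oplus>i\<in>{..<q}. [i] \<cdot> (g [^] i))"
  proof -
    have "N' \<otimes> g = (\<Oplus>i\<in>{..<q}. [i] \<cdot> (g [^] (i - 1)) \<otimes> g)"
      unfolding W_def using gc by (subst finsum_ldistr) auto
    also have "\<dots> = (\<Oplus>i\<in>{..<q}. [i] \<cdot> (g [^] i))"
    proof (intro finsum_cong')
      fix i :: nat
      show "[i] \<cdot> (g [^] (i - 1)) \<otimes> g = [i] \<cdot> (g [^] i)" using gc by (cases i) (auto simp: add_pow_ldistr l_distr)
    qed (use gc in auto)
    finally show ?thesis .
  qed
  hence "N' \<otimes> g \<oplus> N = (\<Oplus>i\<in>{..<q}. [i] \<cdot> (g [^] i) \<oplus> g [^] i)"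
    unfolding N_eq using gc by (subst finsum_addf) auto
  also have "\<dots> = (\<Oplus>i\<in>{..<q}. [Suc i] \<cdot> (g [^] (Suc i - 1)))"
    using gc by (intro finsum_cong') auto
  also have "\<dots> = (\<Oplus>i\<in>{..<q}. [i] \<cdot> (g [^] (i - 1)))"
    using gc nat_mult_zero[OF pq] by (intro finsum_shift[of "\<lambda>i. [i] \<cdot> (g [^] (i - 1))"]) auto
  also have "\<dots> = N'" unfolding W_def using gc by (intro finsum_cong') auto
  finally show ?thesis ..
qed

text \<open>\<open>power_sum n w = \<Sum>\<^sub>k\<^sub>+\<^sub>m\<^sub>=\<^sub>n\<^sub>-\<^sub>1 y\<^sup>k w y\<^sup>m\<close>\<close>

primrec power_sum :: "nat \<Rightarrow> 'a \<Rightarrow> 'a" where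
  "power_sum 0 w = \<zero>"
| "power_sum (Suc n) w = power_sum n w \<otimes> y \<oplus> y [^] n \<otimes> w"

lemma power_sum_closed: "w \<in> carrier A \<Longrightarrow> power_sum n w \<in> carrier A"
  using yc by (induction n) auto

text \<open>The sequence \<open>w j\<close> consists of the iterated commutators of
  \<open>w 0\<close> with \<open>y\<close>, each divided by \<open>z\<close>. Moving all
  \<open>y\<close> to the left yields one factor \<open>z\<close> per commutator, and Pascal's rule
  collects the coefficients.\<close>

lemma power_sum_eq:
  assumes w: "\<And>j. w j \<in> carrier A" and wy: "\<And>j. w j \<otimes> y = y \<otimes> w j \<oplus> w (Suc j) \<otimes> z"
  shows "power_sum n (w 0) = (\<Oplus>j\<in>{..<n}. [(n choose Suc j)] \<cdot> (y [^] (n - 1 - j) \<otimes> w j \<otimes> z [^] j))"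
proof (induction n)
  case (Suc n)
  have zpy: "z [^] (j::nat) \<otimes> y = y \<otimes> z [^] j" for j
    using zc yc zy by (induction j) (simp_all add: m_assoc, simp add: m_assoc[symmetric])
  define t where "t m j = y [^] (m - j) \<otimes> w j \<otimes> z [^] (j::nat)" for m j :: nat
  have tc: "t m j \<in> carrier A" for m j unfolding t_def using w yc zc by simp
  have ty: "t (n - 1) j \<otimes> y = t n j \<oplus> t n (Suc j)" if "j < n" for j
  proof -
    have "t (n - 1) j \<otimes> y = y [^] (n - 1 - j) \<otimes> (w j \<otimes> y) \<otimes> z [^] j"
      using w yc zc by (simp add: t_def m_assoc zpy)
    also have "\<dots> = y [^] (n - 1 - j) \<otimes> y \<otimes> w j \<otimes> z [^] j \<oplus> y [^] (n - 1 - j) \<otimes> w (Suc j) \<otimes> (z \<otimes> z [^] j)"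
      using w yc zc by (simp add: wy r_distr l_distr m_assoc)
    also have "y [^] (n - 1 - j) \<otimes> y = y [^] (n - j)" using that yc by (metis Suc_diff_Suc diff_Suc_1 diff_commute nat_pow_Suc)
    also have "z \<otimes> z [^] j = z [^] Suc j" using zc by (simp add: nat_pow_Suc2[symmetric] del: nat_pow_Suc)
    also have "n - 1 - j = n - Suc j" by simp
    finally show ?thesis by (simp add: t_def)
  qed
  have "power_sum n (w 0) \<otimes> y = (\<Oplus>j\<in>{..<n}. [(n choose Suc j)] \<cdot> t (n - 1) j \<otimes> y)"
    unfolding Suc t_def[symmetric] using tc yc by (intro finsum_ldistr) auto
  also have "\<dots> = (\<Oplus>j\<in>{..<n}. [(n choose Suc j)] \<cdot> t n j \<oplus> [(n choose Suc j)] \<cdot> t n (Suc j))"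
    using tc yc ty by (intro finsum_cong') (auto simp: add_pow_ldistr add.nat_pow_distrib)
  also have "\<dots> = (\<Oplus>j\<in>{..<n}. [(n choose Suc j)] \<cdot> t n j) \<oplus> (\<Oplus>j\<in>{..<n}. [(n choose Suc j)] \<cdot> t n (Suc j))"
    using tc by (intro finsum_addf) auto
  finally have 1: "power_sum (Suc n) (w 0) = (\<Oplus>j\<in>{..<n}. [(n choose Suc j)] \<cdot> t n j) \<oplus>
      (\<Oplus>j\<in>{..<n}. [(n choose Suc j)] \<cdot> t n (Suc j)) \<oplus> t n 0"
    using w yc zc by (simp add: t_def)
  \<comment> \<open>Shifting the index makes both sums run over the same terms; the missing term at
    zero is supplied by \<open>y^n w 0\<close>, the new summand of \<open>power_sum\<close>.\<close>
  have "(\<Oplus>j\<in>{..<n}. [(n choose Suc j)] \<cdot> t n (Suc j)) \<oplus> t n 0 = (\<Oplus>j\<in>{..<Suc n}. [(n choose j)] \<cdot> t n j)"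
  proof -
    have "(\<Oplus>j\<in>{..<n}. [(n choose Suc j)] \<cdot> t n (Suc j)) = (\<Oplus>j\<in>Suc ` {..<n}. [(n choose j)] \<cdot> t n j)"
      using tc by (intro finsum_reindex[symmetric]) auto
    moreover have "{..<Suc n} = insert 0 (Suc ` {..<n})" by (simp add: lessThan_Suc_eq_insert_0)
    ultimately show ?thesis using tc by (simp add: finsum_insert a_comm)
  qed
  moreover have "(\<Oplus>j\<in>{..<n}. [(n choose Suc j)] \<cdot> t n j) = (\<Oplus>j\<in>{..<Suc n}. [(n choose Suc j)] \<cdot> t n j)"
    unfolding lessThan_Suc using tc by (subst finsum_insert) (auto simp: binomial_eq_0)
  ultimately have "power_sum (Suc n) (w 0) =
      (\<Oplus>j\<in>{..<Suc n}. [(n choose Suc j)] \<cdot> t n j) \<oplus> (\<Oplus>j\<in>{..<Suc n}. [(n choose j)] \<cdot> t n j)"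
    using 1 tc by (simp add: a_assoc)
  also have "\<dots> = (\<Oplus>j\<in>{..<Suc n}. [(n choose Suc j)] \<cdot> t n j \<oplus> [(n choose j)] \<cdot> t n j)"
    using tc by (intro finsum_addf[symmetric]) auto
  also have "\<dots> = (\<Oplus>j\<in>{..<Suc n}. [(Suc n choose Suc j)] \<cdot> t n j)"
    using tc by (intro finsum_cong') (auto simp: add.nat_pow_mult add.commute)
  finally show ?case by (simp add: t_def)
qed simp

text \<open>For \<open>j < p - 1\<close> the binomial coefficient is divisible by \<open>p\<close>.
  At \<open>j = p - 1\<close> it equals one, and there the commutator itself has to vanish.\<close>

lemma power_sum_p:
  assumes w: "\<And>j. w j \<in> carrier A" and wy: "\<And>j. w j \<otimes> y = y \<otimes> w j \<oplus> w (Suc j) \<otimes> z"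
    and w0: "w (p - 1) = \<zero>"
  shows "power_sum p (w 0) = \<zero>"
proof -
  have "[(p choose Suc j)] \<cdot> (y [^] (p - 1 - j) \<otimes> w j \<otimes> z [^] j) = \<zero>" if "j < p" for j
  proof (cases "j = p - 1")
    case True thus ?thesis using w0 yc zc by simp
  next
    case False
    hence "p dvd (p choose Suc j)" using that p by (intro dvd_choose_prime) auto
    thus ?thesis using w yc zc by (intro nat_mult_zero) auto
  qed
  hence "power_sum p (w 0) = (\<Oplus>j\<in>{..<p}. \<zero>)"
    unfolding power_sum_eq[of w, OF w wy] by (intro finsum_cong') auto
  thus ?thesis by simp
qed

text \<open>The coefficients of the correction to \<open>y\<close>, indexed by the
  \<open>\<gamma>\<close>-exponent: 1 is the derivative of \<open>g - 1\<close>, and the minus sign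
  at \<open>N'\<close> compensates the sign \<open>sg\<close> of the total complex (see
  \<open>T_y\<close>).\<close>

definition \<mu> :: "nat \<Rightarrow> 'a" where "\<mu> l = (if odd l then \<one> else \<ominus> N')"

text \<open>For 1 all commutators vanish, and \<open>p > 1\<close>. For \<open>- N'\<close> they are
  the \<open>- W (Suc j)\<close>, and the one at \<open>j = p - 1\<close> is
  \<open>- W p = 0\<close>.\<close>

lemma power_sum_\<mu>: "power_sum p (\<mu> l) = \<zero>"
proof (cases "odd l")
  case True
  have "power_sum p \<one> = \<zero>"
    using yc zc prime_gt_1_nat[OF p] power_sum_p[of "\<lambda>j. if j = 0 then \<one> else \<zero>"] by simp
  thus ?thesis using True by (simp add: \<mu>_def)
next
  case False
  have "\<ominus> W (Suc j) \<otimes> y = y \<otimes> (\<ominus> W (Suc j)) \<oplus> \<ominus> W (Suc (Suc j)) \<otimes> z" for j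
    using W_closed[of "Suc j"] W_closed[of "Suc (Suc j)"] yc zc
    by (simp only: l_minus r_minus W_y minus_add m_closed)
  hence "power_sum p (\<ominus> N') = \<zero>"
    using W_closed W_p prime_gt_0_nat[OF p] power_sum_p[of "\<lambda>j. \<ominus> W (Suc j)"] by simp
  thus ?thesis using False by (simp add: \<mu>_def)
qed

end

section \<open>Right multiplications and basis vectors in function modules\<close>

definition (in ring) rmul :: "'a \<Rightarrow> ('i \<Rightarrow> 'a) \<Rightarrow> 'i \<Rightarrow> 'a" where
  "rmul c v = (\<lambda>b. v b \<otimes> c)"

definition (in ring) el :: "'i \<Rightarrow> 'a \<Rightarrow> 'i \<Rightarrow> 'a" where
  "el b c = (\<lambda>b'. if b' = b then c else \<zero>)"

lemma (in ring) el_graded: "c \<in> carrier R \<Longrightarrow> n = wt b \<Longrightarrow> el b c \<in> graded R wt n"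
  by (auto simp: el_def graded_def fun_module_simps)

lemma (in ring) rmul_lin_op: "c \<in> carrier R \<Longrightarrow> lin_op R (rmul c)"
  by (rule lin_opI) (auto simp: rmul_def fun_module_simps fun_eq_iff l_distr m_assoc)

lemma (in ring) rmul_graded: "c \<in> carrier R \<Longrightarrow> v \<in> graded R wt n \<Longrightarrow> rmul c v \<in> graded R wt n"
  by (auto simp: rmul_def graded_def fun_module_simps)

lemma graded_zeroD: "v \<in> graded A wt n \<Longrightarrow> wt b \<noteq> n \<Longrightarrow> v b = \<zero>\<^bsub>A\<^esub>"
  by (simp add: graded_def)

lemma fun_carrierD: "v \<in> carrier (fun_module A) \<Longrightarrow> v b \<in> carrier A"
  by (simp add: fun_module_simps)

lemma lin_op_funpow:
  fixes f :: "('i \<Rightarrow> 'a) \<Rightarrow> 'i \<Rightarrow> 'a"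
  assumes "lin_op A f" shows "lin_op A (f ^^ n)"
proof (induction n)
  case (Suc n)
  show ?case
    by (rule lin_opI) (simp_all add: lin_opD[OF assms] lin_opD[OF Suc])
qed (simp add: lin_op_def)

text \<open>Each pair of conditions states exactness of a periodic sequence of right multiplications
  modulo a left ideal: first zero, then \<open>A z\<close>, then
  \<open>A (g - 1) + A z\<close>.\<close>

locale heis_exact = heis +
  assumes exact_z: "a \<in> carrier A \<Longrightarrow> a \<otimes> z = \<zero> \<Longrightarrow> \<exists>b\<in>carrier A. a = b \<otimes> z [^] (p - 1)"
    and exact_zp: "a \<in> carrier A \<Longrightarrow> a \<otimes> z [^] (p - 1) = \<zero> \<Longrightarrow> \<exists>b\<in>carrier A. a = b \<otimes> z"
    and exact_g: "a \<in> carrier A \<Longrightarrow> b \<in> carrier A \<Longrightarrow> a \<otimes> (g \<ominus> \<one>) = b \<otimes> z \<Longrightarrow>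
      \<exists>c\<in>carrier A. \<exists>e\<in>carrier A. a = c \<otimes> N \<oplus> e \<otimes> z"
    and exact_N: "a \<in> carrier A \<Longrightarrow> b \<in> carrier A \<Longrightarrow> a \<otimes> N = b \<otimes> z \<Longrightarrow>
      \<exists>c\<in>carrier A. \<exists>e\<in>carrier A. a = c \<otimes> (g \<ominus> \<one>) \<oplus> e \<otimes> z"
    and exact_y: "a \<in> carrier A \<Longrightarrow> b \<in> carrier A \<Longrightarrow> c \<in> carrier A \<Longrightarrow>
      a \<otimes> y = b \<otimes> (g \<ominus> \<one>) \<oplus> c \<otimes> z \<Longrightarrow>
      \<exists>e\<in>carrier A. \<exists>b'\<in>carrier A. \<exists>c'\<in>carrier A. a = e \<otimes> y [^] (p - 1) \<oplus> (b' \<otimes> (g \<ominus> \<one>) \<oplus> c' \<otimes> z)"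
    and exact_yp: "a \<in> carrier A \<Longrightarrow> b \<in> carrier A \<Longrightarrow> c \<in> carrier A \<Longrightarrow>
      a \<otimes> y [^] (p - 1) = b \<otimes> (g \<ominus> \<one>) \<oplus> c \<otimes> z \<Longrightarrow>
      \<exists>e\<in>carrier A. \<exists>b'\<in>carrier A. \<exists>c'\<in>carrier A. a = e \<otimes> y \<oplus> (b' \<otimes> (g \<ominus> \<one>) \<oplus> c' \<otimes> z)"
begin

lemma p_pow: "c \<in> carrier A \<Longrightarrow> c \<otimes> c [^] (p - 1) = c [^] p" "c \<in> carrier A \<Longrightarrow> c [^] (p - 1) \<otimes> c = c [^] p"
  using prime_gt_0_nat[OF p] by (cases p; simp add: nat_pow_Suc2[symmetric] del: nat_pow_Suc; simp)+

lemma g1c: "g \<ominus> \<one> \<in> carrier A" using gc by simp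

definition wt0 :: "unit \<Rightarrow> nat" where "wt0 = (\<lambda>_. 0)"
definition d0 :: "(unit \<Rightarrow> 'a) \<Rightarrow> unit \<Rightarrow> 'a" where "d0 = (\<lambda>v b. \<zero>)"
abbreviation "wt1 \<equiv> tot_wt wt0"
abbreviation "wt2 \<equiv> tot_wt wt1"
abbreviation "wt3 \<equiv> tot_wt wt2"

definition D1 where "D1 = tot_d A d0 (rmul z) (rmul (z [^] (p - 1)))"
definition D2 where "D2 = tot_d A D1 (rmul (g \<ominus> \<one>)) (rmul N)"

definition Z :: "nat \<Rightarrow> 'a" where "Z i = (if odd i then z else z [^] (p - 1))"
definition T :: "nat \<Rightarrow> 'a" where "T l = (if odd l then g \<ominus> \<one> else N)"

lemma Zc: "Z i \<in> carrier A" and Tc: "T i \<in> carrier A" and \<mu>c: "\<mu> i \<in> carrier A" and Nc: "N \<in> carrier A"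
  using zc gc W_closed by (auto simp: Z_def T_def \<mu>_def)

lemma D1_eq: "v \<in> carrier (fun_module A) \<Longrightarrow> D1 v (i, b) = v (Suc i, b) \<otimes> Z (Suc i)"
  using fun_carrierD[of v A] Zc zc
  by (simp add: D1_def tot_d_def alt_def rmul_def d0_def Z_def col_def sg_simps)

lemma D2_eq: "v \<in> carrier (fun_module A) \<Longrightarrow>
    D2 v (l, (i, b)) = v (Suc l, (i, b)) \<otimes> T (Suc l) \<oplus> sg A l \<otimes> (v (l, (Suc i, b)) \<otimes> Z (Suc i))"
  using col_closed[of v A l] by (auto simp: D2_def tot_d_def alt_def rmul_def T_def D1_eq) (simp_all add: col_def)

text \<open>The starting complex is \<open>A\<close> itself, placed in degree zero with zero
  differential. Its twisted total complex is the periodic resolution of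
  \<open>A / A z\<close>.\<close>

interpretation c1: twisted_tot A wt0 d0 "rmul z" "rmul (z [^] (p - 1))"
proof
  show "lin_op A d0" by (rule lin_opI) (auto simp: d0_def fun_module_simps)
  show "\<exists>w\<in>graded A wt0 (Suc (Suc n)). d0 w = v" if "v \<in> graded A wt0 (Suc n)" for v n
  proof -
    have "v = \<zero>\<^bsub>fun_module A\<^esub>" using that by (auto simp: graded_def wt0_def fun_module_simps fun_eq_iff)
    thus ?thesis using graded_zero by (auto simp: d0_def fun_module_simps intro!: bexI[of _ "\<zero>\<^bsub>fun_module A\<^esub>"])
  qed
  show "\<exists>a\<in>graded A wt0 0. \<exists>b\<in>graded A wt0 1. m = rmul (z [^] (p - 1)) a \<oplus>\<^bsub>fun_module A\<^esub> d0 b"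
    if m: "m \<in> graded A wt0 0" "rmul z m = d0 m'" for m m'
  proof -
    have "m () \<in> carrier A" using fun_carrierD[OF graded_carrier[OF m(1)]] .
    moreover have "m () \<otimes> z = \<zero>" using fun_cong[OF m(2), of "()"] by (simp add: rmul_def d0_def)
    ultimately obtain b where b: "b \<in> carrier A" "m () = b \<otimes> z [^] (p - 1)" using exact_z by blast
    hence "m = rmul (z [^] (p - 1)) (el () b) \<oplus>\<^bsub>fun_module A\<^esub> d0 \<zero>\<^bsub>fun_module A\<^esub>"
      using zc by (auto simp: fun_eq_iff rmul_def el_def d0_def fun_module_simps)
    thus ?thesis using graded_zero el_graded[OF b(1), of 0 wt0 "()"] by (auto simp: wt0_def)
  qed
  show "\<exists>a\<in>graded A wt0 0. \<exists>b\<in>graded A wt0 1. m = rmul z a \<oplus>\<^bsub>fun_module A\<^esub> d0 b"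
    if m: "m \<in> graded A wt0 0" "rmul (z [^] (p - 1)) m = d0 m'" for m m'
  proof -
    have "m () \<in> carrier A" using fun_carrierD[OF graded_carrier[OF m(1)]] .
    moreover have "m () \<otimes> z [^] (p - 1) = \<zero>" using fun_cong[OF m(2), of "()"] by (simp add: rmul_def d0_def)
    ultimately obtain b where b: "b \<in> carrier A" "m () = b \<otimes> z" using exact_zp by blast
    hence "m = rmul z (el () b) \<oplus>\<^bsub>fun_module A\<^esub> d0 \<zero>\<^bsub>fun_module A\<^esub>"
      using zc by (auto simp: fun_eq_iff rmul_def el_def d0_def fun_module_simps)
    thus ?thesis using graded_zero el_graded[OF b(1), of 0 wt0 "()"] by (auto simp: wt0_def)
  qed
  fix v :: "unit \<Rightarrow> 'a" assume v: "v \<in> carrier (fun_module A)"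
  note vc = fun_carrierD[OF v]
  show "rmul z (rmul (z [^] (p - 1)) v) = \<zero>\<^bsub>fun_module A\<^esub>"
    using vc zc zp p_pow[OF zc] by (auto simp: rmul_def fun_module_simps m_assoc)
  show "rmul (z [^] (p - 1)) (rmul z v) = \<zero>\<^bsub>fun_module A\<^esub>"
    using vc zc zp p_pow[OF zc] by (auto simp: rmul_def fun_module_simps m_assoc)
  show "rmul z (d0 v) = d0 (rmul z v)" "rmul (z [^] (p - 1)) (d0 v) = d0 (rmul (z [^] (p - 1)) v)"
    using zc by (auto simp: d0_def rmul_def)
next
  have d0: "d0 v = \<zero>\<^bsub>fun_module A\<^esub>" for v by (simp add: d0_def fun_module_simps)
  fix v :: "unit \<Rightarrow> 'a" and n
  show "d0 v \<in> graded A wt0 n" "d0 v = \<zero>\<^bsub>fun_module A\<^esub>" "d0 (d0 v) = \<zero>\<^bsub>fun_module A\<^esub>"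
    by (simp_all add: d0 graded_zero)
qed (use zc in \<open>auto intro: rmul_lin_op rmul_graded\<close>)

lemma c1: "graded_complex A wt1 D1" unfolding D1_def by (rule c1.tot.graded_complex_axioms)

lemma graded_0_eqI1: "v \<in> graded A wt1 0 \<Longrightarrow> w \<in> graded A wt1 0 \<Longrightarrow> v (0, ()) = w (0, ()) \<Longrightarrow> v = w"
proof
  fix b :: "nat \<times> unit" assume "v \<in> graded A wt1 0" "w \<in> graded A wt1 0" "v (0, ()) = w (0, ())"
  moreover obtain i :: nat where "b = (i, ())" by (cases b) auto
  ultimately show "v b = w b" by (cases "i = 0") (auto simp: graded_def tot_wt_def wt0_def)
qed

lemma graded_0_eqI2: "v \<in> graded A wt2 0 \<Longrightarrow> w \<in> graded A wt2 0 \<Longrightarrow> v (0, (0, ())) = w (0, (0, ())) \<Longrightarrow> v = w"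
proof
  fix b :: "nat \<times> nat \<times> unit" assume "v \<in> graded A wt2 0" "w \<in> graded A wt2 0" "v (0, (0, ())) = w (0, (0, ()))"
  moreover obtain l i :: nat where "b = (l, i, ())" by (cases b) auto
  ultimately show "v b = w b" by (cases "l = 0 \<and> i = 0") (auto simp: graded_def tot_wt_def wt0_def)
qed

lemma g1_N: "(g \<ominus> \<one>) \<otimes> N = \<zero>" "N \<otimes> (g \<ominus> \<one>) = \<zero>"
  using gc Nc g_N N_g by (simp_all add: a_minus_def l_distr r_distr l_minus r_minus r_neg)

lemma z_T: "z \<otimes> T l = T l \<otimes> z"
proof (cases "odd l")
  case True
  thus ?thesis using zc gc zg by (simp add: T_def a_minus_def l_distr r_distr l_minus r_minus)
next
  case False thus ?thesis using W_commute[OF zc zg, of 0] by (simp add: T_def)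
qed

lemma z_\<mu>: "z \<otimes> \<mu> l = \<mu> l \<otimes> z"
  using zc W_closed W_commute[OF zc zg, of 1] by (simp add: \<mu>_def l_minus r_minus)

lemma z_pow_commute: "c \<in> carrier A \<Longrightarrow> z \<otimes> c = c \<otimes> z \<Longrightarrow> Z i \<otimes> c = c \<otimes> Z i"
proof -
  assume c: "c \<in> carrier A" "z \<otimes> c = c \<otimes> z"
  have "z [^] (n::nat) \<otimes> c = c \<otimes> z [^] n" for n
    using c zc by (induction n) (simp_all add: m_assoc, simp add: m_assoc[symmetric])
  thus ?thesis using c by (simp add: Z_def)
qed

text \<open>Since \<open>z\<close> commutes with \<open>g\<close>, right multiplications by
  \<open>g - 1\<close> and by \<open>N\<close> are chain maps of the first stage as they stand. They
  act on the homology \<open>A / A z\<close>.\<close>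

interpretation c2: twisted_tot A wt1 D1 "rmul (g \<ominus> \<one>)" "rmul N"
proof (rule twisted_tot.intro[OF c1], unfold_locales)
  have comm: "rmul c (D1 v) = D1 (rmul c v)"
    if "c \<in> carrier A" "z \<otimes> c = c \<otimes> z" "v \<in> carrier (fun_module A)" for c v
  proof
    fix b :: "nat \<times> unit"
    obtain i u where b: "b = (i, u)" by (cases b)
    show "rmul c (D1 v) b = D1 (rmul c v) b"
      using that fun_carrierD[OF that(3)] lin_opD(1)[OF rmul_lin_op[OF that(1)] that(3)] Zc z_pow_commute[OF that(1,2)]
      unfolding b by (simp add: D1_eq) (simp add: rmul_def D1_eq m_assoc)
  qed
  fix v :: "nat \<times> unit \<Rightarrow> 'a"
  show "rmul (g \<ominus> \<one>) (D1 v) = D1 (rmul (g \<ominus> \<one>) v)" if "v \<in> carrier (fun_module A)"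
    using comm[OF g1c _ that] z_T[of 1] by (simp add: T_def)
  show "rmul N (D1 v) = D1 (rmul N v)" if "v \<in> carrier (fun_module A)"
    using comm[OF Nc _ that] z_T[of 0] by (simp add: T_def)
  show "rmul (g \<ominus> \<one>) (rmul N v) = \<zero>\<^bsub>fun_module A\<^esub>" if "v \<in> carrier (fun_module A)"
    using fun_carrierD[OF that] g1_N g1c Nc by (auto simp: rmul_def fun_module_simps m_assoc)
  show "rmul N (rmul (g \<ominus> \<one>) v) = \<zero>\<^bsub>fun_module A\<^esub>" if "v \<in> carrier (fun_module A)"
    using fun_carrierD[OF that] g1_N g1c Nc by (auto simp: rmul_def fun_module_simps m_assoc)
next
  interpret C: graded_complex A wt1 D1 by (rule c1)
  \<comment> \<open>In degree zero there is one basis element, so an equation between elements of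
    that degree reduces to a single coordinate.\<close>
  have ex: "\<exists>a\<in>graded A wt1 0. \<exists>b\<in>graded A wt1 1. m = rmul s a \<oplus>\<^bsub>fun_module A\<^esub> D1 b"
    if m: "m \<in> graded A wt1 0" and ce: "c \<in> carrier A" "e \<in> carrier A"
      and eq: "m (0, ()) = c \<otimes> s \<oplus> e \<otimes> z" and s: "s \<in> carrier A" for m c e s
  proof (intro bexI)
    show 1: "el (0, ()) c \<in> graded A wt1 0" "el (Suc 0, ()) e \<in> graded A wt1 1"
      by (rule el_graded; use ce in \<open>simp add: tot_wt_def wt0_def\<close>)+
    have "D1 (el (Suc 0, ()) e) \<in> graded A wt1 0" using 1(2) by (intro C.d_deg) simp
    thus "m = rmul s (el (0, ()) c) \<oplus>\<^bsub>fun_module A\<^esub> D1 (el (Suc 0, ()) e)"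
      using eq m s D1_eq[OF graded_carrier[OF 1(2)]]
      by (intro graded_0_eqI1 graded_add rmul_graded 1)
        (auto simp: fun_module_simps(3) rmul_def el_def Z_def)
  qed
  fix m m' :: "nat \<times> unit \<Rightarrow> 'a"
  assume m: "m \<in> graded A wt1 0" "m' \<in> graded A wt1 1"
  note mc = fun_carrierD[OF graded_carrier[OF m(1)]] fun_carrierD[OF graded_carrier[OF m(2)]]
  have D1m: "D1 m' (0, ()) = m' (1, ()) \<otimes> z" using D1_eq[OF graded_carrier[OF m(2)]] by (simp add: Z_def)
  {
    assume "rmul (g \<ominus> \<one>) m = D1 m'"
    hence "m (0, ()) \<otimes> (g \<ominus> \<one>) = m' (1, ()) \<otimes> z" using D1m fun_cong[of _ _ "(0, ())"] by (fastforce simp: rmul_def)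
    then obtain c e where "c \<in> carrier A" "e \<in> carrier A" "m (0, ()) = c \<otimes> N \<oplus> e \<otimes> z"
      using exact_g[OF mc(1) mc(2)] by blast
    thus "\<exists>a\<in>graded A wt1 0. \<exists>b\<in>graded A wt1 1. m = rmul N a \<oplus>\<^bsub>fun_module A\<^esub> D1 b" using ex[OF m(1)] Nc by blast
  next
    assume "rmul N m = D1 m'"
    hence "m (0, ()) \<otimes> N = m' (1, ()) \<otimes> z" using D1m fun_cong[of _ _ "(0, ())"] by (fastforce simp: rmul_def)
    then obtain c e where "c \<in> carrier A" "e \<in> carrier A" "m (0, ()) = c \<otimes> (g \<ominus> \<one>) \<oplus> e \<otimes> z"
      using exact_N[OF mc(1) mc(2)] by blast
    thus "\<exists>a\<in>graded A wt1 0. \<exists>b\<in>graded A wt1 1. m = rmul (g \<ominus> \<one>) a \<oplus>\<^bsub>fun_module A\<^esub> D1 b"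
      using ex[OF m(1)] g1c by blast
  }
qed (use g1c Nc in \<open>auto intro: rmul_lin_op rmul_graded\<close>)

lemma c2: "graded_complex A wt2 D2" unfolding D2_def by (rule c2.tot.graded_complex_axioms)

text \<open>This is \<open>\<sigma>\<close>; the value at a basis element collects what arrives
  there. Only odd \<open>i\<close> is corrected: the defect of \<open>y\<close> is a multiple of
  \<open>z\<close>, and \<open>z\<close> rather than \<open>z^(p-1)\<close> is the differential
  leaving an odd \<open>z\<close>-exponent.\<close>

definition tw :: "(nat \<times> nat \<times> unit \<Rightarrow> 'a) \<Rightarrow> nat \<times> nat \<times> unit \<Rightarrow> 'a" where
  "tw v = (\<lambda>(l, i, b). v (l, i, b) \<otimes> y \<oplus> (if odd i then v (Suc l, i - 1, b) \<otimes> \<mu> (Suc l) else \<zero>))"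

lemma tw_lin: "lin_op A tw"
proof (rule lin_opI)
  fix v w :: "nat \<times> nat \<times> unit \<Rightarrow> 'a" assume v: "v \<in> carrier (fun_module A)"
  note vc = fun_carrierD[OF v]
  show "tw v \<in> carrier (fun_module A)" using vc yc \<mu>c by (auto simp: tw_def fun_module_simps)
  show "tw (a \<odot>\<^bsub>fun_module A\<^esub> v) = a \<odot>\<^bsub>fun_module A\<^esub> tw v" if "a \<in> carrier A" for a
    using that vc yc \<mu>c by (auto simp: tw_def fun_module_simps fun_eq_iff r_distr m_assoc)
  assume w: "w \<in> carrier (fun_module A)"
  show "tw (v \<oplus>\<^bsub>fun_module A\<^esub> w) = tw v \<oplus>\<^bsub>fun_module A\<^esub> tw w"
    using vc fun_carrierD[OF w] yc \<mu>c by (auto simp: tw_def fun_module_simps fun_eq_iff l_distr a_ac)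
qed

lemma tw_deg: assumes v: "v \<in> graded A wt2 n" shows "tw v \<in> graded A wt2 n"
proof -
  have "tw v (l, i, b) = \<zero>" if "l + i \<noteq> n" for l i b
  proof -
    have "odd i \<Longrightarrow> v (Suc l, i - 1, b) = \<zero>"
      using graded_zeroD[OF v, of "(Suc l, i - 1, b)"] that by (auto simp: tot_wt_def wt0_def elim!: oddE)
    moreover have "v (l, i, b) = \<zero>"
      using graded_zeroD[OF v, of "(l, i, b)"] that by (auto simp: tot_wt_def wt0_def)
    ultimately show ?thesis using yc \<mu>c by (simp add: tw_def)
  qed
  thus ?thesis using lin_opD(1)[OF tw_lin graded_carrier[OF v]]
    by (auto simp: graded_def tot_wt_def wt0_def)
qed

text \<open>The defect is the derivative of \<open>T\<close> times \<open>z\<close>. The sign of the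
  total complex is split off here, which fixes the signs in \<open>\<mu>\<close>.\<close>

lemma T_y: "T (Suc l) \<otimes> y = y \<otimes> T (Suc l) \<oplus> sg A l \<otimes> (\<mu> (Suc l) \<otimes> z)"
proof (cases "even l")
  case True
  have "(g \<ominus> \<one>) \<otimes> y = g \<otimes> y \<ominus> y" using gc yc by (simp add: a_minus_def l_distr l_minus)
  also have "\<dots> = y \<otimes> (g \<ominus> \<one>) \<oplus> z" unfolding gy using gc yc zc by (simp add: a_minus_def r_distr r_minus a_ac)
  finally show ?thesis using True zc by (simp add: T_def \<mu>_def sg_def)
next
  case False
  have "\<ominus> \<one> \<otimes> (\<ominus> N' \<otimes> z) = N' \<otimes> z" using zc W_closed[of 1] by (simp add: l_minus)
  thus ?thesis using False W_y[of 0] by (simp add: T_def \<mu>_def sg_def)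
qed

text \<open>The compatibility of the two corrections: for both parities it amounts to
  \<open>- N' (g - 1) = N\<close>.\<close>

lemma T_\<mu>: "T (Suc (Suc l)) \<otimes> \<mu> (Suc l) = \<mu> (Suc (Suc l)) \<otimes> T (Suc l)"
proof -
  have 1: "\<ominus> N' \<otimes> (g \<ominus> \<one>) = N"
  proof -
    have c: "N' \<in> carrier A" "N \<in> carrier A" "N' \<otimes> g \<in> carrier A" using W_closed gc by auto
    have "\<ominus> N' \<otimes> (g \<ominus> \<one>) = \<ominus> (N' \<otimes> g) \<oplus> N'" using c gc by (simp add: a_minus_def r_distr l_minus r_minus minus_add)
    also have "\<dots> = \<ominus> (N' \<otimes> g) \<oplus> (N' \<otimes> g \<oplus> N)" using N'_eq by simp
    also have "\<dots> = N" using c by (rule_tac r_neg1) auto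
    finally show ?thesis .
  qed
  have 2: "(g \<ominus> \<one>) \<otimes> \<ominus> N' = \<ominus> N' \<otimes> (g \<ominus> \<one>)"
    using W_commute[OF gc refl, of 1] W_closed[of 1] gc
    by (simp add: a_minus_def l_distr r_distr l_minus r_minus minus_add)
  show ?thesis using 1 2 Nc by (simp add: T_def \<mu>_def)
qed

text \<open>For even \<open>i\<close> the correction in position \<open>Suc i\<close>, followed by
  \<open>z\<close>, supplies exactly the defect in \<open>T_y\<close>. For odd \<open>i\<close> that
  defect cancels against the correction applied to the \<open>z\<close>-part of the differential,
  because \<open>sg\<close> changes sign with \<open>l\<close>; what remains is
  \<open>T_\<mu>\<close>.\<close>

lemma tw_D2: assumes v: "v \<in> carrier (fun_module A)" shows "tw (D2 v) = D2 (tw v)"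
proof
  fix b :: "nat \<times> nat \<times> unit"
  interpret C: graded_complex A wt2 D2 by (rule c2)
  obtain l i u where b: "b = (l, i, u)" by (cases b)
  note sv = lin_opD(1)[OF tw_lin v] and vc = fun_carrierD[OF v]
  note sc = sg_simps(1)[of l] sg_simps(1)[of "Suc l"]
  have Zy: "Z j \<otimes> y = y \<otimes> Z j" for j by (rule z_pow_commute[OF yc zy])
  have sm: "sg A l \<otimes> c = c \<otimes> sg A l" "sg A (Suc l) \<otimes> c = \<ominus> (sg A l \<otimes> c)" if "c \<in> carrier A" for c l
    using that by (auto simp: sg_def l_minus r_minus)
  show "tw (D2 v) b = D2 (tw v) b"
  proof (cases "odd i")
    case False
    define a c where "a = v (Suc l, i, u)" and "c = v (l, Suc i, u)"
    have ac: "a \<in> carrier A" "c \<in> carrier A" using vc by (auto simp: a_def c_def)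
    have "tw (D2 v) b = (a \<otimes> T (Suc l) \<oplus> sg A l \<otimes> (c \<otimes> z)) \<otimes> y"
      using False yc Tc zc ac sc by (simp add: b tw_def D2_eq[OF v] Z_def a_def c_def)
    also have "\<dots> = a \<otimes> (T (Suc l) \<otimes> y) \<oplus> sg A l \<otimes> (c \<otimes> (z \<otimes> y))"
      using yc Tc zc ac sc by (simp add: l_distr m_assoc)
    also have "\<dots> = a \<otimes> (y \<otimes> T (Suc l) \<oplus> sg A l \<otimes> (\<mu> (Suc l) \<otimes> z)) \<oplus> sg A l \<otimes> (c \<otimes> (y \<otimes> z))"
      unfolding T_y zy ..
    also have "\<dots> = a \<otimes> y \<otimes> T (Suc l) \<oplus> sg A l \<otimes> ((c \<otimes> y \<oplus> a \<otimes> \<mu> (Suc l)) \<otimes> z)"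
    proof -
      have "a \<otimes> (sg A l \<otimes> (\<mu> (Suc l) \<otimes> z)) = sg A l \<otimes> (a \<otimes> \<mu> (Suc l) \<otimes> z)"
        using sm(1)[OF ac(1)] ac zc \<mu>c sc by (simp add: m_assoc[symmetric])
      thus ?thesis using yc Tc zc ac sc \<mu>c by (simp add: l_distr r_distr m_assoc a_ac)
    qed
    also have "\<dots> = D2 (tw v) b"
      unfolding b D2_eq[OF sv] using False yc Tc zc ac sc by (simp add: tw_def Z_def a_def c_def)
    finally show ?thesis .
  next
    case True
    then obtain i' where i: "i = Suc i'" "even i'" by (auto elim: oddE)
    define a c e where "a = v (Suc l, i, u)" and "c = v (l, Suc i, u)" and "e = v (Suc (Suc l), i', u)"
    have ac: "a \<in> carrier A" "c \<in> carrier A" "e \<in> carrier A" using vc by (auto simp: a_def c_def e_def)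
    have m: "\<mu> (Suc l) \<in> carrier A" "\<mu> (Suc (Suc l)) \<in> carrier A" by (auto intro: \<mu>c)
    have t: "T (Suc l) \<in> carrier A" "T (Suc (Suc l)) \<in> carrier A" by (auto intro: Tc)
    have "tw (D2 v) b = (a \<otimes> T (Suc l) \<oplus> sg A l \<otimes> (c \<otimes> Z (Suc i))) \<otimes> y \<oplus>
        (e \<otimes> T (Suc (Suc l)) \<oplus> sg A (Suc l) \<otimes> (a \<otimes> z)) \<otimes> \<mu> (Suc l)"
      using i by (simp add: b tw_def D2_eq[OF v] Z_def a_def c_def e_def)
    also have "\<dots> = a \<otimes> (T (Suc l) \<otimes> y) \<oplus> sg A l \<otimes> (c \<otimes> (Z (Suc i) \<otimes> y)) \<oplus>
        (e \<otimes> (T (Suc (Suc l)) \<otimes> \<mu> (Suc l)) \<oplus> sg A (Suc l) \<otimes> (a \<otimes> (z \<otimes> \<mu> (Suc l))))"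
      using yc t zc ac sc Zc[of "Suc i"] m by (simp add: l_distr m_assoc)
    also have "\<dots> = a \<otimes> (y \<otimes> T (Suc l) \<oplus> sg A l \<otimes> (\<mu> (Suc l) \<otimes> z)) \<oplus> sg A l \<otimes> (c \<otimes> (y \<otimes> Z (Suc i))) \<oplus>
        (e \<otimes> (\<mu> (Suc (Suc l)) \<otimes> T (Suc l)) \<oplus> sg A (Suc l) \<otimes> (a \<otimes> (\<mu> (Suc l) \<otimes> z)))"
      unfolding T_y T_\<mu> z_\<mu> Zy ..
    also have "\<dots> = (a \<otimes> y \<oplus> e \<otimes> \<mu> (Suc (Suc l))) \<otimes> T (Suc l) \<oplus> sg A l \<otimes> (c \<otimes> y \<otimes> Z (Suc i))"
    proof -
      define h where "h = a \<otimes> (\<mu> (Suc l) \<otimes> z)"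
      have h: "h \<in> carrier A" using ac m zc by (simp add: h_def)
      have 1: "a \<otimes> (sg A l \<otimes> (\<mu> (Suc l) \<otimes> z)) = sg A l \<otimes> h"
        using sm(1)[OF ac(1)] ac zc m sc by (simp add: h_def m_assoc[symmetric])
      have 2: "sg A (Suc l) \<otimes> (a \<otimes> (\<mu> (Suc l) \<otimes> z)) = \<ominus> (sg A l \<otimes> h)"
        using sm(2)[OF h] by (simp add: h_def)
      define k where "k = sg A l \<otimes> h"
      define r s w where "r = a \<otimes> y \<otimes> T (Suc l)" and "s = e \<otimes> \<mu> (Suc (Suc l)) \<otimes> T (Suc l)"
        and "w = sg A l \<otimes> (c \<otimes> y \<otimes> Z (Suc i))"
      have cl: "k \<in> carrier A" "r \<in> carrier A" "s \<in> carrier A" "w \<in> carrier A"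
        using h sc ac yc t m Zc by (auto simp: k_def r_def s_def w_def)
      have "a \<otimes> (y \<otimes> T (Suc l) \<oplus> sg A l \<otimes> (\<mu> (Suc l) \<otimes> z)) = r \<oplus> k"
        using 1 ac yc t sc m zc by (simp add: r_distr m_assoc r_def k_def)
      moreover have "sg A l \<otimes> (c \<otimes> (y \<otimes> Z (Suc i))) = w" using ac yc Zc by (simp add: m_assoc w_def)
      moreover have "e \<otimes> (\<mu> (Suc (Suc l)) \<otimes> T (Suc l)) = s" using ac t m by (simp add: m_assoc s_def)
      moreover have "(a \<otimes> y \<oplus> e \<otimes> \<mu> (Suc (Suc l))) \<otimes> T (Suc l) = r \<oplus> s"
        using ac yc t m by (simp add: l_distr r_def s_def)
      moreover have "r \<oplus> k \<oplus> w \<oplus> (s \<oplus> \<ominus> k) = r \<oplus> s \<oplus> w" using cl by algebra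
      ultimately show ?thesis using 2 by (simp add: k_def[symmetric] w_def[symmetric])
    qed
    also have "\<dots> = D2 (tw v) b"
      unfolding b D2_eq[OF sv] using i yc t zc ac sc m Zc by (simp add: tw_def a_def c_def e_def)
    finally show ?thesis .
  qed
qed

text \<open>The correction leads from even to odd \<open>i\<close> and therefore cannot be applied
  twice. A power of \<open>tw\<close> thus has a part without it and a part where it occurs once, at
  any of the \<open>n\<close> positions; the latter is \<open>power_sum\<close>.\<close>

lemma tw_pow:
  assumes v: "v \<in> carrier (fun_module A)"
  shows "(tw ^^ n) v (l, i, b) = v (l, i, b) \<otimes> y [^] n \<oplus>
    (if odd i then v (Suc l, i - 1, b) \<otimes> power_sum n (\<mu> (Suc l)) else \<zero>)"
proof (induction n arbitrary: l i)
  case 0 thus ?case using fun_carrierD[OF v] by simp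
next
  case (Suc n)
  note vc = fun_carrierD[OF v]
  note c = vc[of "(l, i, b)"] vc[of "(Suc l, i - 1, b)"] power_sum_closed[OF \<mu>c[of "Suc l"], of n] \<mu>c[of "Suc l"] yc
  have "(tw ^^ Suc n) v (l, i, b) = (tw ^^ n) v (l, i, b) \<otimes> y \<oplus>
      (if odd i then (tw ^^ n) v (Suc l, i - 1, b) \<otimes> \<mu> (Suc l) else \<zero>)"
    by (simp add: tw_def)
  thus ?case using c unfolding Suc by (auto simp: l_distr r_distr m_assoc a_assoc)
qed

lemma tw_pow_p: "v \<in> carrier (fun_module A) \<Longrightarrow> (tw ^^ p) v = \<zero>\<^bsub>fun_module A\<^esub>"
  using fun_carrierD[of v A] by (auto simp: fun_eq_iff tw_pow yp power_sum_\<mu> fun_module_simps)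

definition D3 where "D3 = tot_d A D2 tw (tw ^^ (p - 1))"

text \<open>In total degree zero the correction is absent and the boundaries of \<open>D2\<close>
  are given by \<open>A (g - 1) + A z\<close>. There exactness becomes that of \<open>y\<close> and
  \<open>y^(p-1)\<close> modulo this left ideal.\<close>

interpretation c3: twisted_tot A wt2 D2 tw "tw ^^ (p - 1)"
proof (rule twisted_tot.intro[OF c2], unfold_locales)
  interpret C: graded_complex A wt2 D2 by (rule c2)
  have p1: "Suc (p - 1) = p" using prime_gt_0_nat[OF p] by simp
  fix v :: "nat \<times> nat \<times> unit \<Rightarrow> 'a"
  show "(tw ^^ (p - 1)) v \<in> graded A wt2 n" if "v \<in> graded A wt2 n" for n
  proof -
    have "(tw ^^ k) v \<in> graded A wt2 n" for k using that by (induction k) (auto intro: tw_deg)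
    thus ?thesis .
  qed
  show "(tw ^^ (p - 1)) (D2 v) = D2 ((tw ^^ (p - 1)) v)" if v: "v \<in> carrier (fun_module A)"
  proof -
    have "(tw ^^ n) (D2 v) = D2 ((tw ^^ n) v)" for n
      by (induction n) (simp_all add: tw_D2 lin_opD(1)[OF lin_op_funpow[OF tw_lin] v])
    thus ?thesis .
  qed
  show "tw ((tw ^^ (p - 1)) v) = \<zero>\<^bsub>fun_module A\<^esub>" if "v \<in> carrier (fun_module A)"
    using tw_pow_p[OF that] p1 by (metis funpow.simps(2) comp_apply)
  show "(tw ^^ (p - 1)) (tw v) = \<zero>\<^bsub>fun_module A\<^esub>" if "v \<in> carrier (fun_module A)"
    using tw_pow_p[OF that] p1 by (metis funpow_Suc_right comp_apply)
next
  interpret C: graded_complex A wt2 D2 by (rule c2)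
  have pg: "(tw ^^ n) v \<in> graded A wt2 k" if "v \<in> graded A wt2 k" for v n k
    using that by (induction n) (auto intro: tw_deg)
  have ex: "\<exists>a\<in>graded A wt2 0. \<exists>b\<in>graded A wt2 1. m = (tw ^^ n) a \<oplus>\<^bsub>fun_module A\<^esub> D2 b"
    if m: "m \<in> graded A wt2 0" and ce: "e \<in> carrier A" "b' \<in> carrier A" "c' \<in> carrier A"
      and eq: "m (0, 0, ()) = e \<otimes> y [^] n \<oplus> (b' \<otimes> (g \<ominus> \<one>) \<oplus> c' \<otimes> z)" for m e b' c' n
  proof (intro bexI)
    let ?b = "el (Suc 0, 0, ()) b' \<oplus>\<^bsub>fun_module A\<^esub> el (0, Suc 0, ()) c'"
    show 1: "el (0, 0, ()) e \<in> graded A wt2 0" "?b \<in> graded A wt2 1"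
      by (intro graded_add el_graded; use ce in \<open>simp add: tot_wt_def wt0_def\<close>)+
    have 2: "D2 ?b \<in> graded A wt2 0" using 1(2) by (intro C.d_deg) simp
    have "D2 ?b (0, 0, ()) = b' \<otimes> (g \<ominus> \<one>) \<oplus> c' \<otimes> z"
      using ce zc g1c by (simp add: D2_eq[OF graded_carrier[OF 1(2)]]) (simp add: fun_module_simps el_def T_def Z_def sg_def)
    moreover have "(tw ^^ n) (el (0, 0, ()) e) (0, 0, ()) = e \<otimes> y [^] n"
    proof -
      have "el (0 :: nat, 0 :: nat, ()) e (0, 0, ()) = e" by (simp add: el_def)
      thus ?thesis using tw_pow[OF graded_carrier[OF 1(1)], of n 0 0 "()"] ce yc by simp
    qed
    ultimately show "m = (tw ^^ n) (el (0, 0, ()) e) \<oplus>\<^bsub>fun_module A\<^esub> D2 ?b"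
      using eq by (intro graded_0_eqI2 graded_add pg 1 2 m) (simp add: fun_module_simps(3))
  qed
  fix m m' :: "nat \<times> nat \<times> unit \<Rightarrow> 'a"
  assume m: "m \<in> graded A wt2 0" "m' \<in> graded A wt2 1"
  note mc = fun_carrierD[OF graded_carrier[OF m(1)]] fun_carrierD[OF graded_carrier[OF m(2)]]
  have D2m: "D2 m' (0, 0, ()) = m' (1, 0, ()) \<otimes> (g \<ominus> \<one>) \<oplus> m' (0, 1, ()) \<otimes> z"
    using D2_eq[OF graded_carrier[OF m(2)]] mc(2) zc g1c by (simp add: Z_def T_def sg_def)
  {
    assume "tw m = D2 m'"
    hence "m (0, 0, ()) \<otimes> y = m' (1, 0, ()) \<otimes> (g \<ominus> \<one>) \<oplus> m' (0, 1, ()) \<otimes> z"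
    proof -
      have "tw m (0, 0, ()) = m (0, 0, ()) \<otimes> y" using mc(1) yc by (simp add: tw_def)
      thus ?thesis using \<open>tw m = D2 m'\<close> D2m by simp
    qed
    then obtain e b' c' where "e \<in> carrier A" "b' \<in> carrier A" "c' \<in> carrier A"
      "m (0, 0, ()) = e \<otimes> y [^] (p - 1) \<oplus> (b' \<otimes> (g \<ominus> \<one>) \<oplus> c' \<otimes> z)"
      using exact_y[OF mc(1) mc(2) mc(2)] by blast
    thus "\<exists>a\<in>graded A wt2 0. \<exists>b\<in>graded A wt2 1. m = (tw ^^ (p - 1)) a \<oplus>\<^bsub>fun_module A\<^esub> D2 b"
      by (rule ex[OF m(1)])
  next
    assume "(tw ^^ (p - 1)) m = D2 m'"
    hence "m (0, 0, ()) \<otimes> y [^] (p - 1) = m' (1, 0, ()) \<otimes> (g \<ominus> \<one>) \<oplus> m' (0, 1, ()) \<otimes> z"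
    proof -
      have "(tw ^^ (p - 1)) m (0, 0, ()) = m (0, 0, ()) \<otimes> y [^] (p - 1)"
        using mc(1) yc tw_pow[OF graded_carrier[OF m(1)], of "p - 1" 0 0 "()"] by simp
      thus ?thesis using \<open>(tw ^^ (p - 1)) m = D2 m'\<close> D2m by simp
    qed
    then obtain e b' c' where "e \<in> carrier A" "b' \<in> carrier A" "c' \<in> carrier A"
      "m (0, 0, ()) = e \<otimes> y \<oplus> (b' \<otimes> (g \<ominus> \<one>) \<oplus> c' \<otimes> z)"
      using exact_yp[OF mc(1) mc(2) mc(2)] by blast
    thus "\<exists>a\<in>graded A wt2 0. \<exists>b\<in>graded A wt2 1. m = tw a \<oplus>\<^bsub>fun_module A\<^esub> D2 b"
      using ex[OF m(1), of e b' c' 1] yc by simp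
  }
qed (auto intro: tw_lin lin_op_funpow tw_deg tw_D2)

lemma c3: "graded_complex A wt3 D3" unfolding D3_def by (rule c3.tot.graded_complex_axioms)

lemma D3_eq: "v \<in> carrier (fun_module A) \<Longrightarrow>
    D3 v (j, b) = alt tw (tw ^^ (p - 1)) (Suc j) (col v (Suc j)) b \<oplus> sg A j \<otimes> D2 (col v j) b"
  by (simp add: D3_def tot_d_def)

end

section \<open>The graded pieces as modules, free when the degree is finite\<close>

definition graded_module :: "('a, 'r) ring_scheme \<Rightarrow> ('i \<Rightarrow> nat) \<Rightarrow> nat \<Rightarrow> ('a, 'i \<Rightarrow> 'a) module" where
  "graded_module A wt n =
    \<lparr>carrier = graded A wt n, monoid.mult = undefined, one = undefined,
     ring.zero = \<zero>\<^bsub>fun_module A\<^esub>, add = add (fun_module A), smult = smult (fun_module A)\<rparr>"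

lemma graded_module_simps:
  "carrier (graded_module A wt n) = graded A wt n"
  "\<zero>\<^bsub>graded_module A wt n\<^esub> = \<zero>\<^bsub>fun_module A\<^esub>"
  "v \<oplus>\<^bsub>graded_module A wt n\<^esub> w = v \<oplus>\<^bsub>fun_module A\<^esub> w"
  "a \<odot>\<^bsub>graded_module A wt n\<^esub> v = a \<odot>\<^bsub>fun_module A\<^esub> v"
  by (simp_all add: graded_module_def)

lemma left_module_graded_module:
  fixes A :: "('a, 'r) ring_scheme" and wt :: "'i \<Rightarrow> nat"
  assumes A: "ring A" shows "left_module A (graded_module A wt n)"
proof -
  interpret ring A by fact
  interpret V: left_module A "fun_module A :: ('a, 'i \<Rightarrow> 'a) module" by (rule left_module_fun_module[OF A])
  have ag: "abelian_group (graded_module A wt n)"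
  proof (rule abelian_groupI)
    fix v assume v: "v \<in> carrier (graded_module A wt n)"
    hence "(\<ominus>\<^bsub>A\<^esub> \<one>\<^bsub>A\<^esub>) \<odot>\<^bsub>fun_module A\<^esub> v \<in> graded A wt n" by (simp add: graded_module_simps graded_smult)
    moreover have "(\<ominus>\<^bsub>A\<^esub> \<one>\<^bsub>A\<^esub>) \<odot>\<^bsub>fun_module A\<^esub> v \<oplus>\<^bsub>fun_module A\<^esub> v = \<zero>\<^bsub>fun_module A\<^esub>"
      using fun_carrierD[OF graded_carrier[OF v[unfolded graded_module_simps]]]
      by (simp add: fun_module_simps l_minus l_neg)
    ultimately show "\<exists>w\<in>carrier (graded_module A wt n). w \<oplus>\<^bsub>graded_module A wt n\<^esub> v = \<zero>\<^bsub>graded_module A wt n\<^esub>"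
      unfolding graded_module_simps by blast
  qed (auto simp: graded_module_simps graded_add graded_zero V.M.a_ac dest!: graded_carrier)
  show ?thesis
    by (intro left_module.intro left_module_axioms.intro A ag)
      (auto simp: graded_module_simps graded_smult V.smult_l_distr V.smult_r_distr V.smult_assoc V.smult_one
        dest!: graded_carrier)
qed

text \<open>Restriction to the basis of degree \<open>n\<close> and extension by zero are mutually
  inverse; finiteness of the degree provides the finite support required in
  \<open>free_module\<close>.\<close>

lemma free_retract_graded_module:
  fixes A :: "('a, 'r) ring_scheme" and wt :: "'i \<Rightarrow> nat"
  assumes A: "ring A" and fin: "finite {b. wt b = n}"
  shows "free_retract A (graded_module A wt n) {b. wt b = n}"
proof -
  interpret ring A by fact
  let ?B = "{b. wt b = n}" and ?M = "graded_module A wt n"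
  let ?i = "\<lambda>v\<in>graded A wt n. \<lambda>b\<in>?B. v b"
  let ?r = "\<lambda>v\<in>carrier (free_module A ?B). \<lambda>b. if wt b = n then v b else \<zero>\<^bsub>A\<^esub>"
  have fin': "finite {b. wt b = n \<and> Q b}" for Q by (rule finite_subset[OF _ fin]) auto
  have "?i \<in> lin_hom A ?M (free_module A ?B)"
    by (rule lin_homI) (auto simp: graded_module_simps graded_add graded_smult,
      auto simp: free_module_def graded_def fun_module_simps fin' fun_eq_iff)
  moreover have "?r \<in> lin_hom A (free_module A ?B) ?M"
  proof -
    interpret F: left_module A "free_module A ?B" by (rule left_module_free_module[OF A])
    show ?thesis
      by (rule lin_homI) (auto simp: F.smult_closed, auto simp: free_module_def graded_module_simps graded_def fun_module_simps fun_eq_iff)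
  qed
  moreover have "?r (?i v) = v" if "v \<in> graded A wt n" for v
  proof -
    have "(\<lambda>b\<in>?B. v b) \<in> carrier (free_module A ?B)"
      using that by (auto simp: free_module_def graded_def fun_module_simps fin')
    thus ?thesis using that by (auto simp: graded_def fun_eq_iff)
  qed
  ultimately show ?thesis
    unfolding free_retract_def using left_module_graded_module[OF A]
    by (intro conjI exI[of _ ?i] exI[of _ ?r]) (auto simp: graded_module_simps)
qed

text \<open>\<open>eps_ker\<close> describes the augmentation ideal as the left ideal generated by
  \<open>y\<close>, \<open>g - 1\<close> and \<open>z\<close>. These are the three differentials out
  of degree one, so this is exactness in degree zero.\<close>

locale heis_aug = heis_exact A z y g p q + K: field K
  for A :: "('k, 'a) module" (structure) and z y g :: 'a and p q :: nat and K :: "'k ring" +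
  fixes \<epsilon> :: "'a \<Rightarrow> 'k"
  assumes eps_hom: "\<epsilon> \<in> ring_hom A K" and eps_surj: "carrier K \<subseteq> \<epsilon> ` carrier A"
    and eps_z: "\<epsilon> z = \<zero>\<^bsub>K\<^esub>" and eps_y: "\<epsilon> y = \<zero>\<^bsub>K\<^esub>" and eps_g: "\<epsilon> g = \<one>\<^bsub>K\<^esub>"
    and eps_ker: "a \<in> carrier A \<Longrightarrow> \<epsilon> a = \<zero>\<^bsub>K\<^esub> \<Longrightarrow> \<exists>b\<in>carrier A. \<exists>c\<in>carrier A. \<exists>e\<in>carrier A.
      a = b \<otimes> y \<oplus> (c \<otimes> (g \<ominus> \<one>) \<oplus> e \<otimes> z)"
    and p2: "p > 2"
begin

lemma hom: "ring_hom_ring A K \<epsilon>"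
  using ring_hom_ringI2[OF ring_axioms K.ring_axioms eps_hom] .

interpretation eps: ring_hom_ring A K \<epsilon> by (rule hom)

lemma eps_simps:
  "a \<in> carrier A \<Longrightarrow> \<epsilon> a \<in> carrier K" "\<epsilon> \<zero> = \<zero>\<^bsub>K\<^esub>" "\<epsilon> \<one> = \<one>\<^bsub>K\<^esub>"
  "a \<in> carrier A \<Longrightarrow> b \<in> carrier A \<Longrightarrow> \<epsilon> (a \<oplus> b) = \<epsilon> a \<oplus>\<^bsub>K\<^esub> \<epsilon> b"
  "a \<in> carrier A \<Longrightarrow> b \<in> carrier A \<Longrightarrow> \<epsilon> (a \<otimes> b) = \<epsilon> a \<otimes>\<^bsub>K\<^esub> \<epsilon> b"
  "a \<in> carrier A \<Longrightarrow> \<epsilon> (\<ominus> a) = \<ominus>\<^bsub>K\<^esub> \<epsilon> a"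
  by auto

lemma eps_nat: "\<epsilon> ([(n::nat)] \<cdot> \<one>) = [n] \<cdot>\<^bsub>K\<^esub> \<one>\<^bsub>K\<^esub>"
  by (induction n) (auto simp: eps_simps)

lemma char_K: "p dvd n \<Longrightarrow> [n] \<cdot>\<^bsub>K\<^esub> \<one>\<^bsub>K\<^esub> = \<zero>\<^bsub>K\<^esub>"
  using eps_nat[of n] nat_mult_zero[of n \<one>] by (simp add: eps_simps)

lemma eps_finsum: "(\<And>i. i < (n::nat) \<Longrightarrow> f i \<in> carrier A) \<Longrightarrow> \<epsilon> (\<Oplus>i\<in>{..<n}. f i) = (\<Oplus>\<^bsub>K\<^esub>i\<in>{..<n}. \<epsilon> (f i))"
proof (induction n)
  case (Suc n)
  have "(\<Oplus>i\<in>{..<Suc n}. f i) = f n \<oplus> (\<Oplus>i\<in>{..<n}. f i)"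
    unfolding lessThan_Suc using Suc.prems by (subst finsum_insert) auto
  moreover have "(\<Oplus>\<^bsub>K\<^esub>i\<in>{..<Suc n}. \<epsilon> (f i)) = \<epsilon> (f n) \<oplus>\<^bsub>K\<^esub> (\<Oplus>\<^bsub>K\<^esub>i\<in>{..<n}. \<epsilon> (f i))"
    unfolding lessThan_Suc using Suc.prems by (subst K.finsum_insert) (auto simp: eps_simps)
  ultimately show ?case using Suc by (simp add: eps_simps)
qed (simp add: eps_simps)

lemma eps_g_pow: "\<epsilon> (g [^] (n::nat)) = \<one>\<^bsub>K\<^esub>"
  using gc by (induction n) (auto simp: eps_simps eps_g)

lemma eps_N: "\<epsilon> N = \<zero>\<^bsub>K\<^esub>"
proof -
  have "(\<Oplus>\<^bsub>K\<^esub>i\<in>{..<n}. \<one>\<^bsub>K\<^esub>) = [(n::nat)] \<cdot>\<^bsub>K\<^esub> \<one>\<^bsub>K\<^esub>" for n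
    by (induction n) (simp_all add: lessThan_Suc K.finsum_insert K.a_comm)
  moreover have "\<epsilon> N = (\<Oplus>\<^bsub>K\<^esub>i\<in>{..<q}. \<one>\<^bsub>K\<^esub>)"
    unfolding N_eq using gc by (subst eps_finsum) (simp_all only: eps_g_pow g_pow_closed)
  ultimately show ?thesis using char_K[OF pq] by simp
qed

text \<open>The image is \<open>0 + 1 + ... + (q - 1) = q (q - 1) / 2\<close> in \<open>K\<close>;
  cancelling the factor two is where an odd \<open>p\<close> is used.\<close>

lemma eps_N': "\<epsilon> N' = \<zero>\<^bsub>K\<^esub>"
proof -
  have c: "\<epsilon> ([(i::nat)] \<cdot> (g [^] j)) = [i] \<cdot>\<^bsub>K\<^esub> \<one>\<^bsub>K\<^esub>" for i and j :: nat
    using gc by (induction i) (auto simp: eps_simps eps_g_pow)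
  have s: "(\<Oplus>\<^bsub>K\<^esub>i\<in>{..<n}. [i] \<cdot>\<^bsub>K\<^esub> \<one>\<^bsub>K\<^esub>) = [(\<Sum>i<n. i)] \<cdot>\<^bsub>K\<^esub> \<one>\<^bsub>K\<^esub>" for n :: nat
    by (induction n) (simp_all add: lessThan_Suc K.finsum_insert K.add.nat_pow_mult add.commute)
  have "\<epsilon> N' = (\<Oplus>\<^bsub>K\<^esub>i\<in>{..<q}. \<epsilon> ([((i choose 1) * fact 1 :: nat)] \<cdot> (g [^] (i - 1))))"
    unfolding W_def using gc by (intro eps_finsum) auto
  also have "\<dots> = (\<Oplus>\<^bsub>K\<^esub>i\<in>{..<q}. [i] \<cdot>\<^bsub>K\<^esub> \<one>\<^bsub>K\<^esub>)"
    by (intro K.finsum_cong') (auto simp: c)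
  also have "\<dots> = [(\<Sum>i<q. i)] \<cdot>\<^bsub>K\<^esub> \<one>\<^bsub>K\<^esub>" by (rule s)
  also have "\<dots> = \<zero>\<^bsub>K\<^esub>"
  proof (rule char_K)
    have "2 * (\<Sum>i<n. i) = n * (n - 1)" for n :: nat
    proof (induction n)
      case (Suc n) thus ?case by (cases n) (auto simp: algebra_simps)
    qed simp
    hence "p dvd 2 * (\<Sum>i<q. i)" using pq by simp
    moreover have "\<not> p dvd 2" using p2 by (auto dest: dvd_imp_le)
    ultimately show "p dvd (\<Sum>i<q. i)" using p prime_dvd_mult_iff by blast
  qed
  finally show ?thesis .
qed

lemma eps_T: "\<epsilon> (T l) = \<zero>\<^bsub>K\<^esub>"
  using gc eps_N by (auto simp: T_def a_minus_def eps_simps eps_g K.r_neg)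

lemma eps_Z: "\<epsilon> (Z i) = \<zero>\<^bsub>K\<^esub>"
proof -
  obtain m where "p - 1 = Suc m" using p2 by (cases "p - 1") auto
  thus ?thesis using zc by (auto simp: Z_def eps_simps eps_z)
qed

lemma eps_\<mu>: "\<epsilon> (\<mu> l) = (if odd l then \<one>\<^bsub>K\<^esub> else \<zero>\<^bsub>K\<^esub>)"
  using eps_N' W_closed[of 1] by (simp add: \<mu>_def eps_simps)

lemma eps_sg_D2:
  assumes v: "v \<in> carrier (fun_module A)" shows "\<epsilon> (D2 v b) = \<zero>\<^bsub>K\<^esub>"
proof -
  obtain l i u where b: "b = (l, i, u)" by (cases b)
  show ?thesis unfolding b D2_eq[OF v]
    using fun_carrierD[OF v] Tc Zc sg_simps(1)[of l] by (simp add: eps_simps eps_T eps_Z)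
qed

text \<open>The summands are \<open>y^k w y^m\<close> with \<open>k + m = p - 2\<close>, and this is
  at least one, so each contains a factor \<open>y\<close>.\<close>

lemma eps_power_sum: "w \<in> carrier A \<Longrightarrow> \<epsilon> (power_sum (p - 1) w) = \<zero>\<^bsub>K\<^esub>"
proof -
  assume w: "w \<in> carrier A"
  obtain m where m: "p - 1 = Suc (Suc m)" using p2 by (metis Suc_diff_Suc Suc_lessD diff_Suc_1 numeral_2_eq_2 One_nat_def)
  show ?thesis unfolding m using w yc power_sum_closed[OF w] by (simp add: eps_simps eps_y)
qed

text \<open>The one entry not killed by \<open>\<epsilon>\<close> is \<open>\<mu>\<close> at an odd
  index. It occurs when the horizontal map is \<open>tw\<close> and not its power (\<open>j\<close>
  even), the \<open>\<gamma>\<close>-exponent \<open>Suc l\<close> is odd, and the correction is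
  present (\<open>i\<close> odd).\<close>

lemma eps_D3:
  assumes v: "v \<in> carrier (fun_module A)"
  shows "\<epsilon> (D3 v (j, l, i, u)) =
    (if even j \<and> even l \<and> odd i then \<epsilon> (v (Suc j, Suc l, i - 1, u)) else \<zero>\<^bsub>K\<^esub>)"
proof -
  define c where "c = col v (Suc j)"
  have cc: "c \<in> carrier (fun_module A)" "col v j \<in> carrier (fun_module A)" unfolding c_def by (rule col_closed[OF v])+
  interpret C: graded_complex A wt2 D2 by (rule c2)
  have D2c: "D2 (col v j) (l, i, u) \<in> carrier A" by (rule fun_carrierD[OF lin_opD(1)[OF C.d_lin cc(2)]])
  have twc: "alt tw (tw ^^ (p - 1)) (Suc j) c (l, i, u) \<in> carrier A"
    using fun_carrierD[OF lin_opD(1)[OF tw_lin cc(1)]] fun_carrierD[OF lin_opD(1)[OF lin_op_funpow[OF tw_lin] cc(1)]]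
    by (simp add: alt_def)
  have "\<epsilon> (D3 v (j, l, i, u)) = \<epsilon> (alt tw (tw ^^ (p - 1)) (Suc j) c (l, i, u))"
    unfolding D3_eq[OF v] c_def[symmetric] using twc D2c sg_simps(1)[of j] eps_sg_D2[OF cc(2)]
    by (simp add: eps_simps)
  also have "\<dots> = (if even j \<and> even l \<and> odd i then \<epsilon> (c (Suc l, i - 1, u)) else \<zero>\<^bsub>K\<^esub>)"
  proof (cases "even j")
    case True
    have "\<epsilon> (tw c (l, i, u)) = (if even l \<and> odd i then \<epsilon> (c (Suc l, i - 1, u)) else \<zero>\<^bsub>K\<^esub>)"
      using fun_carrierD[OF cc(1)] yc \<mu>c[of "Suc l"] by (simp add: tw_def eps_simps eps_y eps_\<mu>)
    thus ?thesis using True by (simp add: alt_def)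
  next
    case False
    obtain m where m: "p - 1 = Suc m" using p2 by (cases "p - 1") auto
    have "\<epsilon> (y [^] (p - 1)) = \<zero>\<^bsub>K\<^esub>" unfolding m using yc by (simp add: eps_simps eps_y)
    hence "\<epsilon> ((tw ^^ (p - 1)) c (l, i, u)) = \<zero>\<^bsub>K\<^esub>"
      unfolding tw_pow[OF cc(1)]
      using fun_carrierD[OF cc(1)] yc power_sum_closed[OF \<mu>c[of "Suc l"], of "p - 1"] eps_power_sum[OF \<mu>c[of "Suc l"]]
      by (simp add: eps_simps)
    thus ?thesis using False by (simp add: alt_def)
  qed
  finally show ?thesis by (simp add: c_def col_def)
qed

section \<open>The free resolution of the trivial module\<close>

abbreviation "FM n \<equiv> graded_module A wt3 n"
abbreviation "o3 \<equiv> (0 :: nat, 0 :: nat, 0 :: nat, ())"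

definition e3 where "e3 n = (\<lambda>v\<in>graded A wt3 (Suc n). D3 v)"
definition \<theta> where "\<theta> = (\<lambda>v\<in>graded A wt3 0. \<epsilon> (v o3))"

abbreviation "TM \<equiv> trivial_module K \<epsilon>"

lemma TM_simps: "carrier TM = carrier K" "\<zero>\<^bsub>TM\<^esub> = \<zero>\<^bsub>K\<^esub>" "c \<oplus>\<^bsub>TM\<^esub> c' = c \<oplus>\<^bsub>K\<^esub> c'" "a \<odot>\<^bsub>TM\<^esub> c = \<epsilon> a \<otimes>\<^bsub>K\<^esub> c"
  by (simp_all add: trivial_module_def)

lemma left_module_TM: "left_module A TM"
proof -
  have "abelian_group TM"
    by (rule abelian_groupI) (auto simp: TM_simps K.a_ac intro: K.a_inv_closed K.l_neg bexI[of _ "\<ominus>\<^bsub>K\<^esub> _"])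
  thus ?thesis
    by (intro left_module.intro left_module_axioms.intro ring_axioms)
      (auto simp: TM_simps eps_simps K.l_distr K.r_distr K.m_assoc)
qed

lemma coordinate_hom:
  assumes "wt3 b = n" shows "(\<lambda>v\<in>graded A wt3 n. \<epsilon> (v b)) \<in> lin_hom A (FM n) TM"
proof (rule lin_homI)
  have c: "v b \<in> carrier A" if "v \<in> graded A wt3 n" for v by (rule fun_carrierD[OF graded_carrier[OF that]])
  show "(\<lambda>v\<in>graded A wt3 n. \<epsilon> (v b)) \<in> carrier (FM n) \<rightarrow>\<^sub>E carrier TM"
    using c by (auto simp: graded_module_simps TM_simps eps_simps)
  show "(\<lambda>v\<in>graded A wt3 n. \<epsilon> (v b)) (v \<oplus>\<^bsub>FM n\<^esub> w) =
      (\<lambda>v\<in>graded A wt3 n. \<epsilon> (v b)) v \<oplus>\<^bsub>TM\<^esub> (\<lambda>v\<in>graded A wt3 n. \<epsilon> (v b)) w"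
    if "v \<in> carrier (FM n)" "w \<in> carrier (FM n)" for v w
    using that c graded_add[of v wt3 n w] unfolding graded_module_simps TM_simps
    by simp (simp add: fun_module_simps eps_simps)
  show "(\<lambda>v\<in>graded A wt3 n. \<epsilon> (v b)) (a \<odot>\<^bsub>FM n\<^esub> v) = a \<odot>\<^bsub>TM\<^esub> (\<lambda>v\<in>graded A wt3 n. \<epsilon> (v b)) v"
    if "a \<in> carrier A" "v \<in> carrier (FM n)" for a v
    using that c graded_smult[of a v wt3 n] unfolding graded_module_simps TM_simps
    by simp (simp add: fun_module_simps eps_simps)
qed

lemma graded_0_eqI3: "v \<in> graded A wt3 0 \<Longrightarrow> w \<in> graded A wt3 0 \<Longrightarrow> v o3 = w o3 \<Longrightarrow> v = w"
proof
  fix b :: "nat \<times> nat \<times> nat \<times> unit"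
  assume "v \<in> graded A wt3 0" "w \<in> graded A wt3 0" "v o3 = w o3"
  moreover obtain j l i :: nat where "b = (j, l, i, ())" by (cases b) auto
  ultimately show "v b = w b" by (cases "j = 0 \<and> l = 0 \<and> i = 0") (auto simp: graded_def tot_wt_def wt0_def)
qed

lemma D3_o3:
  assumes v: "v \<in> carrier (fun_module A)"
  shows "D3 v o3 = v (1, 0, 0, ()) \<otimes> y \<oplus> (v (0, 1, 0, ()) \<otimes> (g \<ominus> \<one>) \<oplus> v (0, 0, 1, ()) \<otimes> z)"
proof -
  note c = col_closed[OF v] and vc = fun_carrierD[OF v]
  have "D2 (col v 0) (0, 0, ()) = v (0, 1, 0, ()) \<otimes> (g \<ominus> \<one>) \<oplus> v (0, 0, 1, ()) \<otimes> z"
    unfolding D2_eq[OF c] using vc zc by (simp add: T_def Z_def sg_def col_def)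
  moreover have "tw (col v (Suc 0)) (0, 0, ()) = v (1, 0, 0, ()) \<otimes> y"
    using vc yc by (simp add: tw_def col_def)
  ultimately show ?thesis unfolding D3_eq[OF v] using vc zc g1c by (simp add: alt_def sg_def)
qed

text \<open>Positive degrees are the exactness of the third stage. In degree zero one inclusion is
  \<open>eps_D3\<close> at exponents zero and the other is \<open>eps_ker\<close>.\<close>

lemma exact_F: "exact_complex A TM FM e3 \<theta>"
proof -
  interpret C: graded_complex A wt3 D3 by (rule c3)
  have e3: "e3 n \<in> lin_hom A (FM (Suc n)) (FM n)" for n
  proof (rule lin_homI)
    show "e3 n \<in> carrier (FM (Suc n)) \<rightarrow>\<^sub>E carrier (FM n)"
      by (auto simp: e3_def graded_module_simps C.d_deg)
    have c: "v \<in> carrier (fun_module A)" if "v \<in> graded A wt3 (Suc n)" for v by (rule graded_carrier[OF that])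
    show "e3 n (v \<oplus>\<^bsub>FM (Suc n)\<^esub> w) = e3 n v \<oplus>\<^bsub>FM n\<^esub> e3 n w"
      if "v \<in> carrier (FM (Suc n))" "w \<in> carrier (FM (Suc n))" for v w
      using that c lin_opD(2)[OF C.d_lin, of v w] by (simp add: e3_def graded_module_simps graded_add)
    show "e3 n (a \<odot>\<^bsub>FM (Suc n)\<^esub> v) = a \<odot>\<^bsub>FM n\<^esub> e3 n v"
      if "a \<in> carrier A" "v \<in> carrier (FM (Suc n))" for a v
      using that c lin_opD(3)[OF C.d_lin, of a v] by (simp add: e3_def graded_module_simps graded_smult)
  qed
  have im0: "e3 0 ` carrier (FM 1) = {x \<in> carrier (FM 0). \<theta> x = \<zero>\<^bsub>TM\<^esub>}"
  proof (intro equalityI subsetI)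
    fix x assume "x \<in> e3 0 ` carrier (FM 1)"
    then obtain v where v: "v \<in> graded A wt3 (Suc 0)" "x = D3 v" by (auto simp: e3_def graded_module_simps)
    have "\<epsilon> (D3 v o3) = \<zero>\<^bsub>K\<^esub>" using eps_D3[OF graded_carrier[OF v(1)], of 0 0 0 "()"] by simp
    thus "x \<in> {x \<in> carrier (FM 0). \<theta> x = \<zero>\<^bsub>TM\<^esub>}"
      using v C.d_deg[OF v(1)] by (simp add: graded_module_simps \<theta>_def TM_simps)
  next
    fix x assume "x \<in> {x \<in> carrier (FM 0). \<theta> x = \<zero>\<^bsub>TM\<^esub>}"
    hence x: "x \<in> graded A wt3 0" "\<epsilon> (x o3) = \<zero>\<^bsub>K\<^esub>" by (auto simp: graded_module_simps \<theta>_def TM_simps)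
    obtain b c e where bce: "b \<in> carrier A" "c \<in> carrier A" "e \<in> carrier A"
      "x o3 = b \<otimes> y \<oplus> (c \<otimes> (g \<ominus> \<one>) \<oplus> e \<otimes> z)"
      using eps_ker[OF fun_carrierD[OF graded_carrier[OF x(1)]] x(2)] by blast
    let ?v = "el (Suc 0, 0, 0, ()) b \<oplus>\<^bsub>fun_module A\<^esub> (el (0, Suc 0, 0, ()) c \<oplus>\<^bsub>fun_module A\<^esub> el (0, 0, Suc 0, ()) e)"
    have v: "?v \<in> graded A wt3 (Suc 0)"
      by (intro graded_add el_graded; use bce in \<open>simp add: tot_wt_def wt0_def\<close>)
    have "D3 ?v o3 = x o3" unfolding D3_o3[OF graded_carrier[OF v]] bce(4)
      using bce by (simp add: fun_module_simps el_def)
    hence "D3 ?v = x" using graded_0_eqI3[OF C.d_deg[OF v] x(1)] by simp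
    thus "x \<in> e3 0 ` carrier (FM 1)" using v by (force simp: e3_def graded_module_simps)
  qed
  have im: "e3 (Suc n) ` carrier (FM (Suc (Suc n))) = {x \<in> carrier (FM (Suc n)). e3 n x = \<zero>\<^bsub>FM n\<^esub>}" for n
  proof (intro equalityI subsetI)
    fix x assume "x \<in> e3 (Suc n) ` carrier (FM (Suc (Suc n)))"
    then obtain v where v: "v \<in> graded A wt3 (Suc (Suc n))" "x = D3 v" by (auto simp: e3_def graded_module_simps)
    thus "x \<in> {x \<in> carrier (FM (Suc n)). e3 n x = \<zero>\<^bsub>FM n\<^esub>}"
      using C.d_deg[OF v(1)] C.d_d[OF graded_carrier[OF v(1)]] by (simp add: e3_def graded_module_simps)
  next
    fix x assume "x \<in> {x \<in> carrier (FM (Suc n)). e3 n x = \<zero>\<^bsub>FM n\<^esub>}"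
    hence "x \<in> graded A wt3 (Suc n)" "D3 x = \<zero>\<^bsub>fun_module A\<^esub>" by (auto simp: e3_def graded_module_simps)
    then obtain v where "v \<in> graded A wt3 (Suc (Suc n))" "D3 v = x" using C.exact by blast
    thus "x \<in> e3 (Suc n) ` carrier (FM (Suc (Suc n)))" by (force simp: e3_def graded_module_simps)
  qed
  have th: "\<theta> \<in> lin_hom A (FM 0) TM" unfolding \<theta>_def by (rule coordinate_hom) (simp add: tot_wt_def wt0_def)
  have "\<theta> ` carrier (FM 0) = carrier TM"
  proof (intro equalityI subsetI)
    fix c assume "c \<in> carrier TM"
    then obtain a where a: "a \<in> carrier A" "c = \<epsilon> a" using eps_surj by (auto simp: TM_simps)
    have "el o3 a \<in> graded A wt3 0" using a by (intro el_graded) (auto simp: tot_wt_def wt0_def)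
    moreover have "\<theta> (el o3 a) = c" using calculation a by (simp add: \<theta>_def) (simp add: el_def)
    ultimately show "c \<in> \<theta> ` carrier (FM 0)" by (force simp: graded_module_simps)
  qed (use lin_homD(2)[OF th] in auto)
  thus ?thesis unfolding exact_complex_def
    using left_module_TM left_module_graded_module[OF ring_axioms] e3 th im0 im by blast
qed

lemma finite_degree: "finite {b. wt3 b = n}"
proof -
  have "{b. wt3 b = n} \<subseteq> {..n} \<times> {..n} \<times> {..n} \<times> UNIV" by (auto simp: tot_wt_def wt0_def)
  thus ?thesis by (rule finite_subset) auto
qed

text \<open>The basis elements that are hit by a unit entry of the differential. Cocycles with
  trivial coefficients vanish on them, and the coordinate functionals of all the others are
  cocycles.\<close>

fun bad :: "nat \<times> nat \<times> nat \<times> unit \<Rightarrow> bool" where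
  "bad (j, l, i, u) \<longleftrightarrow> even j \<and> even l \<and> odd i"

definition I where "I n = {b. wt3 b = n \<and> \<not> bad b}"
definition \<beta> where "\<beta> b = (\<lambda>v\<in>graded A wt3 (wt3 b). \<epsilon> (v b))"

lemma \<beta>_cocycle: "b \<in> I n \<Longrightarrow> \<beta> b \<in> carrier (cocycles A FM e3 TM n)"
proof -
  assume b: "b \<in> I n"
  interpret C: graded_complex A wt3 D3 by (rule c3)
  interpret F: module_complex A FM e3 by (rule exact_complex_module_complex[OF exact_F])
  have n: "wt3 b = n" using b by (simp add: I_def)
  show ?thesis
  proof (rule F.cocycleI)
    show "\<beta> b \<in> lin_hom A (FM n) TM" unfolding \<beta>_def n by (rule coordinate_hom[OF n])
    fix x assume "x \<in> carrier (FM (Suc n))"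
    hence x: "x \<in> graded A wt3 (Suc n)" by (simp add: graded_module_simps)
    obtain j l i where bb: "b = (j, l, i, ())" by (cases b) auto
    have "\<epsilon> (D3 x b) = \<zero>\<^bsub>K\<^esub>"
      using b eps_D3[OF graded_carrier[OF x], of j l i "()"] by (auto simp: bb I_def)
    thus "\<beta> b (e3 n x) = \<zero>\<^bsub>TM\<^esub>" using x n C.d_deg[OF x] by (simp add: \<beta>_def e3_def TM_simps)
  qed
qed

text \<open>Scalars act on the trivial module through \<open>\<epsilon>\<close>, so a homomorphism
  sees the coordinates of \<open>x\<close> only after applying \<open>\<epsilon>\<close>.\<close>

lemma hom_coordinates:
  assumes f: "f \<in> lin_hom A (FM n) TM" and x: "x \<in> graded A wt3 n"
  shows "f x = (\<Oplus>\<^bsub>K\<^esub>b\<in>{b. wt3 b = n}. \<epsilon> (x b) \<otimes>\<^bsub>K\<^esub> f (el b \<one>))"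
proof -
  note fD = lin_homD[OF f, unfolded graded_module_simps TM_simps]
  have el: "el b \<one> \<in> graded A wt3 n" if "wt3 b = n" for b using that by (intro el_graded) auto
  have main: "f x = (\<Oplus>\<^bsub>K\<^esub>b\<in>S. \<epsilon> (x b) \<otimes>\<^bsub>K\<^esub> f (el b \<one>))"
    if "finite S" "S \<subseteq> {b. wt3 b = n}" "x \<in> graded A wt3 n" "\<And>b. b \<notin> S \<Longrightarrow> x b = \<zero>" for S x
    using that
  proof (induction S arbitrary: x)
    case empty
    hence "x = \<zero>\<^bsub>FM n\<^esub>" by (auto simp: graded_module_simps fun_module_simps)
    thus ?case using lin_hom_zero_minus(1)[OF f left_module_graded_module[OF ring_axioms] left_module_TM]
      by (simp add: TM_simps)
  next
    case (insert b S)
    have xc: "x b \<in> carrier A" for b using insert.prems(2) by (rule fun_carrierD[OF graded_carrier])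
    have bn: "wt3 b = n" using insert.prems by auto
    let ?y = "x(b := \<zero>)"
    have y: "?y \<in> graded A wt3 n" using insert.prems(2) by (auto simp: graded_def fun_module_simps)
    have dec: "x = x b \<odot>\<^bsub>fun_module A\<^esub> el b \<one> \<oplus>\<^bsub>fun_module A\<^esub> ?y"
      using xc by (auto simp: fun_module_simps el_def fun_eq_iff)
    have "f x = f (x b \<odot>\<^bsub>fun_module A\<^esub> el b \<one>) \<oplus>\<^bsub>K\<^esub> f ?y"
      using fD(3)[OF graded_smult[OF xc[of b] el[OF bn]] y] dec by simp
    also have "f (x b \<odot>\<^bsub>fun_module A\<^esub> el b \<one>) = \<epsilon> (x b) \<otimes>\<^bsub>K\<^esub> f (el b \<one>)"
      by (rule fD(4)[OF xc el[OF bn]])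
    also have "f ?y = (\<Oplus>\<^bsub>K\<^esub>b\<in>S. \<epsilon> (?y b) \<otimes>\<^bsub>K\<^esub> f (el b \<one>))"
    proof (rule insert.IH)
      show "?y b' = \<zero>" if "b' \<notin> S" for b' using insert.prems(3)[of b'] that by auto
    qed (use insert.prems(1) y in blast)+
    also have "\<dots> = (\<Oplus>\<^bsub>K\<^esub>b\<in>S. \<epsilon> (x b) \<otimes>\<^bsub>K\<^esub> f (el b \<one>))"
      using insert.hyps insert.prems xc el fD(2) by (intro K.finsum_cong') (auto simp: eps_simps)
    finally show ?case using insert.hyps insert.prems xc el fD(2)
      by (subst K.finsum_insert) (auto simp: eps_simps)
  qed
  show ?thesis
    by (rule main[OF finite_degree subset_refl x]) (use graded_zeroD[OF x] in simp)
qed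

text \<open>A homomorphism is the combination of coordinate functionals given by its values on the
  basis; the cocycle condition removes the bad ones. Coboundaries are not divided out, since
  spanning is all that is wanted.\<close>

lemma cocycle_span:
  assumes f: "f \<in> carrier (cocycles A FM e3 TM n)"
  shows "\<exists>c \<in> I n \<rightarrow> carrier K. \<forall>x\<in>carrier (FM n). f x = (\<Oplus>\<^bsub>K\<^esub>b\<in>I n. c b \<otimes>\<^bsub>K\<^esub> \<beta> b x)"
proof -
  interpret C: graded_complex A wt3 D3 by (rule c3)
  interpret F: module_complex A FM e3 by (rule exact_complex_module_complex[OF exact_F])
  have fh: "f \<in> lin_hom A (FM n) TM" using F.cocycleD(1)[OF f] .
  note fD = lin_homD[OF fh, unfolded graded_module_simps TM_simps]
  have el: "el b \<one> \<in> graded A wt3 n" if "wt3 b = n" for b using that by (intro el_graded) auto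
  have bad0: "f (el b \<one>) = \<zero>\<^bsub>K\<^esub>" if bn: "wt3 b = n" and bad: "bad b" for b
  proof -
    obtain j l i u where b: "b = (j, l, i, u)" by (cases b)
    \<comment> \<open>The basis element whose differential has the unit entry at \<open>b\<close>.
      All its other coordinates lie in the kernel of \<open>\<epsilon>\<close>, so the cocycle
      condition evaluated on it isolates the value at \<open>b\<close>.\<close>
    let ?b = "(Suc j, Suc l, i - 1, u)"
    have x: "el ?b \<one> \<in> graded A wt3 (Suc n)"
      using bad bn by (intro el_graded) (auto simp: b tot_wt_def wt0_def elim!: oddE)
    have *: "\<epsilon> (D3 (el ?b \<one>) b') = (if b = b' then \<one>\<^bsub>K\<^esub> else \<zero>\<^bsub>K\<^esub>)" for b'
    proof -
      obtain j' l' i' u' where b': "b' = (j', l', i', u')" by (cases b')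
      show ?thesis using bad unfolding b' eps_D3[OF graded_carrier[OF x]]
        by (auto simp: b el_def eps_simps elim!: oddE)
    qed
    have "\<zero>\<^bsub>K\<^esub> = f (D3 (el ?b \<one>))"
      using F.cocycleD(2)[OF f, of "el ?b \<one>"] x by (simp add: graded_module_simps e3_def TM_simps)
    also have "\<dots> = (\<Oplus>\<^bsub>K\<^esub>b'\<in>{b. wt3 b = n}. \<epsilon> (D3 (el ?b \<one>) b') \<otimes>\<^bsub>K\<^esub> f (el b' \<one>))"
      by (rule hom_coordinates[OF fh C.d_deg[OF x]])
    also have "\<dots> = (\<Oplus>\<^bsub>K\<^esub>b'\<in>{b. wt3 b = n}. if b = b' then f (el b' \<one>) else \<zero>\<^bsub>K\<^esub>)"
      unfolding * using el fD(2) by (intro K.finsum_cong') auto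
    also have "\<dots> = f (el b \<one>)"
      using finite_degree bn el fD(2) by (intro K.finsum_singleton) auto
    finally show ?thesis ..
  qed
  have "f x = (\<Oplus>\<^bsub>K\<^esub>b\<in>I n. f (el b \<one>) \<otimes>\<^bsub>K\<^esub> \<beta> b x)" if "x \<in> carrier (FM n)" for x
  proof -
    have x: "x \<in> graded A wt3 n" using that by (simp add: graded_module_simps)
    have xc: "x b \<in> carrier A" for b by (rule fun_carrierD[OF graded_carrier[OF x]])
    have "f x = (\<Oplus>\<^bsub>K\<^esub>b\<in>{b. wt3 b = n}. \<epsilon> (x b) \<otimes>\<^bsub>K\<^esub> f (el b \<one>))" by (rule hom_coordinates[OF fh x])
    also have "\<dots> = (\<Oplus>\<^bsub>K\<^esub>b\<in>I n. f (el b \<one>) \<otimes>\<^bsub>K\<^esub> \<beta> b x)"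
      using bad0 el fD(2) xc x finite_degree
      by (intro K.add.finprod_mono_neutral_cong_right) (auto simp: I_def \<beta>_def eps_simps K.m_comm)
    finally show ?thesis .
  qed
  moreover have "(\<lambda>b. f (el b \<one>)) \<in> I n \<rightarrow> carrier K" using el fD(2) by (auto simp: I_def)
  ultimately show ?thesis by (intro bexI[of _ "\<lambda>b. f (el b \<one>)"] ballI)
qed

definition shift_map where
  "shift_map S n = (\<lambda>v\<in>graded A wt3 (Suc (Suc n)). S v)"

text \<open>A shift that commutes strictly with the differential is its own chain map. The cocycle
  it lifts is the coordinate functional of the basis element moved to \<open>o3\<close>.\<close>

lemma chain_lift_shift:
  assumes S: "shift_op A wt3 S" and comm: "\<And>v. v \<in> carrier (fun_module A) \<Longrightarrow> D3 (S v) = S (D3 v)"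
    and wt: "wt3 b = 2" and Sb: "\<And>v. S v o3 = v b"
  shows "chain_lift A FM e3 \<theta> 2 (\<beta> b) (shift_map S)"
proof -
  interpret C: graded_complex A wt3 D3 by (rule c3)
  have Sl: "lin_op A S" using S by (simp add: shift_op_def)
  have Sd: "S v \<in> graded A wt3 n" if "v \<in> graded A wt3 (Suc (Suc n))" for v n
  proof -
    have "if Suc (Suc n) < 2 then S v = \<zero>\<^bsub>fun_module A\<^esub> else S v \<in> graded A wt3 (Suc (Suc n) - 2)"
      using S that unfolding shift_op_def by blast
    thus ?thesis by simp
  qed
  have "shift_map S n \<in> lin_hom A (FM (Suc (Suc n))) (FM n)" for n
  proof (rule lin_homI)
    have c: "v \<in> carrier (fun_module A)" if "v \<in> graded A wt3 (Suc (Suc n))" for v by (rule graded_carrier[OF that])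
    show "shift_map S n \<in> carrier (FM (Suc (Suc n))) \<rightarrow>\<^sub>E carrier (FM n)"
      by (auto simp: shift_map_def graded_module_simps Sd)
    show "shift_map S n (v \<oplus>\<^bsub>FM (Suc (Suc n))\<^esub> w) = shift_map S n v \<oplus>\<^bsub>FM n\<^esub> shift_map S n w"
      if "v \<in> carrier (FM (Suc (Suc n)))" "w \<in> carrier (FM (Suc (Suc n)))" for v w
      using that c lin_opD(2)[OF Sl, of v w] by (simp add: shift_map_def graded_module_simps graded_add)
    show "shift_map S n (a \<odot>\<^bsub>FM (Suc (Suc n))\<^esub> v) = a \<odot>\<^bsub>FM n\<^esub> shift_map S n v"
      if "a \<in> carrier A" "v \<in> carrier (FM (Suc (Suc n)))" for a v
      using that c lin_opD(3)[OF Sl, of a v] by (simp add: shift_map_def graded_module_simps graded_smult)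
  qed
  moreover have "\<theta> (shift_map S 0 x) = \<beta> b x" if "x \<in> carrier (FM 2)" for x
  proof -
    have "x \<in> graded A wt3 (Suc (Suc 0))" using that by (simp add: graded_module_simps numeral_2_eq_2)
    thus ?thesis using Sd[of x 0] wt by (simp add: \<theta>_def shift_map_def \<beta>_def Sb numeral_2_eq_2)
  qed
  moreover have "e3 i (shift_map S (Suc i) x) = shift_map S i (e3 (Suc (Suc i)) x)"
    if "x \<in> carrier (FM (Suc (Suc (Suc i))))" for x i
    using that Sd[of x "Suc i"] C.d_deg[of x "Suc (Suc i)"] comm[OF graded_carrier[of x]]
    by (simp add: graded_module_simps shift_map_def e3_def)
  ultimately show ?thesis by (simp add: chain_lift_def)
qed

section \<open>Periodicity of the resolution and factorisation of coordinate functionals\<close>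

lemma funpow_commute:
  fixes f S :: "('i \<Rightarrow> 'a) \<Rightarrow> 'i \<Rightarrow> 'a"
  assumes "lin_op A f" "\<And>v. v \<in> carrier (fun_module A) \<Longrightarrow> f (S v) = S (f v)" "v \<in> carrier (fun_module A)"
  shows "(f ^^ n) (S v) = S ((f ^^ n) v)"
  by (induction n) (simp_all add: assms lin_opD(1)[OF lin_op_funpow[OF assms(1)]])

definition "S1 = (outer_shift :: (nat \<times> nat \<times> nat \<times> unit \<Rightarrow> 'a) \<Rightarrow> _)"
definition "S2 = (inner_op outer_shift :: (nat \<times> nat \<times> nat \<times> unit \<Rightarrow> 'a) \<Rightarrow> _)"
definition "S3 = (inner_op (inner_op outer_shift) :: (nat \<times> nat \<times> nat \<times> unit \<Rightarrow> 'a) \<Rightarrow> _)"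

lemma S_eq: "S1 v (j, l, i, u) = v (j + 2, l, i, u)" "S2 v (j, l, i, u) = v (j, l + 2, i, u)"
  "S3 v (j, l, i, u) = v (j, l, i + 2, u)"
  by (simp_all add: S1_def S2_def S3_def outer_shift_def inner_op_def col_def)

lemma S_shift_op: "shift_op A wt3 S1" "shift_op A wt3 S2" "shift_op A wt3 S3"
  unfolding S1_def S2_def S3_def
  by (intro inner_shift_op outer_shift_op ring_axioms)+

text \<open>The coefficients depend on the exponents only through parities. The neighbour
  \<open>i - 1\<close> in \<open>tw\<close> is consulted for odd \<open>i\<close> only, so the shift
  of the \<open>z\<close>-exponent causes no boundary effect at zero.\<close>

lemma S_D3:
  assumes v: "v \<in> carrier (fun_module A)"
  shows "D3 (S1 v) = S1 (D3 v)" "D3 (S2 v) = S2 (D3 v)" "D3 (S3 v) = S3 (D3 v)"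
proof -
  interpret C1: graded_complex A wt1 D1 by (rule c1)
  interpret C2: graded_complex A wt2 D2 by (rule c2)
  let ?s1 = "outer_shift :: (nat \<times> unit \<Rightarrow> 'a) \<Rightarrow> _"
  let ?s2 = "outer_shift :: (nat \<times> nat \<times> unit \<Rightarrow> 'a) \<Rightarrow> _"
  let ?s3 = "inner_op outer_shift :: (nat \<times> nat \<times> unit \<Rightarrow> 'a) \<Rightarrow> _"
  have l1: "lin_op A ?s1" and l2: "lin_op A ?s2" and l3: "lin_op A ?s3"
    using outer_shift_op[OF ring_axioms, of wt0] outer_shift_op[OF ring_axioms, of wt1]
      inner_shift_op[OF ring_axioms outer_shift_op[OF ring_axioms, of wt0]] by (simp_all add: shift_op_def)
  have tw2: "tw (?s2 v) = ?s2 (tw v)" for v by (auto simp: tw_def outer_shift_def \<mu>_def fun_eq_iff)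
  have tw3: "tw (?s3 v) = ?s3 (tw v)" for v
  proof
    fix b :: "nat \<times> nat \<times> unit"
    obtain l i where b: "b = (l, i, ())" by (cases b) auto
    show "tw (?s3 v) b = ?s3 (tw v) b"
      by (cases i) (simp_all add: b tw_def outer_shift_def inner_op_def col_def)
  qed
  have D1s: "D1 (?s1 v) = ?s1 (D1 v)" for v unfolding D1_def by (rule outer_shift_tot_d)
  have r: "rmul c (?s1 v) = ?s1 (rmul c v)" for c v by (auto simp: rmul_def outer_shift_def)
  have D2s2: "D2 (?s2 v) = ?s2 (D2 v)" for v unfolding D2_def by (rule outer_shift_tot_d)
  have D2s3: "D2 (?s3 v) = ?s3 (D2 v)" if "v \<in> carrier (fun_module A)" for v
    unfolding D2_def
    by (rule inner_op_tot_d) (use that l1 C1.d_lin rmul_lin_op[OF g1c] rmul_lin_op[OF Nc] ring_axioms in \<open>simp_all add: D1s r\<close>)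
  show "D3 (S1 v) = S1 (D3 v)" unfolding D3_def S1_def by (rule outer_shift_tot_d)
  show "D3 (S2 v) = S2 (D3 v)" unfolding D3_def S2_def
    by (rule inner_op_tot_d) (use v l2 C2.d_lin tw_lin lin_op_funpow[OF tw_lin] ring_axioms
        funpow_commute[of tw ?s2, OF tw_lin tw2] in \<open>simp_all add: D2s2 tw2\<close>)
  show "D3 (S3 v) = S3 (D3 v)" unfolding D3_def S3_def
    by (rule inner_op_tot_d) (use v l3 C2.d_lin tw_lin lin_op_funpow[OF tw_lin] ring_axioms
        funpow_commute[of tw ?s3, OF tw_lin tw3] in \<open>simp_all add: D2s3 tw3\<close>)
qed

text \<open>The total degree is at least four, so one exponent is at least two. Lowering it by two
  keeps the parities and hence goodness; the three generators of degree two have an even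
  \<open>z\<close>-exponent and are good themselves.\<close>

lemma decomposition:
  assumes n: "n \<ge> 2" and b: "b \<in> I (Suc (Suc n))"
  shows "\<exists>b'\<in>I n. \<exists>z\<in>I 2. \<exists>S. chain_lift A FM e3 \<theta> 2 (\<beta> z) S \<and>
    (\<forall>x\<in>carrier (FM (Suc (Suc n))). \<beta> b x = \<beta> b' (S n x))"
proof -
  obtain j l i where bb: "b = (j, l, i, ())" by (cases b) auto
  have w: "wt3 (j, l, i, ()) = j + (l + i)" for j l i by (simp add: tot_wt_def wt0_def)
  have wb: "j + (l + i) = Suc (Suc n)" and nb: "\<not> bad b" using b by (auto simp: I_def bb w)
  have *: ?thesis
    if S: "shift_op A wt3 S" and comm: "\<And>v. v \<in> carrier (fun_module A) \<Longrightarrow> D3 (S v) = S (D3 v)"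
      and z: "z \<in> I 2" "\<And>v. S v o3 = v z" and b': "b' \<in> I n" "\<And>v. S v b' = v b" for S z b'
  proof (intro bexI[OF _ b'(1)] bexI[OF _ z(1)] exI conjI ballI)
    show "chain_lift A FM e3 \<theta> 2 (\<beta> z) (shift_map S)"
      using z by (intro chain_lift_shift[OF S comm]) (auto simp: I_def)
    fix x assume "x \<in> carrier (FM (Suc (Suc n)))"
    hence x: "x \<in> graded A wt3 (Suc (Suc n))" by (simp add: graded_module_simps)
    have "if Suc (Suc n) < 2 then S x = \<zero>\<^bsub>fun_module A\<^esub> else S x \<in> graded A wt3 (Suc (Suc n) - 2)"
      using S x unfolding shift_op_def by blast
    thus "\<beta> b x = \<beta> b' (shift_map S n x)"
      using x b b' by (simp add: \<beta>_def shift_map_def I_def)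
  qed
  consider "j \<ge> 2" | "l \<ge> 2" | "i \<ge> 2" using wb n by linarith
  thus ?thesis
  proof cases
    case 1
    then obtain k where k: "j = k + 2" by (metis add.commute le_Suc_ex)
    show ?thesis
      by (rule *[OF S_shift_op(1) S_D3(1), of "(Suc (Suc 0), 0, 0, ())" "(k, l, i, ())"])
        (use wb nb k in \<open>auto simp: I_def w S_eq bb\<close>)
  next
    case 2
    then obtain k where k: "l = k + 2" by (metis add.commute le_Suc_ex)
    show ?thesis
      by (rule *[OF S_shift_op(2) S_D3(2), of "(0, Suc (Suc 0), 0, ())" "(j, k, i, ())"])
        (use wb nb k in \<open>auto simp: I_def w S_eq bb\<close>)
  next
    case 3
    then obtain k where k: "i = k + 2" by (metis add.commute le_Suc_ex)
    show ?thesis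
      by (rule *[OF S_shift_op(3) S_D3(3), of "(0, 0, Suc (Suc 0), ())" "(j, l, k, ())"])
        (use wb nb k in \<open>auto simp: I_def w S_eq bb\<close>)
  qed
qed

theorem finitely_generated:
  assumes "ext_algebra K A \<epsilon> P d \<eta> B"
  shows "finitely_generated_algebra K (Ext_algebra A P d \<eta> TM)"
proof -
  interpret E: ext_algebra K A \<epsilon> P d \<eta> B by fact
  show ?thesis
  proof (rule E.finitely_generated_by_resolution[of FM e3 \<theta> "\<lambda>n. {b. wt3 b = n}" I \<beta>])
    show "finite (I n)" for n by (rule finite_subset[OF _ finite_degree[of n]]) (auto simp: I_def)
    show "free_retract A (FM n) {b. wt3 b = n}" for n
      by (rule free_retract_graded_module[OF ring_axioms finite_degree])
  qed (use exact_F \<beta>_cocycle cocycle_span decomposition in blast)+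
qed

end

section \<open>The free algebra\<close>

locale free_alg = cring K for K :: "'k ring" (structure)
begin

abbreviation "F \<equiv> free_algebra K :: ('k, 'x list \<Rightarrow> 'k) module"

definition conv :: "('x list \<Rightarrow> 'k) \<Rightarrow> ('x list \<Rightarrow> 'k) \<Rightarrow> 'x list \<Rightarrow> 'k" where
  "conv f h w = (\<Oplus>i\<in>{..length w}. f (take i w) \<otimes> h (drop i w))"

definition delta :: "'x list \<Rightarrow> 'x list \<Rightarrow> 'k" where
  "delta u = (\<lambda>w. if w = u then \<one> else \<zero>)"

abbreviation supp :: "('x list \<Rightarrow> 'k) \<Rightarrow> 'x list set" where "supp f \<equiv> {w. f w \<noteq> \<zero>}"

lemma F_simps:
  "carrier F = {f. (\<forall>w. f w \<in> carrier K) \<and> finite (supp f)}"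
  "f \<otimes>\<^bsub>F\<^esub> h = conv f h" "\<one>\<^bsub>F\<^esub> = delta []" "\<zero>\<^bsub>F\<^esub> = (\<lambda>w. \<zero>)"
  "f \<oplus>\<^bsub>F\<^esub> h = (\<lambda>w. f w \<oplus> h w)" "c \<odot>\<^bsub>F\<^esub> f = (\<lambda>w. c \<otimes> f w)"
  by (simp_all add: free_algebra_def conv_def delta_def fun_eq_iff)

lemma conv_closed:
  "(\<And>w. f w \<in> carrier K) \<Longrightarrow> (\<And>w. h w \<in> carrier K) \<Longrightarrow> conv f h w \<in> carrier K"
  unfolding conv_def by (intro finsum_closed) auto

lemma conv_Nil: "f [] \<in> carrier K \<Longrightarrow> h [] \<in> carrier K \<Longrightarrow> conv f h [] = f [] \<otimes> h []"
  by (simp add: conv_def)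

text \<open>A recursion on the first letter, with \<open>f\<close> replaced by its left quotient. It
  reduces associativity and the unit laws to inductions on words, in place of double sums over
  cutting points.\<close>

lemma conv_Cons:
  assumes "\<And>w. f w \<in> carrier K" "\<And>w. h w \<in> carrier K"
  shows "conv f h (a # w) = f [] \<otimes> h (a # w) \<oplus> conv (\<lambda>w. f (a # w)) h w"
proof -
  have "conv f h (a # w) = (\<Oplus>i\<in>{..length w}. f (take (Suc i) (a # w)) \<otimes> h (drop (Suc i) (a # w))) \<oplus> f [] \<otimes> h (a # w)"
    unfolding conv_def length_Cons by (subst finsum_Suc2) (use assms in auto)
  thus ?thesis using assms conv_closed[of "\<lambda>w. f (a # w)" h w] by (simp add: conv_def a_comm)
qed

lemma conv_add_left:
  assumes "\<And>w. f w \<in> carrier K" "\<And>w. f' w \<in> carrier K" "\<And>w. h w \<in> carrier K"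
  shows "conv (\<lambda>w. f w \<oplus> f' w) h w = conv f h w \<oplus> conv f' h w"
proof -
  have "conv (\<lambda>w. f w \<oplus> f' w) h w =
      (\<Oplus>i\<in>{..length w}. f (take i w) \<otimes> h (drop i w) \<oplus> f' (take i w) \<otimes> h (drop i w))"
    unfolding conv_def using assms by (simp only: l_distr)
  also have "\<dots> = conv f h w \<oplus> conv f' h w" unfolding conv_def by (rule finsum_addf) (use assms in auto)
  finally show ?thesis .
qed

lemma conv_add_right:
  assumes "\<And>w. f w \<in> carrier K" "\<And>w. h' w \<in> carrier K" "\<And>w. h w \<in> carrier K"
  shows "conv f (\<lambda>w. h w \<oplus> h' w) w = conv f h w \<oplus> conv f h' w"
proof -
  have "conv f (\<lambda>w. h w \<oplus> h' w) w =
      (\<Oplus>i\<in>{..length w}. f (take i w) \<otimes> h (drop i w) \<oplus> f (take i w) \<otimes> h' (drop i w))"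
    unfolding conv_def using assms by (simp only: r_distr)
  also have "\<dots> = conv f h w \<oplus> conv f h' w" unfolding conv_def by (rule finsum_addf) (use assms in auto)
  finally show ?thesis .
qed

lemma conv_smult_left:
  assumes "c \<in> carrier K" "\<And>w. f w \<in> carrier K" "\<And>w. h w \<in> carrier K"
  shows "conv (\<lambda>w. c \<otimes> f w) h w = c \<otimes> conv f h w"
  unfolding conv_def using assms by (subst finsum_rdistr) (simp_all add: m_assoc Pi_def)

lemma conv_smult_right:
  assumes "c \<in> carrier K" "\<And>w. f w \<in> carrier K" "\<And>w. h w \<in> carrier K"
  shows "conv f (\<lambda>w. c \<otimes> h w) w = c \<otimes> conv f h w"
  unfolding conv_def using assms by (subst finsum_rdistr) (simp_all add: m_lcomm Pi_def)

lemma conv_assoc: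
  assumes "\<And>w. f w \<in> carrier K" "\<And>w. h w \<in> carrier K" "\<And>w. k w \<in> carrier K"
  shows "conv (conv f h) k w = conv f (conv h k) w"
  using assms(1,2)
proof (induction w arbitrary: f h)
  case Nil
  have "conv f h [] = f [] \<otimes> h []" "conv h k [] = h [] \<otimes> k []"
    "conv (conv f h) k [] = conv f h [] \<otimes> k []" "conv f (conv h k) [] = f [] \<otimes> conv h k []"
    by (intro conv_Nil conv_closed Nil assms(3))+
  thus ?case using Nil assms(3) by (simp add: m_assoc)
next
  case (Cons a w)
  let ?fa = "\<lambda>w. f (a # w)" and ?ha = "\<lambda>w. h (a # w)"
  note c = Cons.prems assms(3)
  have cl: "f [] \<in> carrier K" "h [] \<in> carrier K" "k (a # w) \<in> carrier K" "h (a # w) \<in> carrier K"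
    "conv ?ha k w \<in> carrier K" "conv ?fa (conv h k) w \<in> carrier K" "\<And>w. conv f h w \<in> carrier K"
    "\<And>w. conv h k w \<in> carrier K" "\<And>w. conv ?fa h w \<in> carrier K"
    by (intro c conv_closed)+
  have "conv (conv f h) k (a # w) = conv f h [] \<otimes> k (a # w) \<oplus> conv (\<lambda>w. conv f h (a # w)) k w"
    by (rule conv_Cons) (rule cl c)+
  also have "(\<lambda>w. conv f h (a # w)) = (\<lambda>w. f [] \<otimes> ?ha w \<oplus> conv ?fa h w)"
    by (intro ext conv_Cons c)
  also have "conv (\<lambda>w. f [] \<otimes> ?ha w \<oplus> conv ?fa h w) k w =
      conv (\<lambda>w. f [] \<otimes> ?ha w) k w \<oplus> conv (conv ?fa h) k w"
    by (rule conv_add_left) (intro m_closed cl c)+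
  also have "conv (\<lambda>w. f [] \<otimes> ?ha w) k w = f [] \<otimes> conv ?ha k w"
    by (rule conv_smult_left) (intro cl c)+
  also have "conv (conv ?fa h) k w = conv ?fa (conv h k) w"
    by (rule Cons.IH) (rule c)+
  also have "conv f h [] = f [] \<otimes> h []" by (intro conv_Nil c)
  also have "f [] \<otimes> h [] \<otimes> k (a # w) \<oplus> (f [] \<otimes> conv ?ha k w \<oplus> conv ?fa (conv h k) w) =
      f [] \<otimes> (h [] \<otimes> k (a # w) \<oplus> conv ?ha k w) \<oplus> conv ?fa (conv h k) w"
    using cl by (simp add: r_distr m_assoc a_assoc)
  also have "h [] \<otimes> k (a # w) \<oplus> conv ?ha k w = conv h k (a # w)" by (intro conv_Cons[symmetric] c)
  also have "f [] \<otimes> conv h k (a # w) \<oplus> conv ?fa (conv h k) w = conv f (conv h k) (a # w)"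
    by (rule conv_Cons[symmetric]) (rule cl c)+
  finally show ?case .
qed

lemma conv_zero_left: "(\<And>w. h w \<in> carrier K) \<Longrightarrow> conv (\<lambda>w. \<zero>) h w = \<zero>"
  unfolding conv_def by (simp add: finsum_zero)

lemma delta_closed: "delta u w \<in> carrier K" by (simp add: delta_def)

lemma conv_delta_Nil:
  fixes h :: "'x list \<Rightarrow> 'k"
  assumes h: "\<And>w. h w \<in> carrier K" shows "conv (delta []) h w = h w"
proof (cases w)
  case Nil
  have "conv (delta []) h [] = (delta [] :: 'x list \<Rightarrow> 'k) [] \<otimes> h []" by (rule conv_Nil[of "delta []" h, OF delta_closed h])
  thus ?thesis using Nil h by (simp add: delta_def)
next
  case (Cons a u)
  have "conv (delta []) h (a # u) = (delta [] :: 'x list \<Rightarrow> 'k) [] \<otimes> h (a # u) \<oplus> conv (\<lambda>w. delta [] (a # w)) h u"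
    by (rule conv_Cons) (rule delta_closed h)+
  also have "(\<lambda>w. delta [] (a # w)) = (\<lambda>w. \<zero>)" by (simp add: delta_def)
  also have "conv (\<lambda>w. \<zero>) h u = \<zero>" by (rule conv_zero_left) (rule h)
  finally show ?thesis using Cons h by (simp add: delta_def)
qed

lemma conv_delta_Nil_right:
  fixes f :: "'x list \<Rightarrow> 'k"
  assumes "\<And>w. f w \<in> carrier K" shows "conv f (delta []) w = f w"
  using assms
proof (induction w arbitrary: f)
  case Nil
  have "conv f (delta []) [] = f [] \<otimes> (delta [] :: 'x list \<Rightarrow> 'k) []" by (rule conv_Nil[of f "delta []", OF Nil delta_closed])
  thus ?case using Nil by (simp add: delta_def)
next
  case (Cons a w)
  have "conv f (delta []) (a # w) = f [] \<otimes> delta [] (a # w) \<oplus> conv (\<lambda>w. f (a # w)) (delta []) w"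
    by (rule conv_Cons) (rule delta_closed Cons.prems)+
  also have "conv (\<lambda>w. f (a # w)) (delta []) w = f (a # w)" by (rule Cons.IH) (rule Cons.prems)
  finally show ?case using Cons.prems by (simp add: delta_def)
qed

lemma conv_delta: "conv (delta u) (delta v) = delta (u @ v)"
proof (induction u)
  case Nil thus ?case by (auto simp: conv_delta_Nil delta_closed)
next
  case (Cons a u)
  show ?case
  proof
    fix w
    show "conv (delta (a # u)) (delta v) w = delta ((a # u) @ v) w"
    proof (cases w)
      case (Cons b w')
      have e: "(\<lambda>w. delta (a # u) (b # w)) = (if a = b then delta u else (\<lambda>w. \<zero>))" by (auto simp: delta_def)
      have "conv (delta (a # u)) (delta v) (b # w') = delta (a # u) [] \<otimes> delta v (b # w') \<oplus>
          conv (\<lambda>w. delta (a # u) (b # w)) (delta v) w'"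
        by (rule conv_Cons) (rule delta_closed)+
      also have "\<dots> = conv (if a = b then delta u else (\<lambda>w. \<zero>)) (delta v) w'"
        unfolding e by (simp add: delta_closed conv_closed) (simp add: delta_def[of "a # u"] delta_closed conv_closed)
      also have "\<dots> = delta ((a # u) @ v) (b # w')"
        using \<open>conv (delta u) (delta v) = delta (u @ v)\<close> conv_zero_left[of "delta v" w'] delta_closed[of v]
        by (cases "a = b") (simp_all, simp_all add: delta_def)
      finally show ?thesis using Cons by simp
    qed (auto simp: conv_Nil delta_def)
  qed
qed

lemma finite_supp_conv:
  assumes "\<And>w. f w \<in> carrier K" "\<And>w. h w \<in> carrier K" "finite (supp f)" "finite (supp h)"
  shows "finite (supp (conv f h))"
proof (rule finite_subset)
  show "supp (conv f h) \<subseteq> (\<lambda>(u, v). u @ v) ` (supp f \<times> supp h)"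
  proof
    fix w assume w: "w \<in> supp (conv f h)"
    have "\<exists>i\<le>length w. f (take i w) \<otimes> h (drop i w) \<noteq> \<zero>"
    proof (rule ccontr)
      assume "\<not> ?thesis"
      hence "conv f h w = \<zero>" unfolding conv_def by (intro add.finprod_one_eqI) auto
      thus False using w by simp
    qed
    then obtain i where "f (take i w) \<otimes> h (drop i w) \<noteq> \<zero>" by blast
    hence "f (take i w) \<noteq> \<zero>" "h (drop i w) \<noteq> \<zero>" using assms by auto
    thus "w \<in> (\<lambda>(u, v). u @ v) ` (supp f \<times> supp h)"
      by (intro image_eqI[of _ _ "(take i w, drop i w)"]) auto
  qed
qed (use assms in auto)

lemma F_ring: "ring F"
proof (rule ringI)
  have add: "(\<lambda>w. f w \<oplus> h w) \<in> carrier F" if "f \<in> carrier F" "h \<in> carrier F" for f h :: "'x list \<Rightarrow> 'k"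
  proof -
    have "supp (\<lambda>w. f w \<oplus> h w) \<subseteq> supp f \<union> supp h" by auto
    moreover have "finite (supp f \<union> supp h)" using that unfolding F_simps(1) by blast
    ultimately have "finite (supp (\<lambda>w. f w \<oplus> h w))" by (rule finite_subset)
    thus ?thesis using that unfolding F_simps(1) by blast
  qed
  show "abelian_group F"
  proof (rule abelian_groupI)
    fix f :: "'x list \<Rightarrow> 'k" assume f: "f \<in> carrier F"
    have "supp (\<lambda>w. \<ominus> f w) \<subseteq> supp f" by auto
    moreover have "finite (supp f)" using f unfolding F_simps(1) by blast
    ultimately have "finite (supp (\<lambda>w. \<ominus> f w))" by (rule finite_subset)
    hence "(\<lambda>w. \<ominus> f w) \<in> carrier F" using f unfolding F_simps(1) by blast
    thus "\<exists>h\<in>carrier F. h \<oplus>\<^bsub>F\<^esub> f = \<zero>\<^bsub>F\<^esub>"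
      using f by (intro bexI[of _ "\<lambda>w. \<ominus> f w"]) (auto simp: F_simps l_neg)
  qed (use add in \<open>auto simp: F_simps a_ac\<close>)
  show "monoid F"
  proof (rule monoidI)
    show "f \<otimes>\<^bsub>F\<^esub> h \<in> carrier F" if "f \<in> carrier F" "h \<in> carrier F" for f h :: "'x list \<Rightarrow> 'k"
      using that finite_supp_conv[of f h] conv_closed[of f h] by (simp add: F_simps)
    show "\<one>\<^bsub>F\<^esub> \<in> (carrier F :: ('x list \<Rightarrow> 'k) set)"
      by (auto simp: F_simps delta_def intro: finite_subset[of _ "{[]}"])
  qed (auto simp: F_simps conv_assoc conv_delta_Nil conv_delta_Nil_right)
qed (auto simp: F_simps conv_add_left conv_add_right)

lemma delta_F: "delta u \<in> carrier F"
  by (auto simp: F_simps delta_def intro: finite_subset[of _ "{u}"])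

lemma F_induct [consumes 1, case_names zero add]:
  assumes f: "f \<in> carrier F" and zero: "Q (\<lambda>w. \<zero>)"
    and add: "\<And>c u f. c \<in> carrier K \<Longrightarrow> f \<in> carrier F \<Longrightarrow> Q f \<Longrightarrow> Q (\<lambda>w. c \<otimes> delta u w \<oplus> f w)"
  shows "Q f"
proof -
  have "Q f" if "finite S" "f \<in> carrier F" "supp f \<subseteq> S" for S f
    using that
  proof (induction S arbitrary: f)
    case empty
    hence "f = (\<lambda>w. \<zero>)" by auto
    thus ?case using zero by simp
  next
    case (insert u S)
    let ?h = "f(u := \<zero>)"
    have fc: "f w \<in> carrier K" for w using insert.prems(1) by (simp add: F_simps)
    have hS: "supp ?h \<subseteq> S" using insert.prems(2) by auto
    have h: "?h \<in> carrier F" unfolding F_simps(1) using fc finite_subset[OF hS insert.hyps(1)] by simp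
    have "Q ?h" using insert.IH[OF h hS] .
    hence "Q (\<lambda>w. f u \<otimes> delta u w \<oplus> ?h w)" using add[OF fc h] by blast
    moreover have "(\<lambda>w. f u \<otimes> delta u w \<oplus> ?h w) = f" using fc by (auto simp: delta_def)
    ultimately show ?case by simp
  qed
  moreover have "finite (supp f)" using f by (simp add: F_simps)
  ultimately show ?thesis using f by blast
qed

text \<open>Evaluates on \<open>f\<close> the linear functional with values \<open>\<phi> w\<close>
  on words; here \<open>\<phi>\<close> may have infinite support.\<close>

definition pair :: "('x list \<Rightarrow> 'k) \<Rightarrow> ('x list \<Rightarrow> 'k) \<Rightarrow> 'k" where
  "pair f \<phi> = (\<Oplus>w\<in>supp f. f w \<otimes> \<phi> w)"

lemma pair_ext:
  assumes "f \<in> carrier F" "\<And>w. \<phi> w \<in> carrier K" "finite S" "supp f \<subseteq> S"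
  shows "pair f \<phi> = (\<Oplus>w\<in>S. f w \<otimes> \<phi> w)"
  unfolding pair_def using assms by (intro add.finprod_mono_neutral_cong_left) (auto simp: F_simps)

lemma pair_closed: "f \<in> carrier F \<Longrightarrow> (\<And>w. \<phi> w \<in> carrier K) \<Longrightarrow> pair f \<phi> \<in> carrier K"
  unfolding pair_def by (intro finsum_closed) (auto simp: F_simps)

lemma pair_lin:
  assumes f: "f \<in> carrier F" and h: "h \<in> carrier F" and c: "c \<in> carrier K" and \<phi>: "\<And>w. \<phi> w \<in> carrier K"
  shows "pair (\<lambda>w. c \<otimes> f w \<oplus> h w) \<phi> = c \<otimes> pair f \<phi> \<oplus> pair h \<phi>"
proof -
  let ?S = "supp f \<union> supp h"
  have fc: "f w \<in> carrier K" "h w \<in> carrier K" for w using f h by (auto simp: F_simps)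
  have S: "finite ?S" using f h unfolding F_simps(1) by blast
  have sub: "supp (\<lambda>w. c \<otimes> f w \<oplus> h w) \<subseteq> ?S" using c by auto
  have "(\<lambda>w. c \<otimes> f w \<oplus> h w) \<in> carrier F"
    unfolding F_simps(1) using fc c finite_subset[OF sub S] by simp
  hence "pair (\<lambda>w. c \<otimes> f w \<oplus> h w) \<phi> = (\<Oplus>w\<in>?S. (c \<otimes> f w \<oplus> h w) \<otimes> \<phi> w)"
    by (rule pair_ext[OF _ \<phi> S sub])
  also have "\<dots> = (\<Oplus>w\<in>?S. c \<otimes> (f w \<otimes> \<phi> w) \<oplus> h w \<otimes> \<phi> w)"
    using fc c \<phi> by (simp add: l_distr m_assoc)
  also have "\<dots> = (\<Oplus>w\<in>?S. c \<otimes> (f w \<otimes> \<phi> w)) \<oplus> (\<Oplus>w\<in>?S. h w \<otimes> \<phi> w)"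
    using fc c \<phi> by (intro finsum_addf) auto
  also have "(\<Oplus>w\<in>?S. c \<otimes> (f w \<otimes> \<phi> w)) = c \<otimes> (\<Oplus>w\<in>?S. f w \<otimes> \<phi> w)"
    using fc c \<phi> S by (intro finsum_rdistr[symmetric]) auto
  finally show ?thesis using pair_ext[OF f \<phi> S] pair_ext[OF h \<phi> S] by simp
qed

lemma pair_lin_right:
  assumes f: "f \<in> carrier F" and c: "c \<in> carrier K" and \<phi>: "\<And>w. \<phi> w \<in> carrier K" and \<psi>: "\<And>w. \<psi> w \<in> carrier K"
  shows "pair f (\<lambda>w. c \<otimes> \<phi> w \<oplus> \<psi> w) = c \<otimes> pair f \<phi> \<oplus> pair f \<psi>"
proof -
  have fc: "f w \<in> carrier K" for w using f by (auto simp: F_simps)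
  have S: "finite (supp f)" using f unfolding F_simps(1) by blast
  have "pair f (\<lambda>w. c \<otimes> \<phi> w \<oplus> \<psi> w) = (\<Oplus>w\<in>supp f. c \<otimes> (f w \<otimes> \<phi> w) \<oplus> f w \<otimes> \<psi> w)"
    unfolding pair_def using fc c \<phi> \<psi> by (simp add: r_distr m_lcomm)
  also have "\<dots> = (\<Oplus>w\<in>supp f. c \<otimes> (f w \<otimes> \<phi> w)) \<oplus> pair f \<psi>"
    unfolding pair_def using fc c \<phi> \<psi> by (intro finsum_addf) auto
  also have "(\<Oplus>w\<in>supp f. c \<otimes> (f w \<otimes> \<phi> w)) = c \<otimes> pair f \<phi>"
    unfolding pair_def using fc c \<phi> S by (intro finsum_rdistr[symmetric]) auto
  finally show ?thesis .
qed

lemma pair_zero: "pair (\<lambda>w. \<zero>) \<phi> = \<zero>"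
  by (simp add: pair_def)

lemma pair_zero_right: "f \<in> carrier F \<Longrightarrow> (\<And>w. \<phi> w = \<zero>) \<Longrightarrow> pair f \<phi> = \<zero>"
  unfolding pair_def by (intro add.finprod_one_eqI) (auto simp: F_simps)

lemma pair_delta: assumes "\<And>w. \<phi> w \<in> carrier K" shows "pair (delta u) \<phi> = \<phi> u"
proof -
  have "supp (delta u) \<subseteq> {u}" by (auto simp: delta_def)
  hence "pair (delta u) \<phi> = (\<Oplus>w\<in>{u}. delta u w \<otimes> \<phi> w)" by (intro pair_ext delta_F assms) auto
  thus ?thesis using assms by (simp add: delta_closed) (simp add: delta_def assms)
qed

lemma pair_conv_delta:
  assumes h: "h \<in> carrier F" and \<phi>: "\<And>w. \<phi> w \<in> carrier K"
  shows "pair (conv (delta u) h) \<phi> = pair h (\<lambda>w. \<phi> (u @ w))"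
  using h
proof (induction h rule: F_induct)
  case zero
  have "conv (delta u) (\<lambda>w. \<zero>) = (\<lambda>w. \<zero>)" unfolding conv_def by (auto simp: delta_closed finsum_zero)
  thus ?case by (simp add: pair_zero)
next
  case (add c v h)
  interpret F: ring F by (rule F_ring)
  have hc: "h w \<in> carrier K" for w using add by (simp add: F_simps)
  have "conv (delta u) (\<lambda>w. c \<otimes> delta v w \<oplus> h w) = (\<lambda>w. c \<otimes> delta (u @ v) w \<oplus> conv (delta u) h w)"
    using hc add by (auto simp: conv_add_right conv_smult_right delta_closed conv_delta[symmetric])
  moreover have "conv (delta u) h \<in> carrier F" using F.m_closed[OF delta_F add(2)] by (simp add: F_simps(2))
  ultimately show ?case using add \<phi> by (simp add: pair_lin delta_F pair_delta)
qed

lemma pair_conv: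
  assumes f: "f \<in> carrier F" and h: "h \<in> carrier F" and \<phi>: "\<And>w. \<phi> w \<in> carrier K"
  shows "pair (conv f h) \<phi> = pair f (\<lambda>u. pair h (\<lambda>w. \<phi> (u @ w)))"
  using f
proof (induction f rule: F_induct)
  case zero
  have "conv (\<lambda>w. \<zero>) h = (\<lambda>w. \<zero>)" using h by (intro ext conv_zero_left) (simp add: F_simps)
  thus ?case by (simp add: pair_zero)
next
  case (add c v f)
  interpret F: ring F by (rule F_ring)
  have fc: "f w \<in> carrier K" "h w \<in> carrier K" for w using add h by (auto simp: F_simps)
  have "conv (\<lambda>w. c \<otimes> delta v w \<oplus> f w) h = (\<lambda>w. c \<otimes> conv (delta v) h w \<oplus> conv f h w)"
    using fc add by (auto simp: conv_add_left conv_smult_left delta_closed)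
  moreover have "conv (delta v) h \<in> carrier F" "conv f h \<in> carrier F"
    using F.m_closed[OF delta_F h] F.m_closed[OF add(2) h] by (auto simp: F_simps(2))
  ultimately show ?case using add \<phi> h by (simp add: pair_lin delta_F pair_delta pair_conv_delta pair_closed)
qed

lemma delta_pow: "delta [a] [^]\<^bsub>F\<^esub> (n::nat) = delta (replicate n a)"
proof (induction n)
  case (Suc n)
  have "replicate n a @ [a] = replicate (Suc n) a" by (simp add: replicate_append_same)
  thus ?case using Suc by (simp add: F_simps(2) conv_delta)
qed (simp add: F_simps(3))

end

section \<open>A basis of the Jordan algebra\<close>

locale jordan = field K for K :: "'k ring" (structure) +
  fixes p :: nat
  assumes p: "Factorial_Ring.prime p" and p2: "p > 2" and char: "[p] \<cdot> \<one> = \<zero>"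
begin

sublocale FA: free_alg K by unfold_locales

abbreviation "F \<equiv> free_algebra K :: ('k, gen list \<Rightarrow> 'k) module"
abbreviation "JI \<equiv> jordan_ideal K p"
abbreviation "JR \<equiv> jordan_algebra K p"
abbreviation "delta \<equiv> (FA.delta :: gen list \<Rightarrow> gen list \<Rightarrow> 'k)"

definition half :: 'k where "half = inv (\<one> \<oplus> \<one>)"

sublocale F: ring F by (rule FA.F_ring)

lemma nat_mult_zero: "p dvd n \<Longrightarrow> a \<in> carrier K \<Longrightarrow> [n] \<cdot> a = \<zero>"
proof -
  assume a: "a \<in> carrier K" and "p dvd n"
  then obtain m where n: "n = p * m" by blast
  have "[p] \<cdot> a = [p] \<cdot> \<one> \<otimes> a" using a by (simp add: add_pow_ldistr)
  also have "\<dots> = \<zero>" using char a by simp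
  finally show "[n] \<cdot> a = \<zero>" using a unfolding n by (simp add: add.nat_pow_pow[symmetric])
qed

lemma half: "half \<in> carrier K" "half \<otimes> (\<one> \<oplus> \<one>) = \<one>" "half \<oplus> half = \<one>"
proof -
  have "\<one> \<oplus> \<one> \<noteq> \<zero>"
  proof
    assume "\<one> \<oplus> \<one> = \<zero>"
    hence 2: "[(2::nat)] \<cdot> \<one> = \<zero>" by (simp add: numeral_2_eq_2)
    \<comment> \<open>As \<open>p\<close> is odd, \<open>1 + 1 = 0\<close> would give
      \<open>p 1 = 1\<close>.\<close>
    obtain m where m: "p = Suc (2 * m)" using p p2 prime_odd_nat[OF p p2] by (auto elim: oddE)
    have "[p] \<cdot> \<one> = [m] \<cdot> ([(2::nat)] \<cdot> \<one>) \<oplus> \<one>"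
      unfolding m by (simp add: add.nat_pow_pow)
    thus False using char 2 by simp
  qed
  hence u: "\<one> \<oplus> \<one> \<in> Units K" by (simp add: field_Units)
  show h: "half \<in> carrier K" "half \<otimes> (\<one> \<oplus> \<one>) = \<one>" using u by (auto simp: half_def Units_l_inv)
  thus "half \<oplus> half = \<one>" by (simp add: r_distr)
qed

subsection \<open>A right module\<close>

text \<open>On the basis \<open>e\<^sub>j\<^sub>i\<close>, which stands for \<open>y\<^sup>j X\<^sup>i\<close> with \<open>X = x / 2\<close>, right multiplication acts by
  \<open>e\<^sub>j\<^sub>i X = e\<^sub>j\<^sub>,\<^sub>i\<^sub>+\<^sub>1\<close> and \<open>e\<^sub>j\<^sub>i y = e\<^sub>j\<^sub>+\<^sub>1\<^sub>,\<^sub>i - i e\<^sub>j\<^sub>,\<^sub>i\<^sub>+\<^sub>1\<close>. The exponents are not truncated: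
  only the coordinates below \<open>p\<close> are inspected in the end.\<close>

definition opX :: "(nat \<times> nat \<Rightarrow> 'k) \<Rightarrow> nat \<times> nat \<Rightarrow> 'k" where
  "opX v = (\<lambda>(j, i). if i = 0 then \<zero> else v (j, i - 1))"

definition opy :: "(nat \<times> nat \<Rightarrow> 'k) \<Rightarrow> nat \<times> nat \<Rightarrow> 'k" where
  "opy v = (\<lambda>(j, i). (if j = 0 then \<zero> else v (j - 1, i)) \<ominus> (if i = 0 then \<zero> else [(i - 1)] \<cdot> v (j, i - 1)))"

definition op :: "gen \<Rightarrow> (nat \<times> nat \<Rightarrow> 'k) \<Rightarrow> nat \<times> nat \<Rightarrow> 'k" where
  "op l v = (case l of gen_x \<Rightarrow> (\<one> \<oplus> \<one>) \<odot>\<^bsub>fun_module K\<^esub> opX v | gen_y \<Rightarrow> opy v)"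

text \<open>Letters act from left to right, so words form a right module structure: concatenation
  becomes composition in reading order (\<open>act_append\<close>).\<close>

primrec act :: "gen list \<Rightarrow> (nat \<times> nat \<Rightarrow> 'k) \<Rightarrow> nat \<times> nat \<Rightarrow> 'k" where
  "act [] v = v"
| "act (l # w) v = act w (op l v)"

abbreviation "CV \<equiv> carrier (fun_module K :: ('k, nat \<times> nat \<Rightarrow> 'k) module)"

lemma vc: "v \<in> CV \<Longrightarrow> v b \<in> carrier K" by (rule fun_carrierD)

lemma opX_lin: "lin_op K opX"
  by (rule lin_opI) (auto simp: opX_def fun_module_simps fun_eq_iff)

lemma minus_add_minus:
  "a \<in> carrier K \<Longrightarrow> b \<in> carrier K \<Longrightarrow> c \<in> carrier K \<Longrightarrow> d \<in> carrier K \<Longrightarrow>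
    a \<oplus> b \<ominus> (c \<oplus> d) = a \<ominus> c \<oplus> (b \<ominus> d)"
  by (simp add: a_minus_def minus_add a_ac)

lemma opy_lin: "lin_op K opy"
proof (rule lin_opI)
  fix v w :: "nat \<times> nat \<Rightarrow> 'k" assume v: "v \<in> CV"
  note c = vc[OF v]
  show "opy v \<in> CV" using c by (auto simp: opy_def fun_module_simps)
  show "opy (a \<odot>\<^bsub>fun_module K\<^esub> v) = a \<odot>\<^bsub>fun_module K\<^esub> opy v" if a: "a \<in> carrier K" for a
    using a c by (auto simp: opy_def fun_module_simps fun_eq_iff a_minus_def r_distr r_minus add_pow_rdistr)
  assume w: "w \<in> CV"
  show "opy (v \<oplus>\<^bsub>fun_module K\<^esub> w) = opy v \<oplus>\<^bsub>fun_module K\<^esub> opy w"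
  proof
    fix b :: "nat \<times> nat"
    obtain j i where b: "b = (j, i)" by (cases b)
    have 1: "[n] \<cdot> (v u \<oplus> w u) = [n] \<cdot> v u \<oplus> [n] \<cdot> w u" for n :: nat and u
      using c vc[OF w] by (simp add: add.nat_pow_distrib)
    show "opy (v \<oplus>\<^bsub>fun_module K\<^esub> w) b = (opy v \<oplus>\<^bsub>fun_module K\<^esub> opy w) b"
      using c vc[OF w] minus_add_minus[of _ _ "[(i - 1)] \<cdot> v (j, i - 1)" "[(i - 1)] \<cdot> w (j, i - 1)"]
        minus_add_minus[of _ _ \<zero> \<zero>]
      by (auto simp: b opy_def fun_module_simps 1)
        (use minus_add_minus[of \<zero> \<zero> "[(i - 1)] \<cdot> v (j, i - 1)" "[(i - 1)] \<cdot> w (j, i - 1)"] in simp)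
  qed
qed

lemma op_lin: "lin_op K (op l)"
proof (rule lin_opI)
  interpret V: left_module K "fun_module K :: ('k, nat \<times> nat \<Rightarrow> 'k) module"
    by (rule left_module_fun_module) (rule ring_axioms)
  fix v w :: "nat \<times> nat \<Rightarrow> 'k" assume v: "v \<in> CV"
  note X = lin_opD[OF opX_lin] and Y = lin_opD[OF opy_lin]
  have 2: "\<one> \<oplus> \<one> \<in> carrier K" by simp
  show "op l v \<in> CV" using v 2 by (cases l) (simp_all add: op_def X Y V.smult_closed)
  show "op l (a \<odot>\<^bsub>fun_module K\<^esub> v) = a \<odot>\<^bsub>fun_module K\<^esub> op l v" if a: "a \<in> carrier K" for a
    using v a 2 by (cases l) (simp_all add: op_def X Y V.smult_assoc[symmetric] m_comm)
  assume w: "w \<in> CV"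
  show "op l (v \<oplus>\<^bsub>fun_module K\<^esub> w) = op l v \<oplus>\<^bsub>fun_module K\<^esub> op l w"
    using v w 2 by (cases l) (simp_all add: op_def X Y V.smult_r_distr)
qed

lemma act_lin: "lin_op K (act w)"
proof (induction w)
  case Nil show ?case by (simp add: lin_op_def)
next
  case (Cons l w)
  show ?case by (rule lin_opI) (simp_all add: lin_opD[OF op_lin] lin_opD[OF Cons])
qed

lemma act_append: "act (u @ w) v = act w (act u v)"
  by (induction u arbitrary: v) auto

text \<open>The relation \<open>y X = X y + X^2\<close> read in the right module. Applying
  \<open>X\<close> first raises the factor \<open>i\<close> in the action of \<open>y\<close> by
  one, and the difference is the square term.\<close>

lemma opX_opy:
  assumes v: "v \<in> CV"
  shows "opX (opy v) = opy (opX v) \<oplus>\<^bsub>fun_module K\<^esub> opX (opX v)"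
proof
  fix b :: "nat \<times> nat"
  obtain j i where b: "b = (j, i)" by (cases b)
  note c = vc[OF v]
  consider "i = 0" | "i = 1" | k where "i = Suc (Suc k)" by (metis One_nat_def not0_implies_Suc)
  thus "opX (opy v) b = (opy (opX v) \<oplus>\<^bsub>fun_module K\<^esub> opX (opX v)) b"
  proof cases
    case 3
    have "a \<ominus> n = a \<ominus> (n \<oplus> e) \<oplus> e" if "a \<in> carrier K" "n \<in> carrier K" "e \<in> carrier K" for a n e
      using that by (simp add: a_minus_def minus_add a_assoc l_neg)
    thus ?thesis using 3 c by (auto simp: b opX_def opy_def fun_module_simps)
  qed (use c in \<open>auto simp: b opX_def opy_def fun_module_simps a_minus_def\<close>)
qed

text \<open>Conjugating by \<open>X\<close>, the identity \<open>y\<^sup>n X = X y\<^sup>n + n X y\<^sup>n\<^sup>-\<^sup>1 X\<close> says that \<open>X\<^sup>-\<^sup>1\<close> and \<open>y\<close> generate a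
  Weyl algebra; in characteristic \<open>p\<close> it makes \<open>y\<^sup>p\<close> central.\<close>

lemma opX_opy_pow:
  assumes v: "v \<in> CV"
  shows "opX ((opy ^^ n) v) = (opy ^^ n) (opX v) \<oplus>\<^bsub>fun_module K\<^esub>
    (\<lambda>b. [n] \<cdot> opX ((opy ^^ (n - 1)) (opX v)) b)"
  using v
proof (induction n)
  case 0
  have "opX v b \<in> carrier K" for b using 0 lin_opD(1)[OF opX_lin] vc by blast
  thus ?case by (simp add: fun_module_simps)
next
  case (Suc n)
  note X = lin_opD[OF opX_lin] and Y = lin_opD[OF opy_lin] and Yn = lin_opD[OF lin_op_funpow[OF opy_lin]]
  let ?u = "opX v"
  have u: "?u \<in> CV" using X Suc.prems by simp
  let ?w = "\<lambda>m. (opy ^^ m) ?u"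
  have w: "?w m \<in> CV" for m using Yn(1) u by blast
  have "(\<lambda>b. [n] \<cdot> opX (?w (n - 1)) b) = ([n] \<cdot> \<one>) \<odot>\<^bsub>fun_module K\<^esub> opX (?w (n - 1))"
    using vc[OF X(1)[OF w[of "n - 1"]]] by (simp add: fun_module_simps add_pow_ldistr)
  hence IH: "opX ((opy ^^ n) v) = ?w n \<oplus>\<^bsub>fun_module K\<^esub> ([n] \<cdot> \<one>) \<odot>\<^bsub>fun_module K\<^esub> opX (?w (n - 1))"
    using Suc.IH[OF Suc.prems] by (rule_tac trans) simp_all
  have "opX (opy ((opy ^^ n) v)) = opy (opX ((opy ^^ n) v)) \<oplus>\<^bsub>fun_module K\<^esub> opX (opX ((opy ^^ n) v))"
    by (rule opX_opy[OF Yn(1)[OF Suc.prems]])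
  hence 1: "opX ((opy ^^ Suc n) v) =
      opy (?w n \<oplus>\<^bsub>fun_module K\<^esub> ([n] \<cdot> \<one>) \<odot>\<^bsub>fun_module K\<^esub> opX (?w (n - 1))) \<oplus>\<^bsub>fun_module K\<^esub>
      opX (?w n \<oplus>\<^bsub>fun_module K\<^esub> ([n] \<cdot> \<one>) \<odot>\<^bsub>fun_module K\<^esub> opX (?w (n - 1)))"
    unfolding IH funpow.simps(2) comp_apply .
  interpret V: left_module K "fun_module K :: ('k, nat \<times> nat \<Rightarrow> 'k) module"
    by (rule left_module_fun_module) (rule ring_axioms)
  have nc: "[n] \<cdot> \<one> \<in> carrier K" by simp
  define c U where "c = [n] \<cdot> \<one>" and "U = opX (?w (n - 1))"
  have c: "c \<in> carrier K" using nc by (simp add: c_def)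
  have cl: "U \<in> CV" "opX U \<in> CV" "opy U \<in> CV" "opX (?w n) \<in> CV" "opy (?w n) \<in> CV" "c \<odot>\<^bsub>fun_module K\<^esub> U \<in> CV"
    "c \<odot>\<^bsub>fun_module K\<^esub> opX U \<in> CV" "c \<odot>\<^bsub>fun_module K\<^esub> opy U \<in> CV"
    unfolding U_def by (intro V.smult_closed X(1) Y(1) w c)+
  have "opX ((opy ^^ Suc n) v) = opy (?w n) \<oplus>\<^bsub>fun_module K\<^esub> c \<odot>\<^bsub>fun_module K\<^esub> opy U \<oplus>\<^bsub>fun_module K\<^esub>
      (opX (?w n) \<oplus>\<^bsub>fun_module K\<^esub> c \<odot>\<^bsub>fun_module K\<^esub> opX U)"
    unfolding 1 c_def[symmetric] U_def[symmetric]
    using X(2)[OF w[of n] cl(6)] X(3)[OF c cl(1)] Y(2)[OF w[of n] cl(6)] Y(3)[OF c cl(1)] by simp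
  also have "\<dots> = opy (?w n) \<oplus>\<^bsub>fun_module K\<^esub> (c \<odot>\<^bsub>fun_module K\<^esub> (opy U \<oplus>\<^bsub>fun_module K\<^esub> opX U) \<oplus>\<^bsub>fun_module K\<^esub> opX (?w n))"
    unfolding V.smult_r_distr[OF c cl(3,2)] using cl by (simp only: V.M.a_ac V.M.a_closed)
  finally have "opX ((opy ^^ Suc n) v) = opy (?w n) \<oplus>\<^bsub>fun_module K\<^esub> (([n] \<cdot> \<one>) \<odot>\<^bsub>fun_module K\<^esub>
      (opy (opX (?w (n - 1))) \<oplus>\<^bsub>fun_module K\<^esub> opX (opX (?w (n - 1)))) \<oplus>\<^bsub>fun_module K\<^esub> opX (?w n))"
    unfolding c_def U_def .
  also have "opy (opX (?w (n - 1))) \<oplus>\<^bsub>fun_module K\<^esub> opX (opX (?w (n - 1))) = opX (opy (?w (n - 1)))"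
    by (rule opX_opy[symmetric]) (rule w)
  also have "([n] \<cdot> \<one>) \<odot>\<^bsub>fun_module K\<^esub> opX (opy (?w (n - 1))) = ([n] \<cdot> \<one>) \<odot>\<^bsub>fun_module K\<^esub> opX (?w n)"
  proof (cases n)
    case 0
    have "([n] \<cdot> \<one>) \<odot>\<^bsub>fun_module K\<^esub> r = \<zero>\<^bsub>fun_module K\<^esub>" if "r \<in> CV" for r
      using 0 vc[OF that] by (simp add: fun_module_simps)
    thus ?thesis using X(1)[OF w[of n]] X(1)[OF Y(1)[OF w[of "n - 1"]]] by simp
  qed simp
  also have "opy (?w n) \<oplus>\<^bsub>fun_module K\<^esub> (([n] \<cdot> \<one>) \<odot>\<^bsub>fun_module K\<^esub> opX (?w n) \<oplus>\<^bsub>fun_module K\<^esub> opX (?w n)) =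
      (opy ^^ Suc n) ?u \<oplus>\<^bsub>fun_module K\<^esub> (\<lambda>b. [Suc n] \<cdot> opX ((opy ^^ (Suc n - 1)) ?u) b)"
    using vc[OF X(1)[OF w[of n]]] by (simp add: fun_module_simps add_pow_ldistr)
  finally show ?case .
qed

text \<open>At \<open>n = p\<close> the extra term of \<open>opX_opy_pow\<close> has coefficient
  \<open>p = 0\<close>; thus \<open>y^p\<close> acts centrally.\<close>

lemma op_opy_p:
  assumes v: "v \<in> CV" shows "op l ((opy ^^ p) v) = (opy ^^ p) (op l v)"
proof (cases l)
  case gen_x
  interpret V: left_module K "fun_module K :: ('k, nat \<times> nat \<Rightarrow> 'k) module"
    by (rule left_module_fun_module) (rule ring_axioms)
  note Xv = lin_opD(1)[OF opX_lin v]
  have c: "opX ((opy ^^ (p - 1)) (opX v)) \<in> CV"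
    by (intro lin_opD(1)[OF opX_lin] lin_opD(1)[OF lin_op_funpow[OF opy_lin]] v)
  have "(\<lambda>b. [p] \<cdot> opX ((opy ^^ (p - 1)) (opX v)) b) = \<zero>\<^bsub>fun_module K\<^esub>"
    using nat_mult_zero[OF dvd_refl vc[OF c]] by (simp add: fun_module_simps)
  hence "opX ((opy ^^ p) v) = (opy ^^ p) (opX v)"
    using opX_opy_pow[OF v, of p] V.M.r_zero[OF lin_opD(1)[OF lin_op_funpow[OF opy_lin] Xv, of p]] by simp
  thus ?thesis using gen_x lin_opD(3)[OF lin_op_funpow[OF opy_lin]] lin_opD(1)[OF opX_lin v]
    by (simp add: op_def)
next
  case gen_y thus ?thesis by (simp add: op_def funpow_swap1)
qed

lemma act_opy_p: "v \<in> CV \<Longrightarrow> act w ((opy ^^ p) v) = (opy ^^ p) (act w v)"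
  by (induction w arbitrary: v) (simp_all add: op_opy_p lin_opD(1)[OF op_lin])

text \<open>Replaces truncation of the exponents: the letters never lower an exponent, so vectors
  without coordinates below \<open>p\<close> form a submodule.\<close>

definition low_zero :: "(nat \<times> nat \<Rightarrow> 'k) \<Rightarrow> bool" where
  "low_zero v \<longleftrightarrow> (\<forall>j<p. \<forall>i<p. v (j, i) = \<zero>)"

lemma low_zero_act: "low_zero v \<Longrightarrow> low_zero (act w v)"
proof (induction w arbitrary: v)
  case (Cons l w)
  have "low_zero (op l v)"
    using Cons.prems by (cases l) (auto simp: low_zero_def op_def opX_def opy_def fun_module_simps a_minus_def)
  thus ?case using Cons.IH by simp
qed simp

definition e00 :: "nat \<times> nat \<Rightarrow> 'k" where "e00 = (\<lambda>b. if b = (0, 0) then \<one> else \<zero>)"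

lemma e00: "e00 \<in> CV" by (simp add: e00_def fun_module_simps)

lemma opy_pow_e00: "(opy ^^ n) e00 = (\<lambda>b. if b = (n, 0) then \<one> else \<zero>)"
proof (induction n)
  case (Suc n)
  have "opy (\<lambda>b. if b = (n, 0) then \<one> else \<zero>) (j, i) = (if (j, i) = (Suc n, 0) then \<one> else \<zero>)" for j i
    by (cases i; cases j) (auto simp: opy_def a_minus_def)
  thus ?case using Suc by auto
qed (simp add: e00_def)

lemma opX_pow: "(opX ^^ n) v = (\<lambda>(j, i). if i < n then \<zero> else v (j, i - n))"
proof (induction n)
  case (Suc n)
  have "opX (\<lambda>(j, i). if i < n then \<zero> else v (j, i - n)) = (\<lambda>(j, i). if i < Suc n then \<zero> else v (j, i - Suc n))"
    by (auto simp: opX_def fun_eq_iff)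
  thus ?case unfolding funpow.simps(2) comp_apply Suc .
qed auto

lemma act_replicate_x: "v \<in> CV \<Longrightarrow> low_zero (act (replicate p gen_x) v)"
proof -
  assume v: "v \<in> CV"
  have "\<exists>c. act (replicate n gen_x) v = c \<odot>\<^bsub>fun_module K\<^esub> (opX ^^ n) v \<and> c \<in> carrier K" for n
    using v
  proof (induction n arbitrary: v)
    case 0
    have "v = \<one> \<odot>\<^bsub>fun_module K\<^esub> v" using vc[OF 0] by (simp add: fun_module_simps)
    thus ?case by (intro exI[of _ \<one>]) simp
  next
    case (Suc n)
    note X = lin_opD[OF opX_lin] and Xn = lin_opD[OF lin_op_funpow[OF opX_lin]]
    interpret V: left_module K "fun_module K :: ('k, nat \<times> nat \<Rightarrow> 'k) module"
      by (rule left_module_fun_module) (rule ring_axioms)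
    have o: "op gen_x v = (\<one> \<oplus> \<one>) \<odot>\<^bsub>fun_module K\<^esub> opX v" by (simp add: op_def)
    have oc: "op gen_x v \<in> CV" by (rule lin_opD(1)[OF op_lin Suc.prems])
    obtain c where c: "act (replicate n gen_x) (op gen_x v) = c \<odot>\<^bsub>fun_module K\<^esub> (opX ^^ n) (op gen_x v)" "c \<in> carrier K"
      using Suc.IH[OF oc] by blast
    have "act (replicate (Suc n) gen_x) v = (c \<otimes> (\<one> \<oplus> \<one>)) \<odot>\<^bsub>fun_module K\<^esub> (opX ^^ n) (opX v)"
    proof -
      have two: "\<one> \<oplus> \<one> \<in> carrier K" by simp
      have "(opX ^^ n) (op gen_x v) = (\<one> \<oplus> \<one>) \<odot>\<^bsub>fun_module K\<^esub> (opX ^^ n) (opX v)"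
        unfolding o by (rule Xn(3)[OF two X(1)[OF Suc.prems]])
      thus ?thesis using c V.smult_assoc[OF c(2) two Xn(1)[OF X(1)[OF Suc.prems], of n]] by simp
    qed
    moreover have "(opX ^^ n) (opX v) = (opX ^^ Suc n) v" by (simp add: funpow_swap1)
    moreover have "c \<otimes> (\<one> \<oplus> \<one>) \<in> carrier K" using c by simp
    ultimately show ?case by (intro exI[of _ "c \<otimes> (\<one> \<oplus> \<one>)"]) simp
  qed
  then obtain c where c: "act (replicate p gen_x) v = c \<odot>\<^bsub>fun_module K\<^esub> (opX ^^ p) v" "c \<in> carrier K" by blast
  show ?thesis unfolding low_zero_def c(1) opX_pow using c(2) by (simp add: fun_module_simps)
qed

lemma act_replicate_y: "act (replicate n gen_y) v = (opy ^^ n) v"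
  by (induction n arbitrary: v) (simp_all add: op_def funpow_swap1)

definition Phi :: "gen list \<Rightarrow> nat \<times> nat \<Rightarrow> 'k" where "Phi w = act w e00"

lemma Phi_closed: "Phi w b \<in> carrier K"
  unfolding Phi_def by (intro vc lin_opD(1)[OF act_lin] e00)

definition kap :: "(gen list \<Rightarrow> 'k) \<Rightarrow> nat \<times> nat \<Rightarrow> 'k" where
  "kap f b = FA.pair f (\<lambda>w. Phi w b)"

text \<open>Quantifying over the contexts \<open>u\<close> and \<open>v\<close> makes this a
  two-sided ideal. It contains the relations, hence \<open>JI\<close>; empty contexts then show that
  the coordinates below \<open>p\<close> are well defined on the quotient.\<close>

definition annih :: "(gen list \<Rightarrow> 'k) set" where
  "annih = {f \<in> carrier F. \<forall>u v j i. j < p \<longrightarrow> i < p \<longrightarrow> FA.pair f (\<lambda>w. Phi (u @ w @ v) (j, i)) = \<zero>}"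

lemma annih_ideal: "ideal annih F"
proof (rule idealI)
  note P = Phi_closed
  have lin: "(\<lambda>w. c \<otimes> f w \<oplus> h w) \<in> annih" if "f \<in> annih" "h \<in> annih" "c \<in> carrier K" for f h c
  proof -
    have "(\<lambda>w. c \<otimes> f w) \<oplus>\<^bsub>F\<^esub> h \<in> carrier F"
    proof (rule F.a_closed)
      have "f \<in> carrier F" using that by (simp add: annih_def)
      hence "\<And>w. f w \<in> carrier K" "finite {w. f w \<noteq> \<zero>}" unfolding FA.F_simps(1) by blast+
      moreover have "{w. c \<otimes> f w \<noteq> \<zero>} \<subseteq> {w. f w \<noteq> \<zero>}" using \<open>c \<in> carrier K\<close> by auto
      ultimately show "(\<lambda>w. c \<otimes> f w) \<in> carrier F" unfolding FA.F_simps(1)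
        using \<open>c \<in> carrier K\<close> finite_subset by auto
      show "h \<in> carrier F" using that by (simp add: annih_def)
    qed
    thus ?thesis using that P by (auto simp: annih_def FA.pair_lin FA.F_simps(5))
  qed
  have zero: "(\<lambda>w. \<zero>) \<in> annih"
    using F.zero_closed by (simp add: annih_def FA.pair_zero FA.F_simps(4))
  show "subgroup annih (add_monoid F)"
  proof (rule F.add.subgroupI)
    show "annih \<subseteq> carrier F" by (auto simp: annih_def)
    show "annih \<noteq> {}" using zero by blast
    fix f assume f: "f \<in> annih"
    have fc: "f \<in> carrier F" using f by (simp add: annih_def)
    have "(\<lambda>w. \<ominus> \<one> \<otimes> f w \<oplus> \<zero>) \<in> annih" by (rule lin[OF f zero]) simp
    moreover have "\<ominus>\<^bsub>F\<^esub> f = (\<lambda>w. \<ominus> \<one> \<otimes> f w \<oplus> \<zero>)"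
    proof (rule F.minus_equality)
      show "(\<lambda>w. \<ominus> \<one> \<otimes> f w \<oplus> \<zero>) \<oplus>\<^bsub>F\<^esub> f = \<zero>\<^bsub>F\<^esub>"
        using fc by (auto simp: FA.F_simps l_minus l_neg)
      show "(\<lambda>w. \<ominus> \<one> \<otimes> f w \<oplus> \<zero>) \<in> carrier F" using calculation by (simp add: annih_def)
    qed (rule fc)
    ultimately show "\<ominus>\<^bsub>F\<^esub> f \<in> annih" by simp
    fix h assume h: "h \<in> annih"
    have "(\<lambda>w. \<one> \<otimes> f w \<oplus> h w) = f \<oplus>\<^bsub>F\<^esub> h" using fc by (auto simp: FA.F_simps)
    thus "f \<oplus>\<^bsub>F\<^esub> h \<in> annih" using lin[OF f h, of \<one>] by simp
  qed
  fix f h assume f: "f \<in> annih" and h: "h \<in> carrier F"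
  have fc: "f \<in> carrier F" using f by (simp add: annih_def)
  show "h \<otimes>\<^bsub>F\<^esub> f \<in> annih"
  proof -
    have "FA.pair (FA.conv h f) (\<lambda>w. Phi (u @ w @ v) (j, i)) = \<zero>" if "j < p" "i < p" for u v j i
    proof -
      have "FA.pair f (\<lambda>w. Phi (u @ (c @ w) @ v) (j, i)) = \<zero>" for c
        using f that by (auto simp: annih_def dest: spec[of _ "u @ c"])
      thus ?thesis using P by (simp add: FA.pair_conv[OF h fc] FA.pair_zero_right[OF h])
    qed
    thus ?thesis using F.m_closed[OF h fc] by (simp add: annih_def FA.F_simps(2))
  qed
  show "f \<otimes>\<^bsub>F\<^esub> h \<in> annih"
  proof -
    have "FA.pair (FA.conv f h) (\<lambda>w. Phi (u @ w @ v) (j, i)) = \<zero>" if ji: "j < p" "i < p" for u v j i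
    proof -
      have "FA.pair f (\<lambda>c. FA.pair h (\<lambda>w. Phi (u @ (c @ w) @ v) (j, i))) = \<zero>"
        using h
      proof (induction h rule: FA.F_induct)
        case zero thus ?case by (simp add: FA.pair_zero FA.pair_zero_right[OF fc])
      next
        case (add a w' h)
        have "FA.pair f (\<lambda>c. Phi (u @ (c @ w') @ v) (j, i)) = \<zero>"
          using f ji by (auto simp: annih_def dest: spec[of _ "w' @ v"])
        thus ?case using add P
          by (simp add: FA.pair_lin FA.delta_F FA.pair_delta FA.pair_lin_right[OF fc] FA.pair_closed)
      qed
      thus ?thesis using P by (simp add: FA.pair_conv[OF fc h])
    qed
    thus ?thesis using F.m_closed[OF fc h] by (simp add: annih_def FA.F_simps(2))
  qed
qed (rule FA.F_ring)

lemma free_gen_delta: "free_gen K l = delta [l]"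
  by (simp add: free_gen_def FA.delta_def)

lemma F_minus: "f \<in> carrier F \<Longrightarrow> h \<in> carrier F \<Longrightarrow> f \<ominus>\<^bsub>F\<^esub> h = (\<lambda>w. \<ominus> \<one> \<otimes> h w \<oplus> f w)"
proof -
  assume f: "f \<in> carrier F" and h: "h \<in> carrier F"
  have c: "\<And>w. f w \<in> carrier K" "\<And>w. h w \<in> carrier K" using f h by (auto simp: FA.F_simps(1))
  have "\<ominus>\<^bsub>F\<^esub> h = (\<lambda>w. \<ominus> h w)"
  proof (rule F.minus_equality[OF _ h])
    show "(\<lambda>w. \<ominus> h w) \<oplus>\<^bsub>F\<^esub> h = \<zero>\<^bsub>F\<^esub>" using c by (auto simp: FA.F_simps l_neg)
    have "{w. \<ominus> h w \<noteq> \<zero>} \<subseteq> {w. h w \<noteq> \<zero>}" by auto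
    moreover have "finite {w. h w \<noteq> \<zero>}" using h unfolding FA.F_simps(1) by blast
    ultimately have "finite {w. \<ominus> h w \<noteq> \<zero>}" by (rule finite_subset)
    thus "(\<lambda>w. \<ominus> h w) \<in> carrier F" using c unfolding FA.F_simps(1) by blast
  qed
  thus ?thesis using c by (auto simp: a_minus_def[of F] FA.F_simps(5) l_minus a_comm)
qed

lemma F_smult_closed: "c \<in> carrier K \<Longrightarrow> f \<in> carrier F \<Longrightarrow> c \<odot>\<^bsub>F\<^esub> f \<in> carrier F"
proof -
  assume c: "c \<in> carrier K" and f: "f \<in> carrier F"
  have "{w. c \<otimes> f w \<noteq> \<zero>} \<subseteq> {w. f w \<noteq> \<zero>}" using c by auto
  moreover have "finite {w. f w \<noteq> \<zero>}" using f unfolding FA.F_simps(1) by blast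
  ultimately have "finite {w. c \<otimes> f w \<noteq> \<zero>}" by (rule finite_subset)
  thus ?thesis using c f unfolding FA.F_simps(1,6) by blast
qed

lemma relations_eq:
  "jordan_relations K p = {delta (replicate p gen_x), delta (replicate p gen_y),
    (delta [gen_y, gen_x] \<ominus>\<^bsub>F\<^esub> delta [gen_x, gen_y]) \<ominus>\<^bsub>F\<^esub> half \<odot>\<^bsub>F\<^esub> delta [gen_x, gen_x]}"
proof -
  have "delta [gen_x] [^]\<^bsub>F\<^esub> (2::nat) = delta [gen_x, gen_x]"
    using FA.delta_pow[of gen_x 2] by (simp add: numeral_2_eq_2)
  thus ?thesis
    unfolding jordan_relations_def Let_def free_gen_delta FA.delta_pow half_def[symmetric]
    by (simp add: FA.F_simps(2) FA.conv_delta)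
qed

lemma relations_annih: "jordan_relations K p \<subseteq> annih"
proof -
  note P = Phi_closed and Ac = lin_opD[OF act_lin]
  interpret V: left_module K "fun_module K :: ('k, nat \<times> nat \<Rightarrow> 'k) module"
    by (rule left_module_fun_module) (rule ring_axioms)
  have "delta (replicate p gen_x) \<in> annih"
  proof -
    have "low_zero (Phi (u @ replicate p gen_x @ v))" for u v
      unfolding Phi_def act_append by (intro low_zero_act act_replicate_x Ac(1) e00)
    thus ?thesis using P by (simp add: annih_def FA.delta_F FA.pair_delta low_zero_def)
  qed
  moreover have "delta (replicate p gen_y) \<in> annih"
  proof -
    have "low_zero (Phi (u @ replicate p gen_y @ v))" for u v
    proof -
      \<comment> \<open>Centrality moves \<open>y^p\<close> in front of \<open>u\<close>, where it
        acts on the initial vector and gives the basis vector with exponents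
        \<open>(p, 0)\<close>.\<close>
      have "Phi (u @ replicate p gen_y @ v) = act v (act u ((opy ^^ p) e00))"
        unfolding Phi_def act_append act_replicate_y by (simp add: act_opy_p e00)
      moreover have "low_zero ((opy ^^ p) e00)" by (simp add: opy_pow_e00 low_zero_def)
      ultimately show ?thesis by (simp add: low_zero_act)
    qed
    thus ?thesis using P by (simp add: annih_def FA.delta_F FA.pair_delta low_zero_def)
  qed
  moreover have "(delta [gen_y, gen_x] \<ominus>\<^bsub>F\<^esub> delta [gen_x, gen_y]) \<ominus>\<^bsub>F\<^esub> half \<odot>\<^bsub>F\<^esub> delta [gen_x, gen_x] \<in> annih"
    (is "?r \<in> annih")
  proof -
    have rc: "?r \<in> carrier F" by (intro F.minus_closed FA.delta_F F_smult_closed half)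
    have r: "?r = (\<lambda>w. \<ominus> half \<otimes> delta [gen_x, gen_x] w \<oplus> (\<ominus> \<one> \<otimes> delta [gen_x, gen_y] w \<oplus> delta [gen_y, gen_x] w))"
      unfolding F_minus[OF F.minus_closed[OF FA.delta_F FA.delta_F] F_smult_closed[OF half(1) FA.delta_F]]
      unfolding F_minus[OF FA.delta_F FA.delta_F]
      using half(1) by (simp add: FA.F_simps(6) l_minus FA.delta_closed)
    have i: "(\<lambda>w. \<ominus> \<one> \<otimes> delta [gen_x, gen_y] w \<oplus> delta [gen_y, gen_x] w) \<in> carrier F"
      using F.minus_closed[OF FA.delta_F FA.delta_F, of "[gen_y, gen_x]" "[gen_x, gen_y]"] by (simp add: F_minus FA.delta_F)
    have "FA.pair ?r (\<lambda>w. Phi (u @ w @ v) (j, i)) = \<zero>" for u v j i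
    proof -
      \<comment> \<open>The state reached after the prefix. With \<open>x = 2 X\<close> the three
        words act on it as \<open>2 (s + t)\<close>, \<open>2 s\<close> and \<open>4 t\<close>, and
        the relation becomes \<open>2 (s + t) - 2 s - half 4 t = 0\<close>.\<close>
      define a where "a = act u e00"
      have a: "a \<in> CV" unfolding a_def by (intro Ac(1) e00)
      note X = lin_opD[OF opX_lin] and Y = lin_opD[OF opy_lin]
      define t s where "t = opX (opX a)" and "s = opy (opX a)"
      have ts: "t \<in> CV" "s \<in> CV" using X Y a by (auto simp: t_def s_def)
      let ?two = "\<one> \<oplus> \<one>"
      have two: "?two \<in> carrier K" by simp
      have yx: "act [gen_y, gen_x] a = ?two \<odot>\<^bsub>fun_module K\<^esub> (s \<oplus>\<^bsub>fun_module K\<^esub> t)"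
        by (simp add: op_def opX_opy[OF a] t_def s_def)
      have xy: "act [gen_x, gen_y] a = ?two \<odot>\<^bsub>fun_module K\<^esub> s"
        using X Y a two by (simp add: op_def s_def)
      have xx: "act [gen_x, gen_x] a = ?two \<odot>\<^bsub>fun_module K\<^esub> (?two \<odot>\<^bsub>fun_module K\<^esub> t)"
        using X Y a two by (simp add: op_def t_def)
      define T S where "T = act v t (j, i)" and "S = act v s (j, i)"
      have TS: "T \<in> carrier K" "S \<in> carrier K" unfolding T_def S_def using Ac(1) ts vc by blast+
      have 1: "Phi (u @ [gen_y, gen_x] @ v) (j, i) = ?two \<otimes> (S \<oplus> T)"
        unfolding Phi_def act_append a_def[symmetric] yx
        using ts two by (simp add: Ac V.smult_closed) (simp add: fun_module_simps S_def T_def)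
      have 2: "Phi (u @ [gen_x, gen_y] @ v) (j, i) = ?two \<otimes> S"
        unfolding Phi_def act_append a_def[symmetric] xy
        using ts two by (simp add: Ac V.smult_closed) (simp add: fun_module_simps S_def T_def)
      have 3: "Phi (u @ [gen_x, gen_x] @ v) (j, i) = ?two \<otimes> (?two \<otimes> T)"
        unfolding Phi_def act_append a_def[symmetric] xx
        using ts two by (simp add: Ac V.smult_closed) (simp add: fun_module_simps S_def T_def)
      have "FA.pair ?r (\<lambda>w. Phi (u @ w @ v) (j, i)) =
          \<ominus> half \<otimes> (?two \<otimes> (?two \<otimes> T)) \<oplus> (\<ominus> \<one> \<otimes> (?two \<otimes> S) \<oplus> ?two \<otimes> (S \<oplus> T))"
        unfolding r using P half i by (simp add: FA.pair_lin FA.delta_F FA.pair_delta 1[simplified] 2[simplified] 3[simplified])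
      also have "\<ominus> half \<otimes> (?two \<otimes> (?two \<otimes> T)) = \<ominus> (?two \<otimes> T)"
        using half TS two by (simp add: l_minus m_assoc[symmetric])
      also have "\<ominus> (?two \<otimes> T) \<oplus> (\<ominus> \<one> \<otimes> (?two \<otimes> S) \<oplus> ?two \<otimes> (S \<oplus> T)) = \<zero>"
      proof -
        have "\<ominus> t' \<oplus> (\<ominus> s' \<oplus> (s' \<oplus> t')) = \<zero>" if "s' \<in> carrier K" "t' \<in> carrier K" for s' t'
          using that by (simp add: r_neg1 l_neg)
        thus ?thesis using TS two by (simp add: l_minus r_distr[of S T ?two])
      qed
      finally show ?thesis .
    qed
    thus ?thesis using rc by (simp add: annih_def)
  qed
  ultimately show ?thesis unfolding relations_eq by blast
qed

lemma JI_ideal: "ideal JI F" and relations_JI: "jordan_relations K p \<subseteq> JI"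
proof -
  have "jordan_relations K p \<subseteq> carrier F" using relations_annih by (auto simp: annih_def)
  thus "ideal JI F" "jordan_relations K p \<subseteq> JI"
    unfolding jordan_ideal_def by (auto intro: F.genideal_ideal dest: F.genideal_self)
qed

lemma JI_annih: "JI \<subseteq> annih"
  unfolding jordan_ideal_def by (rule F.genideal_minimal[OF annih_ideal relations_annih])

lemma kap_JI: "f \<in> JI \<Longrightarrow> j < p \<Longrightarrow> i < p \<Longrightarrow> kap f (j, i) = \<zero>"
  using JI_annih by (auto simp: annih_def kap_def dest!: subsetD spec[of _ "[]"])

end

section \<open>The quotient algebra, its scalars and its relations\<close>

context jordan
begin

interpretation JI: ideal JI F by (rule JI_ideal)

definition pi :: "(gen list \<Rightarrow> 'k) \<Rightarrow> (gen list \<Rightarrow> 'k) set" where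
  "pi f = JI +>\<^bsub>F\<^esub> f"

lemma JR_simps:
  "carrier JR = carrier (F Quot JI)" "r \<otimes>\<^bsub>JR\<^esub> s = r \<otimes>\<^bsub>F Quot JI\<^esub> s"
  "r \<oplus>\<^bsub>JR\<^esub> s = r \<oplus>\<^bsub>F Quot JI\<^esub> s" "\<one>\<^bsub>JR\<^esub> = \<one>\<^bsub>F Quot JI\<^esub>" "\<zero>\<^bsub>JR\<^esub> = \<zero>\<^bsub>F Quot JI\<^esub>"
  by (simp_all add: jordan_algebra_def quot_algebra_def)

lemma JR_ring: "ring JR"
proof -
  interpret Q: ring "F Quot JI" by (rule JI.quotient_is_ring)
  show ?thesis
  proof (rule ringI)
    show "abelian_group JR"
    proof (rule abelian_groupI)
      fix r s assume "r \<in> carrier JR" "s \<in> carrier JR"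
      thus "r \<oplus>\<^bsub>JR\<^esub> s = s \<oplus>\<^bsub>JR\<^esub> r" unfolding JR_simps by (rule Q.a_comm)
    qed (auto simp: JR_simps Q.a_assoc Q.l_neg intro: bexI[of _ "\<ominus>\<^bsub>F Quot JI\<^esub> _"])
    show "monoid JR" by (rule monoidI) (auto simp: JR_simps Q.m_assoc)
  qed (auto simp: JR_simps Q.l_distr Q.r_distr)
qed

sublocale R: ring JR by (rule JR_ring)

lemma carrier_JR: "carrier JR = pi ` carrier F"
  by (auto simp: JR_simps FactRing_def A_RCOSETS_def' pi_def)

lemma pi_closed: "f \<in> carrier F \<Longrightarrow> pi f \<in> carrier JR" by (simp add: carrier_JR)

lemma pi_hom:
  "f \<in> carrier F \<Longrightarrow> h \<in> carrier F \<Longrightarrow> pi (f \<oplus>\<^bsub>F\<^esub> h) = pi f \<oplus>\<^bsub>JR\<^esub> pi h"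
  "f \<in> carrier F \<Longrightarrow> h \<in> carrier F \<Longrightarrow> pi (f \<otimes>\<^bsub>F\<^esub> h) = pi f \<otimes>\<^bsub>JR\<^esub> pi h"
  "pi \<one>\<^bsub>F\<^esub> = \<one>\<^bsub>JR\<^esub>"
  using JI.rcos_ring_hom unfolding JR_simps pi_def
  by (auto simp: ring_hom_add ring_hom_mult ring_hom_one)

lemma pi_eq_iff: "f \<in> carrier F \<Longrightarrow> h \<in> carrier F \<Longrightarrow> pi f = pi h \<longleftrightarrow> f \<ominus>\<^bsub>F\<^esub> h \<in> JI"
  unfolding pi_def using F.quotient_eq_iff_same_a_r_cos[OF JI_ideal] by blast

lemma pi_zero: "f \<in> JI \<Longrightarrow> pi f = \<zero>\<^bsub>JR\<^esub>"
proof -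
  assume f: "f \<in> JI"
  have fc: "f \<in> carrier F" using f JI.Icarr by blast
  have "pi f = pi \<zero>\<^bsub>F\<^esub>" unfolding pi_eq_iff[OF fc F.zero_closed]
    using f fc by (simp add: a_minus_def)
  also have "pi \<zero>\<^bsub>F\<^esub> = \<zero>\<^bsub>JR\<^esub>"
    using pi_hom(1)[OF F.zero_closed F.zero_closed] pi_closed[OF F.zero_closed]
    by (simp add: R.add.l_cancel_one)
  finally show ?thesis .
qed

lemma F_smult_mult:
  assumes "c \<in> carrier K" "f \<in> carrier F" "h \<in> carrier F"
  shows "(c \<odot>\<^bsub>F\<^esub> f) \<otimes>\<^bsub>F\<^esub> h = c \<odot>\<^bsub>F\<^esub> (f \<otimes>\<^bsub>F\<^esub> h)" "f \<otimes>\<^bsub>F\<^esub> (c \<odot>\<^bsub>F\<^esub> h) = c \<odot>\<^bsub>F\<^esub> (f \<otimes>\<^bsub>F\<^esub> h)"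
  using assms by (auto simp: FA.F_simps FA.conv_smult_left FA.conv_smult_right)

lemma F_smult_one: "f \<in> carrier F \<Longrightarrow> \<one> \<odot>\<^bsub>F\<^esub> f = f"
  by (auto simp: FA.F_simps)

lemma F_smult_ideal: "c \<in> carrier K \<Longrightarrow> f \<in> JI \<Longrightarrow> c \<odot>\<^bsub>F\<^esub> f \<in> JI"
proof -
  assume c: "c \<in> carrier K" and f: "f \<in> JI"
  have fc: "f \<in> carrier F" using f JI.Icarr by blast
  have "c \<odot>\<^bsub>F\<^esub> f = (c \<odot>\<^bsub>F\<^esub> \<one>\<^bsub>F\<^esub>) \<otimes>\<^bsub>F\<^esub> f"
    using F_smult_mult(1)[OF c F.one_closed fc] fc by simp
  thus ?thesis using JI.I_l_closed[OF f F_smult_closed[OF c F.one_closed]] by simp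
qed

lemma pi_smult: "c \<in> carrier K \<Longrightarrow> f \<in> carrier F \<Longrightarrow> c \<odot>\<^bsub>JR\<^esub> pi f = pi (c \<odot>\<^bsub>F\<^esub> f)"
proof -
  assume c: "c \<in> carrier K" and f: "f \<in> carrier F"
  have *: "pi (c \<odot>\<^bsub>F\<^esub> h) = pi (c \<odot>\<^bsub>F\<^esub> f)" if h: "h \<in> pi f" for h
  proof -
    obtain i where i: "i \<in> JI" "h = i \<oplus>\<^bsub>F\<^esub> f" using h unfolding pi_def a_r_coset_def' by blast
    have ic: "i \<in> carrier F" using i JI.Icarr by blast
    have "c \<odot>\<^bsub>F\<^esub> h = c \<odot>\<^bsub>F\<^esub> i \<oplus>\<^bsub>F\<^esub> c \<odot>\<^bsub>F\<^esub> f" unfolding i(2) using c ic f by (auto simp: FA.F_simps r_distr)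
    hence "pi (c \<odot>\<^bsub>F\<^esub> h) = pi (c \<odot>\<^bsub>F\<^esub> i) \<oplus>\<^bsub>JR\<^esub> pi (c \<odot>\<^bsub>F\<^esub> f)"
      using pi_hom(1)[OF F_smult_closed[OF c ic] F_smult_closed[OF c f]] by simp
    thus ?thesis using pi_zero[OF F_smult_ideal[OF c i(1)]] pi_closed[OF F_smult_closed[OF c f]] by simp
  qed
  have "f \<in> pi f" unfolding pi_def using JI.a_rcos_self[OF f] .
  hence "(\<Union>h\<in>pi f. pi (c \<odot>\<^bsub>F\<^esub> h)) = pi (c \<odot>\<^bsub>F\<^esub> f)" using * by blast
  thus ?thesis by (simp add: jordan_algebra_def quot_algebra_def pi_def)
qed

lemma JR_smult:
  assumes r: "r \<in> carrier JR" and s: "s \<in> carrier JR" and c: "c \<in> carrier K" and c': "c' \<in> carrier K"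
  shows "c \<odot>\<^bsub>JR\<^esub> r \<in> carrier JR" "\<one> \<odot>\<^bsub>JR\<^esub> r = r" "\<zero> \<odot>\<^bsub>JR\<^esub> r = \<zero>\<^bsub>JR\<^esub>"
    "(c \<odot>\<^bsub>JR\<^esub> r) \<otimes>\<^bsub>JR\<^esub> s = c \<odot>\<^bsub>JR\<^esub> (r \<otimes>\<^bsub>JR\<^esub> s)" "r \<otimes>\<^bsub>JR\<^esub> (c \<odot>\<^bsub>JR\<^esub> s) = c \<odot>\<^bsub>JR\<^esub> (r \<otimes>\<^bsub>JR\<^esub> s)"
    "c \<odot>\<^bsub>JR\<^esub> (r \<oplus>\<^bsub>JR\<^esub> s) = c \<odot>\<^bsub>JR\<^esub> r \<oplus>\<^bsub>JR\<^esub> c \<odot>\<^bsub>JR\<^esub> s"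
    "(c \<oplus> c') \<odot>\<^bsub>JR\<^esub> r = c \<odot>\<^bsub>JR\<^esub> r \<oplus>\<^bsub>JR\<^esub> c' \<odot>\<^bsub>JR\<^esub> r"
    "c \<odot>\<^bsub>JR\<^esub> (c' \<odot>\<^bsub>JR\<^esub> r) = (c \<otimes> c') \<odot>\<^bsub>JR\<^esub> r"
proof -
  obtain f h where f: "f \<in> carrier F" "r = pi f" and h: "h \<in> carrier F" "s = pi h"
    using r s by (auto simp: carrier_JR)
  note fh = f(1) h(1)
  note cl = F_smult_closed[OF c f(1)] F_smult_closed[OF c h(1)] F_smult_closed[OF c' f(1)]
  show "c \<odot>\<^bsub>JR\<^esub> r \<in> carrier JR" using cl c f by (simp add: pi_smult pi_closed)
  show "\<one> \<odot>\<^bsub>JR\<^esub> r = r" using f by (simp add: pi_smult F_smult_one)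
  have "\<zero> \<odot>\<^bsub>F\<^esub> f = \<zero>\<^bsub>F\<^esub>" using f by (auto simp: FA.F_simps)
  thus "\<zero> \<odot>\<^bsub>JR\<^esub> r = \<zero>\<^bsub>JR\<^esub>" using f pi_zero[OF additive_subgroup.zero_closed[OF JI.additive_subgroup_axioms]] by (simp add: pi_smult)
  show "(c \<odot>\<^bsub>JR\<^esub> r) \<otimes>\<^bsub>JR\<^esub> s = c \<odot>\<^bsub>JR\<^esub> (r \<otimes>\<^bsub>JR\<^esub> s)"
    unfolding f(2) h(2) pi_smult[OF c f(1)] pi_hom(2)[OF cl(1) h(1), symmetric] pi_hom(2)[OF fh, symmetric]
      pi_smult[OF c F.m_closed[OF fh]] F_smult_mult(1)[OF c fh] ..
  show "r \<otimes>\<^bsub>JR\<^esub> (c \<odot>\<^bsub>JR\<^esub> s) = c \<odot>\<^bsub>JR\<^esub> (r \<otimes>\<^bsub>JR\<^esub> s)"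
    unfolding f(2) h(2) pi_smult[OF c h(1)] pi_hom(2)[OF f(1) cl(2), symmetric] pi_hom(2)[OF fh, symmetric]
      pi_smult[OF c F.m_closed[OF fh]] F_smult_mult(2)[OF c fh] ..
  have "c \<odot>\<^bsub>F\<^esub> (f \<oplus>\<^bsub>F\<^esub> h) = c \<odot>\<^bsub>F\<^esub> f \<oplus>\<^bsub>F\<^esub> c \<odot>\<^bsub>F\<^esub> h" using c fh by (auto simp: FA.F_simps r_distr)
  thus "c \<odot>\<^bsub>JR\<^esub> (r \<oplus>\<^bsub>JR\<^esub> s) = c \<odot>\<^bsub>JR\<^esub> r \<oplus>\<^bsub>JR\<^esub> c \<odot>\<^bsub>JR\<^esub> s"
    unfolding f(2) h(2) pi_smult[OF c f(1)] pi_smult[OF c h(1)] pi_hom(1)[OF fh, symmetric]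
      pi_hom(1)[OF cl(1,2), symmetric] pi_smult[OF c F.a_closed[OF fh]] by simp
  have "(c \<oplus> c') \<odot>\<^bsub>F\<^esub> f = c \<odot>\<^bsub>F\<^esub> f \<oplus>\<^bsub>F\<^esub> c' \<odot>\<^bsub>F\<^esub> f" using c c' f by (auto simp: FA.F_simps l_distr)
  thus "(c \<oplus> c') \<odot>\<^bsub>JR\<^esub> r = c \<odot>\<^bsub>JR\<^esub> r \<oplus>\<^bsub>JR\<^esub> c' \<odot>\<^bsub>JR\<^esub> r"
    unfolding f(2) pi_smult[OF c f(1)] pi_smult[OF c' f(1)] pi_hom(1)[OF cl(1,3), symmetric]
      pi_smult[OF a_closed[OF c c'] f(1)] by simp
  have "c \<odot>\<^bsub>F\<^esub> (c' \<odot>\<^bsub>F\<^esub> f) = (c \<otimes> c') \<odot>\<^bsub>F\<^esub> f" using c c' f by (auto simp: FA.F_simps m_assoc)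
  thus "c \<odot>\<^bsub>JR\<^esub> (c' \<odot>\<^bsub>JR\<^esub> r) = (c \<otimes> c') \<odot>\<^bsub>JR\<^esub> r"
    unfolding f(2) pi_smult[OF c' f(1)] pi_smult[OF c cl(3)] pi_smult[OF m_closed[OF c c'] f(1)] by simp
qed

subsection \<open>Coordinates\<close>

lemma kap_lin:
  assumes "f \<in> carrier F" "h \<in> carrier F" "c \<in> carrier K"
  shows "kap (\<lambda>w. c \<otimes> f w \<oplus> h w) b = c \<otimes> kap f b \<oplus> kap h b"
  unfolding kap_def using assms by (intro FA.pair_lin Phi_closed)

lemma kap_closed: "f \<in> carrier F \<Longrightarrow> kap f b \<in> carrier K"
  unfolding kap_def by (intro FA.pair_closed Phi_closed)

lemma kap_CV: "f \<in> carrier F \<Longrightarrow> kap f \<in> CV"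
  by (simp add: fun_module_simps kap_closed)

text \<open>Coordinates intertwine right multiplication by a letter with its operator, which
  transports computations in the algebra to the right module.\<close>

lemma kap_mult_gen:
  assumes f: "f \<in> carrier F"
  shows "kap (f \<otimes>\<^bsub>F\<^esub> delta [l]) = op l (kap f)"
  using f
proof (induction f rule: FA.F_induct)
  case zero
  have "FA.conv (\<lambda>w. \<zero>) (delta [l]) = (\<lambda>w. \<zero>)" by (intro ext FA.conv_zero_left FA.delta_closed)
  moreover have "kap (\<lambda>w. \<zero>) = \<zero>\<^bsub>fun_module K\<^esub>" by (auto simp: kap_def FA.pair_zero fun_module_simps)
  ultimately show ?case using lin_op_zero[OF ring_axioms op_lin[of l]] by (simp add: FA.F_simps(2))
next
  case (add c u f)
  have fc: "f w \<in> carrier K" for w using add by (simp add: FA.F_simps)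
  have pd: "kap (delta w) = Phi w" for w unfolding kap_def by (intro ext FA.pair_delta Phi_closed)
  have fd: "f \<otimes>\<^bsub>F\<^esub> delta [l] \<in> carrier F" by (intro F.m_closed FA.delta_F add)
  have "(\<lambda>w. c \<otimes> delta u w \<oplus> f w) \<otimes>\<^bsub>F\<^esub> delta [l] = (\<lambda>w. c \<otimes> delta (u @ [l]) w \<oplus> (f \<otimes>\<^bsub>F\<^esub> delta [l]) w)"
    using fc add(1) by (auto simp: FA.F_simps(2) FA.conv_add_left FA.conv_smult_left FA.delta_closed FA.conv_delta[symmetric])
  hence "kap ((\<lambda>w. c \<otimes> delta u w \<oplus> f w) \<otimes>\<^bsub>F\<^esub> delta [l]) =
      c \<odot>\<^bsub>fun_module K\<^esub> Phi (u @ [l]) \<oplus>\<^bsub>fun_module K\<^esub> op l (kap f)"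
    using kap_lin[OF FA.delta_F fd add(1)] add by (auto simp: fun_module_simps pd)
  moreover have "Phi (u @ [l]) = op l (Phi u)" by (simp add: Phi_def act_append)
  moreover have "kap (\<lambda>w. c \<otimes> delta u w \<oplus> f w) = c \<odot>\<^bsub>fun_module K\<^esub> Phi u \<oplus>\<^bsub>fun_module K\<^esub> kap f"
    using kap_lin[OF FA.delta_F add(2,1)] by (auto simp: fun_module_simps pd)
  moreover have "Phi u \<in> CV" by (simp add: fun_module_simps Phi_closed)
  moreover have "c \<odot>\<^bsub>fun_module K\<^esub> Phi u \<in> CV" using add(1) by (simp add: fun_module_simps Phi_closed)
  ultimately show ?case
    using lin_opD(2)[OF op_lin, of "c \<odot>\<^bsub>fun_module K\<^esub> Phi u" "kap f" l]
      lin_opD(3)[OF op_lin add(1), of "Phi u" l] kap_CV[OF add(2)] by simp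
qed

text \<open>The coordinates of an arbitrary representative. Those below \<open>p\<close> do not
  depend on the choice (\<open>kappa_pi\<close>), which is why the statements below compare vectors
  by \<open>low\<close> instead of equality.\<close>

definition kappa :: "(gen list \<Rightarrow> 'k) set \<Rightarrow> nat \<times> nat \<Rightarrow> 'k" where
  "kappa r = kap (SOME f. f \<in> carrier F \<and> pi f = r)"

definition low :: "(nat \<times> nat \<Rightarrow> 'k) \<Rightarrow> (nat \<times> nat \<Rightarrow> 'k) \<Rightarrow> bool" where
  "low v w \<longleftrightarrow> (\<forall>j<p. \<forall>i<p. v (j, i) = w (j, i))"

lemma low_refl: "low v v" and low_trans: "low u v \<Longrightarrow> low v w \<Longrightarrow> low u w"
  by (auto simp: low_def)

lemma low_opX: "low v w \<Longrightarrow> low (opX v) (opX w)" and low_opy: "low v w \<Longrightarrow> low (opy v) (opy w)"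
  by (auto simp: low_def opX_def opy_def)

lemma kappa_pi: "f \<in> carrier F \<Longrightarrow> low (kappa (pi f)) (kap f)"
proof -
  assume f: "f \<in> carrier F"
  define h where "h = (SOME h. h \<in> carrier F \<and> pi h = pi f)"
  have h: "h \<in> carrier F" "pi h = pi f"
    using someI[of "\<lambda>h. h \<in> carrier F \<and> pi h = pi f" f] f by (auto simp: h_def)
  have d: "h \<ominus>\<^bsub>F\<^esub> f \<in> JI" using pi_eq_iff[OF h(1) f] h(2) by simp
  have "kap h (j, i) = kap f (j, i)" if "j < p" "i < p" for j i
  proof -
    have "\<ominus> \<one> \<otimes> kap f (j, i) \<oplus> kap h (j, i) = \<zero>"
      using kap_JI[OF d that] kap_lin[OF f h(1), of "\<ominus> \<one>" "(j, i)"] by (simp add: F_minus[OF h(1) f])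
    hence "kap h (j, i) \<ominus> kap f (j, i) = \<zero>"
      using kap_closed[OF f] kap_closed[OF h(1)] by (simp add: l_minus a_minus_def a_comm)
    thus ?thesis using kap_closed[OF f] kap_closed[OF h(1)] by simp
  qed
  thus ?thesis by (auto simp: low_def kappa_def h_def[symmetric])
qed

lemma kappa_closed: "r \<in> carrier JR \<Longrightarrow> kappa r b \<in> carrier K"
proof -
  assume "r \<in> carrier JR"
  then obtain f where "f \<in> carrier F \<and> pi f = r" by (auto simp: carrier_JR)
  hence "(SOME f. f \<in> carrier F \<and> pi f = r) \<in> carrier F" using someI[of "\<lambda>f. f \<in> carrier F \<and> pi f = r" f] by blast
  thus ?thesis unfolding kappa_def by (rule kap_closed)
qed

lemma kappa_lin:
  assumes r: "r \<in> carrier JR" and s: "s \<in> carrier JR" and c: "c \<in> carrier K"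
  shows "low (kappa (c \<odot>\<^bsub>JR\<^esub> r \<oplus>\<^bsub>JR\<^esub> s)) (\<lambda>b. c \<otimes> kappa r b \<oplus> kappa s b)"
proof -
  obtain f h where f: "f \<in> carrier F" "r = pi f" and h: "h \<in> carrier F" "s = pi h"
    using r s by (auto simp: carrier_JR)
  have cf: "c \<odot>\<^bsub>F\<^esub> f \<in> carrier F" by (rule F_smult_closed[OF c f(1)])
  have "c \<odot>\<^bsub>JR\<^esub> r \<oplus>\<^bsub>JR\<^esub> s = pi (c \<odot>\<^bsub>F\<^esub> f \<oplus>\<^bsub>F\<^esub> h)" using f h c cf by (simp add: pi_smult pi_hom)
  moreover have "c \<odot>\<^bsub>F\<^esub> f \<oplus>\<^bsub>F\<^esub> h = (\<lambda>w. c \<otimes> f w \<oplus> h w)" by (simp add: FA.F_simps)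
  ultimately show ?thesis
    using kappa_pi[OF F.a_closed[OF cf h(1)]] kappa_pi[OF f(1)] kappa_pi[OF h(1)] kap_lin[OF f(1) h(1) c]
    by (simp add: low_def f(2) h(2))
qed

abbreviation "gx \<equiv> jordan_gen K p gen_x"
abbreviation "gy \<equiv> jordan_gen K p gen_y"
definition gX :: "(gen list \<Rightarrow> 'k) set" where "gX = half \<odot>\<^bsub>JR\<^esub> gx"

lemma gen_pi: "jordan_gen K p l = pi (delta [l])"
  by (simp add: jordan_gen_def pi_def free_gen_delta)

lemma gen_closed: "jordan_gen K p l \<in> carrier JR" "gX \<in> carrier JR"
proof -
  show g: "jordan_gen K p l \<in> carrier JR" for l unfolding gen_pi by (rule pi_closed[OF FA.delta_F])
  show "gX \<in> carrier JR" unfolding gX_def by (rule JR_smult(1)[OF g g half(1) half(1)])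
qed

lemma gen_pow: "jordan_gen K p l [^]\<^bsub>JR\<^esub> (n::nat) = pi (delta (replicate n l))"
proof (induction n)
  case 0 thus ?case using pi_hom(3) by (simp add: FA.F_simps(3))
next
  case (Suc n)
  have "delta (replicate (Suc n) l) = delta (replicate n l) \<otimes>\<^bsub>F\<^esub> delta [l]"
    by (simp add: FA.F_simps(2) FA.conv_delta replicate_append_same)
  thus ?case using Suc by (simp add: gen_pi pi_hom(2) FA.delta_F)
qed

lemma gx_gy_pow: "gx [^]\<^bsub>JR\<^esub> p = \<zero>\<^bsub>JR\<^esub>" "gy [^]\<^bsub>JR\<^esub> p = \<zero>\<^bsub>JR\<^esub>"
  unfolding gen_pow using relations_JI unfolding relations_eq by (intro pi_zero; blast)+

lemma gX_pow_eq: "gX [^]\<^bsub>JR\<^esub> (n::nat) = (half [^] n) \<odot>\<^bsub>JR\<^esub> (gx [^]\<^bsub>JR\<^esub> n)"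
proof (induction n)
  case 0 show ?case using JR_smult(2)[OF R.one_closed R.one_closed one_closed one_closed] by simp
next
  case (Suc n)
  have c: "gx [^]\<^bsub>JR\<^esub> n \<in> carrier JR" "half [^] n \<in> carrier K" using gen_closed half by auto
  have "gX [^]\<^bsub>JR\<^esub> Suc n = (half [^] n \<odot>\<^bsub>JR\<^esub> (gx [^]\<^bsub>JR\<^esub> n)) \<otimes>\<^bsub>JR\<^esub> (half \<odot>\<^bsub>JR\<^esub> gx)"
    using Suc by (simp add: gX_def)
  also have "\<dots> = half \<odot>\<^bsub>JR\<^esub> (half [^] n \<odot>\<^bsub>JR\<^esub> (gx [^]\<^bsub>JR\<^esub> n \<otimes>\<^bsub>JR\<^esub> gx))"
    using c gen_closed(1)[of gen_x] half(1) JR_smult(1)[OF c(1) c(1) c(2) c(2)]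
    by (simp add: JR_smult(4)[OF c(1) _ c(2) c(2)] JR_smult(5)[OF _ gen_closed(1) half(1) half(1)])
  also have "\<dots> = (half [^] Suc n) \<odot>\<^bsub>JR\<^esub> (gx [^]\<^bsub>JR\<^esub> Suc n)"
    using c gen_closed(1)[of gen_x] half(1) JR_smult(8)[of "gx [^]\<^bsub>JR\<^esub> n \<otimes>\<^bsub>JR\<^esub> gx" "gx" half "half [^] n"]
    by (simp add: m_comm)
  finally show ?case .
qed

lemma gX_pow: "gX [^]\<^bsub>JR\<^esub> p = \<zero>\<^bsub>JR\<^esub>"
proof -
  have "c \<odot>\<^bsub>JR\<^esub> \<zero>\<^bsub>JR\<^esub> = \<zero>\<^bsub>JR\<^esub>" if "c \<in> carrier K" for c
    using JR_smult(5)[OF R.zero_closed R.zero_closed that that] JR_smult(1)[OF R.zero_closed R.zero_closed that that]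
    by (metis R.l_null R.r_null JR_smult(4) R.zero_closed that)
  thus ?thesis using half by (simp add: gX_pow_eq gx_gy_pow)
qed

lemma gx_eq: "gx = gX \<oplus>\<^bsub>JR\<^esub> gX"
  using JR_smult(7)[OF gen_closed(1)[of gen_x] gen_closed(1)[of gen_x] half(1) half(1)]
    JR_smult(2)[OF gen_closed(1)[of gen_x] gen_closed(1) half(1) half(1)] half(3)
  by (simp add: gX_def)

text \<open>Half of the defining relation: in terms of \<open>X = x / 2\<close> the coefficient of
  the square becomes one.\<close>

lemma gy_gX: "gy \<otimes>\<^bsub>JR\<^esub> gX = gX \<otimes>\<^bsub>JR\<^esub> gy \<oplus>\<^bsub>JR\<^esub> gX \<otimes>\<^bsub>JR\<^esub> gX"
proof -
  let ?r = "half \<odot>\<^bsub>F\<^esub> delta [gen_x, gen_x]"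
  have rc: "?r \<in> carrier F" by (intro F_smult_closed half FA.delta_F)
  have d: "delta [gen_x, gen_y] \<in> carrier F" "delta [gen_y, gen_x] \<in> carrier F" by (rule FA.delta_F)+
  have "(delta [gen_y, gen_x] \<ominus>\<^bsub>F\<^esub> delta [gen_x, gen_y]) \<ominus>\<^bsub>F\<^esub> ?r \<in> JI"
    using relations_JI relations_eq by blast
  hence "pi (delta [gen_y, gen_x] \<ominus>\<^bsub>F\<^esub> delta [gen_x, gen_y]) = pi ?r"
    using pi_eq_iff[OF F.minus_closed[OF d(2,1)] rc] by simp
  moreover have "delta [gen_y, gen_x] = (delta [gen_y, gen_x] \<ominus>\<^bsub>F\<^esub> delta [gen_x, gen_y]) \<oplus>\<^bsub>F\<^esub> delta [gen_x, gen_y]"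
    using d by (simp add: a_minus_def F.a_assoc F.l_neg)
  ultimately have "pi (delta [gen_y, gen_x]) = pi ?r \<oplus>\<^bsub>JR\<^esub> pi (delta [gen_x, gen_y])"
    using pi_hom(1)[OF F.minus_closed[OF d(2,1)] d(1)] by simp
  hence rel: "gy \<otimes>\<^bsub>JR\<^esub> gx = half \<odot>\<^bsub>JR\<^esub> (gx \<otimes>\<^bsub>JR\<^esub> gx) \<oplus>\<^bsub>JR\<^esub> gx \<otimes>\<^bsub>JR\<^esub> gy"
    using half by (simp add: gen_pi pi_hom(2)[symmetric] FA.delta_F FA.F_simps(2) FA.conv_delta pi_smult)
  note x = gen_closed(1)[of gen_x] and y = gen_closed(1)[of gen_y] and h = half(1)
  have xx: "gx \<otimes>\<^bsub>JR\<^esub> gx \<in> carrier JR" and xy: "gx \<otimes>\<^bsub>JR\<^esub> gy \<in> carrier JR" using x y by auto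
  have "gy \<otimes>\<^bsub>JR\<^esub> gX = half \<odot>\<^bsub>JR\<^esub> (half \<odot>\<^bsub>JR\<^esub> (gx \<otimes>\<^bsub>JR\<^esub> gx)) \<oplus>\<^bsub>JR\<^esub> half \<odot>\<^bsub>JR\<^esub> (gx \<otimes>\<^bsub>JR\<^esub> gy)"
    unfolding gX_def JR_smult(5)[OF y x h h] rel
    by (rule JR_smult(6)[OF JR_smult(1)[OF xx xx h h] xy h h])
  also have "half \<odot>\<^bsub>JR\<^esub> (half \<odot>\<^bsub>JR\<^esub> (gx \<otimes>\<^bsub>JR\<^esub> gx)) = gX \<otimes>\<^bsub>JR\<^esub> gX"
    unfolding gX_def JR_smult(4)[OF x JR_smult(1)[OF x x h h] h h] JR_smult(5)[OF x x h h] ..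
  also have "half \<odot>\<^bsub>JR\<^esub> (gx \<otimes>\<^bsub>JR\<^esub> gy) = gX \<otimes>\<^bsub>JR\<^esub> gy"
    unfolding gX_def JR_smult(4)[OF x y h h] ..
  finally show ?thesis using gen_closed by (simp add: R.a_comm)
qed

lemma kappa_gy: "r \<in> carrier JR \<Longrightarrow> low (kappa (r \<otimes>\<^bsub>JR\<^esub> gy)) (opy (kappa r))"
proof -
  assume "r \<in> carrier JR"
  then obtain f where f: "f \<in> carrier F" "r = pi f" by (auto simp: carrier_JR)
  have "r \<otimes>\<^bsub>JR\<^esub> gy = pi (f \<otimes>\<^bsub>F\<^esub> delta [gen_y])" using f by (simp add: gen_pi pi_hom(2) FA.delta_F)
  hence "low (kappa (r \<otimes>\<^bsub>JR\<^esub> gy)) (opy (kap f))"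
    using kappa_pi[OF F.m_closed[OF f(1) FA.delta_F[of "[gen_y]"]]] kap_mult_gen[OF f(1), of gen_y] by (simp add: op_def)
  moreover have "low (opy (kap f)) (opy (kappa r))"
    using low_opy[OF kappa_pi[OF f(1)]] f(2) by (simp add: low_def)
  ultimately show ?thesis by (rule low_trans)
qed

lemma kappa_gX: "r \<in> carrier JR \<Longrightarrow> low (kappa (r \<otimes>\<^bsub>JR\<^esub> gX)) (opX (kappa r))"
proof -
  assume "r \<in> carrier JR"
  then obtain f where f: "f \<in> carrier F" "r = pi f" by (auto simp: carrier_JR)
  have fx: "f \<otimes>\<^bsub>F\<^esub> delta [gen_x] \<in> carrier F" by (intro F.m_closed f FA.delta_F)
  have "r \<otimes>\<^bsub>JR\<^esub> gX = pi (half \<odot>\<^bsub>F\<^esub> (f \<otimes>\<^bsub>F\<^esub> delta [gen_x]))"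
    using f half(1) by (simp add: gX_def gen_pi pi_smult pi_hom(2)[symmetric] F_smult_closed FA.delta_F F_smult_mult)
  moreover have "kap (half \<odot>\<^bsub>F\<^esub> (f \<otimes>\<^bsub>F\<^esub> delta [gen_x])) = opX (kap f)"
  proof
    fix b
    have "half \<odot>\<^bsub>F\<^esub> (f \<otimes>\<^bsub>F\<^esub> delta [gen_x]) = (\<lambda>w. half \<otimes> (f \<otimes>\<^bsub>F\<^esub> delta [gen_x]) w \<oplus> \<zero>\<^bsub>F\<^esub> w)"
      using fx half(1) by (auto simp: FA.F_simps(1,4,6))
    hence "kap (half \<odot>\<^bsub>F\<^esub> (f \<otimes>\<^bsub>F\<^esub> delta [gen_x])) b = half \<otimes> kap (f \<otimes>\<^bsub>F\<^esub> delta [gen_x]) b \<oplus> kap \<zero>\<^bsub>F\<^esub> b"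
      using kap_lin[OF fx F.zero_closed half(1)] by simp
    also have "kap \<zero>\<^bsub>F\<^esub> b = \<zero>" by (simp add: kap_def FA.F_simps(4) FA.pair_zero)
    also have "kap (f \<otimes>\<^bsub>F\<^esub> delta [gen_x]) b = (\<one> \<oplus> \<one>) \<otimes> opX (kap f) b"
      by (simp add: kap_mult_gen[OF f(1)] op_def fun_module_simps)
    also have "half \<otimes> ((\<one> \<oplus> \<one>) \<otimes> opX (kap f) b) \<oplus> \<zero> = opX (kap f) b"
      using vc[OF lin_opD(1)[OF opX_lin kap_CV[OF f(1)]]] half by (simp add: m_assoc[symmetric])
    finally show "kap (half \<odot>\<^bsub>F\<^esub> (f \<otimes>\<^bsub>F\<^esub> delta [gen_x])) b = opX (kap f) b" .
  qed
  ultimately have "low (kappa (r \<otimes>\<^bsub>JR\<^esub> gX)) (opX (kap f))"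
    using kappa_pi[OF F_smult_closed[OF half(1) fx]] by simp
  moreover have "low (opX (kap f)) (opX (kappa r))"
    using low_opX[OF kappa_pi[OF f(1)]] f(2) by (simp add: low_def)
  ultimately show ?thesis by (rule low_trans)
qed

lemma kappa_one: "low (kappa \<one>\<^bsub>JR\<^esub>) e00"
proof -
  have "\<one>\<^bsub>JR\<^esub> = pi (delta [])" using pi_hom(3) by (simp add: FA.F_simps(3))
  moreover have "kap (delta []) b = Phi [] b" for b unfolding kap_def by (intro FA.pair_delta Phi_closed)
  hence "kap (delta []) = e00" by (auto simp: Phi_def)
  ultimately show ?thesis using kappa_pi[OF FA.delta_F, of "[]"] by simp
qed

lemma kappa_gy_pow: "r \<in> carrier JR \<Longrightarrow> low (kappa (r \<otimes>\<^bsub>JR\<^esub> gy [^]\<^bsub>JR\<^esub> (n::nat))) ((opy ^^ n) (kappa r))"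
proof (induction n)
  case (Suc n)
  have c: "r \<otimes>\<^bsub>JR\<^esub> gy [^]\<^bsub>JR\<^esub> n \<in> carrier JR" using Suc.prems gen_closed by auto
  have "r \<otimes>\<^bsub>JR\<^esub> gy [^]\<^bsub>JR\<^esub> Suc n = (r \<otimes>\<^bsub>JR\<^esub> gy [^]\<^bsub>JR\<^esub> n) \<otimes>\<^bsub>JR\<^esub> gy"
    using Suc.prems gen_closed by (simp add: R.m_assoc)
  thus ?case using low_trans[OF kappa_gy[OF c] low_opy[OF Suc.IH[OF Suc.prems]]] by simp
qed (simp add: low_refl)

lemma kappa_gX_pow: "r \<in> carrier JR \<Longrightarrow> low (kappa (r \<otimes>\<^bsub>JR\<^esub> gX [^]\<^bsub>JR\<^esub> (n::nat))) ((opX ^^ n) (kappa r))"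
proof (induction n)
  case (Suc n)
  have c: "r \<otimes>\<^bsub>JR\<^esub> gX [^]\<^bsub>JR\<^esub> n \<in> carrier JR" using Suc.prems gen_closed by auto
  have "r \<otimes>\<^bsub>JR\<^esub> gX [^]\<^bsub>JR\<^esub> Suc n = (r \<otimes>\<^bsub>JR\<^esub> gX [^]\<^bsub>JR\<^esub> n) \<otimes>\<^bsub>JR\<^esub> gX"
    using Suc.prems gen_closed by (simp add: R.m_assoc)
  thus ?case using low_trans[OF kappa_gX[OF c] low_opX[OF Suc.IH[OF Suc.prems]]] by simp
qed (simp add: low_refl)

section \<open>The monomials \<open>y^j X^i\<close> with exponents below \<open>p\<close> as a
  basis\<close>

definition mon :: "nat \<times> nat \<Rightarrow> (gen list \<Rightarrow> 'k) set" where
  "mon = (\<lambda>(j, i). gy [^]\<^bsub>JR\<^esub> j \<otimes>\<^bsub>JR\<^esub> gX [^]\<^bsub>JR\<^esub> i)"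

lemma mon_closed: "mon b \<in> carrier JR"
  using gen_closed by (cases b) (simp add: mon_def)

lemma kappa_mon: "low (kappa (mon (j, i))) (\<lambda>b. if b = (j, i) then \<one> else \<zero>)"
proof -
  have yj: "gy [^]\<^bsub>JR\<^esub> j \<in> carrier JR" using gen_closed by simp
  have op_pow: "low ((opy ^^ n) v) ((opy ^^ n) w)" "low ((opX ^^ n) v) ((opX ^^ n) w)" if "low v w" for v w n
    using that by (induction n) (auto intro: low_opX low_opy)
  have "low (kappa (gy [^]\<^bsub>JR\<^esub> j)) ((opy ^^ j) e00)"
    using low_trans[OF kappa_gy_pow[OF R.one_closed, of j] op_pow(1)[OF kappa_one]] yj by simp
  hence "low (kappa (mon (j, i))) ((opX ^^ i) ((opy ^^ j) e00))"
    using low_trans[OF kappa_gX_pow[OF yj] op_pow(2)] by (simp add: mon_def)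
  moreover have "(opX ^^ i) ((opy ^^ j) e00) = (\<lambda>b. if b = (j, i) then \<one> else \<zero>)"
    unfolding opX_pow opy_pow_e00 by (auto simp: fun_eq_iff)
  ultimately show ?thesis by simp
qed

abbreviation "PP \<equiv> {..<p} \<times> {..<p}"

text \<open>Prescribing the coefficients to be the coordinates \<open>kappa\<close> turns spanning
  into an explicit expansion, from which divisibility can be read off monomial by monomial.\<close>

definition spanned :: "(gen list \<Rightarrow> 'k) set set" where
  "spanned = {r \<in> carrier JR. r = (\<Oplus>\<^bsub>JR\<^esub>b\<in>PP. kappa r b \<odot>\<^bsub>JR\<^esub> mon b)}"

lemma spanned_lin:
  assumes r: "r \<in> spanned" and s: "s \<in> spanned" and c: "c \<in> carrier K"
  shows "c \<odot>\<^bsub>JR\<^esub> r \<oplus>\<^bsub>JR\<^esub> s \<in> spanned"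
proof -
  have rc: "r \<in> carrier JR" and sc: "s \<in> carrier JR" using r s by (auto simp: spanned_def)
  note m = mon_closed
  have t: "kappa r b \<odot>\<^bsub>JR\<^esub> mon b \<in> carrier JR" "kappa s b \<odot>\<^bsub>JR\<^esub> mon b \<in> carrier JR" for b
    using JR_smult(1)[OF m m kappa_closed[OF rc] kappa_closed[OF rc]]
      JR_smult(1)[OF m m kappa_closed[OF sc] kappa_closed[OF sc]] by auto
  have ct: "c \<odot>\<^bsub>JR\<^esub> (kappa r b \<odot>\<^bsub>JR\<^esub> mon b) \<in> carrier JR" for b using JR_smult(1)[OF t(1) t(1) c c] .
  have hom: "c \<odot>\<^bsub>JR\<^esub> (\<Oplus>\<^bsub>JR\<^esub>b\<in>B. kappa r b \<odot>\<^bsub>JR\<^esub> mon b) = (\<Oplus>\<^bsub>JR\<^esub>b\<in>B. c \<odot>\<^bsub>JR\<^esub> (kappa r b \<odot>\<^bsub>JR\<^esub> mon b))"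
    if "finite B" for B
    using that
  proof (induction B)
    case empty
    have "c \<odot>\<^bsub>JR\<^esub> \<zero>\<^bsub>JR\<^esub> = \<zero>\<^bsub>JR\<^esub>"
      using JR_smult(4)[OF R.zero_closed R.zero_closed c c] JR_smult(1)[OF R.zero_closed R.zero_closed c c] by simp
    thus ?case by simp
  next
    case (insert b B)
    have "(\<Oplus>\<^bsub>JR\<^esub>b\<in>B. kappa r b \<odot>\<^bsub>JR\<^esub> mon b) \<in> carrier JR" using t by (intro R.finsum_closed) auto
    thus ?case using insert t ct by (simp add: R.finsum_insert JR_smult(6)[OF _ _ c c])
  qed
  have "c \<odot>\<^bsub>JR\<^esub> r \<oplus>\<^bsub>JR\<^esub> s = (\<Oplus>\<^bsub>JR\<^esub>b\<in>PP. c \<odot>\<^bsub>JR\<^esub> (kappa r b \<odot>\<^bsub>JR\<^esub> mon b)) \<oplus>\<^bsub>JR\<^esub>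
      (\<Oplus>\<^bsub>JR\<^esub>b\<in>PP. kappa s b \<odot>\<^bsub>JR\<^esub> mon b)"
    using r s hom[of PP] by (simp add: spanned_def)
  also have "\<dots> = (\<Oplus>\<^bsub>JR\<^esub>b\<in>PP. c \<odot>\<^bsub>JR\<^esub> (kappa r b \<odot>\<^bsub>JR\<^esub> mon b) \<oplus>\<^bsub>JR\<^esub> kappa s b \<odot>\<^bsub>JR\<^esub> mon b)"
    using ct t by (intro R.finsum_addf[symmetric]) auto
  also have "\<dots> = (\<Oplus>\<^bsub>JR\<^esub>b\<in>PP. kappa (c \<odot>\<^bsub>JR\<^esub> r \<oplus>\<^bsub>JR\<^esub> s) b \<odot>\<^bsub>JR\<^esub> mon b)"
  proof (rule R.finsum_cong'[OF refl])
    have rs: "c \<odot>\<^bsub>JR\<^esub> r \<oplus>\<^bsub>JR\<^esub> s \<in> carrier JR" using JR_smult(1)[OF rc rc c c] sc by simp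
    show "(\<lambda>b. kappa (c \<odot>\<^bsub>JR\<^esub> r \<oplus>\<^bsub>JR\<^esub> s) b \<odot>\<^bsub>JR\<^esub> mon b) \<in> PP \<rightarrow> carrier JR"
      using JR_smult(1)[OF m m kappa_closed[OF rs] kappa_closed[OF rs]] by auto
    fix b assume "b \<in> PP"
    hence "kappa (c \<odot>\<^bsub>JR\<^esub> r \<oplus>\<^bsub>JR\<^esub> s) b = c \<otimes> kappa r b \<oplus> kappa s b"
      using kappa_lin[OF rc sc c] by (auto simp: low_def)
    thus "c \<odot>\<^bsub>JR\<^esub> (kappa r b \<odot>\<^bsub>JR\<^esub> mon b) \<oplus>\<^bsub>JR\<^esub> kappa s b \<odot>\<^bsub>JR\<^esub> mon b =
        kappa (c \<odot>\<^bsub>JR\<^esub> r \<oplus>\<^bsub>JR\<^esub> s) b \<odot>\<^bsub>JR\<^esub> mon b"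
      using JR_smult(7)[OF m m m_closed[OF c kappa_closed[OF rc]] kappa_closed[OF sc]]
        JR_smult(8)[OF m m c kappa_closed[OF rc]] by simp
  qed
  finally show ?thesis using JR_smult(1)[OF rc rc c c] sc by (simp add: spanned_def)
qed

end

context jordan
begin

lemma JR_mon_term:
  assumes r: "r \<in> carrier JR"
  shows "kappa r b \<odot>\<^bsub>JR\<^esub> mon b \<in> carrier JR"
  by (rule JR_smult(1)[OF mon_closed mon_closed kappa_closed[OF r] kappa_closed[OF r]])

text \<open>For a set closed under linear combinations, membership may be tested on the monomials
  that actually occur in \<open>r\<close>.\<close>

lemma spanned_memI:
  assumes r: "r \<in> spanned" and zero: "\<zero>\<^bsub>JR\<^esub> \<in> L"
    and lin: "\<And>c r s. c \<in> carrier K \<Longrightarrow> r \<in> L \<Longrightarrow> s \<in> L \<Longrightarrow> c \<odot>\<^bsub>JR\<^esub> r \<oplus>\<^bsub>JR\<^esub> s \<in> L"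
    and mon: "\<And>j i. j < p \<Longrightarrow> i < p \<Longrightarrow> kappa r (j, i) = \<zero> \<or> mon (j, i) \<in> L"
  shows "r \<in> L"
proof -
  have rc: "r \<in> carrier JR" using r by (simp add: spanned_def)
  have "(\<Oplus>\<^bsub>JR\<^esub>b\<in>B. kappa r b \<odot>\<^bsub>JR\<^esub> mon b) \<in> L" if "finite B" "B \<subseteq> PP" for B
    using that
  proof (induction B)
    case (insert b B)
    have sc: "(\<Oplus>\<^bsub>JR\<^esub>b\<in>B. kappa r b \<odot>\<^bsub>JR\<^esub> mon b) \<in> carrier JR"
      using JR_mon_term[OF rc] by (intro R.finsum_closed) auto
    have eq: "(\<Oplus>\<^bsub>JR\<^esub>b\<in>insert b B. kappa r b \<odot>\<^bsub>JR\<^esub> mon b) =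
        kappa r b \<odot>\<^bsub>JR\<^esub> mon b \<oplus>\<^bsub>JR\<^esub> (\<Oplus>\<^bsub>JR\<^esub>b\<in>B. kappa r b \<odot>\<^bsub>JR\<^esub> mon b)"
      using insert.hyps JR_mon_term[OF rc] by (intro R.finsum_insert) auto
    have IH: "(\<Oplus>\<^bsub>JR\<^esub>b\<in>B. kappa r b \<odot>\<^bsub>JR\<^esub> mon b) \<in> L" using insert by simp
    from insert.prems mon consider "kappa r b = \<zero>" | "mon b \<in> L" by (cases b) auto
    thus ?case
    proof cases
      case 1
      thus ?thesis unfolding eq using IH sc JR_smult(3)[OF mon_closed mon_closed zero_closed zero_closed] by simp
    next
      case 2
      thus ?thesis unfolding eq using IH by (intro lin kappa_closed rc)
    qed
  qed (simp add: zero)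
  from this[of PP] show ?thesis using r by (simp add: spanned_def)
qed

lemma gen_pow_zero: "p \<le> n \<Longrightarrow> gy [^]\<^bsub>JR\<^esub> n = \<zero>\<^bsub>JR\<^esub>" "p \<le> n \<Longrightarrow> gX [^]\<^bsub>JR\<^esub> n = \<zero>\<^bsub>JR\<^esub>"
proof -
  assume n: "p \<le> n"
  have "gy [^]\<^bsub>JR\<^esub> n = gy [^]\<^bsub>JR\<^esub> p \<otimes>\<^bsub>JR\<^esub> gy [^]\<^bsub>JR\<^esub> (n - p)"
    using R.nat_pow_mult[OF gen_closed(1), of gen_y p "n - p"] n by simp
  thus "gy [^]\<^bsub>JR\<^esub> n = \<zero>\<^bsub>JR\<^esub>" using gen_closed by (simp add: gx_gy_pow)
  have "gX [^]\<^bsub>JR\<^esub> n = gX [^]\<^bsub>JR\<^esub> p \<otimes>\<^bsub>JR\<^esub> gX [^]\<^bsub>JR\<^esub> (n - p)"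
    using R.nat_pow_mult[OF gen_closed(2), of p "n - p"] n by simp
  thus "gX [^]\<^bsub>JR\<^esub> n = \<zero>\<^bsub>JR\<^esub>" using gen_closed by (simp add: gX_pow)
qed

lemma mon_spanned_low:
  assumes b: "b \<in> PP"
  shows "mon b \<in> spanned"
proof -
  have "(\<Oplus>\<^bsub>JR\<^esub>c\<in>PP. kappa (mon b) c \<odot>\<^bsub>JR\<^esub> mon c) = (\<Oplus>\<^bsub>JR\<^esub>c\<in>PP. if b = c then mon c else \<zero>\<^bsub>JR\<^esub>)"
  proof (rule R.finsum_cong'[OF refl])
    show "(\<lambda>c. if b = c then mon c else \<zero>\<^bsub>JR\<^esub>) \<in> PP \<rightarrow> carrier JR" using mon_closed by simp
    fix c assume "c \<in> PP"
    hence "kappa (mon b) c = (if b = c then \<one> else \<zero>)"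
      using kappa_mon[of "fst b" "snd b"] by (cases c) (auto simp: low_def)
    thus "kappa (mon b) c \<odot>\<^bsub>JR\<^esub> mon c = (if b = c then mon c else \<zero>\<^bsub>JR\<^esub>)"
      using JR_smult(2)[OF mon_closed mon_closed one_closed one_closed]
        JR_smult(3)[OF mon_closed mon_closed one_closed one_closed] by simp
  qed
  also have "\<dots> = mon b"
    using R.finsum_singleton[OF b, of mon] mon_closed by simp
  finally show ?thesis using mon_closed by (simp add: spanned_def)
qed

lemma zero_spanned: "\<zero>\<^bsub>JR\<^esub> \<in> spanned"
proof -
  have m: "mon (0, 0) \<in> spanned" using prime_gt_0_nat[OF p] by (intro mon_spanned_low) auto
  have "\<ominus> \<one> \<odot>\<^bsub>JR\<^esub> mon (0, 0) \<oplus>\<^bsub>JR\<^esub> mon (0, 0) = (\<ominus> \<one> \<oplus> \<one>) \<odot>\<^bsub>JR\<^esub> mon (0, 0)"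
    using JR_smult(7)[OF mon_closed mon_closed a_inv_closed[OF one_closed] one_closed, of "(0, 0)"]
      JR_smult(2)[OF mon_closed mon_closed one_closed one_closed, of "(0, 0)"] by simp
  also have "\<dots> = \<zero>\<^bsub>JR\<^esub>"
    using JR_smult(3)[OF mon_closed mon_closed one_closed one_closed, of "(0, 0)"] by (simp add: l_neg)
  finally show ?thesis using spanned_lin[OF m m a_inv_closed[OF one_closed]] by simp
qed

lemma mon_spanned: "mon b \<in> spanned"
proof (cases "b \<in> PP")
  case False
  hence "mon b = \<zero>\<^bsub>JR\<^esub>" using gen_closed by (cases b) (auto simp: mon_def gen_pow_zero not_less)
  thus ?thesis by (simp add: zero_spanned)
qed (rule mon_spanned_low)

text \<open>The scalar is \<open>- n\<close>, one unit for each \<open>X\<close> that passes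
  \<open>y\<close>; only its existence is used afterwards.\<close>

lemma gX_pow_gy:
  "\<exists>c\<in>carrier K. gX [^]\<^bsub>JR\<^esub> (n::nat) \<otimes>\<^bsub>JR\<^esub> gy = c \<odot>\<^bsub>JR\<^esub> (gX [^]\<^bsub>JR\<^esub> Suc n) \<oplus>\<^bsub>JR\<^esub> gy \<otimes>\<^bsub>JR\<^esub> gX [^]\<^bsub>JR\<^esub> n"
proof (induction n)
  case 0
  show ?case using JR_smult(3)[OF gen_closed(2,2) zero_closed zero_closed] gen_closed by (intro bexI[of _ \<zero>]) auto
next
  case (Suc n)
  note g = gen_closed(2) gen_closed(1)[of gen_y]
  then obtain c where c: "c \<in> carrier K"
    "gX [^]\<^bsub>JR\<^esub> n \<otimes>\<^bsub>JR\<^esub> gy = c \<odot>\<^bsub>JR\<^esub> (gX [^]\<^bsub>JR\<^esub> Suc n) \<oplus>\<^bsub>JR\<^esub> gy \<otimes>\<^bsub>JR\<^esub> gX [^]\<^bsub>JR\<^esub> n"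
    using Suc by blast
  let ?P = "\<lambda>n::nat. gX [^]\<^bsub>JR\<^esub> n" and ?m = "\<lambda>a. \<ominus> \<one> \<odot>\<^bsub>JR\<^esub> a"
  have P: "?P n \<in> carrier JR" for n using g by simp
  have neg: "?m (gX \<otimes>\<^bsub>JR\<^esub> gX) \<oplus>\<^bsub>JR\<^esub> gX \<otimes>\<^bsub>JR\<^esub> gX = \<zero>\<^bsub>JR\<^esub>"
  proof -
    have X2: "gX \<otimes>\<^bsub>JR\<^esub> gX \<in> carrier JR" using g by simp
    show ?thesis
      using JR_smult(7)[OF X2 X2 a_inv_closed[OF one_closed] one_closed] JR_smult(2)[OF X2 X2 one_closed one_closed]
        JR_smult(3)[OF X2 X2 one_closed one_closed] by (simp add: l_neg)
  qed
  have m1: "\<ominus> \<one> \<in> carrier K" by simp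
  have mX: "?m (gX \<otimes>\<^bsub>JR\<^esub> gX) \<in> carrier JR" using JR_smult(1)[OF R.m_closed[OF g(1,1)] g(1) m1 m1] .
  have "gX \<otimes>\<^bsub>JR\<^esub> gy = ?m (gX \<otimes>\<^bsub>JR\<^esub> gX) \<oplus>\<^bsub>JR\<^esub> (gX \<otimes>\<^bsub>JR\<^esub> gX \<oplus>\<^bsub>JR\<^esub> gX \<otimes>\<^bsub>JR\<^esub> gy)"
    using g mX neg by (simp add: R.a_assoc[symmetric])
  hence Xy: "gX \<otimes>\<^bsub>JR\<^esub> gy = ?m (gX \<otimes>\<^bsub>JR\<^esub> gX) \<oplus>\<^bsub>JR\<^esub> gy \<otimes>\<^bsub>JR\<^esub> gX"
    using g by (simp add: gy_gX R.a_comm)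
  have Pg: "?P n \<otimes>\<^bsub>JR\<^esub> (gX \<otimes>\<^bsub>JR\<^esub> gX) = ?P (Suc (Suc n))" using g P by (simp add: R.m_assoc)
  have cP: "c \<odot>\<^bsub>JR\<^esub> ?P (Suc n) \<in> carrier JR" by (rule JR_smult(1)[OF P P c(1) c(1)])
  have "?P (Suc n) \<otimes>\<^bsub>JR\<^esub> gy = ?P n \<otimes>\<^bsub>JR\<^esub> (gX \<otimes>\<^bsub>JR\<^esub> gy)" using g P by (simp add: R.m_assoc)
  also have "\<dots> = ?P n \<otimes>\<^bsub>JR\<^esub> ?m (gX \<otimes>\<^bsub>JR\<^esub> gX) \<oplus>\<^bsub>JR\<^esub> (?P n \<otimes>\<^bsub>JR\<^esub> gy) \<otimes>\<^bsub>JR\<^esub> gX"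
    unfolding Xy using g P mX by (simp add: R.r_distr R.m_assoc)
  also have "?P n \<otimes>\<^bsub>JR\<^esub> ?m (gX \<otimes>\<^bsub>JR\<^esub> gX) = ?m (?P (Suc (Suc n)))"
    unfolding JR_smult(5)[OF P R.m_closed[OF g(1,1)] m1 m1] Pg ..
  also have "(?P n \<otimes>\<^bsub>JR\<^esub> gy) \<otimes>\<^bsub>JR\<^esub> gX = c \<odot>\<^bsub>JR\<^esub> ?P (Suc (Suc n)) \<oplus>\<^bsub>JR\<^esub> gy \<otimes>\<^bsub>JR\<^esub> ?P (Suc n)"
    unfolding c(2) using g P cP JR_smult(4)[OF P g(1) c(1) c(1), of "Suc n"] by (simp add: R.l_distr R.m_assoc)
  also have "?m (?P (Suc (Suc n))) \<oplus>\<^bsub>JR\<^esub> (c \<odot>\<^bsub>JR\<^esub> ?P (Suc (Suc n)) \<oplus>\<^bsub>JR\<^esub> gy \<otimes>\<^bsub>JR\<^esub> ?P (Suc n)) =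
      (\<ominus> \<one> \<oplus> c) \<odot>\<^bsub>JR\<^esub> ?P (Suc (Suc n)) \<oplus>\<^bsub>JR\<^esub> gy \<otimes>\<^bsub>JR\<^esub> ?P (Suc n)"
    unfolding JR_smult(7)[OF P P m1 c(1)]
    by (rule R.a_assoc[symmetric, OF JR_smult(1)[OF P P m1 m1] JR_smult(1)[OF P P c(1) c(1)] R.m_closed[OF g(2) P]])
  finally show ?case using c(1) by (intro bexI[of _ "\<ominus> \<one> \<oplus> c"]) simp_all
qed

lemma spanned_mult:
  assumes r: "r \<in> spanned" and s: "s \<in> carrier JR" and m: "\<And>b. mon b \<otimes>\<^bsub>JR\<^esub> s \<in> spanned"
  shows "r \<otimes>\<^bsub>JR\<^esub> s \<in> spanned"
proof -
  have "r \<in> {r \<in> carrier JR. r \<otimes>\<^bsub>JR\<^esub> s \<in> spanned}"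
  proof (rule spanned_memI[OF r])
    show "\<zero>\<^bsub>JR\<^esub> \<in> {r \<in> carrier JR. r \<otimes>\<^bsub>JR\<^esub> s \<in> spanned}" using s by (simp add: zero_spanned)
    show "kappa r (j, i) = \<zero> \<or> mon (j, i) \<in> {r \<in> carrier JR. r \<otimes>\<^bsub>JR\<^esub> s \<in> spanned}" for j i
      using m mon_closed by blast
    fix c u v assume c: "c \<in> carrier K" and u: "u \<in> {r \<in> carrier JR. r \<otimes>\<^bsub>JR\<^esub> s \<in> spanned}"
      and v: "v \<in> {r \<in> carrier JR. r \<otimes>\<^bsub>JR\<^esub> s \<in> spanned}"
    hence uv: "u \<in> carrier JR" "v \<in> carrier JR" by auto
    have cu: "c \<odot>\<^bsub>JR\<^esub> u \<in> carrier JR" by (rule JR_smult(1)[OF uv c c])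
    have "(c \<odot>\<^bsub>JR\<^esub> u \<oplus>\<^bsub>JR\<^esub> v) \<otimes>\<^bsub>JR\<^esub> s = c \<odot>\<^bsub>JR\<^esub> (u \<otimes>\<^bsub>JR\<^esub> s) \<oplus>\<^bsub>JR\<^esub> v \<otimes>\<^bsub>JR\<^esub> s"
      using cu uv s by (simp add: R.l_distr JR_smult(4)[OF uv(1) s c c])
    thus "c \<odot>\<^bsub>JR\<^esub> u \<oplus>\<^bsub>JR\<^esub> v \<in> {r \<in> carrier JR. r \<otimes>\<^bsub>JR\<^esub> s \<in> spanned}"
      using spanned_lin[OF _ _ c] u v cu by simp
  qed
  thus ?thesis by simp
qed

lemma spanned_mult_gen:
  assumes r: "r \<in> spanned"
  shows "r \<otimes>\<^bsub>JR\<^esub> jordan_gen K p l \<in> spanned"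
proof -
  have rc: "r \<in> carrier JR" using r by (simp add: spanned_def)
  note g = gen_closed(2) gen_closed(1)[of gen_y]
  have X: "r \<otimes>\<^bsub>JR\<^esub> gX \<in> spanned"
  proof (rule spanned_mult[OF r g(1)])
    fix b :: "nat \<times> nat" obtain j i where b: "b = (j, i)" by (cases b)
    have "mon b \<otimes>\<^bsub>JR\<^esub> gX = mon (j, Suc i)" using g by (simp add: b mon_def R.m_assoc)
    thus "mon b \<otimes>\<^bsub>JR\<^esub> gX \<in> spanned" by (simp add: mon_spanned)
  qed
  have Y: "r \<otimes>\<^bsub>JR\<^esub> gy \<in> spanned"
  proof (rule spanned_mult[OF r g(2)])
    fix b :: "nat \<times> nat" obtain j i where b: "b = (j, i)" by (cases b)
    have P: "gX [^]\<^bsub>JR\<^esub> n \<in> carrier JR" "gy [^]\<^bsub>JR\<^esub> n \<in> carrier JR" for n :: nat using g by auto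
    obtain c where c: "c \<in> carrier K"
      "gX [^]\<^bsub>JR\<^esub> i \<otimes>\<^bsub>JR\<^esub> gy = c \<odot>\<^bsub>JR\<^esub> (gX [^]\<^bsub>JR\<^esub> Suc i) \<oplus>\<^bsub>JR\<^esub> gy \<otimes>\<^bsub>JR\<^esub> gX [^]\<^bsub>JR\<^esub> i"
      using gX_pow_gy by blast
    have cP: "c \<odot>\<^bsub>JR\<^esub> (gX [^]\<^bsub>JR\<^esub> Suc i) \<in> carrier JR" by (rule JR_smult(1)[OF P(1) P(1) c(1) c(1)])
    have "mon b \<otimes>\<^bsub>JR\<^esub> gy = gy [^]\<^bsub>JR\<^esub> j \<otimes>\<^bsub>JR\<^esub> (gX [^]\<^bsub>JR\<^esub> i \<otimes>\<^bsub>JR\<^esub> gy)" using g by (simp add: b mon_def R.m_assoc)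
    also have "\<dots> = gy [^]\<^bsub>JR\<^esub> j \<otimes>\<^bsub>JR\<^esub> (c \<odot>\<^bsub>JR\<^esub> (gX [^]\<^bsub>JR\<^esub> Suc i)) \<oplus>\<^bsub>JR\<^esub> gy [^]\<^bsub>JR\<^esub> j \<otimes>\<^bsub>JR\<^esub> (gy \<otimes>\<^bsub>JR\<^esub> gX [^]\<^bsub>JR\<^esub> i)"
      unfolding c(2) by (intro R.r_distr cP P R.m_closed g)
    also have "gy [^]\<^bsub>JR\<^esub> j \<otimes>\<^bsub>JR\<^esub> (c \<odot>\<^bsub>JR\<^esub> (gX [^]\<^bsub>JR\<^esub> Suc i)) = c \<odot>\<^bsub>JR\<^esub> mon (j, Suc i)"
      unfolding mon_def prod.case by (rule JR_smult(5)[OF P(2) P(1) c(1) c(1)])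
    also have "gy [^]\<^bsub>JR\<^esub> j \<otimes>\<^bsub>JR\<^esub> (gy \<otimes>\<^bsub>JR\<^esub> gX [^]\<^bsub>JR\<^esub> i) = mon (Suc j, i)"
      using g by (simp add: mon_def R.m_assoc)
    finally show "mon b \<otimes>\<^bsub>JR\<^esub> gy \<in> spanned" using spanned_lin[OF mon_spanned mon_spanned c(1)] by simp
  qed
  show ?thesis
  proof (cases l)
    case gen_x
    have "r \<otimes>\<^bsub>JR\<^esub> gx = \<one> \<odot>\<^bsub>JR\<^esub> (r \<otimes>\<^bsub>JR\<^esub> gX) \<oplus>\<^bsub>JR\<^esub> r \<otimes>\<^bsub>JR\<^esub> gX"
      using rc g JR_smult(2)[OF R.m_closed[OF rc g(1)] rc one_closed one_closed] by (simp add: gx_eq R.r_distr)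
    thus ?thesis using spanned_lin[OF X X one_closed] gen_x by simp
  qed (simp add: Y)
qed

text \<open>The span of the monomials contains 1 and is stable under right multiplication by the
  generators, so it contains every word.\<close>

lemma all_spanned:
  assumes "r \<in> carrier JR"
  shows "r \<in> spanned"
proof -
  have w: "pi (delta w) \<in> spanned" for w
  proof (induction w rule: rev_induct)
    case Nil
    have "pi (delta []) = mon (0, 0)" using pi_hom(3) by (simp add: mon_def FA.F_simps(3))
    thus ?case by (simp add: mon_spanned)
  next
    case (snoc l w)
    have "pi (delta (w @ [l])) = pi (delta w) \<otimes>\<^bsub>JR\<^esub> jordan_gen K p l"
      unfolding gen_pi pi_hom(2)[OF FA.delta_F FA.delta_F, symmetric] by (simp add: FA.F_simps(2) FA.conv_delta)
    thus ?case using spanned_mult_gen[OF snoc] by simp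
  qed
  obtain f where f: "f \<in> carrier F" "r = pi f" using assms by (auto simp: carrier_JR)
  have "pi f \<in> spanned" using f(1)
  proof (induction f rule: FA.F_induct)
    case zero
    have "pi (\<lambda>w. \<zero>) = \<zero>\<^bsub>JR\<^esub>"
      using pi_zero[OF additive_subgroup.zero_closed[OF ideal.axioms(1)[OF JI_ideal]]] by (simp add: FA.F_simps(4))
    thus ?case by (simp add: zero_spanned)
  next
    case (add c u f)
    have cd: "c \<odot>\<^bsub>F\<^esub> delta u \<in> carrier F" by (rule F_smult_closed[OF add(1) FA.delta_F])
    have "pi (\<lambda>w. c \<otimes> delta u w \<oplus> f w) = c \<odot>\<^bsub>JR\<^esub> pi (delta u) \<oplus>\<^bsub>JR\<^esub> pi f"
      unfolding pi_smult[OF add(1) FA.delta_F] pi_hom(1)[OF cd add(2), symmetric] by (simp add: FA.F_simps)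
    thus ?case using spanned_lin[OF w add(3,1)] by simp
  qed
  thus ?thesis using f by simp
qed

lemma JR_nat_mult: "r \<in> carrier JR \<Longrightarrow> [(n::nat)] \<cdot>\<^bsub>JR\<^esub> r = ([n] \<cdot> \<one>) \<odot>\<^bsub>JR\<^esub> r"
proof (induction n)
  case 0
  thus ?case using JR_smult(3)[of r r \<one> \<one>] by simp
next
  case (Suc n)
  have c: "[n] \<cdot> \<one> \<in> carrier K" by simp
  show ?case using Suc JR_smult(7)[OF Suc.prems Suc.prems c one_closed] JR_smult(2)[OF Suc.prems Suc.prems c c]
    by simp
qed

section \<open>Annihilators in the Jordan algebra, read off from coordinates\<close>

definition left_span :: "(gen list \<Rightarrow> 'k) set \<Rightarrow> (gen list \<Rightarrow> 'k) set \<Rightarrow> (gen list \<Rightarrow> 'k) set set" where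
  "left_span u v = {r. \<exists>a\<in>carrier JR. \<exists>b\<in>carrier JR. r = a \<otimes>\<^bsub>JR\<^esub> u \<oplus>\<^bsub>JR\<^esub> b \<otimes>\<^bsub>JR\<^esub> v}"

lemma left_spanI:
  assumes "a \<in> carrier JR" "u \<in> carrier JR" "v \<in> carrier JR"
  shows "a \<otimes>\<^bsub>JR\<^esub> u \<in> left_span u v" "a \<otimes>\<^bsub>JR\<^esub> v \<in> left_span u v"
proof -
  have "a \<otimes>\<^bsub>JR\<^esub> u = a \<otimes>\<^bsub>JR\<^esub> u \<oplus>\<^bsub>JR\<^esub> \<zero>\<^bsub>JR\<^esub> \<otimes>\<^bsub>JR\<^esub> v" "a \<otimes>\<^bsub>JR\<^esub> v = \<zero>\<^bsub>JR\<^esub> \<otimes>\<^bsub>JR\<^esub> u \<oplus>\<^bsub>JR\<^esub> a \<otimes>\<^bsub>JR\<^esub> v"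
    using assms by auto
  thus "a \<otimes>\<^bsub>JR\<^esub> u \<in> left_span u v" "a \<otimes>\<^bsub>JR\<^esub> v \<in> left_span u v"
    unfolding left_span_def using assms(1) R.zero_closed by blast+
qed

lemma left_span_memI:
  assumes r: "r \<in> carrier JR" and u: "u \<in> carrier JR" and v: "v \<in> carrier JR"
    and mon: "\<And>j i. j < p \<Longrightarrow> i < p \<Longrightarrow> kappa r (j, i) = \<zero> \<or> mon (j, i) \<in> left_span u v"
  shows "r \<in> left_span u v"
proof (rule spanned_memI[OF all_spanned[OF r]])
  show "\<zero>\<^bsub>JR\<^esub> \<in> left_span u v" using left_spanI(1)[OF R.zero_closed u v] u by simp
  fix c s t assume c: "c \<in> carrier K" and "s \<in> left_span u v" "t \<in> left_span u v"
  then obtain a b a' b' where ab: "a \<in> carrier JR" "b \<in> carrier JR" "a' \<in> carrier JR" "b' \<in> carrier JR"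
    and st: "s = a \<otimes>\<^bsub>JR\<^esub> u \<oplus>\<^bsub>JR\<^esub> b \<otimes>\<^bsub>JR\<^esub> v" "t = a' \<otimes>\<^bsub>JR\<^esub> u \<oplus>\<^bsub>JR\<^esub> b' \<otimes>\<^bsub>JR\<^esub> v"
    unfolding left_span_def by blast
  have cab: "c \<odot>\<^bsub>JR\<^esub> a \<in> carrier JR" "c \<odot>\<^bsub>JR\<^esub> b \<in> carrier JR" by (rule JR_smult(1)[OF _ ab(1) c c], fact)+
  have "c \<odot>\<^bsub>JR\<^esub> s = (c \<odot>\<^bsub>JR\<^esub> a) \<otimes>\<^bsub>JR\<^esub> u \<oplus>\<^bsub>JR\<^esub> (c \<odot>\<^bsub>JR\<^esub> b) \<otimes>\<^bsub>JR\<^esub> v"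
    unfolding st JR_smult(4)[OF ab(1) u c c] JR_smult(4)[OF ab(2) v c c]
    by (rule JR_smult(6)[OF R.m_closed[OF ab(1) u] R.m_closed[OF ab(2) v] c c])
  hence "c \<odot>\<^bsub>JR\<^esub> s \<oplus>\<^bsub>JR\<^esub> t = (c \<odot>\<^bsub>JR\<^esub> a \<oplus>\<^bsub>JR\<^esub> a') \<otimes>\<^bsub>JR\<^esub> u \<oplus>\<^bsub>JR\<^esub> (c \<odot>\<^bsub>JR\<^esub> b \<oplus>\<^bsub>JR\<^esub> b') \<otimes>\<^bsub>JR\<^esub> v"
    unfolding st using cab ab u v by (simp add: R.l_distr R.a_ac)
  thus "c \<odot>\<^bsub>JR\<^esub> s \<oplus>\<^bsub>JR\<^esub> t \<in> left_span u v" unfolding left_span_def using cab ab R.a_closed by blast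
qed (rule mon)

lemma left_span_zero: "u \<in> carrier JR \<Longrightarrow> r \<in> left_span u \<zero>\<^bsub>JR\<^esub> \<Longrightarrow> \<exists>a\<in>carrier JR. r = a \<otimes>\<^bsub>JR\<^esub> u"
  by (auto simp: left_span_def)

lemma mon_split:
  "i' \<le> i \<Longrightarrow> mon (j, i) = mon (j, i - i') \<otimes>\<^bsub>JR\<^esub> gX [^]\<^bsub>JR\<^esub> i'"
  "j' \<le> j \<Longrightarrow> mon (j, 0) = mon (j - j', 0) \<otimes>\<^bsub>JR\<^esub> gy [^]\<^bsub>JR\<^esub> j'"
  using gen_closed(2) gen_closed(1)[of gen_y] by (auto simp: mon_def R.m_assoc R.nat_pow_mult)

text \<open>In the row \<open>i = 0\<close> the second term of \<open>opy\<close> is absent, so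
  \<open>y\<close> acts there as a pure shift of the first exponent.\<close>

lemma opy_pow_low: "v \<in> CV \<Longrightarrow> (opy ^^ n) v (j + n, 0) = v (j, 0)"
proof (induction n arbitrary: j)
  case (Suc n)
  have c: "(opy ^^ n) v b \<in> carrier K" for b by (intro vc lin_op_funpow[THEN lin_opD(1)] opy_lin Suc.prems)
  show ?case using Suc.IH[OF Suc.prems, of j] c vc[OF Suc.prems] by (simp add: opy_def a_minus_def)
qed simp

lemma kappa_CV: "r \<in> carrier JR \<Longrightarrow> kappa r \<in> CV"
  by (simp add: fun_module_simps kappa_closed)

lemma kappa_JR_zero: "low (kappa \<zero>\<^bsub>JR\<^esub>) (\<lambda>b. \<zero>)"
proof -
  have "low (kappa (\<zero> \<odot>\<^bsub>JR\<^esub> \<zero>\<^bsub>JR\<^esub> \<oplus>\<^bsub>JR\<^esub> \<zero>\<^bsub>JR\<^esub>)) (\<lambda>b. \<zero> \<otimes> kappa \<zero>\<^bsub>JR\<^esub> b \<oplus> kappa \<zero>\<^bsub>JR\<^esub> b)"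
    by (rule kappa_lin) simp_all
  have "pi \<zero>\<^bsub>F\<^esub> = \<zero>\<^bsub>JR\<^esub>" by (rule pi_zero[OF additive_subgroup.zero_closed[OF ideal.axioms(1)[OF JI_ideal]]])
  moreover have "kap \<zero>\<^bsub>F\<^esub> = (\<lambda>b. \<zero>)" by (auto simp: kap_def FA.F_simps(4) FA.pair_zero)
  ultimately show ?thesis using kappa_pi[OF F.zero_closed] by simp
qed

lemma kappa_gX_multiple: "a \<in> carrier JR \<Longrightarrow> j < p \<Longrightarrow> kappa (a \<otimes>\<^bsub>JR\<^esub> gX) (j, 0) = \<zero>"
  using kappa_gX[of a] p by (simp add: low_def opX_def)

text \<open>Right multiplication by \<open>X^n\<close> shifts the second exponent. Coordinates with
  \<open>i + n < p\<close> stay visible in the product and must vanish; all other monomials are left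
  multiples of \<open>X^(p-n)\<close>.\<close>

lemma annihilated_by_gX_pow:
  assumes r: "r \<in> carrier JR" and n: "n \<le> p" and z: "r \<otimes>\<^bsub>JR\<^esub> gX [^]\<^bsub>JR\<^esub> n = \<zero>\<^bsub>JR\<^esub>"
  shows "\<exists>a\<in>carrier JR. r = a \<otimes>\<^bsub>JR\<^esub> gX [^]\<^bsub>JR\<^esub> (p - n)"
proof (rule left_span_zero)
  show c: "gX [^]\<^bsub>JR\<^esub> (p - n) \<in> carrier JR" using gen_closed by simp
  show "r \<in> left_span (gX [^]\<^bsub>JR\<^esub> (p - n)) \<zero>\<^bsub>JR\<^esub>"
  proof (rule left_span_memI[OF r c R.zero_closed])
    fix j i assume ji: "j < p" "i < p"
    show "kappa r (j, i) = \<zero> \<or> mon (j, i) \<in> left_span (gX [^]\<^bsub>JR\<^esub> (p - n)) \<zero>\<^bsub>JR\<^esub>"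
    proof (cases "i + n < p")
      case True
      hence "kappa r (j, i) = kappa (r \<otimes>\<^bsub>JR\<^esub> gX [^]\<^bsub>JR\<^esub> n) (j, i + n)"
        using kappa_gX_pow[OF r, of n] ji by (simp add: low_def opX_pow)
      thus ?thesis using kappa_JR_zero True ji unfolding z by (simp add: low_def)
    next
      case False
      hence "mon (j, i) = mon (j, i - (p - n)) \<otimes>\<^bsub>JR\<^esub> gX [^]\<^bsub>JR\<^esub> (p - n)" by (intro mon_split) simp
      thus ?thesis using left_spanI(1)[OF mon_closed c R.zero_closed] by simp
    qed
  qed
qed

text \<open>Modulo left multiples of \<open>X\<close> only the row \<open>i = 0\<close> matters, and
  there right multiplication by \<open>y^n\<close> shifts the first exponent. The argument is then
  the one for \<open>X\<close>.\<close>

lemma annihilated_by_gy_pow: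
  assumes r: "r \<in> carrier JR" and n: "n \<le> p" and a: "a \<in> carrier JR"
    and z: "r \<otimes>\<^bsub>JR\<^esub> gy [^]\<^bsub>JR\<^esub> n = a \<otimes>\<^bsub>JR\<^esub> gX"
  shows "\<exists>b\<in>carrier JR. \<exists>c\<in>carrier JR. r = b \<otimes>\<^bsub>JR\<^esub> gy [^]\<^bsub>JR\<^esub> (p - n) \<oplus>\<^bsub>JR\<^esub> c \<otimes>\<^bsub>JR\<^esub> gX"
proof -
  have c: "gy [^]\<^bsub>JR\<^esub> (p - n) \<in> carrier JR" using gen_closed by simp
  have "r \<in> left_span (gy [^]\<^bsub>JR\<^esub> (p - n)) gX"
  proof (rule left_span_memI[OF r c gen_closed(2)])
    fix j i assume ji: "j < p" "i < p"
    consider "0 < i" | "i = 0" "j + n < p" | "i = 0" "p \<le> j + n" by linarith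
    thus "kappa r (j, i) = \<zero> \<or> mon (j, i) \<in> left_span (gy [^]\<^bsub>JR\<^esub> (p - n)) gX"
    proof cases
      case 1
      hence "mon (j, i) = mon (j, i - 1) \<otimes>\<^bsub>JR\<^esub> gX" using mon_split(1)[of 1 i j] gen_closed by simp
      thus ?thesis using left_spanI(2)[OF mon_closed c gen_closed(2)] by simp
    next
      case 2
      hence "kappa (r \<otimes>\<^bsub>JR\<^esub> gy [^]\<^bsub>JR\<^esub> n) (j + n, 0) = kappa r (j, 0)"
        using kappa_gy_pow[OF r, of n] opy_pow_low[OF kappa_CV[OF r], of n j] ji by (simp add: low_def)
      thus ?thesis unfolding z using kappa_gX_multiple[OF a 2(2)] 2 by simp
    next
      case 3
      hence "mon (j, i) = mon (j - (p - n), 0) \<otimes>\<^bsub>JR\<^esub> gy [^]\<^bsub>JR\<^esub> (p - n)"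
        using mon_split(2)[of "p - n" j] by simp
      thus ?thesis using left_spanI(1)[OF mon_closed c gen_closed(2)] by simp
    qed
  qed
  thus ?thesis by (simp add: left_span_def)
qed

text \<open>Every monomial except 1 ends in \<open>X\<close> or in \<open>y\<close>.\<close>

lemma augmentation_ideal:
  assumes r: "r \<in> carrier JR" and z: "kappa r (0, 0) = \<zero>"
  shows "\<exists>b\<in>carrier JR. \<exists>c\<in>carrier JR. r = b \<otimes>\<^bsub>JR\<^esub> gy \<oplus>\<^bsub>JR\<^esub> c \<otimes>\<^bsub>JR\<^esub> gX"
proof -
  note g = gen_closed(1)[of gen_y] gen_closed(2)
  have "r \<in> left_span gy gX"
  proof (rule left_span_memI[OF r g])
    fix j i :: nat
    consider "0 < i" | "i = 0" "j = 0" | "i = 0" "0 < j" by linarith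
    thus "kappa r (j, i) = \<zero> \<or> mon (j, i) \<in> left_span gy gX"
    proof cases
      case 1
      hence "mon (j, i) = mon (j, i - 1) \<otimes>\<^bsub>JR\<^esub> gX" using mon_split(1)[of 1 i j] gen_closed by simp
      thus ?thesis using left_spanI(2)[OF mon_closed g] by simp
    next
      case 3
      hence "mon (j, i) = mon (j - 1, 0) \<otimes>\<^bsub>JR\<^esub> gy" using mon_split(2)[of 1 j] gen_closed by simp
      thus ?thesis using left_spanI(1)[OF mon_closed g] by simp
    qed (simp add: z)
  qed
  thus ?thesis by (simp add: left_span_def)
qed

end

section \<open>Skew group algebras\<close>

text \<open>The ring axioms of the skew group algebra enter as \<open>skew_ring\<close>; in the
  final theorem they come with the left module structure of the trivial module.\<close>

locale skew_algebra = R: ring R + G: group G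
  for R :: "('k, 'a) module" and G :: "'g monoid" +
  fixes \<phi> :: "'g \<Rightarrow> 'a \<Rightarrow> 'a"
  assumes fin: "finite (carrier G)"
    and phi_hom: "h \<in> carrier G \<Longrightarrow> \<phi> h \<in> ring_hom R R"
    and phi_one: "r \<in> carrier R \<Longrightarrow> \<phi> \<one>\<^bsub>G\<^esub> r = r"
    and phi_mult: "h \<in> carrier G \<Longrightarrow> k \<in> carrier G \<Longrightarrow> r \<in> carrier R \<Longrightarrow> \<phi> (h \<otimes>\<^bsub>G\<^esub> k) r = \<phi> h (\<phi> k r)"
    and skew_ring: "ring (skew_group_algebra R G \<phi>)"
begin

abbreviation "A \<equiv> skew_group_algebra R G \<phi>"
abbreviation "sk \<equiv> skew_elt R G"

sublocale A: ring A by (rule skew_ring)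

lemma A_simps:
  "carrier A = carrier G \<rightarrow>\<^sub>E carrier R"
  "s \<otimes>\<^bsub>A\<^esub> t = (\<lambda>u\<in>carrier G. \<Oplus>\<^bsub>R\<^esub>a\<in>carrier G. s a \<otimes>\<^bsub>R\<^esub> \<phi> a (t (inv\<^bsub>G\<^esub> a \<otimes>\<^bsub>G\<^esub> u)))"
  "\<one>\<^bsub>A\<^esub> = sk \<one>\<^bsub>R\<^esub> \<one>\<^bsub>G\<^esub>" "\<zero>\<^bsub>A\<^esub> = (\<lambda>u\<in>carrier G. \<zero>\<^bsub>R\<^esub>)"
  "s \<oplus>\<^bsub>A\<^esub> t = (\<lambda>u\<in>carrier G. s u \<oplus>\<^bsub>R\<^esub> t u)"
  "c \<odot>\<^bsub>A\<^esub> s = (\<lambda>u\<in>carrier G. c \<odot>\<^bsub>R\<^esub> s u)"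
  by (simp_all add: skew_group_algebra_def skew_elt_def)

lemma A_val: "s \<in> carrier A \<Longrightarrow> u \<in> carrier G \<Longrightarrow> s u \<in> carrier R"
  by (auto simp: A_simps)

lemma A_eqI:
  assumes "s \<in> carrier A" "t \<in> carrier A" "\<And>u. u \<in> carrier G \<Longrightarrow> s u = t u"
  shows "s = t"
  using assms unfolding A_simps(1) by (rule PiE_ext)

lemma A_add_val: "u \<in> carrier G \<Longrightarrow> (s \<oplus>\<^bsub>A\<^esub> t) u = s u \<oplus>\<^bsub>R\<^esub> t u"
  by (simp add: A_simps(5))

lemma A_minus_val:
  assumes s: "s \<in> carrier A" and t: "t \<in> carrier A" and u: "u \<in> carrier G"
  shows "(s \<ominus>\<^bsub>A\<^esub> t) u = s u \<ominus>\<^bsub>R\<^esub> t u"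
proof -
  have "(s \<ominus>\<^bsub>A\<^esub> t) \<oplus>\<^bsub>A\<^esub> t = s" using s t by (simp add: a_minus_def A.a_assoc A.l_neg)
  hence "(s \<ominus>\<^bsub>A\<^esub> t) u \<oplus>\<^bsub>R\<^esub> t u = s u" using A_add_val[OF u, of "s \<ominus>\<^bsub>A\<^esub> t" t] by simp
  thus ?thesis using A_val[OF s u] A_val[OF t u] A_val[OF A.minus_closed[OF s t] u]
    by (metis R.add.inv_solve_right a_minus_def)
qed

lemma phi_simps:
  assumes h: "h \<in> carrier G"
  shows "r \<in> carrier R \<Longrightarrow> \<phi> h r \<in> carrier R" "\<phi> h \<zero>\<^bsub>R\<^esub> = \<zero>\<^bsub>R\<^esub>" "\<phi> h \<one>\<^bsub>R\<^esub> = \<one>\<^bsub>R\<^esub>"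
    "r \<in> carrier R \<Longrightarrow> s \<in> carrier R \<Longrightarrow> \<phi> h (r \<oplus>\<^bsub>R\<^esub> s) = \<phi> h r \<oplus>\<^bsub>R\<^esub> \<phi> h s"
    "r \<in> carrier R \<Longrightarrow> s \<in> carrier R \<Longrightarrow> \<phi> h (r \<otimes>\<^bsub>R\<^esub> s) = \<phi> h r \<otimes>\<^bsub>R\<^esub> \<phi> h s"
  using ring_hom_closed[OF phi_hom[OF h]] ring_hom_one[OF phi_hom[OF h]] ring_hom_add[OF phi_hom[OF h]]
    ring_hom_mult[OF phi_hom[OF h]] ring_hom_zero[OF phi_hom[OF h] R.ring_axioms R.ring_axioms] by simp_all

lemma el_closed: "r \<in> carrier R \<Longrightarrow> sk r h \<in> carrier A"
  by (auto simp: A_simps(1) skew_elt_def)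

lemma el_val: "u \<in> carrier G \<Longrightarrow> sk r h u = (if u = h then r else \<zero>\<^bsub>R\<^esub>)"
  by (simp add: skew_elt_def)

lemma el_add: "r \<in> carrier R \<Longrightarrow> s \<in> carrier R \<Longrightarrow> sk (r \<oplus>\<^bsub>R\<^esub> s) h = sk r h \<oplus>\<^bsub>A\<^esub> sk s h"
  by (auto simp: A_simps(5) skew_elt_def fun_eq_iff)

lemma el_zero: "sk \<zero>\<^bsub>R\<^esub> h = \<zero>\<^bsub>A\<^esub>"
  by (auto simp: A_simps(4) skew_elt_def fun_eq_iff)

text \<open>Of the convolution sum only the term \<open>a = u h^(-1)\<close> survives.\<close>

lemma mult_el_val:
  assumes s: "s \<in> carrier A" and r: "r \<in> carrier R" and h: "h \<in> carrier G" and u: "u \<in> carrier G"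
  shows "(s \<otimes>\<^bsub>A\<^esub> sk r h) u = s (u \<otimes>\<^bsub>G\<^esub> inv\<^bsub>G\<^esub> h) \<otimes>\<^bsub>R\<^esub> \<phi> (u \<otimes>\<^bsub>G\<^esub> inv\<^bsub>G\<^esub> h) r"
proof -
  let ?v = "u \<otimes>\<^bsub>G\<^esub> inv\<^bsub>G\<^esub> h"
  have v: "?v \<in> carrier G" using h u by simp
  have "(\<Oplus>\<^bsub>R\<^esub>a\<in>carrier G. s a \<otimes>\<^bsub>R\<^esub> \<phi> a (sk r h (inv\<^bsub>G\<^esub> a \<otimes>\<^bsub>G\<^esub> u))) =
      (\<Oplus>\<^bsub>R\<^esub>a\<in>carrier G. if ?v = a then s a \<otimes>\<^bsub>R\<^esub> \<phi> a r else \<zero>\<^bsub>R\<^esub>)"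
  proof (rule R.finsum_cong'[OF refl])
    show "(\<lambda>a. if ?v = a then s a \<otimes>\<^bsub>R\<^esub> \<phi> a r else \<zero>\<^bsub>R\<^esub>) \<in> carrier G \<rightarrow> carrier R"
      using A_val[OF s] r phi_simps(1) by auto
    fix a assume a: "a \<in> carrier G"
    have "inv\<^bsub>G\<^esub> a \<otimes>\<^bsub>G\<^esub> u = h \<longleftrightarrow> ?v = a"
      using a h u by (metis G.inv_closed G.inv_solve_left G.inv_solve_right G.m_closed)
    thus "s a \<otimes>\<^bsub>R\<^esub> \<phi> a (sk r h (inv\<^bsub>G\<^esub> a \<otimes>\<^bsub>G\<^esub> u)) = (if ?v = a then s a \<otimes>\<^bsub>R\<^esub> \<phi> a r else \<zero>\<^bsub>R\<^esub>)"
      using a u A_val[OF s a] phi_simps(2)[OF a] by (simp add: el_val)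
  qed
  also have "\<dots> = s ?v \<otimes>\<^bsub>R\<^esub> \<phi> ?v r"
    using R.finsum_singleton[OF v fin, of "\<lambda>a. s a \<otimes>\<^bsub>R\<^esub> \<phi> a r"] A_val[OF s] phi_simps(1) r by simp
  finally show ?thesis using u by (simp add: A_simps(2))
qed

lemma el_mult:
  assumes r: "r \<in> carrier R" and s: "s \<in> carrier R" and h: "h \<in> carrier G" and k: "k \<in> carrier G"
  shows "sk r h \<otimes>\<^bsub>A\<^esub> sk s k = sk (r \<otimes>\<^bsub>R\<^esub> \<phi> h s) (h \<otimes>\<^bsub>G\<^esub> k)"
proof (rule A_eqI)
  have c: "r \<otimes>\<^bsub>R\<^esub> \<phi> h s \<in> carrier R" using r s h by (simp add: phi_simps)
  show "sk r h \<otimes>\<^bsub>A\<^esub> sk s k \<in> carrier A" "sk (r \<otimes>\<^bsub>R\<^esub> \<phi> h s) (h \<otimes>\<^bsub>G\<^esub> k) \<in> carrier A"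
    using r s c by (simp_all add: el_closed)
  fix u assume u: "u \<in> carrier G"
  have v: "u \<otimes>\<^bsub>G\<^esub> inv\<^bsub>G\<^esub> k \<in> carrier G" using u k by simp
  have "u \<otimes>\<^bsub>G\<^esub> inv\<^bsub>G\<^esub> k = h \<longleftrightarrow> u = h \<otimes>\<^bsub>G\<^esub> k" using u h k G.inv_solve_right' by metis
  thus "(sk r h \<otimes>\<^bsub>A\<^esub> sk s k) u = sk (r \<otimes>\<^bsub>R\<^esub> \<phi> h s) (h \<otimes>\<^bsub>G\<^esub> k) u"
    unfolding mult_el_val[OF el_closed[OF r] s k u] el_val[OF v] el_val[OF u]
    using phi_simps(1)[OF v s] h k by (simp add: G.m_assoc)
qed

lemma el_pow_one:
  assumes r: "r \<in> carrier R"
  shows "sk r \<one>\<^bsub>G\<^esub> [^]\<^bsub>A\<^esub> (n::nat) = sk (r [^]\<^bsub>R\<^esub> n) \<one>\<^bsub>G\<^esub>"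
proof (induction n)
  case (Suc n)
  thus ?case using r el_mult[OF R.nat_pow_closed[OF r] r G.one_closed G.one_closed] by (simp add: phi_one)
qed (simp add: A_simps)

lemma el_group_pow:
  assumes h: "h \<in> carrier G"
  shows "sk \<one>\<^bsub>R\<^esub> h [^]\<^bsub>A\<^esub> (n::nat) = sk \<one>\<^bsub>R\<^esub> (h [^]\<^bsub>G\<^esub> n)"
proof (induction n)
  case (Suc n)
  thus ?case using el_mult[OF R.one_closed R.one_closed G.nat_pow_closed[OF h] h] h by (simp add: phi_simps)
qed (simp add: A_simps)

lemma el_fixed_pow:
  assumes r: "r \<in> carrier R" and h: "h \<in> carrier G" and f: "\<phi> h r = r"
  shows "sk r h [^]\<^bsub>A\<^esub> (n::nat) = sk (r [^]\<^bsub>R\<^esub> n) (h [^]\<^bsub>G\<^esub> n)"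
proof (induction n)
  case (Suc n)
  have "\<phi> (h [^]\<^bsub>G\<^esub> n) r = r"
  proof (induction n)
    case (Suc n)
    thus ?case using h r f by (simp add: phi_mult)
  qed (simp add: phi_one r)
  thus ?case using Suc r h el_mult[OF R.nat_pow_closed[OF r] r G.nat_pow_closed[OF h] h] by simp
qed (simp add: A_simps)

text \<open>The left linear map with \<open>r h\<close> going to \<open>r\<close>. It kills
  \<open>A (\<gamma> - 1)\<close> and identifies the quotient by this left ideal with
  \<open>R\<close> when \<open>\<gamma>\<close> generates the group, which moves exactness questions
  from \<open>A\<close> to \<open>R\<close>.\<close>

definition total :: "('g \<Rightarrow> 'a) \<Rightarrow> 'a" where "total s = (\<Oplus>\<^bsub>R\<^esub>u\<in>carrier G. s u)"

lemma total_closed: "s \<in> carrier A \<Longrightarrow> total s \<in> carrier R"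
  unfolding total_def using A_val by (intro R.finsum_closed) auto

lemma total_add: "s \<in> carrier A \<Longrightarrow> t \<in> carrier A \<Longrightarrow> total (s \<oplus>\<^bsub>A\<^esub> t) = total s \<oplus>\<^bsub>R\<^esub> total t"
proof -
  assume st: "s \<in> carrier A" "t \<in> carrier A"
  have "total (s \<oplus>\<^bsub>A\<^esub> t) = (\<Oplus>\<^bsub>R\<^esub>u\<in>carrier G. s u \<oplus>\<^bsub>R\<^esub> t u)" unfolding total_def
    using A_val[OF st(1)] A_val[OF st(2)] by (intro R.finsum_cong') (auto simp: A_add_val)
  thus ?thesis unfolding total_def using A_val[OF st(1)] A_val[OF st(2)] by (subst R.finsum_addf[symmetric]) auto
qed

text \<open>Multiplication by the group element \<open>h\<close> only permutes the summands.\<close>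

lemma total_mult_el:
  assumes s: "s \<in> carrier A" and r: "r \<in> carrier R" and h: "h \<in> carrier G"
  shows "total (s \<otimes>\<^bsub>A\<^esub> sk r h) = (\<Oplus>\<^bsub>R\<^esub>u\<in>carrier G. s u \<otimes>\<^bsub>R\<^esub> \<phi> u r)"
proof -
  let ?f = "\<lambda>u. u \<otimes>\<^bsub>G\<^esub> inv\<^bsub>G\<^esub> h"
  have inj: "inj_on ?f (carrier G)" using h by (intro inj_onI) simp
  have im: "?f ` carrier G = carrier G"
  proof
    show "carrier G \<subseteq> ?f ` carrier G"
    proof
      fix v assume v: "v \<in> carrier G"
      hence "v = ?f (v \<otimes>\<^bsub>G\<^esub> h)" using h by (simp add: G.m_assoc)
      thus "v \<in> ?f ` carrier G" using v h by (intro image_eqI[of _ _ "v \<otimes>\<^bsub>G\<^esub> h"]) auto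
    qed
  qed (use h in auto)
  have c: "(\<lambda>u. s u \<otimes>\<^bsub>R\<^esub> \<phi> u r) \<in> carrier G \<rightarrow> carrier R" using A_val[OF s] r by (auto simp: phi_simps)
  have "total (s \<otimes>\<^bsub>A\<^esub> sk r h) = (\<Oplus>\<^bsub>R\<^esub>u\<in>carrier G. s (?f u) \<otimes>\<^bsub>R\<^esub> \<phi> (?f u) r)" unfolding total_def
    using A_val[OF s] r h by (intro R.finsum_cong') (auto simp: mult_el_val[OF s r h] phi_simps)
  also have "\<dots> = (\<Oplus>\<^bsub>R\<^esub>u\<in>?f ` carrier G. s u \<otimes>\<^bsub>R\<^esub> \<phi> u r)"
    using c by (intro R.add.finprod_reindex[symmetric] inj) (simp add: im)
  finally show ?thesis by (simp add: im)
qed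

lemma total_mult_fixed:
  assumes s: "s \<in> carrier A" and r: "r \<in> carrier R" and h: "h \<in> carrier G" and f: "\<And>u. u \<in> carrier G \<Longrightarrow> \<phi> u r = r"
  shows "total (s \<otimes>\<^bsub>A\<^esub> sk r h) = total s \<otimes>\<^bsub>R\<^esub> r"
proof -
  have "total (s \<otimes>\<^bsub>A\<^esub> sk r h) = (\<Oplus>\<^bsub>R\<^esub>u\<in>carrier G. s u \<otimes>\<^bsub>R\<^esub> r)" unfolding total_mult_el[OF s r h]
    using A_val[OF s] r f by (intro R.finsum_cong') auto
  also have "\<dots> = total s \<otimes>\<^bsub>R\<^esub> r"
    unfolding total_def using A_val[OF s] r fin by (intro R.finsum_ldistr[symmetric]) auto
  finally show ?thesis .
qed

lemma total_el: "r \<in> carrier R \<Longrightarrow> h \<in> carrier G \<Longrightarrow> total (sk r h) = r"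
proof -
  assume r: "r \<in> carrier R" and h: "h \<in> carrier G"
  have "total (sk r h) = (\<Oplus>\<^bsub>R\<^esub>u\<in>carrier G. if h = u then r else \<zero>\<^bsub>R\<^esub>)" unfolding total_def
    using r by (intro R.finsum_cong') (auto simp: el_val)
  thus ?thesis using R.finsum_singleton[OF h fin, of "\<lambda>_. r"] r by simp
qed

text \<open>Each difference \<open>r \<gamma>^n - r\<close> is a left multiple of
  \<open>\<gamma> - 1\<close>; summing over the coefficients of \<open>s\<close> replaces every
  group element by 1.\<close>

lemma total_decomposition:
  assumes s: "s \<in> carrier A" and gen: "\<And>u. u \<in> carrier G \<Longrightarrow> \<exists>n::nat. u = \<gamma> [^]\<^bsub>G\<^esub> n" and \<gamma>: "\<gamma> \<in> carrier G"
  shows "\<exists>c\<in>carrier A. s = c \<otimes>\<^bsub>A\<^esub> (sk \<one>\<^bsub>R\<^esub> \<gamma> \<ominus>\<^bsub>A\<^esub> \<one>\<^bsub>A\<^esub>) \<oplus>\<^bsub>A\<^esub> sk (total s) \<one>\<^bsub>G\<^esub>"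
proof -
  define e where "e = sk \<one>\<^bsub>R\<^esub> \<gamma>"
  define d where "d = e \<ominus>\<^bsub>A\<^esub> \<one>\<^bsub>A\<^esub>"
  have gc: "e \<in> carrier A" by (simp add: e_def el_closed)
  have dc: "d \<in> carrier A" using gc by (simp add: d_def)
  have d1: "d \<oplus>\<^bsub>A\<^esub> \<one>\<^bsub>A\<^esub> = e" using gc by (simp add: d_def a_minus_def A.a_assoc A.l_neg)
  have dg: "d \<otimes>\<^bsub>A\<^esub> e = e \<otimes>\<^bsub>A\<^esub> d" unfolding d1[symmetric] using dc by (simp add: A.l_distr A.r_distr)
  have pow: "\<exists>c\<in>carrier A. sk r (\<gamma> [^]\<^bsub>G\<^esub> n) = c \<otimes>\<^bsub>A\<^esub> d \<oplus>\<^bsub>A\<^esub> sk r \<one>\<^bsub>G\<^esub>" if r: "r \<in> carrier R" for r and n :: nat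
  proof (induction n)
    case 0
    show ?case using dc el_closed[OF r] by (intro bexI[of _ "\<zero>\<^bsub>A\<^esub>"]) auto
  next
    case (Suc n)
    then obtain c where c: "c \<in> carrier A" "sk r (\<gamma> [^]\<^bsub>G\<^esub> n) = c \<otimes>\<^bsub>A\<^esub> d \<oplus>\<^bsub>A\<^esub> sk r \<one>\<^bsub>G\<^esub>" by blast
    have rc: "sk r \<one>\<^bsub>G\<^esub> \<in> carrier A" using r by (rule el_closed)
    have re: "sk r \<one>\<^bsub>G\<^esub> \<otimes>\<^bsub>A\<^esub> e = sk r \<one>\<^bsub>G\<^esub> \<otimes>\<^bsub>A\<^esub> d \<oplus>\<^bsub>A\<^esub> sk r \<one>\<^bsub>G\<^esub>"
      unfolding d1[symmetric] using dc rc by (simp add: A.r_distr)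
    have "sk r (\<gamma> [^]\<^bsub>G\<^esub> Suc n) = sk r (\<gamma> [^]\<^bsub>G\<^esub> n) \<otimes>\<^bsub>A\<^esub> e"
      using el_mult[OF r R.one_closed G.nat_pow_closed[OF \<gamma>] \<gamma>, of n] r \<gamma> by (simp add: e_def phi_simps)
    also have "\<dots> = c \<otimes>\<^bsub>A\<^esub> (d \<otimes>\<^bsub>A\<^esub> e) \<oplus>\<^bsub>A\<^esub> sk r \<one>\<^bsub>G\<^esub> \<otimes>\<^bsub>A\<^esub> e"
      unfolding c(2) using c(1) dc gc rc by (simp add: A.l_distr A.m_assoc)
    also have "\<dots> = (c \<otimes>\<^bsub>A\<^esub> e \<oplus>\<^bsub>A\<^esub> sk r \<one>\<^bsub>G\<^esub>) \<otimes>\<^bsub>A\<^esub> d \<oplus>\<^bsub>A\<^esub> sk r \<one>\<^bsub>G\<^esub>"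
      unfolding dg re using c(1) dc gc rc by (simp add: A.l_distr A.m_assoc A.a_assoc)
    finally show ?case using c(1) gc rc by blast
  qed
  have part: "\<exists>c\<in>carrier A. (\<lambda>u\<in>carrier G. if u \<in> S then s u else \<zero>\<^bsub>R\<^esub>) =
      c \<otimes>\<^bsub>A\<^esub> d \<oplus>\<^bsub>A\<^esub> sk (\<Oplus>\<^bsub>R\<^esub>u\<in>S. s u) \<one>\<^bsub>G\<^esub>" if "finite S" "S \<subseteq> carrier G" for S
    using that
  proof (induction S)
    case empty
    have "(\<lambda>u\<in>carrier G. \<zero>\<^bsub>R\<^esub>) = \<zero>\<^bsub>A\<^esub>" by (simp add: A_simps)
    thus ?case using dc by (intro bexI[of _ "\<zero>\<^bsub>A\<^esub>"]) (auto simp: el_zero)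
  next
    case (insert v S)
    let ?s = "\<lambda>S. \<lambda>u\<in>carrier G. if u \<in> S then s u else \<zero>\<^bsub>R\<^esub>"
    have v: "v \<in> carrier G" and S: "S \<subseteq> carrier G" using insert.prems by auto
    obtain n where n: "v = \<gamma> [^]\<^bsub>G\<^esub> (n::nat)" using gen[OF v] by blast
    have sv: "s v \<in> carrier R" using A_val[OF s v] .
    have tS: "(\<Oplus>\<^bsub>R\<^esub>u\<in>S. s u) \<in> carrier R" using A_val[OF s] S by (intro R.finsum_closed) auto
    obtain c where c: "c \<in> carrier A" "?s S = c \<otimes>\<^bsub>A\<^esub> d \<oplus>\<^bsub>A\<^esub> sk (\<Oplus>\<^bsub>R\<^esub>u\<in>S. s u) \<one>\<^bsub>G\<^esub>"
      using insert.IH[OF S] by blast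
    obtain b where b: "b \<in> carrier A" "sk (s v) v = b \<otimes>\<^bsub>A\<^esub> d \<oplus>\<^bsub>A\<^esub> sk (s v) \<one>\<^bsub>G\<^esub>"
      using pow[OF sv, of n] unfolding n by blast
    have sum: "(\<Oplus>\<^bsub>R\<^esub>u\<in>insert v S. s u) = s v \<oplus>\<^bsub>R\<^esub> (\<Oplus>\<^bsub>R\<^esub>u\<in>S. s u)"
      using insert.hyps A_val[OF s] S v by (intro R.finsum_insert) auto
    have "?s (insert v S) = sk (s v) v \<oplus>\<^bsub>A\<^esub> ?s S"
    proof
      fix u
      show "?s (insert v S) u = (sk (s v) v \<oplus>\<^bsub>A\<^esub> ?s S) u"
      proof (cases "u \<in> carrier G")
        case True
        thus ?thesis using insert.hyps(2) A_val[OF s True] by (cases "u = v") (simp_all add: A_add_val el_val)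
      qed (simp add: A_simps(5))
    qed
    also have "\<dots> = (b \<oplus>\<^bsub>A\<^esub> c) \<otimes>\<^bsub>A\<^esub> d \<oplus>\<^bsub>A\<^esub> (sk (s v) \<one>\<^bsub>G\<^esub> \<oplus>\<^bsub>A\<^esub> sk (\<Oplus>\<^bsub>R\<^esub>u\<in>S. s u) \<one>\<^bsub>G\<^esub>)"
      unfolding c(2) b(2) using c(1) b(1) dc el_closed[OF sv] el_closed[OF tS]
      by (simp add: A.l_distr A.a_ac)
    finally show ?case unfolding sum el_add[OF sv tS] using c(1) b(1) A.a_closed by blast
  qed
  have eq: "(\<lambda>u\<in>carrier G. if u \<in> carrier G then s u else \<zero>\<^bsub>R\<^esub>) = s"
  proof
    fix u
    show "(\<lambda>u\<in>carrier G. if u \<in> carrier G then s u else \<zero>\<^bsub>R\<^esub>) u = s u"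
    proof (cases "u \<in> carrier G")
      case False
      thus ?thesis using s unfolding A_simps(1) by (simp add: PiE_arb[of s])
    qed simp
  qed
  show ?thesis using part[OF fin subset_refl] unfolding eq total_def[symmetric] d_def e_def .
qed

end

section \<open>The bosonization\<close>

text \<open>Here \<open>\<gamma>\<close> is the rescaled generator, which moves \<open>y\<close> by
  \<open>X = x / 2\<close> and not by \<open>x\<close>.\<close>

locale jordan_bosonization = jordan K p + skew_algebra "jordan_algebra K p" G \<phi>
  for K :: "'k ring" (structure) and p :: nat and G :: "'g monoid" and \<phi> +
  fixes \<gamma> :: 'g and q :: nat
  assumes \<gamma>: "\<gamma> \<in> carrier G" and gen: "u \<in> carrier G \<Longrightarrow> \<exists>n::nat. u = \<gamma> [^]\<^bsub>G\<^esub> n"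
    and order: "order G = q" and pq: "p dvd q"
    and phi_gX: "\<phi> \<gamma> gX = gX" and phi_gy: "\<phi> \<gamma> gy = gX \<oplus>\<^bsub>JR\<^esub> gy"
begin

abbreviation "z \<equiv> sk gX \<gamma>"
abbreviation "y \<equiv> sk gy \<one>\<^bsub>G\<^esub>"
abbreviation "g \<equiv> sk \<one>\<^bsub>JR\<^esub> \<gamma>"

lemma gens: "gX \<in> carrier JR" "gy \<in> carrier JR"
  by (rule gen_closed)+

lemma zyg_closed: "z \<in> carrier A" "y \<in> carrier A" "g \<in> carrier A" "g \<ominus>\<^bsub>A\<^esub> \<one>\<^bsub>A\<^esub> \<in> carrier A"
  using el_closed gens R.one_closed A.one_closed A.minus_closed by blast+

lemma q_pos: "q > 0"
  using order fin G.order_gt_0_iff_finite by blast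

section \<open>Powers of the generator and their action on the Jordan algebra\<close>

lemma pow_bij: "bij_betw (\<lambda>i. \<gamma> [^]\<^bsub>G\<^esub> i) {..<q} (carrier G)"
proof -
  have gens_all: "(\<lambda>i::nat. \<gamma> [^]\<^bsub>G\<^esub> i) ` UNIV = carrier G" using gen \<gamma> by auto
  have o: "G.ord \<gamma> > 0" using G.ord_ge_1[OF fin \<gamma>] by simp
  have S: "{0..G.ord \<gamma> - 1} = {..<G.ord \<gamma>}" using o by auto
  have "(\<lambda>i::nat. \<gamma> [^]\<^bsub>G\<^esub> i) ` {..<G.ord \<gamma>} = carrier G"
    using G.ord_elems[OF fin \<gamma>] gens_all unfolding S setcompr_eq_image by (simp add: lessThan_def)
  moreover have inj: "inj_on (\<lambda>i::nat. \<gamma> [^]\<^bsub>G\<^esub> i) {..<G.ord \<gamma>}" using G.ord_inj[OF \<gamma>] unfolding S .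
  ultimately have "bij_betw (\<lambda>i::nat. \<gamma> [^]\<^bsub>G\<^esub> i) {..<G.ord \<gamma>} (carrier G)" by (simp add: bij_betw_def)
  moreover from bij_betw_same_card[OF this] have "G.ord \<gamma> = q" using order by (simp add: order_def)
  ultimately show ?thesis by simp
qed

lemma \<gamma>_pow_q: "\<gamma> [^]\<^bsub>G\<^esub> q = \<one>\<^bsub>G\<^esub>"
  using G.pow_order_eq_1[OF \<gamma>] order by simp

lemma phi_X: "u \<in> carrier G \<Longrightarrow> \<phi> u (gX [^]\<^bsub>JR\<^esub> (n::nat)) = gX [^]\<^bsub>JR\<^esub> n"
proof -
  assume u: "u \<in> carrier G"
  then obtain m where m: "u = \<gamma> [^]\<^bsub>G\<^esub> (m::nat)" using gen by blast
  have X: "\<phi> (\<gamma> [^]\<^bsub>G\<^esub> m) gX = gX" for m :: nat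
  proof (induction m)
    case (Suc m)
    thus ?case using \<gamma> gens by (simp add: phi_mult phi_gX)
  qed (simp add: phi_one gens)
  show ?thesis
  proof (induction n)
    case (Suc n)
    thus ?case using phi_simps(5)[OF u R.nat_pow_closed[OF gens(1)] gens(1)] X m by simp
  qed (use phi_simps(3)[OF u] in simp)
qed

lemma phi_X1: "u \<in> carrier G \<Longrightarrow> \<phi> u gX = gX"
  using phi_X[of u 1] gens by simp

lemma phi_y: "u \<in> carrier G \<Longrightarrow> \<exists>c\<in>carrier JR. \<phi> u gy = gy \<oplus>\<^bsub>JR\<^esub> c \<otimes>\<^bsub>JR\<^esub> gX"
proof -
  assume "u \<in> carrier G"
  then obtain m where m: "u = \<gamma> [^]\<^bsub>G\<^esub> (m::nat)" using gen by blast
  have "\<exists>c\<in>carrier JR. \<phi> (\<gamma> [^]\<^bsub>G\<^esub> m) gy = gy \<oplus>\<^bsub>JR\<^esub> c \<otimes>\<^bsub>JR\<^esub> gX" for m :: nat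
  proof (induction m)
    case 0 show ?case using gens by (intro bexI[of _ "\<zero>\<^bsub>JR\<^esub>"]) (auto simp: phi_one)
  next
    case (Suc m)
    then obtain c where c: "c \<in> carrier JR" "\<phi> (\<gamma> [^]\<^bsub>G\<^esub> m) gy = gy \<oplus>\<^bsub>JR\<^esub> c \<otimes>\<^bsub>JR\<^esub> gX" by blast
    have m: "\<gamma> [^]\<^bsub>G\<^esub> m \<in> carrier G" using \<gamma> by simp
    have "\<phi> (\<gamma> [^]\<^bsub>G\<^esub> Suc m) gy = \<phi> (\<gamma> [^]\<^bsub>G\<^esub> m) (gX \<oplus>\<^bsub>JR\<^esub> gy)"
      using phi_mult[OF m \<gamma> gens(2)] by (simp add: phi_gy)
    also have "\<dots> = gX \<oplus>\<^bsub>JR\<^esub> (gy \<oplus>\<^bsub>JR\<^esub> c \<otimes>\<^bsub>JR\<^esub> gX)"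
      unfolding phi_simps(4)[OF m gens] phi_X1[OF m] c(2) ..
    also have "\<dots> = gy \<oplus>\<^bsub>JR\<^esub> (\<one>\<^bsub>JR\<^esub> \<oplus>\<^bsub>JR\<^esub> c) \<otimes>\<^bsub>JR\<^esub> gX"
      using c gens by (simp add: R.l_distr R.a_lcomm)
    finally show ?case using c(1) by blast
  qed
  thus ?thesis using m by blast
qed

lemma z_pow: "z [^]\<^bsub>A\<^esub> (n::nat) = sk (gX [^]\<^bsub>JR\<^esub> n) (\<gamma> [^]\<^bsub>G\<^esub> n)"
  by (rule el_fixed_pow[OF gens(1) \<gamma> phi_gX])

lemma mult_z_pow_val:
  assumes b: "b \<in> carrier A" and u: "u \<in> carrier G"
  shows "(b \<otimes>\<^bsub>A\<^esub> z [^]\<^bsub>A\<^esub> (n::nat)) u = b (u \<otimes>\<^bsub>G\<^esub> inv\<^bsub>G\<^esub> (\<gamma> [^]\<^bsub>G\<^esub> n)) \<otimes>\<^bsub>JR\<^esub> gX [^]\<^bsub>JR\<^esub> n"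
  unfolding z_pow mult_el_val[OF b R.nat_pow_closed[OF gens(1)] G.nat_pow_closed[OF \<gamma>] u]
  using u \<gamma> by (simp add: phi_X)

text \<open>The group fixes \<open>X\<close>, so right multiplication by \<open>z^n\<close>
  multiplies all coefficients by \<open>X^n\<close> and translates them by
  \<open>\<gamma>^n\<close>. The witness undoes the translation.\<close>

lemma multiple_z_pow:
  assumes s: "s \<in> carrier A" and m: "\<And>u. u \<in> carrier G \<Longrightarrow> \<exists>r\<in>carrier JR. s u = r \<otimes>\<^bsub>JR\<^esub> gX [^]\<^bsub>JR\<^esub> (n::nat)"
  shows "\<exists>b\<in>carrier A. s = b \<otimes>\<^bsub>A\<^esub> z [^]\<^bsub>A\<^esub> n"
proof -
  obtain f where f: "\<And>u. u \<in> carrier G \<Longrightarrow> f u \<in> carrier JR \<and> s u = f u \<otimes>\<^bsub>JR\<^esub> gX [^]\<^bsub>JR\<^esub> n"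
    using m by metis
  define b where "b = (\<lambda>u\<in>carrier G. f (u \<otimes>\<^bsub>G\<^esub> \<gamma> [^]\<^bsub>G\<^esub> n))"
  have \<gamma>n: "\<gamma> [^]\<^bsub>G\<^esub> n \<in> carrier G" using \<gamma> by simp
  have b: "b \<in> carrier A" using f \<gamma>n by (auto simp: b_def A_simps(1))
  have "s = b \<otimes>\<^bsub>A\<^esub> z [^]\<^bsub>A\<^esub> n"
  proof (rule A_eqI[OF s A.m_closed[OF b A.nat_pow_closed[OF zyg_closed(1)]]])
    fix u assume u: "u \<in> carrier G"
    hence "b (u \<otimes>\<^bsub>G\<^esub> inv\<^bsub>G\<^esub> (\<gamma> [^]\<^bsub>G\<^esub> n)) = f u" using \<gamma>n by (simp add: b_def G.m_assoc)
    thus "s u = (b \<otimes>\<^bsub>A\<^esub> z [^]\<^bsub>A\<^esub> n) u" unfolding mult_z_pow_val[OF b u] using f[OF u] by simp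
  qed
  thus ?thesis using b by blast
qed

text \<open>Evaluated at \<open>u \<gamma>^n\<close>, the hypothesis says that \<open>X^n\<close>
  annihilates the coefficient at \<open>u\<close>; the question becomes one about single
  coefficients in \<open>R\<close>.\<close>

lemma annihilated_by_z_pow:
  assumes a: "a \<in> carrier A" and n: "n \<le> p" and z: "a \<otimes>\<^bsub>A\<^esub> z [^]\<^bsub>A\<^esub> n = \<zero>\<^bsub>A\<^esub>"
  shows "\<exists>b\<in>carrier A. a = b \<otimes>\<^bsub>A\<^esub> z [^]\<^bsub>A\<^esub> (p - n)"
proof (rule multiple_z_pow[OF a])
  fix u assume u: "u \<in> carrier G"
  have \<gamma>n: "\<gamma> [^]\<^bsub>G\<^esub> n \<in> carrier G" using \<gamma> by simp
  have un: "u \<otimes>\<^bsub>G\<^esub> \<gamma> [^]\<^bsub>G\<^esub> n \<in> carrier G" using u \<gamma>n by simp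
  have "(a \<otimes>\<^bsub>A\<^esub> z [^]\<^bsub>A\<^esub> n) (u \<otimes>\<^bsub>G\<^esub> \<gamma> [^]\<^bsub>G\<^esub> n) = \<zero>\<^bsub>JR\<^esub>" unfolding z using un by (simp add: A_simps(4))
  hence "a u \<otimes>\<^bsub>JR\<^esub> gX [^]\<^bsub>JR\<^esub> n = \<zero>\<^bsub>JR\<^esub>"
    unfolding mult_z_pow_val[OF a un] using u \<gamma>n by (simp add: G.m_assoc)
  thus "\<exists>r\<in>carrier JR. a u = r \<otimes>\<^bsub>JR\<^esub> gX [^]\<^bsub>JR\<^esub> (p - n)"
    by (rule annihilated_by_gX_pow[OF A_val[OF a u] n])
qed

lemma mult_g_val:
  assumes a: "a \<in> carrier A" and u: "u \<in> carrier G"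
  shows "(a \<otimes>\<^bsub>A\<^esub> g [^]\<^bsub>A\<^esub> (n::nat)) u = a (u \<otimes>\<^bsub>G\<^esub> inv\<^bsub>G\<^esub> (\<gamma> [^]\<^bsub>G\<^esub> n))"
proof -
  have v: "u \<otimes>\<^bsub>G\<^esub> inv\<^bsub>G\<^esub> (\<gamma> [^]\<^bsub>G\<^esub> n) \<in> carrier G" using u \<gamma> by simp
  show ?thesis unfolding el_group_pow[OF \<gamma>] mult_el_val[OF a R.one_closed G.nat_pow_closed[OF \<gamma>] u]
    using phi_simps(3)[OF v] A_val[OF a v] by simp
qed

lemma A_finsum_val:
  assumes f: "\<And>i. i \<in> I \<Longrightarrow> f i \<in> carrier A" and u: "u \<in> carrier G" and I: "finite I"
  shows "(\<Oplus>\<^bsub>A\<^esub>i\<in>I. f i) u = (\<Oplus>\<^bsub>JR\<^esub>i\<in>I. f i u)"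
  using I f
proof (induction I)
  case (insert i I)
  have "(\<Oplus>\<^bsub>A\<^esub>i\<in>insert i I. f i) = f i \<oplus>\<^bsub>A\<^esub> (\<Oplus>\<^bsub>A\<^esub>i\<in>I. f i)"
    using insert by (intro A.finsum_insert) auto
  moreover have "(\<Oplus>\<^bsub>JR\<^esub>i\<in>insert i I. f i u) = f i u \<oplus>\<^bsub>JR\<^esub> (\<Oplus>\<^bsub>JR\<^esub>i\<in>I. f i u)"
    using insert A_val[OF _ u] by (intro R.finsum_insert) auto
  ultimately show ?case using insert by (simp add: A_add_val[OF u])
qed (simp add: A_simps(4) u)

text \<open>The translates by the \<open>q\<close> powers of \<open>\<gamma>\<close> carry every
  coefficient to every group element exactly once.\<close>

lemma mult_sum_g:
  assumes a: "a \<in> carrier A"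
  shows "a \<otimes>\<^bsub>A\<^esub> (\<Oplus>\<^bsub>A\<^esub>i\<in>{..<q}. g [^]\<^bsub>A\<^esub> i) = (\<lambda>u\<in>carrier G. total a)"
proof (rule A_eqI)
  let ?N = "\<Oplus>\<^bsub>A\<^esub>i\<in>{..<q}. g [^]\<^bsub>A\<^esub> i"
  have gi: "g [^]\<^bsub>A\<^esub> i \<in> carrier A" for i :: nat using zyg_closed by simp
  show "a \<otimes>\<^bsub>A\<^esub> ?N \<in> carrier A" using a gi by (intro A.m_closed A.finsum_closed) auto
  show "(\<lambda>u\<in>carrier G. total a) \<in> carrier A" using total_closed[OF a] by (auto simp: A_simps(1))
  fix u assume u: "u \<in> carrier G"
  let ?h = "\<lambda>i::nat. u \<otimes>\<^bsub>G\<^esub> inv\<^bsub>G\<^esub> (\<gamma> [^]\<^bsub>G\<^esub> i)"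
  have canc: "u \<otimes>\<^bsub>G\<^esub> (inv\<^bsub>G\<^esub> u \<otimes>\<^bsub>G\<^esub> v) = v" if "v \<in> carrier G" for v
    using u that by (simp add: G.m_assoc[symmetric])
  have "bij_betw (\<lambda>v. u \<otimes>\<^bsub>G\<^esub> inv\<^bsub>G\<^esub> v) (carrier G) (carrier G)"
    by (rule bij_betw_byWitness[of _ "\<lambda>v. inv\<^bsub>G\<^esub> v \<otimes>\<^bsub>G\<^esub> u"])
      (use u canc in \<open>auto simp: G.inv_mult_group G.m_assoc\<close>)
  from bij_betw_trans[OF pow_bij this] have bij: "bij_betw ?h {..<q} (carrier G)" by (simp add: comp_def)
  have "a \<otimes>\<^bsub>A\<^esub> ?N = (\<Oplus>\<^bsub>A\<^esub>i\<in>{..<q}. a \<otimes>\<^bsub>A\<^esub> g [^]\<^bsub>A\<^esub> i)" using a gi by (intro A.finsum_rdistr) auto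
  hence "(a \<otimes>\<^bsub>A\<^esub> ?N) u = (\<Oplus>\<^bsub>JR\<^esub>i\<in>{..<q}. (a \<otimes>\<^bsub>A\<^esub> g [^]\<^bsub>A\<^esub> i) u)"
    using A_finsum_val[of "{..<q}" "\<lambda>i. a \<otimes>\<^bsub>A\<^esub> g [^]\<^bsub>A\<^esub> i", OF _ u] a gi by simp
  also have "\<dots> = (\<Oplus>\<^bsub>JR\<^esub>i\<in>{..<q}. a (?h i))" unfolding mult_g_val[OF a u] ..
  also have "\<dots> = (\<Oplus>\<^bsub>JR\<^esub>v\<in>?h ` {..<q}. a v)"
    using A_val[OF a] u \<gamma> bij by (intro R.add.finprod_reindex[symmetric]) (auto simp: bij_betw_def)
  finally show "(a \<otimes>\<^bsub>A\<^esub> ?N) u = (\<lambda>u\<in>carrier G. total a) u"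
    using u bij by (simp add: total_def bij_betw_def)
qed

lemma total_mult_z: "c \<in> carrier A \<Longrightarrow> total (c \<otimes>\<^bsub>A\<^esub> z) = total c \<otimes>\<^bsub>JR\<^esub> gX"
  by (rule total_mult_fixed[OF _ gens(1) \<gamma> phi_X1])

lemma total_mult_g: "b \<in> carrier A \<Longrightarrow> total (b \<otimes>\<^bsub>A\<^esub> (g \<ominus>\<^bsub>A\<^esub> \<one>\<^bsub>A\<^esub>)) = \<zero>\<^bsub>JR\<^esub>"
proof -
  assume b: "b \<in> carrier A"
  have c: "b \<otimes>\<^bsub>A\<^esub> (g \<ominus>\<^bsub>A\<^esub> \<one>\<^bsub>A\<^esub>) \<in> carrier A" using b zyg_closed by blast
  have "b \<otimes>\<^bsub>A\<^esub> g = b \<otimes>\<^bsub>A\<^esub> (g \<ominus>\<^bsub>A\<^esub> \<one>\<^bsub>A\<^esub>) \<oplus>\<^bsub>A\<^esub> b"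
    using b zyg_closed(3) by (simp add: a_minus_def A.r_distr A.a_assoc A.r_minus A.l_neg)
  hence "total (b \<otimes>\<^bsub>A\<^esub> g) = total (b \<otimes>\<^bsub>A\<^esub> (g \<ominus>\<^bsub>A\<^esub> \<one>\<^bsub>A\<^esub>)) \<oplus>\<^bsub>JR\<^esub> total b" using total_add[OF c b] by simp
  moreover have "total (b \<otimes>\<^bsub>A\<^esub> g) = total b"
    using total_mult_fixed[OF b R.one_closed \<gamma> phi_simps(3)] total_closed[OF b] by simp
  ultimately show ?thesis using total_closed[OF b] total_closed[OF c] by simp
qed

lemma total_mult_y: "s \<in> carrier A \<Longrightarrow> \<exists>c\<in>carrier JR. total (s \<otimes>\<^bsub>A\<^esub> y) = total s \<otimes>\<^bsub>JR\<^esub> gy \<oplus>\<^bsub>JR\<^esub> c \<otimes>\<^bsub>JR\<^esub> gX"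
proof -
  assume s: "s \<in> carrier A"
  obtain k where k: "\<And>u. u \<in> carrier G \<Longrightarrow> k u \<in> carrier JR \<and> \<phi> u gy = gy \<oplus>\<^bsub>JR\<^esub> k u \<otimes>\<^bsub>JR\<^esub> gX"
    using phi_y by metis
  have sv: "s u \<in> carrier JR" if "u \<in> carrier G" for u by (rule A_val[OF s that])
  let ?c = "\<Oplus>\<^bsub>JR\<^esub>u\<in>carrier G. s u \<otimes>\<^bsub>JR\<^esub> k u"
  have "total (s \<otimes>\<^bsub>A\<^esub> y) = (\<Oplus>\<^bsub>JR\<^esub>u\<in>carrier G. s u \<otimes>\<^bsub>JR\<^esub> gy \<oplus>\<^bsub>JR\<^esub> (s u \<otimes>\<^bsub>JR\<^esub> k u) \<otimes>\<^bsub>JR\<^esub> gX)"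
    unfolding total_mult_el[OF s gens(2) G.one_closed] using k sv gens
    by (intro R.finsum_cong') (auto simp: R.r_distr R.m_assoc)
  also have "\<dots> = (\<Oplus>\<^bsub>JR\<^esub>u\<in>carrier G. s u \<otimes>\<^bsub>JR\<^esub> gy) \<oplus>\<^bsub>JR\<^esub> (\<Oplus>\<^bsub>JR\<^esub>u\<in>carrier G. (s u \<otimes>\<^bsub>JR\<^esub> k u) \<otimes>\<^bsub>JR\<^esub> gX)"
    using k sv gens by (intro R.finsum_addf) auto
  also have "(\<Oplus>\<^bsub>JR\<^esub>u\<in>carrier G. s u \<otimes>\<^bsub>JR\<^esub> gy) = total s \<otimes>\<^bsub>JR\<^esub> gy"
    unfolding total_def using sv gens fin by (intro R.finsum_ldistr[symmetric]) auto
  also have "(\<Oplus>\<^bsub>JR\<^esub>u\<in>carrier G. (s u \<otimes>\<^bsub>JR\<^esub> k u) \<otimes>\<^bsub>JR\<^esub> gX) = ?c \<otimes>\<^bsub>JR\<^esub> gX"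
    using sv k gens fin by (intro R.finsum_ldistr[symmetric]) auto
  finally have "total (s \<otimes>\<^bsub>A\<^esub> y) = total s \<otimes>\<^bsub>JR\<^esub> gy \<oplus>\<^bsub>JR\<^esub> ?c \<otimes>\<^bsub>JR\<^esub> gX" .
  moreover have "?c \<in> carrier JR" using sv k by (intro R.finsum_closed) auto
  ultimately show ?thesis by blast
qed

lemma gX_gy: "gX \<otimes>\<^bsub>JR\<^esub> gy = (gy \<ominus>\<^bsub>JR\<^esub> gX) \<otimes>\<^bsub>JR\<^esub> gX"
  using gens by (simp add: a_minus_def R.l_distr R.l_minus gy_gX R.a_assoc R.r_neg)

text \<open>Modulo \<open>R X\<close> the group acts trivially on \<open>y\<close>, and
  \<open>R X\<close> is stable under right multiplication by \<open>y\<close> because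
  \<open>X y = (y - X) X\<close>.\<close>

lemma total_mult_y_pow:
  assumes s: "s \<in> carrier A"
  shows "\<exists>c\<in>carrier JR. total (s \<otimes>\<^bsub>A\<^esub> y [^]\<^bsub>A\<^esub> (n::nat)) = total s \<otimes>\<^bsub>JR\<^esub> gy [^]\<^bsub>JR\<^esub> n \<oplus>\<^bsub>JR\<^esub> c \<otimes>\<^bsub>JR\<^esub> gX"
proof (induction n)
  case 0
  show ?case using s gens total_closed[OF s] by (intro bexI[of _ "\<zero>\<^bsub>JR\<^esub>"]) auto
next
  case (Suc n)
  then obtain c where c: "c \<in> carrier JR"
    "total (s \<otimes>\<^bsub>A\<^esub> y [^]\<^bsub>A\<^esub> n) = total s \<otimes>\<^bsub>JR\<^esub> gy [^]\<^bsub>JR\<^esub> n \<oplus>\<^bsub>JR\<^esub> c \<otimes>\<^bsub>JR\<^esub> gX" by blast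
  have sn: "s \<otimes>\<^bsub>A\<^esub> y [^]\<^bsub>A\<^esub> n \<in> carrier A" using s zyg_closed by simp
  obtain e where e: "e \<in> carrier JR"
    "total (s \<otimes>\<^bsub>A\<^esub> y [^]\<^bsub>A\<^esub> n \<otimes>\<^bsub>A\<^esub> y) = total (s \<otimes>\<^bsub>A\<^esub> y [^]\<^bsub>A\<^esub> n) \<otimes>\<^bsub>JR\<^esub> gy \<oplus>\<^bsub>JR\<^esub> e \<otimes>\<^bsub>JR\<^esub> gX"
    using total_mult_y[OF sn] by blast
  have d: "gy \<ominus>\<^bsub>JR\<^esub> gX \<in> carrier JR" using gens by simp
  define d' where "d' = gy \<ominus>\<^bsub>JR\<^esub> gX"
  note d = d[folded d'_def] and Xy = gX_gy[folded d'_def]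
  have "total (s \<otimes>\<^bsub>A\<^esub> y [^]\<^bsub>A\<^esub> Suc n) = total (s \<otimes>\<^bsub>A\<^esub> y [^]\<^bsub>A\<^esub> n \<otimes>\<^bsub>A\<^esub> y)"
    using s zyg_closed by (simp add: A.m_assoc)
  also have "\<dots> = (total s \<otimes>\<^bsub>JR\<^esub> gy [^]\<^bsub>JR\<^esub> n \<oplus>\<^bsub>JR\<^esub> c \<otimes>\<^bsub>JR\<^esub> gX) \<otimes>\<^bsub>JR\<^esub> gy \<oplus>\<^bsub>JR\<^esub> e \<otimes>\<^bsub>JR\<^esub> gX"
    unfolding e(2) c(2) ..
  also have "\<dots> = total s \<otimes>\<^bsub>JR\<^esub> gy [^]\<^bsub>JR\<^esub> Suc n \<oplus>\<^bsub>JR\<^esub> (c \<otimes>\<^bsub>JR\<^esub> d' \<oplus>\<^bsub>JR\<^esub> e) \<otimes>\<^bsub>JR\<^esub> gX"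
    using total_closed[OF s] gens c(1) e(1) d by (simp add: R.l_distr R.m_assoc R.a_assoc Xy)
  finally show ?case using c(1) e(1) d by blast
qed

text \<open>Left multiples of \<open>X\<close> in \<open>R\<close> become left multiples of
  \<open>z\<close> in \<open>A\<close>, since \<open>X\<close> is
  \<open>\<gamma>^(-1) z\<close>.\<close>

lemma el_multiple_gX: "r \<in> carrier JR \<Longrightarrow> sk (r \<otimes>\<^bsub>JR\<^esub> gX) \<one>\<^bsub>G\<^esub> = sk r (inv\<^bsub>G\<^esub> \<gamma>) \<otimes>\<^bsub>A\<^esub> z"
  using el_mult[OF _ gens(1) G.inv_closed[OF \<gamma>] \<gamma>, of r] \<gamma> by (simp add: phi_X1)

text \<open>Returns from \<open>R\<close> modulo \<open>R X\<close> to \<open>A\<close>: what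
  \<open>total\<close> forgets is a left multiple of \<open>\<gamma> - 1\<close>, and left multiples
  of \<open>X\<close> become left multiples of \<open>z\<close>.\<close>

lemma from_total:
  assumes a: "a \<in> carrier A" and r: "r \<in> carrier JR" and c: "c \<in> carrier JR"
    and t: "total a = r \<otimes>\<^bsub>JR\<^esub> gy [^]\<^bsub>JR\<^esub> (n::nat) \<oplus>\<^bsub>JR\<^esub> c \<otimes>\<^bsub>JR\<^esub> gX"
  shows "\<exists>e\<in>carrier A. \<exists>b\<in>carrier A. \<exists>c\<in>carrier A.
    a = e \<otimes>\<^bsub>A\<^esub> y [^]\<^bsub>A\<^esub> n \<oplus>\<^bsub>A\<^esub> (b \<otimes>\<^bsub>A\<^esub> (g \<ominus>\<^bsub>A\<^esub> \<one>\<^bsub>A\<^esub>) \<oplus>\<^bsub>A\<^esub> c \<otimes>\<^bsub>A\<^esub> z)"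
proof -
  have yn: "gy [^]\<^bsub>JR\<^esub> n \<in> carrier JR" using gens by simp
  have e1: "sk (r \<otimes>\<^bsub>JR\<^esub> gy [^]\<^bsub>JR\<^esub> n) \<one>\<^bsub>G\<^esub> = sk r \<one>\<^bsub>G\<^esub> \<otimes>\<^bsub>A\<^esub> y [^]\<^bsub>A\<^esub> n"
    using el_mult[OF r yn G.one_closed G.one_closed] yn by (simp add: el_pow_one[OF gens(2)] phi_one)
  obtain b where b: "b \<in> carrier A" "a = b \<otimes>\<^bsub>A\<^esub> (g \<ominus>\<^bsub>A\<^esub> \<one>\<^bsub>A\<^esub>) \<oplus>\<^bsub>A\<^esub> sk (total a) \<one>\<^bsub>G\<^esub>"
    using total_decomposition[OF a gen \<gamma>] by blast
  have el: "sk (total a) \<one>\<^bsub>G\<^esub> = sk r \<one>\<^bsub>G\<^esub> \<otimes>\<^bsub>A\<^esub> y [^]\<^bsub>A\<^esub> n \<oplus>\<^bsub>A\<^esub> sk c (inv\<^bsub>G\<^esub> \<gamma>) \<otimes>\<^bsub>A\<^esub> z"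
    unfolding t el_add[OF R.m_closed[OF r yn] R.m_closed[OF c gens(1)]] e1 el_multiple_gX[OF c] ..
  have cl: "b \<otimes>\<^bsub>A\<^esub> (g \<ominus>\<^bsub>A\<^esub> \<one>\<^bsub>A\<^esub>) \<in> carrier A" "sk r \<one>\<^bsub>G\<^esub> \<otimes>\<^bsub>A\<^esub> y [^]\<^bsub>A\<^esub> n \<in> carrier A"
      "sk c (inv\<^bsub>G\<^esub> \<gamma>) \<otimes>\<^bsub>A\<^esub> z \<in> carrier A"
    by (intro A.m_closed b(1) zyg_closed el_closed r c A.nat_pow_closed)+
  have "a = sk r \<one>\<^bsub>G\<^esub> \<otimes>\<^bsub>A\<^esub> y [^]\<^bsub>A\<^esub> n \<oplus>\<^bsub>A\<^esub> (b \<otimes>\<^bsub>A\<^esub> (g \<ominus>\<^bsub>A\<^esub> \<one>\<^bsub>A\<^esub>) \<oplus>\<^bsub>A\<^esub> sk c (inv\<^bsub>G\<^esub> \<gamma>) \<otimes>\<^bsub>A\<^esub> z)"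
    by (subst b(2)) (simp only: el A.a_lcomm[OF cl(1) cl(2) cl(3)])
  thus ?thesis using b(1) el_closed[OF r] el_closed[OF c] by blast
qed

text \<open>Applying \<open>total\<close> removes the multiple of \<open>\<gamma> - 1\<close> and
  turns the one of \<open>z\<close> into a multiple of \<open>X\<close>. The statement in
  \<open>R\<close> is \<open>annihilated_by_gy_pow\<close>, and \<open>from_total\<close> lifts its
  conclusion.\<close>

lemma annihilated_by_y_pow:
  assumes a: "a \<in> carrier A" and b: "b \<in> carrier A" and c: "c \<in> carrier A" and n: "n \<le> p"
    and eq: "a \<otimes>\<^bsub>A\<^esub> y [^]\<^bsub>A\<^esub> n = b \<otimes>\<^bsub>A\<^esub> (g \<ominus>\<^bsub>A\<^esub> \<one>\<^bsub>A\<^esub>) \<oplus>\<^bsub>A\<^esub> c \<otimes>\<^bsub>A\<^esub> z"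
  shows "\<exists>e\<in>carrier A. \<exists>b\<in>carrier A. \<exists>c\<in>carrier A.
    a = e \<otimes>\<^bsub>A\<^esub> y [^]\<^bsub>A\<^esub> (p - n) \<oplus>\<^bsub>A\<^esub> (b \<otimes>\<^bsub>A\<^esub> (g \<ominus>\<^bsub>A\<^esub> \<one>\<^bsub>A\<^esub>) \<oplus>\<^bsub>A\<^esub> c \<otimes>\<^bsub>A\<^esub> z)"
proof -
  note ta = total_closed[OF a] and tc = total_closed[OF c]
  obtain e where e: "e \<in> carrier JR"
    "total (a \<otimes>\<^bsub>A\<^esub> y [^]\<^bsub>A\<^esub> n) = total a \<otimes>\<^bsub>JR\<^esub> gy [^]\<^bsub>JR\<^esub> n \<oplus>\<^bsub>JR\<^esub> e \<otimes>\<^bsub>JR\<^esub> gX"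
    using total_mult_y_pow[OF a] by blast
  have "total (a \<otimes>\<^bsub>A\<^esub> y [^]\<^bsub>A\<^esub> n) = total c \<otimes>\<^bsub>JR\<^esub> gX"
    unfolding eq total_add[OF A.m_closed[OF b zyg_closed(4)] A.m_closed[OF c zyg_closed(1)]]
      total_mult_g[OF b] total_mult_z[OF c] using tc gens by simp
  hence s: "total a \<otimes>\<^bsub>JR\<^esub> gy [^]\<^bsub>JR\<^esub> n \<oplus>\<^bsub>JR\<^esub> e \<otimes>\<^bsub>JR\<^esub> gX = total c \<otimes>\<^bsub>JR\<^esub> gX" using e(2) by simp
  have u: "total a \<otimes>\<^bsub>JR\<^esub> gy [^]\<^bsub>JR\<^esub> n \<in> carrier JR" using ta gens by simp
  have "total a \<otimes>\<^bsub>JR\<^esub> gy [^]\<^bsub>JR\<^esub> n = (total a \<otimes>\<^bsub>JR\<^esub> gy [^]\<^bsub>JR\<^esub> n \<oplus>\<^bsub>JR\<^esub> e \<otimes>\<^bsub>JR\<^esub> gX) \<oplus>\<^bsub>JR\<^esub> \<ominus>\<^bsub>JR\<^esub> e \<otimes>\<^bsub>JR\<^esub> gX"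
    using u e(1) gens by (simp add: R.a_assoc R.l_minus R.r_neg)
  also have "\<dots> = (total c \<oplus>\<^bsub>JR\<^esub> \<ominus>\<^bsub>JR\<^esub> e) \<otimes>\<^bsub>JR\<^esub> gX" unfolding s using tc e(1) gens by (simp add: R.l_distr)
  finally obtain r v where "r \<in> carrier JR" "v \<in> carrier JR"
    "total a = r \<otimes>\<^bsub>JR\<^esub> gy [^]\<^bsub>JR\<^esub> (p - n) \<oplus>\<^bsub>JR\<^esub> v \<otimes>\<^bsub>JR\<^esub> gX"
    using annihilated_by_gy_pow[OF ta n R.a_closed[OF tc R.a_inv_closed[OF e(1)]]] by blast
  thus ?thesis by (rule from_total[OF a])
qed

lemma A_nat_mult_val:
  "s \<in> carrier A \<Longrightarrow> u \<in> carrier G \<Longrightarrow> ([(n::nat)] \<cdot>\<^bsub>A\<^esub> s) u = [n] \<cdot>\<^bsub>JR\<^esub> (s u)"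
proof (induction n)
  case (Suc n)
  thus ?case by (simp add: A_add_val)
qed (simp add: A_simps(4))

lemma A_char: "[p] \<cdot>\<^bsub>A\<^esub> \<one>\<^bsub>A\<^esub> = \<zero>\<^bsub>A\<^esub>"
proof (rule A_eqI)
  fix u assume u: "u \<in> carrier G"
  have v: "\<one>\<^bsub>A\<^esub> u \<in> carrier JR" by (rule A_val[OF A.one_closed u])
  show "([p] \<cdot>\<^bsub>A\<^esub> \<one>\<^bsub>A\<^esub>) u = \<zero>\<^bsub>A\<^esub> u"
    unfolding A_nat_mult_val[OF A.one_closed u] JR_nat_mult[OF v] char JR_smult(3)[OF v v one_closed one_closed]
    using u by (simp add: A_simps(4))
qed simp_all

text \<open>The essential relation is \<open>z y = X (X + y) \<gamma> = y X \<gamma> = y z\<close>,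
  where the middle equality is \<open>gy_gX\<close>; the rescaling of the generator was chosen for
  it.\<close>

lemma heis: "heis A z y g p q"
proof (intro heis.intro heis_axioms.intro)
  show "z \<otimes>\<^bsub>A\<^esub> y = y \<otimes>\<^bsub>A\<^esub> z"
    using \<gamma> gens by (simp add: el_mult phi_gy phi_one gy_gX R.r_distr R.a_comm)
  show "z \<otimes>\<^bsub>A\<^esub> g = g \<otimes>\<^bsub>A\<^esub> z"
    using \<gamma> gens phi_simps(3)[OF \<gamma>] by (simp add: el_mult phi_gX)
  show "g \<otimes>\<^bsub>A\<^esub> y = y \<otimes>\<^bsub>A\<^esub> g \<oplus>\<^bsub>A\<^esub> z"
    using \<gamma> gens by (simp add: el_mult phi_gy phi_one el_add A.a_comm el_closed)
  show "z [^]\<^bsub>A\<^esub> p = \<zero>\<^bsub>A\<^esub>" by (simp add: z_pow gX_pow el_zero)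
  show "y [^]\<^bsub>A\<^esub> p = \<zero>\<^bsub>A\<^esub>" by (simp add: el_pow_one[OF gens(2)] gx_gy_pow el_zero)
  show "g [^]\<^bsub>A\<^esub> q = \<one>\<^bsub>A\<^esub>" by (simp add: el_group_pow[OF \<gamma>] \<gamma>_pow_q A_simps(3))
qed (use zyg_closed p pq q_pos A_char A.ring_axioms in blast)+

sublocale H: heis A z y g p q by (rule heis)

lemma total_N:
  assumes a: "a \<in> carrier A"
  shows "a \<otimes>\<^bsub>A\<^esub> H.N = (\<lambda>u\<in>carrier G. total a)"
  unfolding H.N_eq by (rule mult_sum_g[OF a])

text \<open>The hypothesis \<open>a \<gamma> = a + b z\<close> says that the coefficients of
  \<open>a\<close> change by multiples of \<open>X\<close> from one power of \<open>\<gamma>\<close>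
  to the next. Hence \<open>a\<close> is constant modulo \<open>A z\<close>, and constant functions
  are multiples of \<open>N\<close>.\<close>

lemma exact_g:
  assumes a: "a \<in> carrier A" and b: "b \<in> carrier A" and eq: "a \<otimes>\<^bsub>A\<^esub> (g \<ominus>\<^bsub>A\<^esub> \<one>\<^bsub>A\<^esub>) = b \<otimes>\<^bsub>A\<^esub> z"
  shows "\<exists>c\<in>carrier A. \<exists>e\<in>carrier A. a = c \<otimes>\<^bsub>A\<^esub> H.N \<oplus>\<^bsub>A\<^esub> e \<otimes>\<^bsub>A\<^esub> z"
proof -
  have ag: "a \<otimes>\<^bsub>A\<^esub> g = a \<oplus>\<^bsub>A\<^esub> b \<otimes>\<^bsub>A\<^esub> z"
    unfolding eq[symmetric] using a zyg_closed(3)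
    by (simp add: a_minus_def A.r_distr A.r_minus A.a_lcomm[of a] A.r_neg)
  have step: "a v = a (v \<otimes>\<^bsub>G\<^esub> \<gamma>) \<oplus>\<^bsub>JR\<^esub> b v \<otimes>\<^bsub>JR\<^esub> gX" if v: "v \<in> carrier G" for v
  proof -
    let ?u = "v \<otimes>\<^bsub>G\<^esub> \<gamma>"
    have u: "?u \<in> carrier G" and uv: "?u \<otimes>\<^bsub>G\<^esub> inv\<^bsub>G\<^esub> \<gamma> = v" using v \<gamma> by (simp_all add: G.m_assoc)
    have "(a \<otimes>\<^bsub>A\<^esub> g) ?u = a v" using mult_g_val[OF a u, of 1] zyg_closed(3) \<gamma> uv by simp
    moreover have "(b \<otimes>\<^bsub>A\<^esub> z) ?u = b v \<otimes>\<^bsub>JR\<^esub> gX"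
      using mult_z_pow_val[OF b u, of 1] zyg_closed(1) \<gamma> gens uv by simp
    ultimately show ?thesis unfolding ag A_add_val[OF u] by simp
  qed
  let ?r = "a \<one>\<^bsub>G\<^esub>"
  have r: "?r \<in> carrier JR" by (rule A_val[OF a G.one_closed])
  have pow: "\<exists>e\<in>carrier JR. a (\<gamma> [^]\<^bsub>G\<^esub> n) = ?r \<oplus>\<^bsub>JR\<^esub> e \<otimes>\<^bsub>JR\<^esub> gX" for n :: nat
  proof (induction n)
    case 0 show ?case using r gens by (intro bexI[of _ "\<zero>\<^bsub>JR\<^esub>"]) auto
  next
    case (Suc n)
    then obtain e where e: "e \<in> carrier JR" "a (\<gamma> [^]\<^bsub>G\<^esub> n) = ?r \<oplus>\<^bsub>JR\<^esub> e \<otimes>\<^bsub>JR\<^esub> gX" by blast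
    have v: "\<gamma> [^]\<^bsub>G\<^esub> n \<in> carrier G" using \<gamma> by simp
    define w w' b' where "w = a (\<gamma> [^]\<^bsub>G\<^esub> n)" and "w' = a (\<gamma> [^]\<^bsub>G\<^esub> Suc n)" and "b' = b (\<gamma> [^]\<^bsub>G\<^esub> n)"
    have c: "w' \<in> carrier JR" "b' \<in> carrier JR" using A_val[OF a, of "\<gamma> [^]\<^bsub>G\<^esub> Suc n"] A_val[OF b v] \<gamma> by (auto simp: w'_def b'_def)
    have "w' = (w' \<oplus>\<^bsub>JR\<^esub> b' \<otimes>\<^bsub>JR\<^esub> gX) \<oplus>\<^bsub>JR\<^esub> \<ominus>\<^bsub>JR\<^esub> b' \<otimes>\<^bsub>JR\<^esub> gX"
      using c gens by (simp add: R.a_assoc R.l_minus R.r_neg)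
    also have "w' \<oplus>\<^bsub>JR\<^esub> b' \<otimes>\<^bsub>JR\<^esub> gX = ?r \<oplus>\<^bsub>JR\<^esub> e \<otimes>\<^bsub>JR\<^esub> gX"
      using step[OF v] e(2) by (simp add: w'_def b'_def)
    also have "(?r \<oplus>\<^bsub>JR\<^esub> e \<otimes>\<^bsub>JR\<^esub> gX) \<oplus>\<^bsub>JR\<^esub> \<ominus>\<^bsub>JR\<^esub> b' \<otimes>\<^bsub>JR\<^esub> gX = ?r \<oplus>\<^bsub>JR\<^esub> (e \<oplus>\<^bsub>JR\<^esub> \<ominus>\<^bsub>JR\<^esub> b') \<otimes>\<^bsub>JR\<^esub> gX"
      using r e(1) c gens by (simp add: R.a_assoc R.l_distr)
    finally show ?case using e(1) c unfolding w'_def by blast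
  qed
  \<comment> \<open>Multiplied by \<open>N\<close>, this gives the constant function whose value is
    the coefficient of \<open>a\<close> at 1.\<close>
  let ?c = "sk ?r \<one>\<^bsub>G\<^esub>"
  have cc: "?c \<in> carrier A" by (rule el_closed[OF r])
  have cN: "(?c \<otimes>\<^bsub>A\<^esub> H.N) u = ?r" if "u \<in> carrier G" for u
    unfolding total_N[OF cc] total_el[OF r G.one_closed] using that by simp
  have cNc: "?c \<otimes>\<^bsub>A\<^esub> H.N \<in> carrier A" using cc H.W_closed by simp
  have "\<exists>e\<in>carrier A. a \<ominus>\<^bsub>A\<^esub> ?c \<otimes>\<^bsub>A\<^esub> H.N = e \<otimes>\<^bsub>A\<^esub> z [^]\<^bsub>A\<^esub> (1::nat)"
  proof (rule multiple_z_pow)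
    show "a \<ominus>\<^bsub>A\<^esub> ?c \<otimes>\<^bsub>A\<^esub> H.N \<in> carrier A" using a cNc by simp
    fix u assume u: "u \<in> carrier G"
    then obtain n where n: "u = \<gamma> [^]\<^bsub>G\<^esub> (n::nat)" using gen by blast
    obtain e where e: "e \<in> carrier JR" "a u = ?r \<oplus>\<^bsub>JR\<^esub> e \<otimes>\<^bsub>JR\<^esub> gX" using pow[of n] n by blast
    have "(a \<ominus>\<^bsub>A\<^esub> ?c \<otimes>\<^bsub>A\<^esub> H.N) u = e \<otimes>\<^bsub>JR\<^esub> gX [^]\<^bsub>JR\<^esub> (1::nat)"
      unfolding A_minus_val[OF a cNc u] cN[OF u] e(2) using r e(1) gens
      by (simp add: a_minus_def R.a_comm[of "a \<one>\<^bsub>G\<^esub>"] R.a_assoc R.r_neg)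
    thus "\<exists>e\<in>carrier JR. (a \<ominus>\<^bsub>A\<^esub> ?c \<otimes>\<^bsub>A\<^esub> H.N) u = e \<otimes>\<^bsub>JR\<^esub> gX [^]\<^bsub>JR\<^esub> (1::nat)" using e(1) by blast
  qed
  then obtain e where e: "e \<in> carrier A" "a \<ominus>\<^bsub>A\<^esub> ?c \<otimes>\<^bsub>A\<^esub> H.N = e \<otimes>\<^bsub>A\<^esub> z" using zyg_closed(1) by auto
  have "a = ?c \<otimes>\<^bsub>A\<^esub> H.N \<oplus>\<^bsub>A\<^esub> (a \<ominus>\<^bsub>A\<^esub> ?c \<otimes>\<^bsub>A\<^esub> H.N)"
    using a cNc by (simp add: a_minus_def A.a_lcomm A.r_neg)
  thus ?thesis unfolding e(2) using cc e(1) by blast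
qed

text \<open>All coefficients of \<open>a N\<close> equal \<open>total a\<close>, so the hypothesis
  makes \<open>total a\<close> a multiple of \<open>X\<close>, and
  \<open>total_decomposition\<close> finishes.\<close>

lemma exact_N:
  assumes a: "a \<in> carrier A" and b: "b \<in> carrier A" and eq: "a \<otimes>\<^bsub>A\<^esub> H.N = b \<otimes>\<^bsub>A\<^esub> z"
  shows "\<exists>c\<in>carrier A. \<exists>e\<in>carrier A. a = c \<otimes>\<^bsub>A\<^esub> (g \<ominus>\<^bsub>A\<^esub> \<one>\<^bsub>A\<^esub>) \<oplus>\<^bsub>A\<^esub> e \<otimes>\<^bsub>A\<^esub> z"
proof -
  let ?r = "b (inv\<^bsub>G\<^esub> \<gamma>)"
  have r: "?r \<in> carrier JR" by (rule A_val[OF b G.inv_closed[OF \<gamma>]])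
  have "total a = (a \<otimes>\<^bsub>A\<^esub> H.N) \<one>\<^bsub>G\<^esub>" unfolding total_N[OF a] by simp
  also have "\<dots> = ?r \<otimes>\<^bsub>JR\<^esub> gX"
    unfolding eq using mult_z_pow_val[OF b G.one_closed, of 1] zyg_closed(1) \<gamma> gens by simp
  finally have t: "total a = ?r \<otimes>\<^bsub>JR\<^esub> gX" .
  obtain c where c: "c \<in> carrier A" "a = c \<otimes>\<^bsub>A\<^esub> (g \<ominus>\<^bsub>A\<^esub> \<one>\<^bsub>A\<^esub>) \<oplus>\<^bsub>A\<^esub> sk (total a) \<one>\<^bsub>G\<^esub>"
    using total_decomposition[OF a gen \<gamma>] by blast
  thus ?thesis unfolding t el_multiple_gX[OF r] using el_closed[OF r] by blast
qed

text \<open>The exponents \<open>n = 1\<close> and \<open>n = p - 1\<close> in the annihilator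
  lemmas give the two halves of the pairs for \<open>z\<close> and for \<open>y\<close>.\<close>

lemma heis_exact: "heis_exact A z y g p q"
proof (rule heis_exact.intro[OF heis], unfold_locales)
  note P = prime_gt_0_nat[OF p]
  show "\<exists>b\<in>carrier A. a = b \<otimes>\<^bsub>A\<^esub> z [^]\<^bsub>A\<^esub> (p - 1)" if "a \<in> carrier A" "a \<otimes>\<^bsub>A\<^esub> z = \<zero>\<^bsub>A\<^esub>" for a
    using annihilated_by_z_pow[OF that(1), of 1] that(2) P zyg_closed(1) by simp
  show "\<exists>b\<in>carrier A. a = b \<otimes>\<^bsub>A\<^esub> z" if "a \<in> carrier A" "a \<otimes>\<^bsub>A\<^esub> z [^]\<^bsub>A\<^esub> (p - 1) = \<zero>\<^bsub>A\<^esub>" for a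
    using annihilated_by_z_pow[OF that(1), of "p - 1"] that(2) P zyg_closed(1) by simp
  show "\<exists>e\<in>carrier A. \<exists>b\<in>carrier A. \<exists>c\<in>carrier A.
      a = e \<otimes>\<^bsub>A\<^esub> y [^]\<^bsub>A\<^esub> (p - 1) \<oplus>\<^bsub>A\<^esub> (b \<otimes>\<^bsub>A\<^esub> (g \<ominus>\<^bsub>A\<^esub> \<one>\<^bsub>A\<^esub>) \<oplus>\<^bsub>A\<^esub> c \<otimes>\<^bsub>A\<^esub> z)"
    if "a \<in> carrier A" "b \<in> carrier A" "c \<in> carrier A"
      "a \<otimes>\<^bsub>A\<^esub> y = b \<otimes>\<^bsub>A\<^esub> (g \<ominus>\<^bsub>A\<^esub> \<one>\<^bsub>A\<^esub>) \<oplus>\<^bsub>A\<^esub> c \<otimes>\<^bsub>A\<^esub> z" for a b c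
    by (rule annihilated_by_y_pow[OF that(1-3)]) (use that(4) P zyg_closed(2) in simp_all)
  show "\<exists>e\<in>carrier A. \<exists>b\<in>carrier A. \<exists>c\<in>carrier A.
      a = e \<otimes>\<^bsub>A\<^esub> y \<oplus>\<^bsub>A\<^esub> (b \<otimes>\<^bsub>A\<^esub> (g \<ominus>\<^bsub>A\<^esub> \<one>\<^bsub>A\<^esub>) \<oplus>\<^bsub>A\<^esub> c \<otimes>\<^bsub>A\<^esub> z)"
    if "a \<in> carrier A" "b \<in> carrier A" "c \<in> carrier A"
      "a \<otimes>\<^bsub>A\<^esub> y [^]\<^bsub>A\<^esub> (p - 1) = b \<otimes>\<^bsub>A\<^esub> (g \<ominus>\<^bsub>A\<^esub> \<one>\<^bsub>A\<^esub>) \<oplus>\<^bsub>A\<^esub> c \<otimes>\<^bsub>A\<^esub> z" for a b c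
    using annihilated_by_y_pow[OF that(1-3) _ that(4)] P zyg_closed(2) by simp
qed (rule exact_g exact_N; assumption)+

end

text \<open>The point is the augmentation ideal. Modulo \<open>A (\<gamma> - 1)\<close> an element
  equals its \<open>total\<close>, and elements of \<open>R\<close> without constant term lie in
  \<open>R y + R X\<close>; it remains to see that \<open>\<epsilon> a = 0\<close> forces the
  constant term of \<open>total a\<close> to vanish.\<close>

lemma (in jordan_bosonization) heis_aug:
  assumes aug: "augmentation K A \<epsilon>"
    and ex: "\<epsilon> (sk gx \<one>\<^bsub>G\<^esub>) = \<zero>" and ey: "\<epsilon> y = \<zero>" and eg: "\<epsilon> g = \<one>"
  shows "heis_aug A z y g p q K \<epsilon>"
proof -
  have hom: "\<epsilon> \<in> ring_hom A K" using aug by (simp add: augmentation_def)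
  have es: "\<epsilon> (c \<odot>\<^bsub>A\<^esub> a) = c \<otimes> \<epsilon> a" if "c \<in> carrier K" "a \<in> carrier A" for c a
    using aug that by (simp add: augmentation_def)
  note eadd = ring_hom_add[OF hom] and emult = ring_hom_mult[OF hom] and eone = ring_hom_one[OF hom]
    and ec = ring_hom_closed[OF hom] and e0 = ring_hom_zero[OF hom A.ring_axioms ring_axioms]
  have sc: "c \<odot>\<^bsub>A\<^esub> a \<in> carrier A" if c: "c \<in> carrier K" and a: "a \<in> carrier A" for c a
    using A_val[OF a] by (auto simp: A_simps(1,6) intro!: JR_smult(1)[OF _ R.zero_closed c c])
  have sk_smult: "sk (c \<odot>\<^bsub>JR\<^esub> r) h = c \<odot>\<^bsub>A\<^esub> sk r h" if c: "c \<in> carrier K" for c r h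
  proof -
    have "c \<odot>\<^bsub>JR\<^esub> \<zero>\<^bsub>JR\<^esub> = \<zero>\<^bsub>JR\<^esub>"
      using JR_smult(4)[OF R.zero_closed R.zero_closed c c] JR_smult(1)[OF R.zero_closed R.zero_closed c c] by simp
    thus ?thesis unfolding A_simps(6) skew_elt_def by (intro restrict_ext) simp
  qed
  have eX: "\<epsilon> (sk gX \<one>\<^bsub>G\<^esub>) = \<zero>"
    unfolding gX_def sk_smult[OF half(1)] es[OF half(1) el_closed[OF gen_closed(1)]] ex
    by (rule r_null[OF half(1)])
  have "z = sk gX \<one>\<^bsub>G\<^esub> \<otimes>\<^bsub>A\<^esub> g"
    using el_mult[OF gens(1) R.one_closed G.one_closed \<gamma>] gens \<gamma> by (simp add: phi_one)
  hence ez: "\<epsilon> z = \<zero>" using emult[OF el_closed[OF gens(1)] zyg_closed(3)] eX eg by simp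
  have "\<epsilon> (g \<ominus>\<^bsub>A\<^esub> \<one>\<^bsub>A\<^esub>) \<oplus> \<one> = \<epsilon> ((g \<ominus>\<^bsub>A\<^esub> \<one>\<^bsub>A\<^esub>) \<oplus>\<^bsub>A\<^esub> \<one>\<^bsub>A\<^esub>)"
    using eadd[OF zyg_closed(4) A.one_closed] eone by simp
  also have "(g \<ominus>\<^bsub>A\<^esub> \<one>\<^bsub>A\<^esub>) \<oplus>\<^bsub>A\<^esub> \<one>\<^bsub>A\<^esub> = g" using zyg_closed(3) by (simp add: a_minus_def A.a_assoc A.l_neg)
  finally have eg1: "\<epsilon> (g \<ominus>\<^bsub>A\<^esub> \<one>\<^bsub>A\<^esub>) = \<zero>" using eg ec[OF zyg_closed(4)] by simp
  show ?thesis
  proof (intro heis_aug.intro heis_aug_axioms.intro heis_exact field_axioms)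
    show "carrier K \<subseteq> \<epsilon> ` carrier A"
    proof
      fix c assume c: "c \<in> carrier K"
      have "\<epsilon> (c \<odot>\<^bsub>A\<^esub> \<one>\<^bsub>A\<^esub>) = c" using es[OF c A.one_closed] eone c by simp
      thus "c \<in> \<epsilon> ` carrier A" using imageI[OF sc[OF c A.one_closed], of \<epsilon>] by simp
    qed
    fix a assume a: "a \<in> carrier A" and e: "\<epsilon> a = \<zero>"
    \<comment> \<open>The constant term. Subtracting it from \<open>total a\<close> leaves an
      element of \<open>R y + R X\<close>, which \<open>\<epsilon>\<close> kills, while additivity
      gives the value \<open>- k\<close>; hence \<open>k = 0\<close>.\<close>
    define k where "k = kappa (total a) (0, 0)"
    have r: "total a \<in> carrier JR" by (rule total_closed[OF a])
    have k: "k \<in> carrier K" and mk: "\<ominus> k \<in> carrier K" using kappa_closed[OF r] by (simp_all add: k_def)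
    have mk1: "\<ominus> k \<odot>\<^bsub>JR\<^esub> \<one>\<^bsub>JR\<^esub> \<in> carrier JR" by (rule JR_smult(1)[OF R.one_closed R.one_closed mk mk])
    obtain b where b: "b \<in> carrier A" "a = b \<otimes>\<^bsub>A\<^esub> (g \<ominus>\<^bsub>A\<^esub> \<one>\<^bsub>A\<^esub>) \<oplus>\<^bsub>A\<^esub> sk (total a) \<one>\<^bsub>G\<^esub>"
      using total_decomposition[OF a gen \<gamma>] by blast
    have bd: "b \<otimes>\<^bsub>A\<^esub> (g \<ominus>\<^bsub>A\<^esub> \<one>\<^bsub>A\<^esub>) \<in> carrier A" using b zyg_closed by blast
    have "\<epsilon> a = \<epsilon> (sk (total a) \<one>\<^bsub>G\<^esub>)"
      by (subst b(2)) (use eadd[OF bd el_closed[OF r]] emult[OF b(1) zyg_closed(4)] eg1 ec[OF b(1)]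
          ec[OF el_closed[OF r]] in simp)
    hence er: "\<epsilon> (sk (total a) \<one>\<^bsub>G\<^esub>) = \<zero>" using e by simp
    have "kappa (\<ominus> k \<odot>\<^bsub>JR\<^esub> \<one>\<^bsub>JR\<^esub> \<oplus>\<^bsub>JR\<^esub> total a) (0, 0) = \<ominus> k \<otimes> kappa \<one>\<^bsub>JR\<^esub> (0, 0) \<oplus> kappa (total a) (0, 0)"
      using kappa_lin[OF R.one_closed r mk] p2 by (simp add: low_def)
    also have "\<dots> = \<zero>" using kappa_one p2 k by (simp add: low_def e00_def k_def[symmetric] l_neg)
    finally obtain u v where uv: "u \<in> carrier JR" "v \<in> carrier JR"
      "\<ominus> k \<odot>\<^bsub>JR\<^esub> \<one>\<^bsub>JR\<^esub> \<oplus>\<^bsub>JR\<^esub> total a = u \<otimes>\<^bsub>JR\<^esub> gy \<oplus>\<^bsub>JR\<^esub> v \<otimes>\<^bsub>JR\<^esub> gX"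
      using augmentation_ideal[OF R.a_closed[OF mk1 r]] by blast
    have "sk (u \<otimes>\<^bsub>JR\<^esub> gy) \<one>\<^bsub>G\<^esub> = sk u \<one>\<^bsub>G\<^esub> \<otimes>\<^bsub>A\<^esub> y"
      using el_mult[OF uv(1) gens(2) G.one_closed G.one_closed] gens by (simp add: phi_one)
    hence "\<epsilon> (sk (u \<otimes>\<^bsub>JR\<^esub> gy \<oplus>\<^bsub>JR\<^esub> v \<otimes>\<^bsub>JR\<^esub> gX) \<one>\<^bsub>G\<^esub>) = \<zero>"
      unfolding el_add[OF R.m_closed[OF uv(1) gens(2)] R.m_closed[OF uv(2) gens(1)]] el_multiple_gX[OF uv(2)]
      using el_closed[OF uv(1)] el_closed[OF uv(2)] zyg_closed
      by (simp add: eadd emult ec ez ey)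
    moreover have "\<epsilon> (sk (\<ominus> k \<odot>\<^bsub>JR\<^esub> \<one>\<^bsub>JR\<^esub> \<oplus>\<^bsub>JR\<^esub> total a) \<one>\<^bsub>G\<^esub>) = \<ominus> k"
      using eadd[OF el_closed[OF mk1] el_closed[OF r], of "\<one>\<^bsub>G\<^esub>" "\<one>\<^bsub>G\<^esub>"] es[OF mk A.one_closed] er eone mk
      by (simp add: el_add[OF mk1 r] sk_smult[OF mk] A_simps(3)[symmetric])
    ultimately have "\<ominus> k = \<zero>" unfolding uv(3) by simp
    hence "k = \<zero>" using minus_minus[OF k] by simp
    then obtain u v where uv: "u \<in> carrier JR" "v \<in> carrier JR" "total a = u \<otimes>\<^bsub>JR\<^esub> gy \<oplus>\<^bsub>JR\<^esub> v \<otimes>\<^bsub>JR\<^esub> gX"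
      using augmentation_ideal[OF r] unfolding k_def by blast
    hence "total a = u \<otimes>\<^bsub>JR\<^esub> gy [^]\<^bsub>JR\<^esub> (1::nat) \<oplus>\<^bsub>JR\<^esub> v \<otimes>\<^bsub>JR\<^esub> gX" using gens by simp
    from from_total[OF a uv(1,2) this]
    show "\<exists>b\<in>carrier A. \<exists>c\<in>carrier A. \<exists>e\<in>carrier A.
        a = b \<otimes>\<^bsub>A\<^esub> y \<oplus>\<^bsub>A\<^esub> (c \<otimes>\<^bsub>A\<^esub> (g \<ominus>\<^bsub>A\<^esub> \<one>\<^bsub>A\<^esub>) \<oplus>\<^bsub>A\<^esub> e \<otimes>\<^bsub>A\<^esub> z)"
      using zyg_closed(2) by simp
  qed (fact hom ez ey eg p2)+
qed

lemma (in jordan_bosonization) finitely_generated: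
  fixes P :: "nat \<Rightarrow> ('g \<Rightarrow> (gen list \<Rightarrow> 'k) set, 'm) module"
  assumes aug: "augmentation K A \<epsilon>"
    and "\<epsilon> (sk gx \<one>\<^bsub>G\<^esub>) = \<zero>" "\<epsilon> y = \<zero>" "\<epsilon> g = \<one>"
    and res: "projective_resolution A (trivial_module K \<epsilon>) P d \<eta>"
  shows "finitely_generated_algebra K (Ext_algebra A P d \<eta> (trivial_module K \<epsilon>))"
proof -
  interpret E: heis_aug A z y g p q K \<epsilon> by (rule heis_aug) fact+
  obtain B :: "nat \<Rightarrow> 'm set" where B: "\<And>n. free_retract A (P n) (B n)"
    using projective_resolution_comparison(2)[OF res] by blast
  have Q: "exact_complex A (trivial_module K \<epsilon>) P d \<eta>" by (rule projective_resolution_comparison(1)[OF res])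
  have "ext_algebra K A \<epsilon> P d \<eta> B"
    by (intro ext_algebra.intro ext_algebra_axioms.intro self_comparison.intro comparison.intro
        comparison_axioms.intro exact_complex_module_complex[OF Q] field_axioms B Q aug)
  thus ?thesis by (rule E.finitely_generated)
qed

text \<open>Rescaling the exponent of the generator turns \<open>\<phi>\<^sub>g y = x + y\<close> into \<open>\<phi>\<^sub>\<gamma> y = x / 2 + y\<close>, which is
  what makes \<open>(x / 2) \<gamma>\<close> commute with \<open>y\<close>.\<close>

lemma half_exponent:
  fixes p q :: nat
  assumes p: "Factorial_Ring.prime p" "p > 2" and q: "q > 0"
  shows "\<exists>j t. coprime j q \<and> 2 * j = p * t + 1"
proof -
  obtain k m where m: "\<not> p dvd m" "q = m * p ^ k" using prime_power_canonical[OF p(1) q] by blast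
  obtain h where h: "p = Suc (2 * h)" using prime_odd_nat[OF p] by (auto elim: oddE)
  have pm: "coprime p m" using prime_imp_coprime[OF p(1) m(1)] .
  have "m \<noteq> 0" "p \<noteq> 0" using m q p by auto
  \<comment> \<open>\<open>Suc h\<close> is \<open>(p + 1) / 2\<close>, the inverse of two modulo
    \<open>p\<close>. The second congruence makes \<open>j\<close> prime to \<open>m\<close>, the
    part of \<open>q\<close> that is prime to \<open>p\<close>.\<close>
  then obtain j s t where j: "j = Suc h + s * p" "j = 1 + t * m"
    using chinese_remainder[OF pm, of "Suc h" 1] by blast
  have tw: "2 * j = p * (1 + 2 * s) + 1" unfolding j(1) using h by (simp add: algebra_simps)
  have "coprime j m"
    unfolding j(2) using gcd_add_mult[of m t 1] by (simp add: coprime_iff_gcd_eq_1 gcd.commute add.commute)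
  moreover have "coprime j p"
  proof (rule ccontr)
    assume "\<not> coprime j p"
    hence "p dvd j" using prime_imp_coprime[OF p(1)] coprime_commute by blast
    hence "p dvd p * (1 + 2 * s) + 1" unfolding tw[symmetric] by simp
    hence "p dvd 1" using dvd_add_right_iff dvd_triv_left by blast
    thus False using p by simp
  qed
  ultimately have "coprime j q" unfolding m(2) by simp
  thus ?thesis using tw by blast
qed

section \<open>Passage from the given generator to the rescaled one\<close>

context jordan
begin

lemma bosonization_data:
  fixes G :: "'g monoid"
  assumes G: "group G" and fin: "finite (carrier G)" and g: "g \<in> carrier G" and gen: "carrier G = generate G {g}"
    and order: "order G = q" and pq: "p dvd q" and act: "acts_by_algebra_automorphisms K G JR \<phi>"
    and gx: "\<phi> g gx = gx" and gy: "\<phi> g gy = gx \<oplus>\<^bsub>JR\<^esub> gy"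
    and A: "ring (skew_group_algebra JR G \<phi>)"
  shows "\<exists>j::nat. jordan_bosonization K p G \<phi> (g [^]\<^bsub>G\<^esub> j) q"
proof -
  interpret G: group G by fact
  interpret act: group_action G "carrier JR" \<phi> using act by (simp add: acts_by_algebra_automorphisms_def)
  have hom: "\<phi> h \<in> ring_hom JR JR" and sm: "\<And>c r. c \<in> carrier K \<Longrightarrow> r \<in> carrier JR \<Longrightarrow> \<phi> h (c \<odot>\<^bsub>JR\<^esub> r) = c \<odot>\<^bsub>JR\<^esub> \<phi> h r"
    if "h \<in> carrier G" for h
    using act that by (auto simp: acts_by_algebra_automorphisms_def ring_iso_def)
  have one: "\<phi> \<one>\<^bsub>G\<^esub> r = r" if "r \<in> carrier JR" for r using that unfolding act.id_eq_one[symmetric] by simp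
  interpret S: skew_algebra JR G \<phi>
    by (intro skew_algebra.intro skew_algebra_axioms.intro R.ring_axioms G fin hom one act.composition_rule A)
  have q: "q > 0" using order fin G.order_gt_0_iff_finite by blast
  obtain j t where j: "coprime j q" "2 * j = p * t + 1" using half_exponent[OF p p2 q] by blast
  have gq: "g [^]\<^bsub>G\<^esub> q = \<one>\<^bsub>G\<^esub>" using G.pow_order_eq_1[OF g] order by simp
  have "j \<noteq> 0" using j(2) by (cases j) auto
  \<comment> \<open>\<open>a\<close> inverts \<open>j\<close> modulo \<open>q\<close>, so
    \<open>g\<close> is a power of \<open>g^j\<close> and the latter generates the group as
    well.\<close>
  then obtain a b where ab: "j * a = q * b + 1" using bezout_nat[of j q] j(1) by (auto simp: coprime_iff_gcd_eq_1)
  have gj: "g [^]\<^bsub>G\<^esub> j \<in> carrier G" using g by simp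
  have gen_j: "\<exists>n::nat. u = (g [^]\<^bsub>G\<^esub> j) [^]\<^bsub>G\<^esub> n" if u: "u \<in> carrier G" for u
  proof -
    obtain k where k: "u = g [^]\<^bsub>G\<^esub> (k::nat)" using u gen G.generate_pow_on_finite_carrier[OF fin g] by blast
    have "(g [^]\<^bsub>G\<^esub> j) [^]\<^bsub>G\<^esub> (a * k) = (g [^]\<^bsub>G\<^esub> (j * a)) [^]\<^bsub>G\<^esub> k"
      using g by (simp add: G.nat_pow_pow mult.assoc)
    also have "g [^]\<^bsub>G\<^esub> (j * a) = g"
      using g gq unfolding ab by (simp add: G.nat_pow_mult[symmetric] G.nat_pow_pow[symmetric])
    finally show ?thesis using k by metis
  qed
  note x = gen_closed(1)[of gen_x] and y = gen_closed(1)[of gen_y]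
  have gx_pow: "\<phi> (g [^]\<^bsub>G\<^esub> n) gx = gx" for n :: nat
  proof (induction n)
    case (Suc n)
    thus ?case using S.phi_mult[OF G.nat_pow_closed[OF g] g x, of n] gx by simp
  qed (simp add: one x)
  have gy_pow: "\<phi> (g [^]\<^bsub>G\<^esub> n) gy = [n] \<cdot>\<^bsub>JR\<^esub> gx \<oplus>\<^bsub>JR\<^esub> gy" for n :: nat
  proof (induction n)
    case (Suc n)
    have gn: "g [^]\<^bsub>G\<^esub> n \<in> carrier G" using g by simp
    have "\<phi> (g [^]\<^bsub>G\<^esub> Suc n) gy = \<phi> (g [^]\<^bsub>G\<^esub> n) (gx \<oplus>\<^bsub>JR\<^esub> gy)"
      using S.phi_mult[OF gn g y] gy by simp
    also have "\<dots> = gx \<oplus>\<^bsub>JR\<^esub> ([n] \<cdot>\<^bsub>JR\<^esub> gx \<oplus>\<^bsub>JR\<^esub> gy)"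
      unfolding S.phi_simps(4)[OF gn x y] gx_pow Suc ..
    finally show ?case using x y by (simp add: R.a_ac)
  qed (simp add: one y)
  have X: "gX \<in> carrier JR" by (rule gen_closed(2))
  \<comment> \<open>Here \<open>j x = 2 j X\<close>, and \<open>2 j = 1\<close> in \<open>K\<close>
    by the choice of \<open>j\<close>.\<close>
  have "[j] \<cdot>\<^bsub>JR\<^esub> gx = [(2 * j)] \<cdot>\<^bsub>JR\<^esub> gX"
    unfolding gx_eq mult_2 using X by (simp add: R.add.nat_pow_distrib R.add.nat_pow_mult R.add.nat_pow_pow)
  also have "\<dots> = ([(2 * j)] \<cdot> \<one>) \<odot>\<^bsub>JR\<^esub> gX" by (rule JR_nat_mult[OF X])
  also have "[(2 * j)] \<cdot> \<one> = \<one>" using nat_mult_zero[of "p * t" \<one>] by (simp add: j(2))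
  also have "\<one> \<odot>\<^bsub>JR\<^esub> gX = gX" by (rule JR_smult(2)[OF X X one_closed one_closed])
  finally have "\<phi> (g [^]\<^bsub>G\<^esub> j) gy = gX \<oplus>\<^bsub>JR\<^esub> gy" by (simp add: gy_pow)
  moreover have "\<phi> (g [^]\<^bsub>G\<^esub> j) gX = gX" using sm[OF gj half(1) x] by (simp add: gX_def gx_pow)
  ultimately have "jordan_bosonization K p G \<phi> (g [^]\<^bsub>G\<^esub> j) q"
    by (intro jordan_bosonization.intro jordan_bosonization_axioms.intro jordan_axioms S.skew_algebra_axioms
        gj gen_j order pq)
  thus ?thesis by blast
qed

end

theorem theorem5p1p2:
  fixes K :: "'k ring" and p q :: nat and G :: "'g monoid" and g :: 'g
    and R :: "('k, (gen list \<Rightarrow> 'k) set) module"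
    and \<phi> :: "'g \<Rightarrow> (gen list \<Rightarrow> 'k) set \<Rightarrow> (gen list \<Rightarrow> 'k) set"
    and A :: "('k, 'g \<Rightarrow> (gen list \<Rightarrow> 'k) set) module"
    and \<epsilon> :: "('g \<Rightarrow> (gen list \<Rightarrow> 'k) set) \<Rightarrow> 'k"
    and P :: "nat \<Rightarrow> ('g \<Rightarrow> (gen list \<Rightarrow> 'k) set, 'm) module"
    and d :: "nat \<Rightarrow> 'm \<Rightarrow> 'm" and \<eta> :: "'m \<Rightarrow> 'k"
  assumes "field K" and "Factorial_Ring.prime p" and "p > 2"
    and char_K: "group.ord (add_monoid K) \<one>\<^bsub>K\<^esub> = p"
    and R_def: "R = jordan_algebra K p"
    and "group G" and "finite (carrier G)"
    and "g \<in> carrier G" and "carrier G = generate G {g}"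
    and "order G = q" and "p dvd q"
    and "acts_by_algebra_automorphisms K G R \<phi>"
    and "\<phi> g (jordan_gen K p gen_x) = jordan_gen K p gen_x"
    and "\<phi> g (jordan_gen K p gen_y) = jordan_gen K p gen_x \<oplus>\<^bsub>R\<^esub> jordan_gen K p gen_y"
    and A_def: "A = skew_group_algebra R G \<phi>"
    and "augmentation K A \<epsilon>"
    and "\<epsilon> (skew_elt R G (jordan_gen K p gen_x) \<one>\<^bsub>G\<^esub>) = \<zero>\<^bsub>K\<^esub>"
    and "\<epsilon> (skew_elt R G (jordan_gen K p gen_y) \<one>\<^bsub>G\<^esub>) = \<zero>\<^bsub>K\<^esub>"
    and "\<epsilon> (skew_elt R G \<one>\<^bsub>R\<^esub> g) = \<one>\<^bsub>K\<^esub>"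
    and "projective_resolution A (trivial_module K \<epsilon>) P d \<eta>"
  shows "finitely_generated_algebra K (Ext_algebra A P d \<eta> (trivial_module K \<epsilon>))"
proof -
  interpret K: field K by fact
  have "[p] \<cdot>\<^bsub>K\<^esub> \<one>\<^bsub>K\<^esub> = \<zero>\<^bsub>K\<^esub>"
    using K.add.pow_ord_eq_1[OF K.one_closed] by (simp only: char_K)
  then interpret J: jordan K p
    by unfold_locales (simp_all add: assms(2,3))
  note A = A_def[unfolded R_def]
  \<comment> \<open>A projective resolution resolves a left module, and this notion includes that
    the scalars form a ring; the ring axioms of \<open>A\<close> are taken from there.\<close>
  have "left_module A (trivial_module K \<epsilon>)"
    using \<open>projective_resolution _ _ _ _ _\<close> by (simp add: projective_resolution_def)
  hence ring: "ring (skew_group_algebra (jordan_algebra K p) G \<phi>)"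
    unfolding A by (rule left_module.axioms(1))
  obtain j where "jordan_bosonization K p G \<phi> (g [^]\<^bsub>G\<^esub> (j::nat)) q"
    using J.bosonization_data[OF assms(6-12)[unfolded R_def] assms(13,14)[unfolded R_def] ring] by blast
  then interpret B: jordan_bosonization K p G \<phi> "g [^]\<^bsub>G\<^esub> j" q .
  note aug = \<open>augmentation K A \<epsilon>\<close>[unfolded A]
  hence hom: "\<epsilon> \<in> ring_hom B.A K" by (simp add: augmentation_def)
  \<comment> \<open>The augmentation is prescribed at \<open>g\<close>, while the resolution is
    built on the power of \<open>g\<close> that serves as \<open>\<gamma>\<close>.\<close>
  have "\<epsilon> (B.sk \<one>\<^bsub>J.JR\<^esub> g [^]\<^bsub>B.A\<^esub> n) = \<one>\<^bsub>K\<^esub>" for n :: nat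
  proof (induction n)
    case (Suc n)
    have c: "B.sk \<one>\<^bsub>J.JR\<^esub> g \<in> carrier B.A" by (intro B.el_closed J.R.one_closed)
    show ?case
      using ring_hom_mult[OF hom B.A.nat_pow_closed[OF c, of n] c] Suc assms(19)[unfolded R_def] by simp
  qed (simp add: ring_hom_one[OF hom])
  hence "\<epsilon> B.g = \<one>\<^bsub>K\<^esub>" by (simp add: B.el_group_pow[OF \<open>g \<in> carrier G\<close>])
  thus ?thesis
    unfolding A
    by (intro B.finitely_generated[OF aug assms(17,18)[unfolded R_def]] assms(20)[unfolded A])
qed

end
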